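(* Let $p>0$ range over prime integers. \begin{enumerate} \item[(a)] Let $X$ be an $n\times n$ matrix of indeterminates over $\mathbb{Z}$, with $n\geqslant 3$, and set $R=\mathbb{Z}[X]/(\det X)$. Then for each prime $p>0$, the Frobenius trace on $R/pR$ does not lift to a differential operator on $R/p^2R$, nor, a fortiori, to a differential operator on $R$. \item[(b)] Let $X$ be an $n\times n$ alternating matrix of indeterminates over $\mathbb{Z}$, with $n\geqslant 4$ even, and set $R=\mathbb{Z}[X]/(\operatorname{pf}X)$, where $\operatorname{pf}X$ is the Pfaffian. Then for each prime $p>0$, the Frobenius trace on $R/pR$ does not lift to a differential operator on $R/p^2R$, nor, a fortiori, to a differential operator on $R$. \item[(c)] Let $X$ be a $3\times 3$ symmetric matrix of indeterminates over $\mathbb{Z}$, and set $R=\mathbb{Z}[X]/(\det X)$. Then for primes $p>2$, each differential operator on $R/pR$ lifts to a differential operator on $R$. For $p=2$, the Frobenius trace on $R/2R$ does not lift to a differential operator on $R/4R$, nor, a fortiori, to a differential operator on $R$. \end{enumerate}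
   Context: For a commutative ring $R$, differential operators are defined inductively: for $r\in R$, multiplication by $r$ is a differential operator of order $0$; an additive map $\delta:R\to R$ is a differential operator of order $\le n$ if each commutator $[\tilde r,\delta]=\tilde r\circ\delta-\delta\circ\tilde r$ ($\tilde r$ = multiplication by $r$) is a differential operator of order $\le n-1$. They form a subring $D_R$ of $\operatorname{End}_{\mathbb{Z}}(R)$. A differential operator $\delta$ on $R/pR$ lifts to a differential operator on $R$ (resp. on $R/p^2R$) if there is a differential operator $\tilde\delta$ on $R$ (resp. on $R/p^2R$) such that $\tilde\delta(r)\equiv \delta(\bar r)$ modulo $p$ for all $r$, i.e. $\delta$ is induced by $\tilde\delta$ (note $\tilde\delta$ preserves $p$-multiples since it is additive). Frobenius trace: let $K$ be a field of characteristic $p>0$, $S=K[x_0,\dots,x_d]$, $f\in S$ a nonzero homogeneous polynomial, $R=S/(f)$. For nonnegative integers $a_i$ let $\partial_{a_0,\dots,a_d}$ be the $K$-linear map on $S$ with $\partial_{a_0,\dots,a_d}(x_0^{b_0}\cdots x_d^{b_d})=\prod_i\binom{b_i}{a_i}x_0^{b_0-a_0}\cdots x_d^{b_d-a_d}$. Set $\Phi_S=\partial_{p-1,\dots,p-1}$, which maps $S$ into $S^p$. The composite $S\xrightarrow{f^{p-1}}S\xrightarrow{\Phi_S}S^p\to R^p$ kills $fS$, hence induces $\Phi_R:R\to R^p\subseteq R$, the Frobenius trace of $R$; it is a differential operator on $R$. Here the hypersurfaces $R/pR$ are of this form over $K=\mathbb{Z}/p\mathbb{Z}$ with the standard grading.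 *)

theory Defs
  imports "HOL-Computational_Algebra.Primes" "HOL-Library.Poly_Mapping" "HOL-Algebra.QuotRing" "HOL-Combinatorics.Permutations"
begin

type_synonym mon = "(nat \<times> nat) \<Rightarrow>\<^sub>0 nat"
type_synonym ipoly = "mon \<Rightarrow>\<^sub>0 int"

definition poly_carrier :: "(nat \<times> nat) set \<Rightarrow> ipoly set" where
  "poly_carrier V = {g. \<forall>m \<in> Poly_Mapping.keys g. Poly_Mapping.keys m \<subseteq> V}"

definition poly_ring :: "(nat \<times> nat) set \<Rightarrow> ipoly ring" where
  "poly_ring V = \<lparr>carrier = poly_carrier V,
                  monoid.mult = (*), one = 1, zero = 0, add = (+)\<rparr>"

definition Var :: "nat \<times> nat \<Rightarrow> ipoly" where
  "Var v = Poly_Mapping.single (Poly_Mapping.single v 1) 1"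

definition gen_entry :: "nat \<Rightarrow> nat \<Rightarrow> ipoly" where
  "gen_entry i j = Var (i, j)"

definition alt_entry :: "nat \<Rightarrow> nat \<Rightarrow> ipoly" where
  "alt_entry i j = (if i < j then Var (i, j) else if j < i then - Var (j, i) else 0)"

definition sym_entry :: "nat \<Rightarrow> nat \<Rightarrow> ipoly" where
  "sym_entry i j = Var (min i j, max i j)"

definition gen_vars :: "nat \<Rightarrow> (nat \<times> nat) set" where
  "gen_vars n = {(i, j). i < n \<and> j < n}"

definition alt_vars :: "nat \<Rightarrow> (nat \<times> nat) set" where
  "alt_vars n = {(i, j). i < j \<and> j < n}"

definition sym_vars :: "nat \<Rightarrow> (nat \<times> nat) set" where
  "sym_vars n = {(i, j). i \<le> j \<and> j < n}"

definition det_poly :: "nat \<Rightarrow> (nat \<Rightarrow> nat \<Rightarrow> ipoly) \<Rightarrow> ipoly" where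
  "det_poly n A = (\<Sum>\<sigma> | \<sigma> permutes {..<n}. of_int (sign \<sigma>) * (\<Prod>i<n. A i (\<sigma> i)))"

text \<open>Pfaffian of an alternating n x n matrix, n = 2m: sum over perfect matchings
  {(\<sigma>(2k), \<sigma>(2k+1))}, each represented by the unique permutation with
  \<sigma>(2k) < \<sigma>(2k+1) and \<sigma>(0) < \<sigma>(2) < ... < \<sigma>(2m-2).\<close>
definition pf_poly :: "nat \<Rightarrow> (nat \<Rightarrow> nat \<Rightarrow> ipoly) \<Rightarrow> ipoly" where
  "pf_poly n A = (\<Sum>\<sigma> | \<sigma> permutes {..<n} \<and> (\<forall>k < n div 2. \<sigma> (2*k) < \<sigma> (2*k+1))
                         \<and> (\<forall>k. k + 1 < n div 2 \<longrightarrow> \<sigma> (2*k) < \<sigma> (2*k+2)).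
        of_int (sign \<sigma>) * (\<Prod>k < n div 2. A (\<sigma> (2*k)) (\<sigma> (2*k+1))))"

fun diffop_le :: "('a, 'b) ring_scheme \<Rightarrow> nat \<Rightarrow> ('a \<Rightarrow> 'a) \<Rightarrow> bool" where
  "diffop_le R 0 \<delta> = (\<exists>r \<in> carrier R. \<forall>x \<in> carrier R. \<delta> x = r \<otimes>\<^bsub>R\<^esub> x)"
| "diffop_le R (Suc n) \<delta> =
     ((\<forall>x \<in> carrier R. \<delta> x \<in> carrier R)
      \<and> (\<forall>x \<in> carrier R. \<forall>y \<in> carrier R. \<delta> (x \<oplus>\<^bsub>R\<^esub> y) = \<delta> x \<oplus>\<^bsub>R\<^esub> \<delta> y)
      \<and> (\<forall>r \<in> carrier R. diffop_le R n (\<lambda>x. r \<otimes>\<^bsub>R\<^esub> \<delta> x \<ominus>\<^bsub>R\<^esub> \<delta> (r \<otimes>\<^bsub>R\<^esub> x))))"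

definition diffop :: "('a, 'b) ring_scheme \<Rightarrow> ('a \<Rightarrow> 'a) \<Rightarrow> bool" where
  "diffop R \<delta> = (\<exists>n. diffop_le R n \<delta>)"

definition int_ideal :: "('a, 'b) ring_scheme \<Rightarrow> nat \<Rightarrow> 'a set" where
  "int_ideal R k = PIdl\<^bsub>R\<^esub> ([k] \<cdot>\<^bsub>R\<^esub> \<one>\<^bsub>R\<^esub>)"

definition mod_int :: "('a, 'b) ring_scheme \<Rightarrow> nat \<Rightarrow> 'a set ring" where
  "mod_int R k = R Quot (int_ideal R k)"

definition lifts_to_ring :: "('a, 'b) ring_scheme \<Rightarrow> nat \<Rightarrow> ('a set \<Rightarrow> 'a set) \<Rightarrow> bool" where
  "lifts_to_ring R p \<delta> = (\<exists>\<delta>'. diffop R \<delta>' \<and>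
      (\<forall>r \<in> carrier R. int_ideal R p +>\<^bsub>R\<^esub> \<delta>' r = \<delta> (int_ideal R p +>\<^bsub>R\<^esub> r)))"

definition lifts_to_mod_sq :: "('a, 'b) ring_scheme \<Rightarrow> nat \<Rightarrow> ('a set \<Rightarrow> 'a set) \<Rightarrow> bool" where
  "lifts_to_mod_sq R p \<delta> = (\<exists>\<delta>'. diffop (mod_int R (p^2)) \<delta>' \<and>
      (\<forall>r \<in> carrier R. \<forall>s \<in> \<delta>' (int_ideal R (p^2) +>\<^bsub>R\<^esub> r).
          int_ideal R p +>\<^bsub>R\<^esub> s = \<delta> (int_ideal R p +>\<^bsub>R\<^esub> r)))"

definition hypersurface :: "(nat \<times> nat) set \<Rightarrow> ipoly \<Rightarrow> ipoly set ring" where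
  "hypersurface V f = poly_ring V Quot (PIdl\<^bsub>poly_ring V\<^esub> f)"

text \<open>\<Phi>_S = \<partial>_{p-1,...,p-1} (over the variables V), computed with integer
  coefficients; its reduction mod p is the operator on (\<int>/p)[x_v].\<close>
definition Phi_S :: "(nat \<times> nat) set \<Rightarrow> nat \<Rightarrow> ipoly \<Rightarrow> ipoly" where
  "Phi_S V p g = (\<Sum>m \<in> Poly_Mapping.keys g.
      Poly_Mapping.single (m - (\<Sum>v \<in> V. Poly_Mapping.single v (p - 1)))
        (Poly_Mapping.lookup g m * (\<Prod>v \<in> V. int (Poly_Mapping.lookup m v choose (p - 1)))))"

definition frob_trace :: "(nat \<times> nat) set \<Rightarrow> ipoly \<Rightarrow> nat \<Rightarrow> ipoly set set \<Rightarrow> ipoly set set" where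
  "frob_trace V f p C =
     (let g = (SOME g. g \<in> \<Union>C) in
        int_ideal (hypersurface V f) p +>\<^bsub>hypersurface V f\<^esub>
          (PIdl\<^bsub>poly_ring V\<^esub> f +>\<^bsub>poly_ring V\<^esub> Phi_S V p (f ^ (p - 1) * g)))"

end

theory Submission
  imports Defs "HOL-Library.Product_Lexorder" "HOL-Number_Theory.Cong"
begin

text \<open>
  Non-lifting: over \<open>\<int>/p\<^sup>2\<close> a differential operator commutes with \<open>q\<close>-th powers for a large power \<open>q\<close> of \<open>p\<close>.
  Evaluating a hypothetical lift of the Frobenius trace on multiples of \<open>f\<close> and dividing by \<open>p\<close> yields a relation
  modulo \<open>p\<close> for \<open>(f\<^sup>p - \<Sum>\<^sub>t t\<^sup>p) / p\<close>, the sum ranging over the terms of \<open>f\<close>; an explicit linear functional on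
  coefficients contradicts it.

  Lifting for symmetric \<open>3 \<times> 3\<close> matrices and odd \<open>p\<close>: after inverting 2 the ring is the ring of invariants of
  \<open>O\<^sub>2\<close> acting on \<open>\<int>[u\<^sub>i, v\<^sub>i]\<close>, via \<open>x\<^sub>i\<^sub>j = u\<^sub>i v\<^sub>j + u\<^sub>j v\<^sub>i\<close>. A \<open>q\<close>-th power linear operator on the invariants
  modulo \<open>p\<close> extends to one on the polynomial ring, where it lifts to divided power operators; averaging brings
  it back to the invariants.
\<close>


text \<open>A lift \<open>d\<close> of the trace is linear over \<open>p\<close>-th powers only
  modulo \<open>p\<close>; linearity modulo \<open>p ^ 2\<close> needs the larger power
  \<open>q\<close>. The terms of \<open>f ^ p\<close> are mere \<open>p\<close>-th powers, so they
  must first be completed to multiples of \<open>q\<close>-th powers. This is the purpose of a set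
  \<open>M\<close> of variables meeting every term of \<open>f\<close>, and of the factor
  \<open>\<Prod>v\<in>M. Var v ^ (q - p)\<close>. The relation obtained says that a Cech class with
  denominator \<open>\<Prod>v\<in>M. Var v ^ p\<close> vanishes modulo \<open>f\<close> and
  \<open>p\<close>. \<open>M\<close> comes from a grading in which all terms of \<open>f\<close>
  have degree 1 and only variables in \<open>M\<close> have positive degree. For the symmetric
  determinant at 2, which has squares and a coefficient 2, the same comparison is made by hand. In
  the positive case 2 is not invertible in the ring, so averaging means twice the Reynolds operator,
  and powers of 2 in denominators are carried along until an inverse of 2 modulo \<open>p\<close>
  absorbs them. The extension step is Cramer's rule: an operator on semi-invariants of one weight is
  determined by two values, and two pairs with coprime denominators show that the denominators
  cancel.\<close>

section \<open>Polynomials supported on a set of variables\<close>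

lemma poly_carrier_zero [simp]: "0 \<in> poly_carrier V"
  and poly_carrier_one [simp]: "1 \<in> poly_carrier V"
  by (auto simp: poly_carrier_def)

lemma poly_carrier_add [simp]:
  assumes "a \<in> poly_carrier V" "b \<in> poly_carrier V"
  shows "a + b \<in> poly_carrier V"
  using assms Poly_Mapping.keys_add[of a b] unfolding poly_carrier_def by blast

lemma poly_carrier_uminus [simp]: "a \<in> poly_carrier V \<Longrightarrow> - a \<in> poly_carrier V"
  by (simp add: poly_carrier_def)

lemma poly_carrier_diff [simp]:
  assumes "a \<in> poly_carrier V" "b \<in> poly_carrier V"
  shows "a - b \<in> poly_carrier V"
  using poly_carrier_add[OF assms(1) poly_carrier_uminus[OF assms(2)]] by simp

lemma poly_carrier_mult [simp]:
  assumes a: "a \<in> poly_carrier V" and b: "b \<in> poly_carrier V"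
  shows "a * b \<in> poly_carrier V"
  unfolding poly_carrier_def
proof safe
  fix m v assume m: "m \<in> Poly_Mapping.keys (a * b)" and v: "v \<in> Poly_Mapping.keys m"
  obtain i j where ij: "m = i + j" "i \<in> Poly_Mapping.keys a" "j \<in> Poly_Mapping.keys b"
    using m Poly_Mapping.keys_mult[of a b] by blast
  then have "v \<in> Poly_Mapping.keys i \<or> v \<in> Poly_Mapping.keys j"
    using v Poly_Mapping.keys_add[of i j] by blast
  then show "v \<in> V" using ij a b unfolding poly_carrier_def by blast
qed

lemma poly_carrier_power [simp]: "a \<in> poly_carrier V \<Longrightarrow> a ^ n \<in> poly_carrier V"
  by (induction n) auto

lemma poly_carrier_of_nat [simp]: "of_nat n \<in> poly_carrier V"
  by (induction n) auto

lemma poly_carrier_numeral [simp]: "numeral n \<in> poly_carrier V"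
  using poly_carrier_of_nat[of "numeral n" V] by simp

lemma poly_carrier_of_int [simp]: "of_int n \<in> poly_carrier V"
  by (cases n rule: int_cases2) auto

lemma poly_carrier_sum [simp]: "(\<And>i. i \<in> I \<Longrightarrow> g i \<in> poly_carrier V) \<Longrightarrow> sum g I \<in> poly_carrier V"
  by (induction I rule: infinite_finite_induct) auto

lemma poly_carrier_prod [simp]: "(\<And>i. i \<in> I \<Longrightarrow> g i \<in> poly_carrier V) \<Longrightarrow> prod g I \<in> poly_carrier V"
  by (induction I rule: infinite_finite_induct) auto

lemma poly_carrier_Var [simp]: "v \<in> V \<Longrightarrow> Var v \<in> poly_carrier V"
  by (simp add: poly_carrier_def Var_def)

lemma poly_carrier_single [simp]: "Poly_Mapping.keys m \<subseteq> V \<Longrightarrow> Poly_Mapping.single m c \<in> poly_carrier V"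
  by (auto simp: poly_carrier_def)

lemma cring_poly_ring: "cring (poly_ring V)"
proof (rule cringI)
  show "abelian_group (poly_ring V)"
  proof (rule abelian_groupI)
    show "\<exists>y\<in>carrier (poly_ring V). y \<oplus>\<^bsub>poly_ring V\<^esub> x = \<zero>\<^bsub>poly_ring V\<^esub>"
      if "x \<in> carrier (poly_ring V)" for x
      using that by (intro bexI[of _ "- x"]) (auto simp: poly_ring_def)
  qed (auto simp: poly_ring_def)
  show "Group.comm_monoid (poly_ring V)"
    by (rule comm_monoidI) (auto simp: poly_ring_def algebra_simps)
qed (auto simp: poly_ring_def algebra_simps)

section \<open>Differential operators through representatives\<close>

text \<open>Differential operators on \<open>S/J\<close>, written on representatives in \<open>S\<close>.\<close>

fun diffop_mod :: "'a::comm_ring_1 set \<Rightarrow> 'a set \<Rightarrow> nat \<Rightarrow> ('a \<Rightarrow> 'a) \<Rightarrow> bool" where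
  "diffop_mod S J 0 d = (\<exists>r\<in>S. \<forall>x\<in>S. d x - r * x \<in> J)"
| "diffop_mod S J (Suc n) d = ((\<forall>x\<in>S. \<forall>y\<in>S. d (x + y) - (d x + d y) \<in> J)
      \<and> (\<forall>r\<in>S. diffop_mod S J n (\<lambda>x. r * d x - d (r * x))))"

lemma diffop_mod_mono: "diffop_mod S J n d \<Longrightarrow> J \<subseteq> J' \<Longrightarrow> diffop_mod S J' n d"
  by (induction n arbitrary: d) auto

text \<open>Elements of \<open>R\<close> are cosets and elements of \<open>R / k\<close> are cosets
  of cosets. Both rings are instances, so that all later work with operators takes place on
  polynomials.\<close>

locale quotient_presentation = cring Q for Q (structure) +
  fixes S :: "'c::comm_ring_1 set" and J :: "'c set" and \<pi> :: "'c \<Rightarrow> 'a"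
  assumes S_add: "x \<in> S \<Longrightarrow> y \<in> S \<Longrightarrow> x + y \<in> S"
    and S_mult: "x \<in> S \<Longrightarrow> y \<in> S \<Longrightarrow> x * y \<in> S"
    and S_diff: "x \<in> S \<Longrightarrow> y \<in> S \<Longrightarrow> x - y \<in> S"
    and S_one: "1 \<in> S"
    and proj_closed: "x \<in> S \<Longrightarrow> \<pi> x \<in> carrier Q"
    and proj_surj: "X \<in> carrier Q \<Longrightarrow> \<exists>x\<in>S. \<pi> x = X"
    and proj_add: "x \<in> S \<Longrightarrow> y \<in> S \<Longrightarrow> \<pi> (x + y) = \<pi> x \<oplus> \<pi> y"
    and proj_mult: "x \<in> S \<Longrightarrow> y \<in> S \<Longrightarrow> \<pi> (x * y) = \<pi> x \<otimes> \<pi> y"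
    and proj_eq_iff: "x \<in> S \<Longrightarrow> y \<in> S \<Longrightarrow> \<pi> x = \<pi> y \<longleftrightarrow> x - y \<in> J"
begin

lemma proj_diff:
  assumes "x \<in> S" "y \<in> S" shows "\<pi> (x - y) = \<pi> x \<ominus> \<pi> y"
proof -
  have "\<pi> (x - y) \<oplus> \<pi> y = \<pi> x"
    using proj_add[of "x - y" y] assms S_diff by simp
  then have "\<pi> x \<ominus> \<pi> y = \<pi> (x - y) \<oplus> \<pi> y \<ominus> \<pi> y" by simp
  also have "\<dots> = \<pi> (x - y)"
    using proj_closed[OF S_diff[OF assms]] proj_closed[OF assms(2)]
    by (simp add: a_minus_def a_assoc r_neg)
  finally show ?thesis by simp
qed

lemma ball_carrier_iff: "(\<forall>X\<in>carrier Q. P X) \<longleftrightarrow> (\<forall>x\<in>S. P (\<pi> x))"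
  using proj_surj proj_closed by blast

lemma bex_carrier_iff: "(\<exists>X\<in>carrier Q. P X) \<longleftrightarrow> (\<exists>x\<in>S. P (\<pi> x))"
  using proj_surj proj_closed by blast

text \<open>Induction on the order: commutators of a map on representatives induce the commutators
  of \<delta>, and quantifiers over the carrier transfer along the surjection \<pi>.\<close>

lemma diffop_le_iff:
  assumes "\<And>x. x \<in> S \<Longrightarrow> d x \<in> S" "\<And>x. x \<in> S \<Longrightarrow> \<pi> (d x) = \<delta> (\<pi> x)"
  shows "diffop_le Q n \<delta> \<longleftrightarrow> diffop_mod S J n d"
  using assms
proof (induction n arbitrary: d \<delta>)
  case 0
  have "(\<exists>r\<in>carrier Q. \<forall>x\<in>carrier Q. \<delta> x = r \<otimes> x) \<longleftrightarrow> (\<exists>r\<in>S. \<forall>x\<in>S. \<delta> (\<pi> x) = \<pi> r \<otimes> \<pi> x)"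
    by (simp only: ball_carrier_iff bex_carrier_iff)
  also have "\<dots> \<longleftrightarrow> (\<exists>r\<in>S. \<forall>x\<in>S. \<pi> (d x) = \<pi> (r * x))"
    using 0 proj_mult by (intro bex_cong ball_cong refl) simp
  also have "\<dots> \<longleftrightarrow> (\<exists>r\<in>S. \<forall>x\<in>S. d x - r * x \<in> J)"
    using 0 S_mult by (intro bex_cong ball_cong refl proj_eq_iff) auto
  finally show ?case by simp
next
  case (Suc n)
  have 1: "(\<forall>x\<in>carrier Q. \<delta> x \<in> carrier Q)"
    using proj_closed Suc.prems by (simp add: ball_carrier_iff flip: Suc.prems(2))
  have "(\<forall>x\<in>carrier Q. \<forall>y\<in>carrier Q. \<delta> (x \<oplus> y) = \<delta> x \<oplus> \<delta> y)
     \<longleftrightarrow> (\<forall>x\<in>S. \<forall>y\<in>S. \<delta> (\<pi> x \<oplus> \<pi> y) = \<delta> (\<pi> x) \<oplus> \<delta> (\<pi> y))"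
    by (simp only: ball_carrier_iff)
  also have "\<dots> \<longleftrightarrow> (\<forall>x\<in>S. \<forall>y\<in>S. \<pi> (d (x + y)) = \<pi> (d x + d y))"
    using S_add by (intro ball_cong refl) (simp add: Suc.prems proj_add flip: Suc.prems(2) proj_add)
  also have "\<dots> \<longleftrightarrow> (\<forall>x\<in>S. \<forall>y\<in>S. d (x + y) - (d x + d y) \<in> J)"
    using Suc.prems S_add by (intro ball_cong refl proj_eq_iff) auto
  finally have 2: "(\<forall>x\<in>carrier Q. \<forall>y\<in>carrier Q. \<delta> (x \<oplus> y) = \<delta> x \<oplus> \<delta> y)
     \<longleftrightarrow> (\<forall>x\<in>S. \<forall>y\<in>S. d (x + y) - (d x + d y) \<in> J)" .
  have 3: "diffop_le Q n (\<lambda>x. \<pi> r \<otimes> \<delta> x \<ominus> \<delta> (\<pi> r \<otimes> x)) \<longleftrightarrow> diffop_mod S J n (\<lambda>x. r * d x - d (r * x))"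
    if "r \<in> S" for r
  proof (rule Suc.IH)
    show "r * d x - d (r * x) \<in> S" if "x \<in> S" for x
      using that \<open>r \<in> S\<close> Suc.prems S_mult S_diff by simp
    show "\<pi> (r * d x - d (r * x)) = \<pi> r \<otimes> \<delta> (\<pi> x) \<ominus> \<delta> (\<pi> r \<otimes> \<pi> x)" if "x \<in> S" for x
      using that \<open>r \<in> S\<close> Suc.prems S_mult proj_mult[of r "d x"] proj_mult[of r x] by (simp add: proj_diff)
  qed
  have "(\<forall>r\<in>carrier Q. diffop_le Q n (\<lambda>x. r \<otimes> \<delta> x \<ominus> \<delta> (r \<otimes> x)))
     \<longleftrightarrow> (\<forall>r\<in>S. diffop_le Q n (\<lambda>x. \<pi> r \<otimes> \<delta> x \<ominus> \<delta> (\<pi> r \<otimes> x)))"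
    by (simp only: ball_carrier_iff)
  then show ?case using 1 2 3 by simp
qed

lemma diffop_le_closed: "diffop_le Q n \<delta> \<Longrightarrow> x \<in> carrier Q \<Longrightarrow> \<delta> x \<in> carrier Q"
  by (cases n) auto

text \<open>\<open>d\<close> is an arbitrary choice of representatives, hence additive only modulo
  \<open>J\<close>; the last property records that it descends to the quotient.\<close>

lemma diffop_representative:
  assumes "diffop Q \<delta>"
  obtains d n where "\<And>x. x \<in> S \<Longrightarrow> d x \<in> S" "\<And>x. x \<in> S \<Longrightarrow> \<pi> (d x) = \<delta> (\<pi> x)"
    "diffop_mod S J n d" "\<And>x y. x \<in> S \<Longrightarrow> y \<in> S \<Longrightarrow> x - y \<in> J \<Longrightarrow> d x - d y \<in> J"
proof -
  obtain n where n: "diffop_le Q n \<delta>" using assms unfolding diffop_def by blast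
  have "\<forall>x. \<exists>y. x \<in> S \<longrightarrow> y \<in> S \<and> \<pi> y = \<delta> (\<pi> x)"
    using diffop_le_closed[OF n] proj_surj proj_closed by blast
  then obtain d where d: "\<And>x. x \<in> S \<Longrightarrow> d x \<in> S" "\<And>x. x \<in> S \<Longrightarrow> \<pi> (d x) = \<delta> (\<pi> x)" by metis
  show ?thesis
  proof (rule that[OF d])
    show "diffop_mod S J n d" using diffop_le_iff[of d \<delta> n] d n by simp
    show "d x - d y \<in> J" if "x \<in> S" "y \<in> S" "x - y \<in> J" for x y
      using that d by (metis proj_eq_iff)
  qed auto
qed

lemma diffop_of_representative:
  assumes d: "\<And>x. x \<in> S \<Longrightarrow> d x \<in> S" and n: "diffop_mod S J n d"
    and compat: "\<And>x y. x \<in> S \<Longrightarrow> y \<in> S \<Longrightarrow> x - y \<in> J \<Longrightarrow> d x - d y \<in> J"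
  obtains \<delta> where "diffop Q \<delta>" "\<And>x. x \<in> S \<Longrightarrow> \<delta> (\<pi> x) = \<pi> (d x)"
proof -
  define \<delta> where "\<delta> X = \<pi> (d (SOME x. x \<in> S \<and> \<pi> x = X))" for X
  have eq: "\<pi> (d x) = \<delta> (\<pi> x)" if "x \<in> S" for x
  proof -
    let ?y = "SOME y. y \<in> S \<and> \<pi> y = \<pi> x"
    have "?y \<in> S \<and> \<pi> ?y = \<pi> x" by (rule someI[of _ x]) (use that in auto)
    then show ?thesis using compat[of x ?y] that d proj_eq_iff unfolding \<delta>_def by metis
  qed
  have "diffop_le Q n \<delta>" using diffop_le_iff[of d \<delta> n] d eq n by simp
  then show ?thesis using that eq unfolding diffop_def by metis
qed

end

text \<open>Let \<open>b = a ^ (P ^ n)\<close>. The commutator \<open>c\<close> of \<open>b\<close>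
  with \<open>d\<close> has order \<open>n\<close>, so by induction it commutes with
  \<open>b\<close> modulo \<open>J\<close>. Moving \<open>b ^ j\<close> past \<open>d\<close>
  therefore costs \<open>j\<close> equal corrections \<open>b ^ (j - 1) * c\<close>, and for
  \<open>j = P\<close> their number lies in \<open>J\<close>.\<close>

lemma diffop_mod_power_linear:
  fixes d :: "'a::comm_ring_1 \<Rightarrow> 'a"
  assumes Sm: "\<And>x y. x \<in> S \<Longrightarrow> y \<in> S \<Longrightarrow> x * y \<in> S"
    and Sd: "\<And>x y. x \<in> S \<Longrightarrow> y \<in> S \<Longrightarrow> x - y \<in> S" and S1: "1 \<in> S"
    and Ja: "\<And>x y. x \<in> J \<Longrightarrow> y \<in> J \<Longrightarrow> x + y \<in> J"
    and Jm: "\<And>x r. x \<in> J \<Longrightarrow> r \<in> S \<Longrightarrow> r * x \<in> J"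
    and P: "of_nat P \<in> J"
  shows "\<lbrakk>diffop_mod S J n d; \<And>x. x \<in> S \<Longrightarrow> d x \<in> S;
     \<And>x y. x \<in> S \<Longrightarrow> y \<in> S \<Longrightarrow> x - y \<in> J \<Longrightarrow> d x - d y \<in> J; a \<in> S; x \<in> S\<rbrakk>
    \<Longrightarrow> d (a ^ (P ^ n) * x) - a ^ (P ^ n) * d x \<in> J"
proof (induction n arbitrary: d x)
  have S0: "0 \<in> S" using Sd[OF S1 S1] by simp
  have Sn: "- x \<in> S" if "x \<in> S" for x using Sd[OF S0 that] by simp
  have Jn: "- x \<in> J" if "x \<in> J" for x using Jm[OF that Sn[OF S1]] by simp
  have Jd: "x - y \<in> J" if "x \<in> J" "y \<in> J" for x y using Ja[OF that(1) Jn[OF that(2)]] by simp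
  have Sp: "x ^ k \<in> S" if "x \<in> S" for x and k :: nat by (induction k) (use that Sm S1 in auto)
  {
    case (0 d)
    then obtain r where r: "r \<in> S" "\<And>x. x \<in> S \<Longrightarrow> d x - r * x \<in> J" by auto
    have "(d (a * x) - r * (a * x)) - a * (d x - r * x) \<in> J"
      by (intro Jd Jm r Sm 0)
    then show ?case by (simp add: algebra_simps)
  next
    case (Suc n d)
    define b where "b = a ^ (P ^ n)"
    have b: "b \<in> S" using Suc.prems Sp by (simp add: b_def)
    define c where "c x = b * d x - d (b * x)" for x
    have cS: "c x \<in> S" if "x \<in> S" for x using that Suc.prems(2) b Sm Sd by (simp add: c_def)
    have cJ: "c x - c y \<in> J" if "x \<in> S" "y \<in> S" "x - y \<in> J" for x y
    proof -
      have "d (b * x) - d (b * y) \<in> J"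
        using Suc.prems(3)[of "b * x" "b * y"] Jm[OF that(3) b] that Sm b by (simp add: algebra_simps)
      then have "b * (d x - d y) - (d (b * x) - d (b * y)) \<in> J"
        by (rule Jd[OF Jm[OF Suc.prems(3)[OF that] b]])
      then show ?thesis by (simp add: c_def algebra_simps)
    qed
    have c: "c (b * x) - b * c x \<in> J" if "x \<in> S" for x
    proof -
      have "diffop_mod S J n c" using Suc.prems(1) b unfolding c_def by simp
      from Suc.IH[OF this cS cJ Suc.prems(4) that] show ?thesis by (simp add: b_def)
    qed
    have cp: "c (b ^ j * x) - b ^ j * c x \<in> J" if "x \<in> S" for x j
    proof (induction j)
      case 0
      then show ?case using Jd[OF P P] by simp
    next
      case (Suc j)
      have "(c (b * (b ^ j * x)) - b * c (b ^ j * x)) + b * (c (b ^ j * x) - b ^ j * c x) \<in> J"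
        by (intro Ja c Jm Suc b Sm Sp that)
      then show ?case by (simp add: algebra_simps)
    qed
    have main: "d (b ^ Suc j * x) - b ^ Suc j * d x + of_nat (Suc j) * b ^ j * c x \<in> J" if "x \<in> S" for x j
    proof (induction j)
      case 0
      have "0 \<in> J" using Jd[OF P P] by simp
      then show ?case by (simp add: c_def)
    next
      case (Suc j)
      have "d (b ^ Suc (Suc j) * x) - b ^ Suc (Suc j) * d x + of_nat (Suc (Suc j)) * b ^ Suc j * c x
        = b * (d (b ^ Suc j * x) - b ^ Suc j * d x + of_nat (Suc j) * b ^ j * c x)
          - (c (b ^ Suc j * x) - b ^ Suc j * c x)"
        by (simp add: c_def algebra_simps)
      also have "\<dots> \<in> J"
        by (intro Jd Jm Suc cp b that)
      finally show ?case .
    qed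
    show ?case
    proof (cases P)
      case 0
      then show ?thesis using Jd[OF P P] by (simp add: power_0_left)
    next
      case (Suc j)
      have "(b ^ j * c x) * of_nat (Suc j) \<in> J"
        using Jm[OF P, of "b ^ j * c x"] Suc cS[OF Suc.prems(5)] Sm Sp b by simp
      from Jd[OF main[OF Suc.prems(5), of j] this]
      have "d (b ^ Suc j * x) - b ^ Suc j * d x \<in> J" by (simp add: algebra_simps)
      moreover have "a ^ (P ^ Suc n) = b ^ Suc j"
        unfolding b_def Suc power_mult[symmetric] by (simp only: power_Suc2)
      ultimately show ?thesis by simp
    qed
  }
qed

section \<open>The ideals (f, k) and the rings R and R / k\<close>

text \<open>The case \<open>k = 0\<close> is the principal ideal of \<open>f\<close>, so one
  calculus serves \<open>R\<close> and all its reductions.\<close>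

definition hyper_ideal :: "(nat \<times> nat) set \<Rightarrow> ipoly \<Rightarrow> int \<Rightarrow> ipoly set" where
  "hyper_ideal V f k = {f * a + of_int k * b | a b. a \<in> poly_carrier V \<and> b \<in> poly_carrier V}"

lemma hyper_idealI: "a \<in> poly_carrier V \<Longrightarrow> b \<in> poly_carrier V \<Longrightarrow> x = f * a + of_int k * b \<Longrightarrow> x \<in> hyper_ideal V f k"
  unfolding hyper_ideal_def by blast

lemma hyper_idealE:
  assumes "x \<in> hyper_ideal V f k"
  obtains a b where "a \<in> poly_carrier V" "b \<in> poly_carrier V" "x = f * a + of_int k * b"
  using assms unfolding hyper_ideal_def by blast

lemma hyper_ideal_add:
  assumes "x \<in> hyper_ideal V f k" "y \<in> hyper_ideal V f k"
  shows "x + y \<in> hyper_ideal V f k"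
proof -
  obtain a b where x: "a \<in> poly_carrier V" "b \<in> poly_carrier V" "x = f * a + of_int k * b"
    using assms(1) by (rule hyper_idealE)
  obtain c d where y: "c \<in> poly_carrier V" "d \<in> poly_carrier V" "y = f * c + of_int k * d"
    using assms(2) by (rule hyper_idealE)
  show ?thesis by (rule hyper_idealI[of "a + c" _ "b + d"]) (use x y in \<open>auto simp: algebra_simps\<close>)
qed

lemma hyper_ideal_mult:
  assumes "x \<in> hyper_ideal V f k" "r \<in> poly_carrier V"
  shows "r * x \<in> hyper_ideal V f k"
proof -
  obtain a b where x: "a \<in> poly_carrier V" "b \<in> poly_carrier V" "x = f * a + of_int k * b"
    using assms(1) by (rule hyper_idealE)
  show ?thesis by (rule hyper_idealI[of "r * a" _ "r * b"]) (use x assms(2) in \<open>auto simp: algebra_simps\<close>)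
qed

lemma hyper_ideal_uminus: "x \<in> hyper_ideal V f k \<Longrightarrow> - x \<in> hyper_ideal V f k"
  using hyper_ideal_mult[of x V f k "-1"] by simp

lemma hyper_ideal_diff:
  "x \<in> hyper_ideal V f k \<Longrightarrow> y \<in> hyper_ideal V f k \<Longrightarrow> x - y \<in> hyper_ideal V f k"
  using hyper_ideal_add[of x V f k "- y"] hyper_ideal_uminus by simp

lemma hyper_ideal_diff_iff:
  "y \<in> hyper_ideal V f k \<Longrightarrow> x - y \<in> hyper_ideal V f k \<longleftrightarrow> x \<in> hyper_ideal V f k"
  using hyper_ideal_add[of "x - y" V f k y] hyper_ideal_diff by auto

lemma hyper_ideal_zero [simp]: "0 \<in> hyper_ideal V f k"
  by (rule hyper_idealI[of 0 _ 0]) auto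

lemma hyper_ideal_sum: "(\<And>i. i \<in> I \<Longrightarrow> g i \<in> hyper_ideal V f k) \<Longrightarrow> sum g I \<in> hyper_ideal V f k"
  by (induction I rule: infinite_finite_induct) (auto intro: hyper_ideal_add)

lemma hyper_ideal_gen [simp]: "a \<in> poly_carrier V \<Longrightarrow> f * a \<in> hyper_ideal V f k"
  by (rule hyper_idealI[of a _ 0]) auto

lemma hyper_ideal_int [simp]: "a \<in> poly_carrier V \<Longrightarrow> of_int k * a \<in> hyper_ideal V f k"
  by (rule hyper_idealI[of 0 _ a]) auto

lemma hyper_ideal_mono:
  assumes "k dvd l" shows "hyper_ideal V f l \<subseteq> hyper_ideal V f k"
proof
  fix x assume "x \<in> hyper_ideal V f l"
  then obtain a b where x: "a \<in> poly_carrier V" "b \<in> poly_carrier V" "x = f * a + of_int l * b"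
    by (rule hyper_idealE)
  obtain c where "l = k * c" using assms by blast
  then show "x \<in> hyper_ideal V f k"
    by (intro hyper_idealI[of a _ "of_int c * b"]) (use x in \<open>auto simp: algebra_simps\<close>)
qed

definition hproj :: "(nat \<times> nat) set \<Rightarrow> ipoly \<Rightarrow> ipoly \<Rightarrow> ipoly set" where
  "hproj V f x = hyper_ideal V f 0 +>\<^bsub>poly_ring V\<^esub> x"

definition mproj :: "(nat \<times> nat) set \<Rightarrow> ipoly \<Rightarrow> nat \<Rightarrow> ipoly \<Rightarrow> ipoly set set" where
  "mproj V f k x = int_ideal (hypersurface V f) k +>\<^bsub>hypersurface V f\<^esub> hproj V f x"

context
  fixes V :: "(nat \<times> nat) set" and f :: ipoly
  assumes f: "f \<in> poly_carrier V"
begin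

interpretation S: cring "poly_ring V" by (rule cring_poly_ring)

lemma cgenideal_poly_ring: "PIdl\<^bsub>poly_ring V\<^esub> f = hyper_ideal V f 0"
proof -
  have "PIdl\<^bsub>poly_ring V\<^esub> f = {x * f | x. x \<in> poly_carrier V}"
    by (simp add: cgenideal_def poly_ring_def)
  also have "\<dots> = hyper_ideal V f 0"
    unfolding hyper_ideal_def by (auto simp: mult.commute)
  finally show ?thesis .
qed

lemma ideal_hyper: "ideal (hyper_ideal V f 0) (poly_ring V)"
  using S.cgenideal_ideal[of f] f cgenideal_poly_ring by (simp add: poly_ring_def)

lemma hypersurface_eq: "hypersurface V f = poly_ring V Quot hyper_ideal V f 0"
  by (simp add: hypersurface_def cgenideal_poly_ring)

lemma minus_poly_ring: "x \<in> poly_carrier V \<Longrightarrow> y \<in> poly_carrier V \<Longrightarrow> x \<ominus>\<^bsub>poly_ring V\<^esub> y = x - y"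
proof -
  assume xy: "x \<in> poly_carrier V" "y \<in> poly_carrier V"
  have "(x - y) \<oplus>\<^bsub>poly_ring V\<^esub> y = x" by (simp add: poly_ring_def)
  then show ?thesis
    using xy by (metis S.add.inv_solve_right S.minus_eq poly_carrier_diff
        partial_object.select_convs(1) poly_ring_def)
qed

lemma cring_hypersurface: "cring (hypersurface V f)"
  unfolding hypersurface_eq using ideal.quotient_is_cring[OF ideal_hyper S.is_cring] .

lemma presentation_hypersurface:
  "quotient_presentation (hypersurface V f) (poly_carrier V) (hyper_ideal V f 0) (hproj V f)"
proof -
  interpret H: cring "hypersurface V f" by (rule cring_hypersurface)
  have hom: "hproj V f \<in> ring_hom (poly_ring V) (hypersurface V f)"
    unfolding hproj_def[abs_def] hypersurface_eq using ideal.rcos_ring_hom[OF ideal_hyper] .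
  show ?thesis
  proof
    show "hproj V f x \<in> carrier (hypersurface V f)" if "x \<in> poly_carrier V" for x
      using ring_hom_closed[OF hom, of x] that by (simp add: poly_ring_def)
    show "\<exists>x\<in>poly_carrier V. hproj V f x = X" if "X \<in> carrier (hypersurface V f)" for X
      using that unfolding hypersurface_eq FactRing_def A_RCOSETS_def'
      by (auto simp: hproj_def poly_ring_def)
    show "hproj V f (x + y) = hproj V f x \<oplus>\<^bsub>hypersurface V f\<^esub> hproj V f y"
      if "x \<in> poly_carrier V" "y \<in> poly_carrier V" for x y
      using ring_hom_add[OF hom, of x y] that by (simp add: poly_ring_def)
    show "hproj V f (x * y) = hproj V f x \<otimes>\<^bsub>hypersurface V f\<^esub> hproj V f y"
      if "x \<in> poly_carrier V" "y \<in> poly_carrier V" for x y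
      using ring_hom_mult[OF hom, of x y] that by (simp add: poly_ring_def)
    show "hproj V f x = hproj V f y \<longleftrightarrow> x - y \<in> hyper_ideal V f 0"
      if "x \<in> poly_carrier V" "y \<in> poly_carrier V" for x y
      using S.quotient_eq_iff_same_a_r_cos[OF ideal_hyper, of x y] that
      by (simp add: poly_ring_def hproj_def minus_poly_ring[unfolded poly_ring_def])
  qed auto
qed

interpretation H: quotient_presentation "hypersurface V f" "poly_carrier V" "hyper_ideal V f 0" "hproj V f"
  by (rule presentation_hypersurface)

lemma hproj_one: "hproj V f 1 = \<one>\<^bsub>hypersurface V f\<^esub>"
  unfolding hproj_def hypersurface_eq FactRing_def
  by (simp add: poly_ring_def)

lemma hproj_of_nat: "hproj V f (of_nat k) = [k] \<cdot>\<^bsub>hypersurface V f\<^esub> \<one>\<^bsub>hypersurface V f\<^esub>"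
proof (induction k)
  case 0
  have "hproj V f 0 \<oplus>\<^bsub>hypersurface V f\<^esub> hproj V f 0 = hproj V f 0"
    using H.proj_add[of 0 0] by simp
  then have "hproj V f 0 = \<zero>\<^bsub>hypersurface V f\<^esub>"
    using H.proj_closed[of 0] by (simp add: H.add.l_cancel_one)
  then show ?case by simp
next
  case (Suc k)
  have "hproj V f (of_nat k + 1) = hproj V f (of_nat k) \<oplus>\<^bsub>hypersurface V f\<^esub> hproj V f 1"
    by (rule H.proj_add) auto
  then show ?case using Suc by (simp add: hproj_one add.commute)
qed

lemma int_ideal_eq: "int_ideal (hypersurface V f) k = {hproj V f (of_nat k * x) | x. x \<in> poly_carrier V}"
proof -
  have "int_ideal (hypersurface V f) k = {X \<otimes>\<^bsub>hypersurface V f\<^esub> hproj V f (of_nat k) | X. X \<in> carrier (hypersurface V f)}"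
    unfolding int_ideal_def cgenideal_def hproj_of_nat ..
  also have "\<dots> = {hproj V f (of_nat k * x) | x. x \<in> poly_carrier V}" (is "?L = ?R")
  proof
    show "?L \<subseteq> ?R"
    proof safe
      fix X assume "X \<in> carrier (hypersurface V f)"
      then obtain x where x: "x \<in> poly_carrier V" "X = hproj V f x" using H.proj_surj by blast
      then show "\<exists>x. X \<otimes>\<^bsub>hypersurface V f\<^esub> hproj V f (of_nat k) = hproj V f (of_nat k * x) \<and> x \<in> poly_carrier V"
        by (intro exI[of _ x]) (simp add: H.proj_mult[symmetric] mult.commute)
    qed
    show "?R \<subseteq> ?L"
    proof safe
      fix x assume x: "x \<in> poly_carrier V"
      then show "\<exists>X. hproj V f (of_nat k * x) = X \<otimes>\<^bsub>hypersurface V f\<^esub> hproj V f (of_nat k) \<and> X \<in> carrier (hypersurface V f)"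
        by (intro exI[of _ "hproj V f x"]) (simp add: H.proj_mult[symmetric] H.proj_closed mult.commute)
    qed
  qed
  finally show ?thesis .
qed

lemma ideal_int_ideal: "ideal (int_ideal (hypersurface V f) k) (hypersurface V f)"
  unfolding int_ideal_def by (rule H.cgenideal_ideal) auto

lemma hproj_mem_int_ideal_iff:
  assumes "x \<in> poly_carrier V"
  shows "hproj V f x \<in> int_ideal (hypersurface V f) k \<longleftrightarrow> x \<in> hyper_ideal V f (int k)"
proof
  assume "hproj V f x \<in> int_ideal (hypersurface V f) k"
  then obtain y where y: "y \<in> poly_carrier V" "hproj V f x = hproj V f (of_nat k * y)"
    unfolding int_ideal_eq by blast
  then have "x - of_nat k * y \<in> hyper_ideal V f 0" using H.proj_eq_iff assms by simp
  then obtain a b where "a \<in> poly_carrier V" "x - of_nat k * y = f * a" by (auto elim: hyper_idealE)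
  then show "x \<in> hyper_ideal V f (int k)"
    using y by (intro hyper_idealI[of a _ y]) (auto simp: algebra_simps)
next
  assume "x \<in> hyper_ideal V f (int k)"
  then obtain a b where x: "a \<in> poly_carrier V" "b \<in> poly_carrier V" "x = f * a + of_int (int k) * b" by (rule hyper_idealE)
  then have "x - of_nat k * b \<in> hyper_ideal V f 0" by simp
  then have "hproj V f x = hproj V f (of_nat k * b)" using H.proj_eq_iff assms x by simp
  then show "hproj V f x \<in> int_ideal (hypersurface V f) k" unfolding int_ideal_eq using x by blast
qed

lemma presentation_mod_int:
  "quotient_presentation (mod_int (hypersurface V f) k) (poly_carrier V) (hyper_ideal V f (int k)) (mproj V f k)"
proof -
  interpret I: ideal "int_ideal (hypersurface V f) k" "hypersurface V f" by (rule ideal_int_ideal)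
  interpret M: cring "mod_int (hypersurface V f) k"
    unfolding mod_int_def by (rule I.quotient_is_cring[OF H.is_cring])
  have hom: "(+>\<^bsub>hypersurface V f\<^esub>) (int_ideal (hypersurface V f) k) \<in> ring_hom (hypersurface V f) (mod_int (hypersurface V f) k)"
    unfolding mod_int_def by (rule I.rcos_ring_hom)
  show ?thesis
  proof
    show "mproj V f k x \<in> carrier (mod_int (hypersurface V f) k)" if "x \<in> poly_carrier V" for x
      using ring_hom_closed[OF hom H.proj_closed[OF that]] by (simp add: mproj_def)
    show "\<exists>x\<in>poly_carrier V. mproj V f k x = X" if X: "X \<in> carrier (mod_int (hypersurface V f) k)" for X
    proof -
      obtain Y where Y: "Y \<in> carrier (hypersurface V f)"
        "X = int_ideal (hypersurface V f) k +>\<^bsub>hypersurface V f\<^esub> Y"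
        using X unfolding mod_int_def FactRing_def A_RCOSETS_def' by auto
      then show ?thesis using H.proj_surj[OF Y(1)] by (auto simp: mproj_def)
    qed
    show "mproj V f k (x + y) = mproj V f k x \<oplus>\<^bsub>mod_int (hypersurface V f) k\<^esub> mproj V f k y"
      if "x \<in> poly_carrier V" "y \<in> poly_carrier V" for x y
      using ring_hom_add[OF hom H.proj_closed[OF that(1)] H.proj_closed[OF that(2)]] that
      by (simp add: mproj_def H.proj_add)
    show "mproj V f k (x * y) = mproj V f k x \<otimes>\<^bsub>mod_int (hypersurface V f) k\<^esub> mproj V f k y"
      if "x \<in> poly_carrier V" "y \<in> poly_carrier V" for x y
      using ring_hom_mult[OF hom H.proj_closed[OF that(1)] H.proj_closed[OF that(2)]] that
      by (simp add: mproj_def H.proj_mult)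
    show "mproj V f k x = mproj V f k y \<longleftrightarrow> x - y \<in> hyper_ideal V f (int k)"
      if "x \<in> poly_carrier V" "y \<in> poly_carrier V" for x y
      using H.quotient_eq_iff_same_a_r_cos[OF ideal_int_ideal H.proj_closed[OF that(1)] H.proj_closed[OF that(2)], of k]
        that by (simp add: mproj_def H.proj_diff[symmetric] hproj_mem_int_ideal_iff)
  qed auto
qed

text \<open>The union over a coset of cosets is the set of all polynomials representing it;
  \<open>frob_trace\<close> selects its argument from this set.\<close>

lemma mem_mproj:
  assumes "x \<in> poly_carrier V"
  shows "\<Union>(mproj V f k x) = {y \<in> poly_carrier V. y - x \<in> hyper_ideal V f (int k)}"
proof -
  have mem: "Y \<in> mproj V f k x \<longleftrightarrow> (\<exists>y\<in>poly_carrier V. Y = hproj V f y \<and> y - x \<in> hyper_ideal V f (int k))" for Y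
  proof -
    have "Y \<in> mproj V f k x \<longleftrightarrow> (\<exists>Z\<in>int_ideal (hypersurface V f) k. Y = Z \<oplus>\<^bsub>hypersurface V f\<^esub> hproj V f x)"
      unfolding mproj_def a_r_coset_def' by blast
    also have "\<dots> \<longleftrightarrow> (\<exists>z\<in>poly_carrier V. z \<in> hyper_ideal V f (int k) \<and> Y = hproj V f (z + x))"
    proof -
      have "Z \<in> int_ideal (hypersurface V f) k \<longleftrightarrow> (\<exists>z\<in>poly_carrier V. z \<in> hyper_ideal V f (int k) \<and> Z = hproj V f z)" for Z
        using hproj_mem_int_ideal_iff H.proj_surj ideal.Icarr[OF ideal_int_ideal] by metis
      then show ?thesis using assms by (auto simp: H.proj_add)
    qed
    also have "\<dots> \<longleftrightarrow> (\<exists>y\<in>poly_carrier V. Y = hproj V f y \<and> y - x \<in> hyper_ideal V f (int k))"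
      using assms by (metis add_diff_cancel_right' diff_add_cancel poly_carrier_add poly_carrier_diff)
    finally show ?thesis .
  qed
  have hp: "z \<in> hproj V f y \<longleftrightarrow> z \<in> poly_carrier V \<and> z - y \<in> hyper_ideal V f 0" if "y \<in> poly_carrier V" for y z
  proof -
    have "z \<in> hproj V f y \<longleftrightarrow> (\<exists>h\<in>hyper_ideal V f 0. z = h + y)"
      unfolding hproj_def a_r_coset_def' by (auto simp: poly_ring_def)
    also have "\<dots> \<longleftrightarrow> z \<in> poly_carrier V \<and> z - y \<in> hyper_ideal V f 0"
    proof
      assume "\<exists>h\<in>hyper_ideal V f 0. z = h + y"
      then show "z \<in> poly_carrier V \<and> z - y \<in> hyper_ideal V f 0"
        using that f by (auto elim!: hyper_idealE)
    next
      assume "z \<in> poly_carrier V \<and> z - y \<in> hyper_ideal V f 0"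
      then show "\<exists>h\<in>hyper_ideal V f 0. z = h + y" by (intro bexI[of _ "z - y"]) auto
    qed
    finally show ?thesis .
  qed
  show ?thesis
  proof safe
    fix z Y assume "z \<in> Y" "Y \<in> mproj V f k x"
    then obtain y where y: "y \<in> poly_carrier V" "y - x \<in> hyper_ideal V f (int k)" "z \<in> hproj V f y" using mem by blast
    then have z: "z \<in> poly_carrier V" "z - y \<in> hyper_ideal V f 0" using hp by auto
    have "(z - y) + (y - x) \<in> hyper_ideal V f (int k)"
      using z y hyper_ideal_mono[of "int k" 0 V f] by (intro hyper_ideal_add) auto
    then show "z \<in> poly_carrier V" "z - x \<in> hyper_ideal V f (int k)" using z by auto
  next
    fix y assume "y \<in> poly_carrier V" "y - x \<in> hyper_ideal V f (int k)"
    then show "y \<in> \<Union>(mproj V f k x)" using mem hp[of y y] by auto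
  qed
qed

text \<open>The polynomial \<open>g\<close> is whatever \<open>SOME\<close> selects in
  \<open>frob_trace\<close>, so it is known only modulo \<open>f\<close> and \<open>p\<close>.
  Independence of this choice is a property of the trace and is shown in
  \<open>frobenius_lift_data\<close>.\<close>

lemma frob_trace_eq:
  assumes x: "x \<in> poly_carrier V"
  obtains g where "g \<in> poly_carrier V" "g - x \<in> hyper_ideal V f (int p)"
    "frob_trace V f p (mproj V f p x) = mproj V f p (Phi_S V p (f ^ (p - 1) * g))"
proof -
  define g where "g = (SOME g. g \<in> \<Union>(mproj V f p x))"
  have "x \<in> \<Union>(mproj V f p x)" using mem_mproj[OF x] x by simp
  then have "g \<in> \<Union>(mproj V f p x)" unfolding g_def by (rule someI)
  then have "g \<in> poly_carrier V" "g - x \<in> hyper_ideal V f (int p)" using mem_mproj[OF x] by auto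
  then show ?thesis
    by (rule that) (simp add: frob_trace_def mproj_def hproj_def cgenideal_poly_ring Let_def g_def)
qed

end

section \<open>Congruences and the Frobenius map\<close>

text \<open>For modulus 0 this is equality, which lets later arguments treat characteristic 0 and
  characteristic \<open>p\<close> together.\<close>

definition pcong :: "int \<Rightarrow> 'a::comm_ring_1 \<Rightarrow> 'a \<Rightarrow> bool" where
  "pcong p a b \<longleftrightarrow> of_int p dvd a - b"

lemma pcong_refl [simp]: "pcong p a a" by (simp add: pcong_def)

lemma pcong_sym: "pcong p a b \<Longrightarrow> pcong p b a"
  unfolding pcong_def using dvd_minus_iff[of "of_int p" "a - b"] by simp

lemma pcong_trans [trans]: "pcong p a b \<Longrightarrow> pcong p b c \<Longrightarrow> pcong p a c"
  unfolding pcong_def using dvd_add[of "of_int p" "a - b" "b - c"] by simp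

lemma pcong_add: "pcong p a b \<Longrightarrow> pcong p c d \<Longrightarrow> pcong p (a + c) (b + d)"
  unfolding pcong_def using dvd_add[of "of_int p" "a - b" "c - d"] by (simp add: algebra_simps)

lemma pcong_diff: "pcong p a b \<Longrightarrow> pcong p c d \<Longrightarrow> pcong p (a - c) (b - d)"
  unfolding pcong_def using dvd_diff[of "of_int p" "a - b" "c - d"] by (simp add: algebra_simps)

lemma pcong_mult: "pcong p a b \<Longrightarrow> pcong p c d \<Longrightarrow> pcong p (a * c) (b * d)"
proof -
  assume "pcong p a b" "pcong p c d"
  then have "of_int p dvd (a - b) * c + b * (c - d)" unfolding pcong_def by (intro dvd_add dvd_mult dvd_mult2)
  then show ?thesis by (simp add: pcong_def algebra_simps)
qed

lemma pcong_power: "pcong p a b \<Longrightarrow> pcong p (a ^ n) (b ^ n)"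
  by (induction n) (auto intro: pcong_mult)

lemma pcong_sum: "(\<And>i. i \<in> I \<Longrightarrow> pcong p (g i) (h i)) \<Longrightarrow> pcong p (sum g I) (sum h I)"
  by (induction I rule: infinite_finite_induct) (auto intro: pcong_add)

lemma pcong_0_iff: "pcong p a 0 \<longleftrightarrow> of_int p dvd a"
  by (simp add: pcong_def)

lemma pcong_of_int: "[i = j] (mod p) \<Longrightarrow> pcong p (of_int i) (of_int j)"
  unfolding pcong_def cong_iff_dvd_diff by (auto elim!: dvdE simp: of_int_diff[symmetric] simp del: of_int_diff)

lemma pcong_frobenius:
  fixes a b :: "'a::comm_ring_1"
  assumes "prime p"
  shows "pcong (int p) ((a + b) ^ p) (a ^ p + b ^ p)"
proof -
  have p: "p > 0" using assms prime_gt_0_nat by blast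
  have "(a + b) ^ p = (\<Sum>k\<le>p. of_nat (p choose k) * a ^ k * b ^ (p - k))"
    by (rule binomial_ring)
  also have "{..p} = insert 0 (insert p {0<..<p})" using p by auto
  also have "(\<Sum>k\<in>insert 0 (insert p {0<..<p}). of_nat (p choose k) * a ^ k * b ^ (p - k))
      = a ^ p + b ^ p + (\<Sum>k\<in>{0<..<p}. of_nat (p choose k) * a ^ k * b ^ (p - k))"
    using p by (simp add: algebra_simps)
  finally have *: "(a + b) ^ p - (a ^ p + b ^ p) = (\<Sum>k\<in>{0<..<p}. of_nat (p choose k) * a ^ k * b ^ (p - k))"
    by simp
  have "of_int (int p) dvd (\<Sum>k\<in>{0<..<p}. of_nat (p choose k) * a ^ k * b ^ (p - k))"
  proof (rule dvd_sum)
    fix k assume k: "k \<in> {0<..<p}"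
    then have "p dvd (p choose k)" using assms by (intro dvd_choose_prime) auto
    then have "of_nat p dvd (of_nat (p choose k) :: 'a)" by (metis dvd_def of_nat_mult)
    then show "of_int (int p) dvd of_nat (p choose k) * a ^ k * b ^ (p - k)" by simp
  qed
  then show ?thesis by (simp add: pcong_def *)
qed

lemma pcong_frobenius_sum:
  fixes g :: "'i \<Rightarrow> 'a::comm_ring_1"
  assumes "prime p"
  shows "pcong (int p) (sum g I ^ p) (\<Sum>i\<in>I. g i ^ p)"
proof (induction I rule: infinite_finite_induct)
  case (insert x F)
  have "pcong (int p) ((g x + sum g F) ^ p) (g x ^ p + sum g F ^ p)"
    by (rule pcong_frobenius[OF assms])
  also have "pcong (int p) (g x ^ p + sum g F ^ p) (g x ^ p + (\<Sum>i\<in>F. g i ^ p))"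
    by (intro pcong_add pcong_refl insert.IH)
  finally show ?case using insert by simp
qed (use assms in \<open>auto simp: prime_gt_0_nat zero_power\<close>)

lemma pcong_frobenius_sum_power:
  fixes g :: "'i \<Rightarrow> 'a::comm_ring_1"
  assumes "prime p"
  shows "pcong (int p) (sum g I ^ (p ^ k)) (\<Sum>i\<in>I. g i ^ (p ^ k))"
proof (induction k)
  case (Suc k)
  have "pcong (int p) ((sum g I ^ (p ^ k)) ^ p) ((\<Sum>i\<in>I. g i ^ (p ^ k)) ^ p)"
    by (intro pcong_power Suc)
  also have "pcong (int p) ((\<Sum>i\<in>I. g i ^ (p ^ k)) ^ p) (\<Sum>i\<in>I. (g i ^ (p ^ k)) ^ p)"
    by (rule pcong_frobenius_sum[OF assms])
  finally show ?case by (simp add: power_mult[symmetric] mult.commute)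
qed auto

section \<open>Coefficients and divisibility of integer polynomials\<close>

lemma lookup_of_int_mult [simp]:
  "Poly_Mapping.lookup (of_int c * P) m = c * Poly_Mapping.lookup (P :: 'k::comm_monoid_add \<Rightarrow>\<^sub>0 int) m"
proof -
  have "of_int c = (Poly_Mapping.single 0 c :: 'k \<Rightarrow>\<^sub>0 int)"
    by (metis of_int_eq_id id_apply single_of_int)
  then have "of_int c * P = Poly_Mapping.map ((*) c) P"
    by (simp only: mult_map_scale_conv_mult)
  then show ?thesis by (simp add: Poly_Mapping.map.rep_eq when_def)
qed

lemma of_int_dvd_poly_iff:
  "of_int c dvd (P :: 'k::comm_monoid_add \<Rightarrow>\<^sub>0 int) \<longleftrightarrow> (\<forall>m. c dvd Poly_Mapping.lookup P m)"
proof
  assume *: "\<forall>m. c dvd Poly_Mapping.lookup P m"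
  have "P = of_int c * Poly_Mapping.map (\<lambda>x. x div c) P"
  proof (rule poly_mapping_eqI)
    fix k
    have "c dvd Poly_Mapping.lookup P k" using * by blast
    then show "Poly_Mapping.lookup P k = Poly_Mapping.lookup (of_int c * Poly_Mapping.map (\<lambda>x. x div c) P) k"
      by (simp add: Poly_Mapping.map.rep_eq when_def)
  qed
  then show "of_int c dvd P" by (rule dvdI)
qed (auto simp: dvd_def)

lemma pcong_poly_iff:
  "pcong p (P :: 'k::comm_monoid_add \<Rightarrow>\<^sub>0 int) Q \<longleftrightarrow> (\<forall>m. [Poly_Mapping.lookup P m = Poly_Mapping.lookup Q m] (mod p))"
  by (simp add: pcong_def of_int_dvd_poly_iff cong_iff_dvd_diff lookup_minus)

lemma lookup_single_mult_add:
  "Poly_Mapping.lookup (Poly_Mapping.single k c * P) (k + m) = c * Poly_Mapping.lookup P (m :: 'k::cancel_comm_monoid_add)"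
proof -
  have "Poly_Mapping.lookup (Poly_Mapping.single k c * P) (k + m)
      = (\<Sum>l. Poly_Mapping.lookup (Poly_Mapping.single k c) l * (\<Sum>q. Poly_Mapping.lookup P q when k + m = l + q))"
    by (rule lookup_mult)
  also have "\<dots> = (\<Sum>l. (c * (\<Sum>q. Poly_Mapping.lookup P q when k + m = l + q)) when l = k)"
    by (rule arg_cong[of _ _ Sum_any]) (auto simp: lookup_single when_def)
  also have "\<dots> = c * (\<Sum>q. Poly_Mapping.lookup P q when q = m)"
    by (simp add: eq_commute[of m])
  finally show ?thesis by simp
qed

lemma lookup_single_mult_not:
  assumes "\<And>m'. m \<noteq> k + m'"
  shows "Poly_Mapping.lookup (Poly_Mapping.single k c * P) (m :: 'k::cancel_comm_monoid_add) = 0"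
proof -
  have "Poly_Mapping.lookup (Poly_Mapping.single k c * P) m
      = (\<Sum>l. Poly_Mapping.lookup (Poly_Mapping.single k c) l * (\<Sum>q. Poly_Mapping.lookup P q when m = l + q))"
    by (rule lookup_mult)
  also have "\<dots> = (\<Sum>l. (c * (\<Sum>q. Poly_Mapping.lookup P q when m = l + q)) when l = k)"
    by (rule arg_cong[of _ _ Sum_any]) (auto simp: lookup_single when_def)
  finally show ?thesis using assms by simp
qed

lemma mon_le_add: "(\<And>v. Poly_Mapping.lookup k v \<le> Poly_Mapping.lookup m v) \<Longrightarrow> m = k + (m - (k :: 'v \<Rightarrow>\<^sub>0 nat))"
  by (rule poly_mapping_eqI) (simp add: lookup_add lookup_minus)

lemma lookup_single_mult:
  fixes k m :: "'v \<Rightarrow>\<^sub>0 nat"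
  shows "Poly_Mapping.lookup (Poly_Mapping.single k c * P) m
    = (if \<forall>v. Poly_Mapping.lookup k v \<le> Poly_Mapping.lookup m v then c * Poly_Mapping.lookup P (m - k) else 0)"
proof (cases "\<forall>v. Poly_Mapping.lookup k v \<le> Poly_Mapping.lookup m v")
  case True
  then show ?thesis using lookup_single_mult_add[of k c P "m - k"] mon_le_add[of k m] by simp
next
  case False
  then have "m \<noteq> k + m'" for m' by (auto simp: lookup_add)
  then have "Poly_Mapping.lookup (Poly_Mapping.single k c * P) m = 0" by (rule lookup_single_mult_not)
  then show ?thesis using False by (simp only: if_False)
qed

lemma single_power:
  "(Poly_Mapping.single m c :: 'k::comm_monoid_add \<Rightarrow>\<^sub>0 'b::comm_semiring_1) ^ n
    = Poly_Mapping.single (((+) m ^^ n) 0) (c ^ n)"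
  by (induction n) (auto simp: mult_single)

lemma lookup_funpow_add: "Poly_Mapping.lookup (((+) m ^^ n) (0 :: 'v \<Rightarrow>\<^sub>0 nat)) v = n * Poly_Mapping.lookup m v"
  by (induction n) (auto simp: lookup_add)

lemma poly_sum_monomials: "P = (\<Sum>m\<in>Poly_Mapping.keys P. Poly_Mapping.single m (Poly_Mapping.lookup P m))"
proof (rule poly_mapping_eqI)
  fix k
  have "Poly_Mapping.lookup (\<Sum>m\<in>Poly_Mapping.keys P. Poly_Mapping.single m (Poly_Mapping.lookup P m)) k
      = (\<Sum>m\<in>Poly_Mapping.keys P. if m = k then Poly_Mapping.lookup P m else 0)"
    unfolding lookup_sum by (intro sum.cong refl) (auto simp: lookup_single when_def)
  then show "Poly_Mapping.lookup P k = Poly_Mapping.lookup (\<Sum>m\<in>Poly_Mapping.keys P. Poly_Mapping.single m (Poly_Mapping.lookup P m)) k"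
    by (auto simp: in_keys_iff sum.delta)
qed

text \<open>\<open>\<int>[x]/p\<close> is a domain: compare the largest monomials of the two factors whose coefficients are not divisible by \<open>p\<close>.\<close>

lemma of_int_dvd_multD:
  fixes P Q :: "'k::{cancel_comm_monoid_add, linordered_cancel_ab_semigroup_add} \<Rightarrow>\<^sub>0 int"
  assumes p: "p = 0 \<or> prime p" and dvd: "of_int p dvd P * Q"
  shows "of_int p dvd P \<or> of_int p dvd Q"
proof (rule ccontr)
  assume neg: "\<not> ?thesis"
  define K where "K P = {m. \<not> p dvd Poly_Mapping.lookup P m}" for P :: "'k \<Rightarrow>\<^sub>0 int"
  have fin: "finite (K P)" for P
    by (rule finite_subset[of _ "Poly_Mapping.keys P"]) (auto simp: K_def in_keys_iff)
  have ne: "K P \<noteq> {}" "K Q \<noteq> {}" using neg by (auto simp: K_def of_int_dvd_poly_iff)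
  define a where "a = Max (K P)"
  define b where "b = Max (K Q)"
  have a: "\<not> p dvd Poly_Mapping.lookup P a" and b: "\<not> p dvd Poly_Mapping.lookup Q b"
    using Max_in[OF fin ne(1)] Max_in[OF fin ne(2)] unfolding a_def b_def by (auto simp: K_def)
  have a': "p dvd Poly_Mapping.lookup P m" if "m > a" for m
  proof (rule ccontr)
    assume "\<not> ?thesis"
    then have "m \<le> a" unfolding a_def by (intro Max_ge fin) (simp add: K_def)
    then show False using that by simp
  qed
  have b': "p dvd Poly_Mapping.lookup Q m" if "m > b" for m
  proof (rule ccontr)
    assume "\<not> ?thesis"
    then have "m \<le> b" unfolding b_def by (intro Max_ge fin) (simp add: K_def)
    then show False using that by simp
  qed
  have "Poly_Mapping.lookup (P * Q) (a + b) = (\<Sum>m\<in>Poly_Mapping.keys P. Poly_Mapping.lookup (Poly_Mapping.single m (Poly_Mapping.lookup P m) * Q) (a + b))"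
    using arg_cong[OF poly_sum_monomials[of P], of "\<lambda>X. Poly_Mapping.lookup (X * Q) (a + b)"]
    by (simp only: sum_distrib_right lookup_sum)
  also have "\<dots> = Poly_Mapping.lookup P a * Poly_Mapping.lookup Q b
      + (\<Sum>m\<in>Poly_Mapping.keys P - {a}. Poly_Mapping.lookup (Poly_Mapping.single m (Poly_Mapping.lookup P m) * Q) (a + b))"
  proof -
    have "a \<in> Poly_Mapping.keys P" using a by (auto simp: in_keys_iff)
    then show ?thesis by (subst sum.remove[of _ a]) (auto simp: lookup_single_mult_add)
  qed
  finally have eq: "Poly_Mapping.lookup P a * Poly_Mapping.lookup Q b = Poly_Mapping.lookup (P * Q) (a + b)
    - (\<Sum>m\<in>Poly_Mapping.keys P - {a}. Poly_Mapping.lookup (Poly_Mapping.single m (Poly_Mapping.lookup P m) * Q) (a + b))"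
    by simp
  have "p dvd Poly_Mapping.lookup P a * Poly_Mapping.lookup Q b"
    unfolding eq
  proof (rule dvd_diff)
    show "p dvd Poly_Mapping.lookup (P * Q) (a + b)" using dvd by (simp add: of_int_dvd_poly_iff)
    show "p dvd (\<Sum>m\<in>Poly_Mapping.keys P - {a}. Poly_Mapping.lookup (Poly_Mapping.single m (Poly_Mapping.lookup P m) * Q) (a + b))"
    proof (rule dvd_sum)
      fix m assume m: "m \<in> Poly_Mapping.keys P - {a}"
      show "p dvd Poly_Mapping.lookup (Poly_Mapping.single m (Poly_Mapping.lookup P m) * Q) (a + b)"
      proof (cases "\<exists>m'. a + b = m + m'")
        case True
        then obtain m' where m': "a + b = m + m'" by blast
        show ?thesis
        proof (cases "m > a")
          case True
          then show ?thesis using a' by (simp add: m' lookup_single_mult_add)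
        next
          case False
          then have "m < a" using m by auto
          have "m' > b"
          proof (rule ccontr)
            assume "\<not> m' > b"
            then have "m + m' < a + b" using \<open>m < a\<close> by (intro add_less_le_mono) auto
            then show False using m' by simp
          qed
          then show ?thesis using b' by (simp add: m' lookup_single_mult_add)
        qed
      next
        case False
        then show ?thesis by (subst lookup_single_mult_not) auto
      qed
    qed
  qed
  then show False using p a b prime_dvd_mult_iff[of p] by auto
qed

lemma pcong_cancel:
  fixes P Q R :: "'k::{cancel_comm_monoid_add, linordered_cancel_ab_semigroup_add} \<Rightarrow>\<^sub>0 int"
  assumes "p = 0 \<or> prime p" "pcong p (P * Q) (P * R)" "\<not> of_int p dvd P"
  shows "pcong p Q R"
  using of_int_dvd_multD[of p P "Q - R"] assms by (simp add: pcong_def right_diff_distrib)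

lemma poly_carrier_of_int_mult_iff:
  "c \<noteq> 0 \<Longrightarrow> of_int c * x \<in> poly_carrier V \<longleftrightarrow> x \<in> poly_carrier V"
  by (auto simp: poly_carrier_def in_keys_iff)

lemma poly_carrier_dvd:
  assumes "of_int c dvd x" "c \<noteq> 0" "x \<in> poly_carrier V"
  obtains y where "y \<in> poly_carrier V" "x = of_int c * y"
proof -
  obtain y where "x = of_int c * y" using assms(1) by (rule dvdE)
  then show ?thesis using that[of y] assms poly_carrier_of_int_mult_iff[of c y V] by simp
qed

section \<open>Binomial coefficients modulo p\<close>

text \<open>Because \<open>j * (p ^ e choose j)\<close> is a multiple of \<open>p ^ e\<close>: if
  the binomial coefficient were prime to \<open>p\<close>, then \<open>p ^ e\<close> would divide
  the smaller number \<open>j\<close>.\<close>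

lemma prime_dvd_choose_prime_power:
  fixes p :: nat
  assumes "prime p" "0 < j" "j < p ^ e"
  shows "p dvd (p ^ e choose j)"
proof (rule ccontr)
  assume "\<not> p dvd (p ^ e choose j)"
  then have co: "coprime (p ^ e) (p ^ e choose j)"
    using assms(1) by (simp add: prime_imp_coprime)
  obtain i where i: "j = Suc i" using assms(2) gr0_implies_Suc by blast
  obtain n where n: "p ^ e = Suc n" using assms(3) by (cases "p ^ e") auto
  have "j * (p ^ e choose j) = p ^ e * (n choose i)"
    unfolding i n by (rule Suc_times_binomial)
  then have "p ^ e dvd j * (p ^ e choose j)" by simp
  then have "p ^ e dvd j" using co by (simp add: coprime_dvd_mult_left_iff)
  then show False using assms by (auto dest: dvd_imp_le)
qed

text \<open>Vandermonde: every summand except the one for \<open>k = 0\<close> contains some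
  \<open>p ^ e choose k\<close> with \<open>0 < k < p ^ e\<close>. The lower index
  \<open>p ^ e - 1\<close> keeps \<open>k = p ^ e\<close> out of the sum.\<close>

lemma choose_add_prime_power_cong:
  fixes p :: nat
  assumes "prime p"
  shows "[(n + p ^ e) choose (p ^ e - 1) = n choose (p ^ e - 1)] (mod p)"
proof -
  have "(n + p ^ e) choose (p ^ e - 1) = (\<Sum>k\<le>p ^ e - 1. (p ^ e choose k) * (n choose (p ^ e - 1 - k)))"
    by (simp only: vandermonde[where m = "p ^ e" and n = n] add.commute)
  also have "\<dots> = (n choose (p ^ e - 1)) + (\<Sum>k\<in>{..p ^ e - 1} - {0}. (p ^ e choose k) * (n choose (p ^ e - 1 - k)))"
    by (subst sum.remove[of _ 0]) auto
  also have "[\<dots> = (n choose (p ^ e - 1)) + 0] (mod p)"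
  proof (intro cong_add cong_refl)
    have "p dvd (\<Sum>k\<in>{..p ^ e - 1} - {0}. (p ^ e choose k) * (n choose (p ^ e - 1 - k)))"
    proof (rule dvd_sum)
      fix k assume k: "k \<in> {..p ^ e - 1} - {0}"
      have "p ^ e > 0" using assms prime_gt_0_nat by simp
      then have "p dvd (p ^ e choose k)" using k assms by (intro prime_dvd_choose_prime_power) auto
      then show "p dvd (p ^ e choose k) * (n choose (p ^ e - 1 - k))" by simp
    qed
    then show "[(\<Sum>k\<in>{..p ^ e - 1} - {0}. (p ^ e choose k) * (n choose (p ^ e - 1 - k))) = 0] (mod p)"
      by (simp add: cong_0_iff)
  qed
  finally show ?thesis by simp
qed

lemma choose_add_mult_prime_power_cong:
  fixes p :: nat
  assumes "prime p"
  shows "[(n + p ^ e * k) choose (p ^ e - 1) = n choose (p ^ e - 1)] (mod p)"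
proof (induction k)
  case (Suc k)
  have "[(n + p ^ e * k + p ^ e) choose (p ^ e - 1) = (n + p ^ e * k) choose (p ^ e - 1)] (mod p)"
    by (rule choose_add_prime_power_cong[OF assms])
  also have "[(n + p ^ e * k) choose (p ^ e - 1) = n choose (p ^ e - 1)] (mod p)" by (rule Suc)
  finally show ?case by (simp add: algebra_simps)
qed auto

text \<open>A case of Lucas' theorem. The exponent \<open>e = 1\<close> describes the Frobenius
  trace; general \<open>e\<close> is used for the coordinate functions over \<open>q\<close>-th
  powers in the lifting part.\<close>

lemma choose_prime_power_cong:
  fixes p :: nat
  assumes "prime p"
  shows "[n choose (p ^ e - 1) = (if n mod p ^ e = p ^ e - 1 then 1 else 0)] (mod p)"
proof -
  have q: "p ^ e > 0" using assms prime_gt_0_nat by simp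
  have "[(n mod p ^ e + p ^ e * (n div p ^ e)) choose (p ^ e - 1) = (n mod p ^ e) choose (p ^ e - 1)] (mod p)"
    by (rule choose_add_mult_prime_power_cong[OF assms])
  moreover have "(n mod p ^ e) choose (p ^ e - 1) = (if n mod p ^ e = p ^ e - 1 then 1 else 0)"
  proof (cases "n mod p ^ e = p ^ e - 1")
    case False
    then have "n mod p ^ e < p ^ e - 1" using mod_less_divisor[OF q, of n] by linarith
    then show ?thesis using False by (simp only: binomial_eq_0 if_False)
  qed simp
  ultimately show ?thesis by simp
qed

lemma choose_prime_dvd:
  fixes p :: nat
  assumes "prime p" "n mod p \<noteq> p - 1"
  shows "int p dvd int (n choose (p - 1))"
  using choose_prime_power_cong[OF assms(1), of n 1] assms(2) by (simp add: cong_0_iff)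

section \<open>The operator \<open>Phi_S\<close> and its linearity over p-th powers\<close>

lemma Phi_S_eq:
  "Phi_S V p = frag_extend (\<lambda>m. Poly_Mapping.single (m - (\<Sum>v \<in> V. Poly_Mapping.single v (p - 1)))
      (\<Prod>v \<in> V. int (Poly_Mapping.lookup m v choose (p - 1))))"
proof
  fix g
  have "frag_cmul c (Poly_Mapping.single k x) = Poly_Mapping.single k (c * x)" for c x and k :: mon
    by (rule poly_mapping_eqI) (auto simp: lookup_single when_def)
  then show "Phi_S V p g = frag_extend (\<lambda>m. Poly_Mapping.single (m - (\<Sum>v \<in> V. Poly_Mapping.single v (p - 1)))
      (\<Prod>v \<in> V. int (Poly_Mapping.lookup m v choose (p - 1)))) g"
    by (simp add: Phi_S_def frag_extend_def)
qed

lemma Phi_S_add: "Phi_S V p (a + b) = Phi_S V p a + Phi_S V p b"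
  unfolding Phi_S_eq by (rule frag_extend_add)

lemma Phi_S_zero [simp]: "Phi_S V p 0 = 0"
  unfolding Phi_S_eq by simp

lemma Phi_S_diff: "Phi_S V p (a - b) = Phi_S V p a - Phi_S V p b"
  unfolding Phi_S_eq by (rule frag_extend_diff)

lemma Phi_S_sum: "Phi_S V p (sum g I) = (\<Sum>i\<in>I. Phi_S V p (g i))"
  by (induction I rule: infinite_finite_induct) (auto simp: Phi_S_add)

lemma Phi_S_of_int_mult: "Phi_S V p (of_int c * g) = of_int c * Phi_S V p g"
proof -
  have "of_int c * g = frag_cmul c g" for g :: ipoly by (rule poly_mapping_eqI) simp
  then show ?thesis unfolding Phi_S_eq by (simp add: frag_extend_cmul)
qed

lemma Phi_S_single:
  "Phi_S V p (Poly_Mapping.single m c) = Poly_Mapping.single (m - (\<Sum>v \<in> V. Poly_Mapping.single v (p - 1)))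
      (c * (\<Prod>v \<in> V. int (Poly_Mapping.lookup m v choose (p - 1))))"
  by (cases "c = 0") (simp_all add: Phi_S_def)

lemma Phi_S_pcong: "pcong p' a b \<Longrightarrow> pcong p' (Phi_S V p a) (Phi_S V p b)"
  unfolding pcong_def by (auto elim!: dvdE simp: Phi_S_diff[symmetric] Phi_S_of_int_mult)

lemma Phi_S_carrier [simp]:
  assumes "g \<in> poly_carrier V" shows "Phi_S V p g \<in> poly_carrier V"
  unfolding Phi_S_def
proof (rule poly_carrier_sum, rule poly_carrier_single)
  fix m assume "m \<in> Poly_Mapping.keys g"
  then have "Poly_Mapping.keys m \<subseteq> V" using assms by (auto simp: poly_carrier_def)
  moreover have "Poly_Mapping.keys (m - k) \<subseteq> Poly_Mapping.keys m" for k :: mon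
    by (auto simp: in_keys_iff lookup_minus)
  ultimately show "Poly_Mapping.keys (m - (\<Sum>v \<in> V. Poly_Mapping.single v (p - 1))) \<subseteq> V" by blast
qed

lemma lookup_sum_singles:
  "finite V \<Longrightarrow> Poly_Mapping.lookup (\<Sum>v \<in> V. Poly_Mapping.single v (k v)) x = (if x \<in> V then k x else 0)"
  by (simp add: lookup_sum lookup_single when_def sum.delta)

text \<open>Adding multiples of \<open>p\<close> to the exponents does not change the binomial
  coefficients modulo \<open>p\<close>. The subtraction of exponents truncates when some exponent is
  below \<open>p - 1\<close>, and exactly then the coefficient vanishes modulo
  \<open>p\<close>.\<close>

lemma Phi_S_monomial_power:
  assumes p: "prime p" and V: "finite V"
  shows "pcong (int p) (Phi_S V p (Poly_Mapping.single n 1 ^ p * g)) (Poly_Mapping.single n 1 ^ p * Phi_S V p g)"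
proof -
  let ?e = "\<Sum>v \<in> V. Poly_Mapping.single v (p - 1)"
  define N where "N = ((+) n ^^ p) 0"
  have X: "Poly_Mapping.single n 1 ^ p = (Poly_Mapping.single N 1 :: ipoly)" by (simp add: single_power N_def)
  have N: "Poly_Mapping.lookup N v = p * Poly_Mapping.lookup n v" for v by (simp add: N_def lookup_funpow_add)
  have single: "pcong (int p) (Phi_S V p (Poly_Mapping.single N 1 * Poly_Mapping.single m c))
      (Poly_Mapping.single N 1 * Phi_S V p (Poly_Mapping.single m c))" for m c
  proof -
    let ?P = "\<Prod>v \<in> V. int (Poly_Mapping.lookup (N + m) v choose (p - 1))"
    let ?Q = "\<Prod>v \<in> V. int (Poly_Mapping.lookup m v choose (p - 1))"
    have L: "Phi_S V p (Poly_Mapping.single N 1 * Poly_Mapping.single m c) = Poly_Mapping.single (N + m - ?e) (c * ?P)"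
      by (simp add: mult_single Phi_S_single)
    have R: "Poly_Mapping.single N 1 * Phi_S V p (Poly_Mapping.single m c) = Poly_Mapping.single (N + (m - ?e)) (c * ?Q)"
      by (simp add: mult_single Phi_S_single)
    have PQ: "[?P = ?Q] (mod int p)"
    proof (rule cong_prod)
      fix v
      have "[(Poly_Mapping.lookup m v + p ^ 1 * Poly_Mapping.lookup n v) choose (p ^ 1 - 1) = Poly_Mapping.lookup m v choose (p ^ 1 - 1)] (mod p)"
        by (rule choose_add_mult_prime_power_cong[OF p])
      then show "[int (Poly_Mapping.lookup (N + m) v choose (p - 1)) = int (Poly_Mapping.lookup m v choose (p - 1))] (mod int p)"
        by (simp add: lookup_add N add.commute cong_int_iff)
    qed
    show ?thesis
    proof (cases "\<forall>v\<in>V. p - 1 \<le> Poly_Mapping.lookup m v")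
      case True
      then have "N + m - ?e = N + (m - ?e)"
        by (intro poly_mapping_eqI) (auto simp: lookup_add lookup_minus lookup_sum_singles[OF V])
      then show ?thesis unfolding L R pcong_poly_iff
        using PQ by (auto simp: lookup_single when_def intro!: cong_mult)
    next
      case False
      then have "?Q = 0" using V by (auto simp: prod_zero_iff not_le intro!: bexI)
      then have "pcong (int p) (Poly_Mapping.single (N + m - ?e) (c * ?P)) 0"
        using PQ unfolding pcong_poly_iff by (auto simp: lookup_single when_def cong_0_iff)
      then show ?thesis using \<open>?Q = 0\<close> unfolding L R by simp
    qed
  qed
  have "pcong (int p) (\<Sum>m\<in>Poly_Mapping.keys g. Phi_S V p (Poly_Mapping.single N 1 * Poly_Mapping.single m (Poly_Mapping.lookup g m)))
      (\<Sum>m\<in>Poly_Mapping.keys g. Poly_Mapping.single N 1 * Phi_S V p (Poly_Mapping.single m (Poly_Mapping.lookup g m)))"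
    by (intro pcong_sum single)
  also have "(\<Sum>m\<in>Poly_Mapping.keys g. Phi_S V p (Poly_Mapping.single N 1 * Poly_Mapping.single m (Poly_Mapping.lookup g m)))
      = Phi_S V p (Poly_Mapping.single N 1 * g)"
    by (simp only: Phi_S_sum[symmetric] sum_distrib_left[symmetric] poly_sum_monomials[symmetric])
  also have "(\<Sum>m\<in>Poly_Mapping.keys g. Poly_Mapping.single N 1 * Phi_S V p (Poly_Mapping.single m (Poly_Mapping.lookup g m)))
      = Poly_Mapping.single N 1 * Phi_S V p g"
    by (simp only: Phi_S_sum[symmetric] sum_distrib_left[symmetric] poly_sum_monomials[symmetric])
  finally show ?thesis unfolding X .
qed

text \<open>Modulo \<open>p\<close>, \<open>x ^ p\<close> is the sum of the \<open>p\<close>-th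
  powers of the terms of \<open>x\<close>, which reduces the claim to monomials; integer
  coefficients pass through by additivity.\<close>

lemma Phi_S_power:
  assumes p: "prime p" and V: "finite V"
  shows "pcong (int p) (Phi_S V p (x ^ p * g)) (x ^ p * Phi_S V p g)"
proof -
  define t where "t m = Poly_Mapping.single m (Poly_Mapping.lookup x m)" for m
  have xt: "x = sum t (Poly_Mapping.keys x)" unfolding t_def by (rule poly_sum_monomials)
  have xp: "pcong (int p) (x ^ p) (\<Sum>m\<in>Poly_Mapping.keys x. t m ^ p)"
    by (subst xt) (rule pcong_frobenius_sum[OF p])
  have t: "t m = of_int (Poly_Mapping.lookup x m) * Poly_Mapping.single m 1" for m
    by (rule poly_mapping_eqI) (simp add: t_def lookup_single when_def)
  have tp: "pcong (int p) (Phi_S V p (t m ^ p * g)) (t m ^ p * Phi_S V p g)" for m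
  proof -
    have "pcong (int p) (of_int (Poly_Mapping.lookup x m ^ p) * Phi_S V p (Poly_Mapping.single m 1 ^ p * g))
       (of_int (Poly_Mapping.lookup x m ^ p) * (Poly_Mapping.single m 1 ^ p * Phi_S V p g))"
      by (intro pcong_mult pcong_refl Phi_S_monomial_power assms)
    moreover have "t m ^ p * h = of_int (Poly_Mapping.lookup x m ^ p) * (Poly_Mapping.single m 1 ^ p * h)" for h
      by (simp add: t power_mult_distrib mult.assoc)
    ultimately show ?thesis by (simp only: Phi_S_of_int_mult)
  qed
  have "pcong (int p) (Phi_S V p (x ^ p * g)) (Phi_S V p ((\<Sum>m\<in>Poly_Mapping.keys x. t m ^ p) * g))"
    by (intro Phi_S_pcong pcong_mult xp pcong_refl)
  also have "Phi_S V p ((\<Sum>m\<in>Poly_Mapping.keys x. t m ^ p) * g) = (\<Sum>m\<in>Poly_Mapping.keys x. Phi_S V p (t m ^ p * g))"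
    by (simp only: sum_distrib_right Phi_S_sum)
  also have "pcong (int p) \<dots> (\<Sum>m\<in>Poly_Mapping.keys x. t m ^ p * Phi_S V p g)"
    by (intro pcong_sum tp)
  also have "\<dots> = (\<Sum>m\<in>Poly_Mapping.keys x. t m ^ p) * Phi_S V p g" by (simp only: sum_distrib_right)
  also have "pcong (int p) \<dots> (x ^ p * Phi_S V p g)"
    by (intro pcong_mult pcong_sym[OF xp] pcong_refl)
  finally show ?thesis .
qed

lemma pcong_hyper_ideal:
  assumes "pcong p x y" "p \<noteq> 0" "x \<in> poly_carrier V" "y \<in> poly_carrier V"
  shows "x - y \<in> hyper_ideal V f p"
proof -
  obtain z where "z \<in> poly_carrier V" "x - y = of_int p * z"
    using poly_carrier_dvd[of p "x - y" V] assms unfolding pcong_def by auto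
  then show ?thesis by simp
qed

section \<open>What a lift of the Frobenius trace provides\<close>

lemma diffop_mod_additive:
  assumes "diffop_mod (poly_carrier V) (hyper_ideal V f k) n d" "x \<in> poly_carrier V" "y \<in> poly_carrier V"
  shows "d (x + y) - (d x + d y) \<in> hyper_ideal V f k"
proof (cases n)
  case 0
  then obtain r where r: "r \<in> poly_carrier V" "\<And>x. x \<in> poly_carrier V \<Longrightarrow> d x - r * x \<in> hyper_ideal V f k"
    using assms(1) by auto
  have "d (x + y) - (d x + d y) = (d (x + y) - r * (x + y)) - (d x - r * x) - (d y - r * y)"
    by (simp add: algebra_simps)
  also have "\<dots> \<in> hyper_ideal V f k"
    by (rule hyper_ideal_diff[OF hyper_ideal_diff]) (use r assms(2,3) in auto)
  finally show ?thesis .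
qed (use assms in auto)

lemma additive_mod_of_nat:
  assumes add: "\<And>x y. x \<in> poly_carrier V \<Longrightarrow> y \<in> poly_carrier V \<Longrightarrow> d (x + y) - (d x + d y) \<in> hyper_ideal V f k"
    and x: "x \<in> poly_carrier V"
  shows "d (of_nat c * x) - of_nat c * d x \<in> hyper_ideal V f k"
proof (induction c)
  case 0
  have "- (d (0 + 0) - (d 0 + d 0)) \<in> hyper_ideal V f k" by (intro hyper_ideal_uminus add) auto
  then show ?case by simp
next
  case (Suc c)
  have "(d (of_nat c * x + x) - (d (of_nat c * x) + d x)) + (d (of_nat c * x) - of_nat c * d x) \<in> hyper_ideal V f k"
    using Suc x by (intro hyper_ideal_add add) auto
  then show ?case by (simp add: algebra_simps)
qed

text \<open>Both kinds of lift give the same data. A lift to \<open>R\<close> is first reduced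
  modulo \<open>p ^ 2\<close>, which is the content of "a fortiori" in the theorem.\<close>

lemma frobenius_lift_data:
  assumes f: "f \<in> poly_carrier V" and p: "prime p" and V: "finite V"
    and lift: "lifts_to_mod_sq (hypersurface V f) p (frob_trace V f p) \<or> lifts_to_ring (hypersurface V f) p (frob_trace V f p)"
  obtains d k where "\<forall>x\<in>poly_carrier V. d x \<in> poly_carrier V"
    "\<forall>x\<in>poly_carrier V. \<forall>y\<in>poly_carrier V. d (x + y) - (d x + d y) \<in> hyper_ideal V f (int p ^ 2)"
    "\<forall>x\<in>poly_carrier V. x \<in> hyper_ideal V f (int p ^ 2) \<longrightarrow> d x \<in> hyper_ideal V f (int p ^ 2)"
    "\<forall>a\<in>poly_carrier V. \<forall>x\<in>poly_carrier V.
       d (a ^ (p ^ Suc (Suc k)) * x) - a ^ (p ^ Suc (Suc k)) * d x \<in> hyper_ideal V f (int p ^ 2)"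
    "\<forall>x\<in>poly_carrier V. d x - Phi_S V p (f ^ (p - 1) * x) \<in> hyper_ideal V f (int p)"
proof -
  note conclude = that
  let ?S = "poly_carrier V" and ?J = "hyper_ideal V f (int p ^ 2)" and ?H = "hypersurface V f"
  have p0: "int p \<noteq> 0" using p by auto
  interpret H: quotient_presentation ?H ?S "hyper_ideal V f 0" "hproj V f"
    by (rule presentation_hypersurface[OF f])
  interpret Mp: quotient_presentation "mod_int ?H p" ?S "hyper_ideal V f (int p)" "mproj V f p"
    by (rule presentation_mod_int[OF f])
  interpret M: quotient_presentation "mod_int ?H (p ^ 2)" ?S ?J "mproj V f (p ^ 2)"
    using presentation_mod_int[OF f, of "p ^ 2"] by simp
  have trace: "y - Phi_S V p (f ^ (p - 1) * x) \<in> hyper_ideal V f (int p)"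
    if x: "x \<in> ?S" and y: "y \<in> ?S" and eq: "mproj V f p y = frob_trace V f p (mproj V f p x)" for x y
  proof -
    obtain g where g: "g \<in> ?S" "g - x \<in> hyper_ideal V f (int p)"
      "frob_trace V f p (mproj V f p x) = mproj V f p (Phi_S V p (f ^ (p - 1) * g))"
      using frob_trace_eq[OF f x] by blast
    have 1: "y - Phi_S V p (f ^ (p - 1) * g) \<in> hyper_ideal V f (int p)"
      using eq g y f Mp.proj_eq_iff[of y "Phi_S V p (f ^ (p - 1) * g)"] by simp
    obtain a b where ab: "a \<in> ?S" "b \<in> ?S" "g - x = f * a + of_int (int p) * b"
      using g(2) by (rule hyper_idealE)
    \<comment> \<open>The difference is \<open>f ^ p * a\<close> up to a multiple of
      \<open>p\<close>, and \<open>f ^ p\<close> passes through \<open>Phi_S\<close> modulo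
      \<open>p\<close>. Hence the trace depends only on the class of its argument modulo
      \<open>f\<close> and \<open>p\<close>.\<close>
    have "f ^ (p - 1) * g - f ^ (p - 1) * x = f ^ (p - 1) * (g - x)" by (simp add: algebra_simps)
    also have "\<dots> = f ^ p * a + of_int (int p) * (f ^ (p - 1) * b)"
      using p prime_gt_0_nat[of p] by (simp add: ab(3) algebra_simps power_eq_if)
    finally have "Phi_S V p (f ^ (p - 1) * g) - Phi_S V p (f ^ (p - 1) * x)
       = (Phi_S V p (f ^ p * a) - f ^ p * Phi_S V p a) + f ^ p * Phi_S V p a + of_int (int p) * Phi_S V p (f ^ (p - 1) * b)"
      by (simp only: Phi_S_diff[symmetric] Phi_S_add Phi_S_of_int_mult) simp
    also have "\<dots> \<in> hyper_ideal V f (int p)"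
    proof (intro hyper_ideal_add)
      show "Phi_S V p (f ^ p * a) - f ^ p * Phi_S V p a \<in> hyper_ideal V f (int p)"
        using f ab p0 by (intro pcong_hyper_ideal Phi_S_power[OF p V]) auto
      have "f ^ p * Phi_S V p a = f * (f ^ (p - 1) * Phi_S V p a)"
        using p prime_gt_0_nat[of p] by (simp add: power_eq_if)
      also have "\<dots> \<in> hyper_ideal V f (int p)" using f ab by (intro hyper_ideal_gen) auto
      finally show "f ^ p * Phi_S V p a \<in> hyper_ideal V f (int p)" .
      show "of_int (int p) * Phi_S V p (f ^ (p - 1) * b) \<in> hyper_ideal V f (int p)"
        using f ab by (intro hyper_ideal_int) auto
    qed
    finally have "(y - Phi_S V p (f ^ (p - 1) * g)) + (Phi_S V p (f ^ (p - 1) * g) - Phi_S V p (f ^ (p - 1) * x))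
        \<in> hyper_ideal V f (int p)"
      using 1 by (intro hyper_ideal_add)
    then show ?thesis by simp
  qed
  have main: thesis
    if d: "\<And>x. x \<in> ?S \<Longrightarrow> d x \<in> ?S" and n: "diffop_mod ?S ?J n d"
      and compat: "\<And>x. x \<in> ?S \<Longrightarrow> x \<in> ?J \<Longrightarrow> d x \<in> ?J"
      and tr: "\<And>x. x \<in> ?S \<Longrightarrow> mproj V f p (d x) = frob_trace V f p (mproj V f p x)" for d n
  proof -
    have add: "d (x + y) - (d x + d y) \<in> ?J" if "x \<in> ?S" "y \<in> ?S" for x y
      using diffop_mod_additive[OF n that] .
    have compat2: "d x - d y \<in> ?J" if "x \<in> ?S" "y \<in> ?S" "x - y \<in> ?J" for x y
    proof -
      have "(d (y + (x - y)) - (d y + d (x - y))) + d (x - y) \<in> ?J"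
        using that by (intro hyper_ideal_add add compat) auto
      then show ?thesis by simp
    qed
    \<comment> \<open>Order \<open>n\<close> and the modulus \<open>p ^ 2\<close> give linearity
      over powers with exponent \<open>(p ^ 2) ^ n\<close>. Starting from \<open>a ^ (p ^ 2)\<close>
      makes the exponent larger than \<open>p\<close> even for order 0, which is needed later for
      \<open>q - p > 0\<close>.\<close>
    have pw: "d (a ^ (p ^ Suc (Suc (2 * n))) * x) - a ^ (p ^ Suc (Suc (2 * n))) * d x \<in> ?J" if "a \<in> ?S" "x \<in> ?S" for a x
    proof -
      have "d ((a ^ (p ^ 2)) ^ ((p ^ 2) ^ n) * x) - (a ^ (p ^ 2)) ^ ((p ^ 2) ^ n) * d x \<in> ?J"
      proof (rule diffop_mod_power_linear[OF _ _ _ _ _ _ n d compat2])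
        show "of_nat (p ^ 2) \<in> ?J" using hyper_ideal_int[of 1 V "int p ^ 2" f] by simp
      qed (use that in \<open>auto intro: hyper_ideal_add hyper_ideal_mult\<close>)
      moreover have "(a ^ (p ^ 2)) ^ ((p ^ 2) ^ n) = a ^ (p ^ Suc (Suc (2 * n)))"
        by (simp add: power_mult[symmetric] power_add[symmetric] del: power_Suc)
      ultimately show ?thesis by simp
    qed
    show thesis
      by (rule conclude[of d "2 * n"]) (use d add compat pw trace tr in auto)
  qed
  from lift show thesis
  proof
    assume "lifts_to_mod_sq ?H p (frob_trace V f p)"
    then obtain \<delta> where \<delta>: "diffop (mod_int ?H (p ^ 2)) \<delta>"
      and tr: "\<forall>r \<in> carrier ?H. \<forall>s \<in> \<delta> (int_ideal ?H (p ^ 2) +>\<^bsub>?H\<^esub> r).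
          int_ideal ?H p +>\<^bsub>?H\<^esub> s = frob_trace V f p (int_ideal ?H p +>\<^bsub>?H\<^esub> r)"
      unfolding lifts_to_mod_sq_def by blast
    obtain d n where d: "\<And>x. x \<in> ?S \<Longrightarrow> d x \<in> ?S" "\<And>x. x \<in> ?S \<Longrightarrow> mproj V f (p ^ 2) (d x) = \<delta> (mproj V f (p ^ 2) x)"
      "diffop_mod ?S ?J n d" "\<And>x y. x \<in> ?S \<Longrightarrow> y \<in> ?S \<Longrightarrow> x - y \<in> ?J \<Longrightarrow> d x - d y \<in> ?J"
      using M.diffop_representative[OF \<delta>] by metis
    show thesis
    proof (rule main[of d n])
      have "d 0 \<in> ?J" using additive_mod_of_nat[OF diffop_mod_additive[OF d(3)], where c = 0 and x = 0] by simp
      then show "d x \<in> ?J" if "x \<in> ?S" "x \<in> ?J" for x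
        using d(4)[of x 0] that by (simp add: hyper_ideal_diff_iff)
      show "mproj V f p (d x) = frob_trace V f p (mproj V f p x)" if x: "x \<in> ?S" for x
      proof -
        interpret I: ideal "int_ideal ?H (p ^ 2)" ?H by (rule ideal_int_ideal[OF f])
        have "hproj V f (d x) \<in> mproj V f (p ^ 2) (d x)"
          unfolding mproj_def by (intro I.a_rcos_self H.proj_closed d x)
        then show ?thesis using tr H.proj_closed[OF x] d(2)[OF x] unfolding mproj_def by simp
      qed
    qed (use d in auto)
  next
    assume "lifts_to_ring ?H p (frob_trace V f p)"
    then obtain \<delta> where \<delta>: "diffop ?H \<delta>"
      and tr: "\<forall>r \<in> carrier ?H. int_ideal ?H p +>\<^bsub>?H\<^esub> \<delta> r = frob_trace V f p (int_ideal ?H p +>\<^bsub>?H\<^esub> r)"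
      unfolding lifts_to_ring_def by blast
    obtain d n where d: "\<And>x. x \<in> ?S \<Longrightarrow> d x \<in> ?S" "\<And>x. x \<in> ?S \<Longrightarrow> hproj V f (d x) = \<delta> (hproj V f x)"
      "diffop_mod ?S (hyper_ideal V f 0) n d"
      "\<And>x y. x \<in> ?S \<Longrightarrow> y \<in> ?S \<Longrightarrow> x - y \<in> hyper_ideal V f 0 \<Longrightarrow> d x - d y \<in> hyper_ideal V f 0"
      using H.diffop_representative[OF \<delta>] by metis
    have sub: "hyper_ideal V f 0 \<subseteq> ?J" by (rule hyper_ideal_mono) simp
    have n: "diffop_mod ?S ?J n d" by (rule diffop_mod_mono[OF d(3) sub])
    show thesis
    proof (rule main[of d n])
      have d0: "d 0 \<in> ?J" using additive_mod_of_nat[OF diffop_mod_additive[OF n], where c = 0 and x = 0] by simp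
      \<comment> \<open>A map well defined modulo \<open>f\<close> and additive modulo
        \<open>?J\<close> sends multiples of \<open>p ^ 2\<close> into \<open>?J\<close>, so it is
        also well defined modulo \<open>?J\<close>.\<close>
      show "d x \<in> ?J" if x: "x \<in> ?S" "x \<in> ?J" for x
      proof -
        obtain a b where ab: "a \<in> ?S" "b \<in> ?S" "x = f * a + of_int (int p ^ 2) * b"
          using x(2) by (rule hyper_idealE)
        have 1: "d (f * a) \<in> ?J"
          using d(4)[of "f * a" 0] ab f d0 sub by (auto simp: hyper_ideal_diff_iff[OF d0])
        have "d (of_nat (p ^ 2) * b) - of_nat (p ^ 2) * d b \<in> ?J"
          by (rule additive_mod_of_nat[OF diffop_mod_additive[OF n] ab(2)])
        moreover have "of_nat (p ^ 2) * d b \<in> ?J"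
          using hyper_ideal_int[OF d(1)[OF ab(2)], of "int p ^ 2" f] by simp
        ultimately have 2: "d (of_nat (p ^ 2) * b) \<in> ?J" by (simp add: hyper_ideal_diff_iff)
        have "d (f * a + of_nat (p ^ 2) * b) - (d (f * a) + d (of_nat (p ^ 2) * b)) \<in> ?J"
          using f ab by (intro diffop_mod_additive[OF n]) auto
        then have "d (f * a + of_nat (p ^ 2) * b) \<in> ?J"
          using hyper_ideal_add[OF 1 2] by (simp only: hyper_ideal_diff_iff)
        then show ?thesis using ab(3) by simp
      qed
      show "mproj V f p (d x) = frob_trace V f p (mproj V f p x)" if x: "x \<in> ?S" for x
        using tr H.proj_closed[OF x] d(2)[OF x] unfolding mproj_def by simp
    qed (use d n in auto)
  qed
qed

text \<open>In \<open>p * x = f * a + p ^ 2 * b\<close> the prime divides \<open>f * a\<close>.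
  Polynomials modulo \<open>p\<close> form a domain in which \<open>f\<close> is nonzero, so
  \<open>p\<close> divides \<open>a\<close> and the equation can be divided by
  \<open>p\<close>.\<close>

lemma hyper_ideal_cancel:
  assumes p: "prime p" and f: "f \<in> poly_carrier V" "\<not> of_int p dvd f" and x: "of_int p * x \<in> hyper_ideal V f (p ^ 2)"
    "x \<in> poly_carrier V"
  shows "x \<in> hyper_ideal V f p"
proof -
  have p0: "p \<noteq> 0" using p by auto
  obtain a b where ab: "a \<in> poly_carrier V" "b \<in> poly_carrier V" "of_int p * x = f * a + of_int (p ^ 2) * b"
    using x(1) by (rule hyper_idealE)
  have "f * a = of_int p * (x - of_int p * b)" using ab(3) by (simp add: algebra_simps power2_eq_square)
  then have "of_int p dvd f * a" by simp
  then have "of_int p dvd a" using of_int_dvd_multD[of p f a] p f by blast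
  then obtain c where c: "c \<in> poly_carrier V" "a = of_int p * c" using poly_carrier_dvd p0 ab(1) by blast
  have "of_int p * x = of_int p * (f * c + of_int p * b)"
    using ab(3) by (simp add: c algebra_simps power2_eq_square)
  then have "of_int p * (x - (f * c + of_int p * b)) = 0" by (simp add: algebra_simps)
  then have "x - (f * c + of_int p * b) = 0"
  proof -
    have "Poly_Mapping.lookup (x - (f * c + of_int p * b)) m = 0" for m
      using arg_cong[OF \<open>of_int p * (x - (f * c + of_int p * b)) = 0\<close>, of "\<lambda>P. Poly_Mapping.lookup P m"] p0 by simp
    then show ?thesis by (intro poly_mapping_eqI) simp
  qed
  then show ?thesis using c ab by (intro hyper_idealI[of c _ b]) auto
qed

section \<open>Ideals generated by powers of variables\<close>

text \<open>That \<open>x * (\<Prod>v\<in>M. Var v ^ (q - p))\<close> lies in this ideal for some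
  \<open>q \<ge> p\<close> means that the Cech class of \<open>x\<close> over
  \<open>\<Prod>v\<in>M. Var v ^ p\<close> vanishes modulo \<open>f\<close> and
  \<open>p\<close>.\<close>

definition power_ideal :: "(nat \<times> nat) set \<Rightarrow> ipoly \<Rightarrow> int \<Rightarrow> (nat \<times> nat) set \<Rightarrow> nat \<Rightarrow> ipoly set" where
  "power_ideal V f p M q =
     {j + (\<Sum>v\<in>M. Var v ^ q * c v) | j c. j \<in> hyper_ideal V f p \<and> (\<forall>v\<in>M. c v \<in> poly_carrier V)}"

lemma power_idealI:
  "j \<in> hyper_ideal V f p \<Longrightarrow> (\<And>v. v \<in> M \<Longrightarrow> c v \<in> poly_carrier V) \<Longrightarrow> x = j + (\<Sum>v\<in>M. Var v ^ q * c v)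
    \<Longrightarrow> x \<in> power_ideal V f p M q"
  unfolding power_ideal_def by blast

lemma power_idealE:
  assumes "x \<in> power_ideal V f p M q"
  obtains j c where "j \<in> hyper_ideal V f p" "\<forall>v\<in>M. c v \<in> poly_carrier V" "x = j + (\<Sum>v\<in>M. Var v ^ q * c v)"
  using assms unfolding power_ideal_def by blast

lemma power_ideal_add:
  assumes "x \<in> power_ideal V f p M q" "y \<in> power_ideal V f p M q"
  shows "x + y \<in> power_ideal V f p M q"
proof -
  obtain j c where x: "j \<in> hyper_ideal V f p" "\<forall>v\<in>M. c v \<in> poly_carrier V" "x = j + (\<Sum>v\<in>M. Var v ^ q * c v)"
    using assms(1) by (rule power_idealE)
  obtain j' c' where y: "j' \<in> hyper_ideal V f p" "\<forall>v\<in>M. c' v \<in> poly_carrier V" "y = j' + (\<Sum>v\<in>M. Var v ^ q * c' v)"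
    using assms(2) by (rule power_idealE)
  show ?thesis
    by (rule power_idealI[OF hyper_ideal_add[OF x(1) y(1)], where c = "\<lambda>v. c v + c' v"])
       (use x y in \<open>auto simp: algebra_simps sum.distrib\<close>)
qed

lemma power_ideal_mult:
  assumes "x \<in> power_ideal V f p M q" "r \<in> poly_carrier V"
  shows "r * x \<in> power_ideal V f p M q"
proof -
  obtain j c where x: "j \<in> hyper_ideal V f p" "\<forall>v\<in>M. c v \<in> poly_carrier V" "x = j + (\<Sum>v\<in>M. Var v ^ q * c v)"
    using assms(1) by (rule power_idealE)
  show ?thesis
    by (rule power_idealI[OF hyper_ideal_mult[OF x(1) assms(2)], where c = "\<lambda>v. r * c v"])
       (use x assms(2) in \<open>auto simp: algebra_simps sum_distrib_left\<close>)
qed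

lemma power_ideal_uminus: "x \<in> power_ideal V f p M q \<Longrightarrow> - x \<in> power_ideal V f p M q"
  using power_ideal_mult[of x V f p M q "-1"] by simp

lemma power_ideal_diff:
  "x \<in> power_ideal V f p M q \<Longrightarrow> y \<in> power_ideal V f p M q \<Longrightarrow> x - y \<in> power_ideal V f p M q"
  using power_ideal_add[of x V f p M q "- y"] power_ideal_uminus by simp

lemma power_ideal_hyper: "j \<in> hyper_ideal V f p \<Longrightarrow> j \<in> power_ideal V f p M q"
  by (rule power_idealI[where c = "\<lambda>_. 0"]) auto

lemma power_ideal_zero [simp]: "0 \<in> power_ideal V f p M q"
  by (rule power_ideal_hyper) simp

lemma power_ideal_Var:
  assumes "finite M" "v \<in> M" "c \<in> poly_carrier V"
  shows "Var v ^ q * c \<in> power_ideal V f p M q"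
  by (rule power_idealI[where j = 0 and c = "\<lambda>u. if u = v then c else 0"])
     (use assms in \<open>auto simp: if_distrib sum.delta cong: if_cong\<close>)

lemma power_ideal_sum: "(\<And>i. i \<in> I \<Longrightarrow> g i \<in> power_ideal V f p M q) \<Longrightarrow> sum g I \<in> power_ideal V f p M q"
  by (induction I rule: infinite_finite_induct) (auto intro: power_ideal_add)

lemma single_zero_eq_of_int: "(Poly_Mapping.single 0 c :: ipoly) = of_int c"
  by (metis of_int_eq_id id_apply single_of_int)

section \<open>Weights and hypersurfaces with squarefree terms\<close>

definition wt :: "(nat \<times> nat) set \<Rightarrow> (nat \<times> nat \<Rightarrow> int) \<Rightarrow> mon \<Rightarrow> int" where
  "wt V w m = (\<Sum>v\<in>V. w v * int (Poly_Mapping.lookup m v))"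

lemma wt_add: "wt V w (a + b) = wt V w a + wt V w b"
  by (simp add: wt_def lookup_add sum.distrib algebra_simps)

lemma wt_zero [simp]: "wt V w 0 = 0"
  by (simp add: wt_def)

lemma wt_keys_power:
  assumes "\<And>m. m \<in> Poly_Mapping.keys f \<Longrightarrow> wt V w m = c"
  shows "m \<in> Poly_Mapping.keys (f ^ n) \<Longrightarrow> wt V w m = int n * c"
proof (induction n arbitrary: m)
  case (Suc n)
  then obtain a b where "m = a + b" "a \<in> Poly_Mapping.keys f" "b \<in> Poly_Mapping.keys (f ^ n)"
    using keys_mult[of f "f ^ n"] by auto
  then show ?case using Suc.IH assms by (simp add: wt_add algebra_simps)
qed auto

lemma Var_power: "Var v ^ n = Poly_Mapping.single (Poly_Mapping.single v n) 1"
proof (induction n)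
  case (Suc n)
  then show ?case by (simp add: Var_def mult_single single_add[symmetric])
qed auto

lemma single_Var_factor:
  assumes "n \<le> Poly_Mapping.lookup m v"
  shows "Poly_Mapping.single m c = Var v ^ n * Poly_Mapping.single (m - Poly_Mapping.single v n) c"
proof -
  have "m = Poly_Mapping.single v n + (m - Poly_Mapping.single v n)"
    by (rule mon_le_add) (use assms in \<open>auto simp: lookup_single when_def\<close>)
  then show ?thesis by (simp add: Var_power mult_single)
qed

lemma keys_minus_subset: "Poly_Mapping.keys (m - k :: mon) \<subseteq> Poly_Mapping.keys m"
  by (auto simp: in_keys_iff lookup_minus)

text \<open>The product completes \<open>Var v ^ p\<close> to \<open>Var v ^ q\<close>; the other
  factors form a \<open>p\<close>-th power because \<open>p\<close> divides
  \<open>q - p\<close>.\<close>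

lemma prod_Var_power_factor:
  assumes "finite M" "v \<in> M" "p \<le> q" "p > 0" "p dvd q"
  obtains z where "z \<in> poly_carrier M" "Var v ^ p * (\<Prod>u\<in>M. Var u ^ (q - p)) = Var v ^ q * z ^ p"
proof -
  obtain c where c: "q = p * c" using assms(5) by blast
  have c0: "q - p = p * (c - 1)" using c by (simp add: algebra_simps diff_mult_distrib2)
  have 1: "(\<Prod>u\<in>M - {v}. Var u ^ (c - 1)) \<in> poly_carrier M"
    by (intro poly_carrier_prod poly_carrier_power poly_carrier_Var) auto
  have "(\<Prod>u\<in>M. Var u ^ (q - p)) = Var v ^ (q - p) * (\<Prod>u\<in>M - {v}. Var u ^ (q - p))"
    using assms by (simp add: prod.remove)
  also have "(\<Prod>u\<in>M - {v}. Var u ^ (q - p)) = (\<Prod>u\<in>M - {v}. Var u ^ (c - 1)) ^ p"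
    unfolding c0 by (simp add: prod_power_distrib power_mult[symmetric] mult.commute)
  finally have "Var v ^ p * (\<Prod>u\<in>M. Var u ^ (q - p)) = Var v ^ q * (\<Prod>u\<in>M - {v}. Var u ^ (c - 1)) ^ p"
    using assms(3) by (simp add: mult.assoc[symmetric] power_add[symmetric])
  then show ?thesis using that 1 by blast
qed

lemma prod_Var_power_is_power:
  assumes "p > 0" "p dvd q"
  obtains z where "z \<in> poly_carrier M" "(\<Prod>u\<in>M. Var u ^ (q - p)) = z ^ p"
proof -
  obtain c where c: "q = p * c" using assms(2) by blast
  have c0: "q - p = p * (c - 1)" using c by (simp add: algebra_simps diff_mult_distrib2)
  have 1: "(\<Prod>u\<in>M. Var u ^ (c - 1)) \<in> poly_carrier M"
    by (intro poly_carrier_prod poly_carrier_power poly_carrier_Var) auto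
  have "(\<Prod>u\<in>M. Var u ^ (q - p)) = (\<Prod>u\<in>M. Var u ^ (c - 1)) ^ p"
    unfolding c0 by (simp add: prod_power_distrib power_mult[symmetric] mult.commute)
  then show ?thesis using that 1 by blast
qed

lemma poly_carrier_mono: "M \<subseteq> V \<Longrightarrow> x \<in> poly_carrier M \<Longrightarrow> x \<in> poly_carrier V"
  by (auto simp: poly_carrier_def)

text \<open>All terms have weight 1 while only variables of \<open>M\<close> can have positive
  weight, so every term involves a variable of \<open>M\<close>. The support of the term
  \<open>t0\<close> contains the support of no other term, which isolates its powers inside the
  powers of \<open>f\<close>.\<close>

locale multilinear_hypersurface =
  fixes V M :: "(nat \<times> nat) set" and p :: nat and T :: "'t set" and \<mu> :: "'t \<Rightarrow> mon" and \<epsilon> :: "'t \<Rightarrow> int"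
    and w :: "nat \<times> nat \<Rightarrow> int" and f :: ipoly and t0 :: 't
  assumes fin: "finite V" "finite T" and M: "M \<subseteq> V" and p: "prime p"
    and f_def: "f = (\<Sum>t\<in>T. Poly_Mapping.single (\<mu> t) (\<epsilon> t))"
    and \<epsilon>: "\<And>t. t \<in> T \<Longrightarrow> \<epsilon> t = 1 \<or> \<epsilon> t = -1"
    and keys: "\<And>t. t \<in> T \<Longrightarrow> Poly_Mapping.keys (\<mu> t) \<subseteq> V"
    and sqfree: "\<And>t v. t \<in> T \<Longrightarrow> Poly_Mapping.lookup (\<mu> t) v \<le> 1"
    and w: "\<And>v. v \<in> V - M \<Longrightarrow> w v \<le> 0"
    and wt: "\<And>t. t \<in> T \<Longrightarrow> wt V w (\<mu> t) = 1"
    and t0: "t0 \<in> T" "\<And>t. t \<in> T \<Longrightarrow> Poly_Mapping.keys (\<mu> t) \<subseteq> Poly_Mapping.keys (\<mu> t0) \<Longrightarrow> t = t0"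
begin

lemma finM: "finite M" using fin M finite_subset by blast

lemma carrier_term: "t \<in> T \<Longrightarrow> Poly_Mapping.single (\<mu> t) c \<in> poly_carrier V"
  using keys by simp

lemma carrier_f: "f \<in> poly_carrier V"
  unfolding f_def using carrier_term by simp

lemma wt_pos_hits:
  assumes "wt V w m > 0" obtains v where "v \<in> M" "Poly_Mapping.lookup m v > 0"
proof (rule ccontr)
  assume neg: "\<not> thesis"
  have "\<forall>v\<in>M. \<not> Poly_Mapping.lookup m v > 0" using that neg by blast
  then have z: "Poly_Mapping.lookup m v = 0" if "v \<in> M" for v using that by auto
  have "wt V w m \<le> 0"
    unfolding wt_def
  proof (rule sum_nonpos)
    fix v assume "v \<in> V"
    then show "w v * int (Poly_Mapping.lookup m v) \<le> 0"
      using z w[of v] by (cases "v \<in> M") (auto intro: mult_nonpos_nonneg)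
  qed
  then show False using assms by simp
qed

lemma keys_f: "m \<in> Poly_Mapping.keys f \<Longrightarrow> \<exists>t\<in>T. m = \<mu> t"
  unfolding f_def using keys_sum[of "\<lambda>t. Poly_Mapping.single (\<mu> t) (\<epsilon> t)" T] by (auto split: if_splits)

lemma wt_f_power: "m \<in> Poly_Mapping.keys (f ^ n) \<Longrightarrow> wt V w m = int n"
  using wt_keys_power[of f V w 1 m n] keys_f wt by fastforce

lemma exponent_f_power: "m \<in> Poly_Mapping.keys (f ^ n) \<Longrightarrow> Poly_Mapping.lookup m v \<le> n"
proof (induction n arbitrary: m)
  case (Suc n)
  then obtain a b where ab: "m = a + b" "a \<in> Poly_Mapping.keys f" "b \<in> Poly_Mapping.keys (f ^ n)"
    using keys_mult[of f "f ^ n"] by auto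
  then have "Poly_Mapping.lookup a v \<le> 1" using keys_f sqfree by blast
  then show ?case using ab Suc.IH[of b] by (simp add: lookup_add)
qed auto

text \<open>No other term divides a power of \<open>\<mu> t0\<close>, so the only contribution comes
  from choosing \<open>t0\<close> in every factor.\<close>

lemma coefficient_f_power:
  "Poly_Mapping.lookup (f ^ n) (((+) (\<mu> t0) ^^ n) 0) = \<epsilon> t0 ^ n"
proof (induction n)
  case (Suc n)
  let ?N = "((+) (\<mu> t0) ^^ n) 0"
  have "Poly_Mapping.lookup (f ^ Suc n) (\<mu> t0 + ?N)
      = (\<Sum>t\<in>T. Poly_Mapping.lookup (Poly_Mapping.single (\<mu> t) (\<epsilon> t) * f ^ n) (\<mu> t0 + ?N))"
    by (simp only: power_Suc) (subst (1) f_def, simp only: sum_distrib_right lookup_sum)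
  also have "\<dots> = Poly_Mapping.lookup (Poly_Mapping.single (\<mu> t0) (\<epsilon> t0) * f ^ n) (\<mu> t0 + ?N)"
  proof -
    have rest: "(\<Sum>t\<in>T - {t0}. Poly_Mapping.lookup (Poly_Mapping.single (\<mu> t) (\<epsilon> t) * f ^ n) (\<mu> t0 + ?N)) = 0"
    proof (rule sum.neutral, rule ballI)
      fix t assume "t \<in> T - {t0}"
      then have t: "t \<in> T" "t \<noteq> t0" by auto
      then have "\<not> Poly_Mapping.keys (\<mu> t) \<subseteq> Poly_Mapping.keys (\<mu> t0)" using t0(2)[of t] by blast
      then obtain v where "v \<in> Poly_Mapping.keys (\<mu> t)" "v \<notin> Poly_Mapping.keys (\<mu> t0)" by blast
      then have v: "Poly_Mapping.lookup (\<mu> t) v \<noteq> 0" "Poly_Mapping.lookup (\<mu> t0) v = 0" by (auto simp: in_keys_iff)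
      show "Poly_Mapping.lookup (Poly_Mapping.single (\<mu> t) (\<epsilon> t) * f ^ n) (\<mu> t0 + ?N) = 0"
      proof (rule lookup_single_mult_not)
        fix m' show "\<mu> t0 + ?N \<noteq> \<mu> t + m'"
          using v by (auto dest!: arg_cong[of _ _ "\<lambda>m. Poly_Mapping.lookup m v"] simp: lookup_add lookup_funpow_add)
      qed
    qed
    show ?thesis
      by (subst sum.remove[OF fin(2) t0(1)]) (simp only: rest add_0_right)
  qed
  also have "\<dots> = \<epsilon> t0 ^ Suc n" by (simp add: lookup_single_mult_add Suc)
  finally show ?case by simp
qed simp

lemma not_dvd_f: "\<not> of_int (int p) dvd f"
proof
  assume "of_int (int p) dvd f"
  then have "int p dvd Poly_Mapping.lookup f (\<mu> t0)" unfolding of_int_dvd_poly_iff by blast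
  then have "int p dvd \<epsilon> t0" using coefficient_f_power[of 1] by simp
  then have "int p dvd 1" using \<epsilon>[OF t0(1)] by (metis dvd_minus_iff)
  then show False using p by simp
qed

text \<open>Complementary to the \<open>(p - 1)\<close>-st power of \<open>\<mu> t0\<close>: their
  product has exponent \<open>p - 1\<close> at every variable of \<open>V\<close>, and
  \<open>Phi_S\<close> maps that monomial to 1.\<close>

definition \<gamma> :: mon where "\<gamma> = (\<Sum>v\<in>V - Poly_Mapping.keys (\<mu> t0). Poly_Mapping.single v (p - 1))"

definition g :: ipoly where "g = Poly_Mapping.single \<gamma> 1"

lemma lookup_\<gamma>: "Poly_Mapping.lookup \<gamma> v = (if v \<in> V \<and> Poly_Mapping.lookup (\<mu> t0) v = 0 then p - 1 else 0)"
  unfolding \<gamma>_def using fin by (subst lookup_sum_singles) (auto simp: in_keys_iff)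

lemma carrier_g: "g \<in> poly_carrier V"
  unfolding g_def by (rule poly_carrier_single) (auto simp: in_keys_iff lookup_\<gamma> split: if_splits)

lemma lookup_t0_outside: "v \<notin> V \<Longrightarrow> Poly_Mapping.lookup (\<mu> t0) v = 0"
  using keys[OF t0(1)] by (meson in_keys_iff subsetD)

lemma lookup_full: "Poly_Mapping.lookup (((+) (\<mu> t0) ^^ (p - 1)) 0 + \<gamma>) v = (if v \<in> V then p - 1 else 0)"
  using sqfree[OF t0(1), of v] lookup_t0_outside[of v]
  by (cases "Poly_Mapping.lookup (\<mu> t0) v = 0") (auto simp: lookup_add lookup_funpow_add lookup_\<gamma>)

text \<open>Multiplying by \<open>g\<close> before taking the trace selects the monomials congruent to \<open>\<mu> t0 ^ (p - 1)\<close>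
  modulo \<open>p\<close>-th powers.\<close>

lemma Phi_S_g_single:
  assumes b: "Poly_Mapping.keys b \<subseteq> V"
  shows "of_int (int p) dvd Phi_S V p (Poly_Mapping.single b c * g) \<or>
    (\<forall>v\<in>V. p - 1 \<le> Poly_Mapping.lookup (b + \<gamma>) v \<and> Poly_Mapping.lookup (b + \<gamma>) v mod p = p - 1)"
proof (cases "\<forall>v\<in>V. Poly_Mapping.lookup (b + \<gamma>) v mod p = p - 1")
  case True
  then show ?thesis using mod_less_eq_dividend by metis
next
  case False
  then obtain v where v: "v \<in> V" "Poly_Mapping.lookup (b + \<gamma>) v mod p \<noteq> p - 1" by blast
  have "int p dvd int (Poly_Mapping.lookup (b + \<gamma>) v choose (p - 1))"
    by (rule choose_prime_dvd[OF p v(2)])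
  then have "int p dvd (\<Prod>v \<in> V. int (Poly_Mapping.lookup (b + \<gamma>) v choose (p - 1)))"
    using fin v(1) by (metis (no_types, lifting) dvd_prodI dvd_trans)
  then have "of_int (int p) dvd Phi_S V p (Poly_Mapping.single b c * g)"
    unfolding g_def mult_single Phi_S_single of_int_dvd_poly_iff lookup_single when_def by auto
  then show ?thesis by blast
qed

lemma Phi_S_g_monomial:
  assumes "\<forall>v\<in>V. p - 1 \<le> Poly_Mapping.lookup (b + \<gamma>) v"
  shows "Poly_Mapping.lookup (b + \<gamma> - (\<Sum>v \<in> V. Poly_Mapping.single v (p - 1))) v + (p - 1) * (if v \<in> V \<and> Poly_Mapping.lookup (\<mu> t0) v \<noteq> 0 then 1 else 0)
    = Poly_Mapping.lookup b v"
  using assms by (auto simp: lookup_minus lookup_add lookup_sum_singles[OF fin(1)] lookup_\<gamma>)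

text \<open>Exponents in \<open>f ^ (p - 1)\<close> are at most \<open>p - 1\<close>, so after
  multiplication by \<open>g\<close> the only monomial with all exponents congruent to
  \<open>p - 1\<close> comes from the power of \<open>t0\<close>. Its coefficient is a sign, so the
  trace of \<open>f ^ (p - 1) * g\<close> is a unit.\<close>

lemma Phi_S_f_g: "pcong (int p) (Phi_S V p (f ^ (p - 1) * g)) (of_int (\<epsilon> t0 ^ (p - 1)))"
proof -
  let ?h = "f ^ (p - 1)"
  define \<mu>0 where "\<mu>0 = ((+) (\<mu> t0) ^^ (p - 1)) 0"
  have p0: "p > 0" using p prime_gt_0_nat by blast
  have h: "?h = (\<Sum>b\<in>Poly_Mapping.keys ?h. Poly_Mapping.single b (Poly_Mapping.lookup ?h b))"
    by (rule poly_sum_monomials)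
  have "Phi_S V p (?h * g) = (\<Sum>b\<in>Poly_Mapping.keys ?h. Phi_S V p (Poly_Mapping.single b (Poly_Mapping.lookup ?h b) * g))"
    by (subst h) (simp only: sum_distrib_right Phi_S_sum)
  also have "pcong (int p) \<dots> (\<Sum>b\<in>Poly_Mapping.keys ?h. if b = \<mu>0 then of_int (\<epsilon> t0 ^ (p - 1)) else 0)"
  proof (rule pcong_sum)
    fix b assume b: "b \<in> Poly_Mapping.keys ?h"
    have bV: "Poly_Mapping.keys b \<subseteq> V" using b carrier_f poly_carrier_power[of f V "p - 1"] by (auto simp: poly_carrier_def)
    have le: "Poly_Mapping.lookup b v \<le> p - 1" for v using exponent_f_power[OF b] .
    consider (dvd) "of_int (int p) dvd Phi_S V p (Poly_Mapping.single b (Poly_Mapping.lookup ?h b) * g)"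
      | (full) "\<forall>v\<in>V. p - 1 \<le> Poly_Mapping.lookup (b + \<gamma>) v \<and> Poly_Mapping.lookup (b + \<gamma>) v mod p = p - 1"
      using Phi_S_g_single[OF bV] by blast
    then show "pcong (int p) (Phi_S V p (Poly_Mapping.single b (Poly_Mapping.lookup ?h b) * g))
        (if b = \<mu>0 then of_int (\<epsilon> t0 ^ (p - 1)) else 0)"
    proof cases
      case full
      have "b = \<mu>0"
      proof (rule poly_mapping_eqI)
        fix v
        show "Poly_Mapping.lookup b v = Poly_Mapping.lookup \<mu>0 v"
        proof (cases "v \<in> V")
          case True
          have m: "(Poly_Mapping.lookup b v + Poly_Mapping.lookup \<gamma> v) mod p = p - 1" "p - 1 \<le> Poly_Mapping.lookup b v + Poly_Mapping.lookup \<gamma> v"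
            using full True by (auto simp: lookup_add)
          show ?thesis
          proof (cases "Poly_Mapping.lookup (\<mu> t0) v = 0")
            case True
            have "Poly_Mapping.lookup b v = 0"
            proof (rule ccontr)
              assume "Poly_Mapping.lookup b v \<noteq> 0"
              then have "(Poly_Mapping.lookup b v + (p - 1)) mod p = (Poly_Mapping.lookup b v - 1 + p) mod p" using p0 by simp
              also have "\<dots> = (Poly_Mapping.lookup b v - 1) mod p" by (rule mod_add_self2)
              also have "\<dots> = Poly_Mapping.lookup b v - 1" using le[of v] p0 by (intro mod_less) linarith
              finally show False using m le[of v] True \<open>v \<in> V\<close> \<open>Poly_Mapping.lookup b v \<noteq> 0\<close> by (simp add: lookup_\<gamma>)
            qed
            then show ?thesis using True by (simp add: \<mu>0_def lookup_funpow_add)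
          next
            case False
            then have "Poly_Mapping.lookup (\<mu> t0) v = 1" using sqfree[OF t0(1), of v] by simp
            then show ?thesis using m le[of v] by (simp add: \<mu>0_def lookup_funpow_add lookup_\<gamma>)
          qed
        next
          case False
          then have "Poly_Mapping.lookup b v = 0" "Poly_Mapping.lookup (\<mu> t0) v = 0"
            using bV keys[OF t0(1)] by (auto simp: in_keys_iff)
          then show ?thesis by (simp add: \<mu>0_def lookup_funpow_add)
        qed
      qed
      moreover have "Phi_S V p (Poly_Mapping.single \<mu>0 (\<epsilon> t0 ^ (p - 1)) * g) = of_int (\<epsilon> t0 ^ (p - 1))"
      proof -
        have l: "Poly_Mapping.lookup (\<mu>0 + \<gamma>) v = (if v \<in> V then p - 1 else 0)" for v
          unfolding \<mu>0_def by (rule lookup_full)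
        have "\<mu>0 + \<gamma> - (\<Sum>v \<in> V. Poly_Mapping.single v (p - 1)) = 0"
          by (rule poly_mapping_eqI) (simp add: lookup_minus l lookup_sum_singles[OF fin(1)])
        then show ?thesis by (simp add: g_def mult_single Phi_S_single l single_zero_eq_of_int)
      qed
      ultimately show ?thesis using coefficient_f_power[of "p - 1"] by (simp add: \<mu>0_def)
    next
      case dvd
      show ?thesis
      proof (cases "b = \<mu>0")
        case True
        have l: "Poly_Mapping.lookup (\<mu>0 + \<gamma>) v = (if v \<in> V then p - 1 else 0)" for v
          unfolding \<mu>0_def by (rule lookup_full)
        have "\<mu>0 + \<gamma> - (\<Sum>v \<in> V. Poly_Mapping.single v (p - 1)) = 0"
          by (rule poly_mapping_eqI) (simp add: lookup_minus l lookup_sum_singles[OF fin(1)])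
        moreover have "Poly_Mapping.lookup ?h \<mu>0 = \<epsilon> t0 ^ (p - 1)"
          unfolding \<mu>0_def by (rule coefficient_f_power)
        ultimately show ?thesis using True
          by (simp add: g_def mult_single Phi_S_single l single_zero_eq_of_int)
      qed (use dvd in \<open>simp add: pcong_0_iff\<close>)
    qed
  qed
  also have "\<dots> = of_int (\<epsilon> t0 ^ (p - 1))"
  proof -
    have "\<epsilon> t0 ^ (p - 1) \<noteq> 0" using \<epsilon>[OF t0(1)] by auto
    then have "\<mu>0 \<in> Poly_Mapping.keys ?h"
      using coefficient_f_power[of "p - 1"] by (simp add: in_keys_iff \<mu>0_def)
    then show ?thesis by (simp add: sum.delta)
  qed
  finally show ?thesis .
qed

text \<open>The monomials that survive modulo \<open>p\<close> have all exponents divisible by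
  \<open>p\<close>, and their weight is \<open>(p - 1) + p - (p - 1) = p\<close>. Positive weight
  forces some variable of \<open>M\<close> to occur, hence its \<open>p\<close>-th power divides the
  monomial.\<close>

lemma Phi_S_f_g_homogeneous:
  assumes D: "D \<in> poly_carrier V" "\<And>m. m \<in> Poly_Mapping.keys D \<Longrightarrow> wt V w m = int p"
  shows "Phi_S V p (f ^ (p - 1) * g * D) \<in> power_ideal V f (int p) M p"
proof -
  let ?h = "f ^ (p - 1) * D"
  have p0: "p > 0" using p prime_gt_0_nat by blast
  have hV: "?h \<in> poly_carrier V" using carrier_f D by simp
  have h: "?h = (\<Sum>b\<in>Poly_Mapping.keys ?h. Poly_Mapping.single b (Poly_Mapping.lookup ?h b))"
    by (rule poly_sum_monomials)
  have eq: "Phi_S V p (?h * g) = (\<Sum>b\<in>Poly_Mapping.keys ?h. Phi_S V p (Poly_Mapping.single b (Poly_Mapping.lookup ?h b) * g))"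
    by (subst h) (simp only: sum_distrib_right Phi_S_sum)
  have "Phi_S V p (?h * g) \<in> power_ideal V f (int p) M p"
    unfolding eq
  proof (rule power_ideal_sum)
    fix b assume b: "b \<in> Poly_Mapping.keys ?h"
    have bV: "Poly_Mapping.keys b \<subseteq> V" using b hV by (auto simp: poly_carrier_def)
    let ?P = "Phi_S V p (Poly_Mapping.single b (Poly_Mapping.lookup ?h b) * g)"
    have PV: "?P \<in> poly_carrier V" using bV carrier_g by simp
    consider (dvd) "of_int (int p) dvd ?P"
      | (full) "\<forall>v\<in>V. p - 1 \<le> Poly_Mapping.lookup (b + \<gamma>) v \<and> Poly_Mapping.lookup (b + \<gamma>) v mod p = p - 1"
      using Phi_S_g_single[OF bV] by blast
    then show "?P \<in> power_ideal V f (int p) M p"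
    proof cases
      case dvd
      then obtain y where y: "y \<in> poly_carrier V" "?P = of_int (int p) * y"
        by (rule poly_carrier_dvd) (use PV p0 in auto)
      show ?thesis unfolding y(2) by (rule power_ideal_hyper[OF hyper_ideal_int[OF y(1)]])
    next
      case full
      define m where "m = b + \<gamma> - (\<Sum>v \<in> V. Poly_Mapping.single v (p - 1))"
      have m: "Poly_Mapping.lookup m v + (p - 1) * (if v \<in> V \<and> Poly_Mapping.lookup (\<mu> t0) v \<noteq> 0 then 1 else 0)
          = Poly_Mapping.lookup b v" for v
        unfolding m_def by (rule Phi_S_g_monomial) (use full in auto)
      \<comment> \<open>Multiplying by \<open>\<gamma>\<close> and then lowering all exponents by
        \<open>p - 1\<close> amounts to dividing by the \<open>(p - 1)\<close>-st power of
        \<open>\<mu> t0\<close>, of weight \<open>p - 1\<close>.\<close>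
      have "m + ((+) (\<mu> t0) ^^ (p - 1)) 0 = b"
      proof (rule poly_mapping_eqI)
        fix v
        have "Poly_Mapping.lookup (\<mu> t0) v = (if v \<in> V \<and> Poly_Mapping.lookup (\<mu> t0) v \<noteq> 0 then 1 else 0)"
          using sqfree[OF t0(1), of v] keys[OF t0(1)] by (auto simp: in_keys_iff)
        then show "Poly_Mapping.lookup (m + ((+) (\<mu> t0) ^^ (p - 1)) 0) v = Poly_Mapping.lookup b v"
          using m[of v] by (simp add: lookup_add lookup_funpow_add)
      qed
      from arg_cong[OF this, of "wt V w"]
      have "wt V w b = wt V w m + wt V w (((+) (\<mu> t0) ^^ (p - 1)) 0)" by (simp only: wt_add)
      moreover have "wt V w (((+) (\<mu> t0) ^^ n) 0) = int n" for n
        by (induction n) (auto simp: wt_add wt[OF t0(1)])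
      moreover have "wt V w b = int (p - 1) + int p"
      proof -
        obtain b1 b2 where "b = b1 + b2" "b1 \<in> Poly_Mapping.keys (f ^ (p - 1))" "b2 \<in> Poly_Mapping.keys D"
          using b keys_mult[of "f ^ (p - 1)" D] by blast
        then show ?thesis using D(2) wt_f_power by (simp add: wt_add)
      qed
      ultimately have "wt V w m > 0" using p0 by simp
      then obtain v where v: "v \<in> M" "Poly_Mapping.lookup m v > 0" by (rule wt_pos_hits)
      have "v \<in> V" using v M by blast
      then have "Poly_Mapping.lookup m v = Poly_Mapping.lookup (b + \<gamma>) v - (p - 1)"
        by (simp add: m_def lookup_minus lookup_sum_singles[OF fin(1)])
      moreover have "p dvd Poly_Mapping.lookup (b + \<gamma>) v - (p - 1)"
        using dvd_minus_mod[of p "Poly_Mapping.lookup (b + \<gamma>) v"] full \<open>v \<in> V\<close> by simp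
      ultimately have "p dvd Poly_Mapping.lookup m v" by (simp only:)
      then have "p \<le> Poly_Mapping.lookup m v" using v(2) by (rule dvd_imp_le)
      then have "?P = Var v ^ p * Poly_Mapping.single (m - Poly_Mapping.single v p)
         (Poly_Mapping.lookup ?h b * (\<Prod>v \<in> V. int (Poly_Mapping.lookup (b + \<gamma>) v choose (p - 1))))"
        by (simp only: g_def mult_single Phi_S_single m_def[symmetric] single_Var_factor[symmetric] mult_1_right)
      moreover have "Poly_Mapping.keys (m - Poly_Mapping.single v p) \<subseteq> V"
      proof -
        have "Poly_Mapping.keys m \<subseteq> Poly_Mapping.keys b"
        proof
          fix u assume "u \<in> Poly_Mapping.keys m"
          then show "u \<in> Poly_Mapping.keys b" using m[of u] unfolding in_keys_iff by linarith
        qed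
        then have "Poly_Mapping.keys m \<subseteq> V" using bV by (rule subset_trans)
        then show ?thesis using keys_minus_subset by blast
      qed
      ultimately show ?thesis using v(1) finM by (simp add: power_ideal_Var)
    qed
  qed
  moreover have "f ^ (p - 1) * g * D = ?h * g" by (simp only: ac_simps)
  ultimately show ?thesis by (simp only:)
qed

text \<open>Apply \<open>d\<close> to \<open>f ^ p * m * g = (\<Sum>t\<in>T. s t ^ p) * m * g + p *
  D * m * g\<close>, where \<open>m\<close> is the completing product. The left side is a multiple
  of \<open>f\<close>; each \<open>s t ^ p * m\<close> is a \<open>q\<close>-th power times a
  \<open>p\<close>-th power. What remains is divisible by \<open>p\<close>, and after division
  \<open>d\<close> may be replaced by the trace. Homogeneity puts the trace of \<open>g * D\<close>
  into the ideal, while the trace of \<open>g\<close> is a unit, so \<open>D * m\<close> is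
  left.\<close>

lemma delta_mem_of_lift:
  assumes lift: "lifts_to_mod_sq (hypersurface V f) p (frob_trace V f p) \<or> lifts_to_ring (hypersurface V f) p (frob_trace V f p)"
  obtains k and D where "D \<in> poly_carrier V" "of_int (int p) * D = f ^ p - (\<Sum>t\<in>T. Poly_Mapping.single (\<mu> t) (\<epsilon> t) ^ p)"
    "D * (\<Prod>v\<in>M. Var v ^ (p ^ Suc (Suc k) - p)) \<in> power_ideal V f (int p) M (p ^ Suc (Suc k))"
proof -
  let ?S = "poly_carrier V" and ?J = "hyper_ideal V f (int p ^ 2)" and ?I = "hyper_ideal V f (int p)"
  let ?\<Phi> = "\<lambda>x. Phi_S V p (f ^ (p - 1) * x)"
  define s where "s t = Poly_Mapping.single (\<mu> t) (\<epsilon> t)" for t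
  have p0: "p > 0" "int p \<noteq> 0" using p prime_gt_0_nat by auto
  have sV: "s t \<in> ?S" if "t \<in> T" for t using carrier_term[OF that] by (simp add: s_def)
  have "pcong (int p) (f ^ p) (\<Sum>t\<in>T. s t ^ p)"
    unfolding f_def s_def by (rule pcong_frobenius_sum[OF p])
  then obtain D where D: "D \<in> ?S" "f ^ p - (\<Sum>t\<in>T. s t ^ p) = of_int (int p) * D"
    using poly_carrier_dvd[of "int p" "f ^ p - (\<Sum>t\<in>T. s t ^ p)" V] sV carrier_f p0
    unfolding pcong_def by auto
  \<comment> \<open>Both \<open>f ^ p\<close> and the powers \<open>s t ^ p\<close> are homogeneous
    of weight \<open>p\<close>, so the quotient \<open>D\<close> is too.\<close>
  have wtD: "wt V w m = int p" if "m \<in> Poly_Mapping.keys D" for m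
  proof -
    have "m \<in> Poly_Mapping.keys (of_int (int p) * D)"
      using that p0 by (simp only: in_keys_iff lookup_of_int_mult) simp
    then have "m \<in> Poly_Mapping.keys (f ^ p) \<or> (\<exists>t\<in>T. m \<in> Poly_Mapping.keys (s t ^ p))"
      unfolding D(2)[symmetric] using keys_diff[of "f ^ p" "\<Sum>t\<in>T. s t ^ p"] keys_sum[of "\<lambda>t. s t ^ p" T] by blast
    then show ?thesis
    proof
      assume "\<exists>t\<in>T. m \<in> Poly_Mapping.keys (s t ^ p)"
      then obtain t where t: "t \<in> T" "m \<in> Poly_Mapping.keys (s t ^ p)" by blast
      have "wt V w m' = 1" if "m' \<in> Poly_Mapping.keys (s t)" for m'
        using that wt[OF t(1)] by (auto simp: s_def split: if_splits)
      from wt_keys_power[OF this t(2)] show ?thesis by simp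
    qed (rule wt_f_power)
  qed
  obtain d k where d0: "\<forall>x\<in>?S. d x \<in> ?S" "\<forall>x\<in>?S. \<forall>y\<in>?S. d (x + y) - (d x + d y) \<in> ?J"
    "\<forall>x\<in>?S. x \<in> ?J \<longrightarrow> d x \<in> ?J" "\<forall>a\<in>?S. \<forall>x\<in>?S. d (a ^ (p ^ Suc (Suc k)) * x) - a ^ (p ^ Suc (Suc k)) * d x \<in> ?J"
    "\<forall>x\<in>?S. d x - ?\<Phi> x \<in> ?I"
    by (rule frobenius_lift_data[OF carrier_f p fin(1) lift])
  have d: "\<And>x. x \<in> ?S \<Longrightarrow> d x \<in> ?S"
    "\<And>x y. x \<in> ?S \<Longrightarrow> y \<in> ?S \<Longrightarrow> d (x + y) - (d x + d y) \<in> ?J"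
    "\<And>x. x \<in> ?S \<Longrightarrow> x \<in> ?J \<Longrightarrow> d x \<in> ?J"
    "\<And>a x. a \<in> ?S \<Longrightarrow> x \<in> ?S \<Longrightarrow> d (a ^ (p ^ Suc (Suc k)) * x) - a ^ (p ^ Suc (Suc k)) * d x \<in> ?J"
    "\<And>x. x \<in> ?S \<Longrightarrow> d x - ?\<Phi> x \<in> ?I"
    using d0 by blast+
  define q where "q = p ^ Suc (Suc k)"
  have q: "p \<le> q" "p dvd q" using p0 by (auto simp: q_def)
  define m where "m = (\<Prod>v\<in>M. Var v ^ (q - p))"
  have mV: "m \<in> ?S" unfolding m_def using M by (intro poly_carrier_prod poly_carrier_power poly_carrier_Var) auto
  have gV: "g \<in> ?S" by (rule carrier_g)
  have pI: "of_int (int p) * x \<in> ?J" if x: "x \<in> ?I" for x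
  proof -
    obtain a b where "a \<in> ?S" "b \<in> ?S" "x = f * a + of_int (int p) * b" using x by (rule hyper_idealE)
    then show ?thesis
      by (intro hyper_idealI[of "of_int (int p) * a" _ b]) (auto simp: algebra_simps power2_eq_square)
  qed
  have power_lin: "?\<Phi> (z ^ p * x) - z ^ p * ?\<Phi> x \<in> ?I" if "z \<in> ?S" "x \<in> ?S" for z x
  proof -
    have "pcong (int p) (Phi_S V p (z ^ p * (f ^ (p - 1) * x))) (z ^ p * ?\<Phi> x)"
      by (rule Phi_S_power[OF p fin(1)])
    then show ?thesis
      using pcong_hyper_ideal[of "int p" "?\<Phi> (z ^ p * x)" "z ^ p * ?\<Phi> x" V f] that carrier_f p0
      by (simp add: mult.left_commute)
  qed
  \<comment> \<open>\<open>d\<close> commutes with \<open>Var v ^ q\<close> modulo \<open>f\<close>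
    and \<open>p ^ 2\<close>, but with the \<open>p\<close>-th power \<open>B\<close> only modulo
    \<open>f\<close> and \<open>p\<close>. The resulting error \<open>p * e\<close> therefore
    carries the factor \<open>Var v ^ q\<close>.\<close>
  have each: "\<exists>v\<in>M. \<exists>e\<in>?S. d (s t ^ p * m * g) - s t ^ p * m * d g - of_int (int p) * (Var v ^ q * e) \<in> ?J" if t: "t \<in> T" for t
  proof -
    have "wt V w (\<mu> t) > 0" using wt[OF t] by simp
    then obtain v where v: "v \<in> M" "Poly_Mapping.lookup (\<mu> t) v > 0" by (rule wt_pos_hits)
    define y where "y = Poly_Mapping.single (\<mu> t - Poly_Mapping.single v 1) (\<epsilon> t)"
    have y: "s t = Var v * y" using single_Var_factor[of 1 "\<mu> t" v "\<epsilon> t"] v by (simp add: s_def y_def)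
    have yV: "y \<in> ?S" unfolding y_def using keys[OF t] keys_minus_subset[of "\<mu> t"] by (intro poly_carrier_single) blast
    have vV: "Var v \<in> ?S" using v M by auto
    obtain z where z: "z \<in> poly_carrier M" "Var v ^ p * m = Var v ^ q * z ^ p"
      unfolding m_def by (rule prod_Var_power_factor[OF finM v(1) q(1) p0(1) q(2)])
    define B where "B = (y * z) ^ p"
    have zV: "z \<in> ?S" using poly_carrier_mono[OF M z(1)] .
    have BV: "B \<in> ?S" using yV zV by (simp add: B_def)
    have eq: "s t ^ p * m = Var v ^ q * B"
    proof -
      have "s t ^ p * m = y ^ p * (Var v ^ p * m)" by (simp add: y power_mult_distrib mult.assoc mult.left_commute)
      then show ?thesis by (simp add: z(2) B_def power_mult_distrib mult.assoc mult.left_commute)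
    qed
    have "d (B * g) - B * d g = (d (B * g) - ?\<Phi> (B * g)) + (?\<Phi> (B * g) - B * ?\<Phi> g) - B * (d g - ?\<Phi> g)"
      by (simp add: algebra_simps)
    also have "\<dots> \<in> ?I"
    proof (rule hyper_ideal_diff[OF hyper_ideal_add])
      show "d (B * g) - ?\<Phi> (B * g) \<in> ?I" by (rule d(5)) (use BV gV in simp)
      show "?\<Phi> (B * g) - B * ?\<Phi> g \<in> ?I" unfolding B_def by (rule power_lin) (use yV zV gV in auto)
      show "B * (d g - ?\<Phi> g) \<in> ?I" by (rule hyper_ideal_mult[OF d(5)[OF gV] BV])
    qed
    finally obtain a e where ae: "a \<in> ?S" "e \<in> ?S" "d (B * g) - B * d g = f * a + of_int (int p) * e" by (rule hyper_idealE)
    have "d (Var v ^ q * (B * g)) - Var v ^ q * d (B * g) \<in> ?J"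
      unfolding q_def using BV gV vV by (intro d(4)) auto
    moreover have "f * (Var v ^ q * a) \<in> ?J" using vV ae by (intro hyper_ideal_gen) auto
    ultimately have "(d (Var v ^ q * (B * g)) - Var v ^ q * d (B * g)) + f * (Var v ^ q * a) \<in> ?J" by (rule hyper_ideal_add)
    moreover have "Var v ^ q * d (B * g) = Var v ^ q * (B * d g + (f * a + of_int (int p) * e))"
      using ae(3) by (simp add: algebra_simps)
    ultimately have "d (s t ^ p * m * g) - s t ^ p * m * d g - of_int (int p) * (Var v ^ q * e) \<in> ?J"
      unfolding eq by (simp add: algebra_simps)
    then show ?thesis using v(1) ae(2) by blast
  qed
  then obtain v e where ve: "\<And>t. t \<in> T \<Longrightarrow> v t \<in> M" "\<And>t. t \<in> T \<Longrightarrow> e t \<in> ?S"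
    "\<And>t. t \<in> T \<Longrightarrow> d (s t ^ p * m * g) - s t ^ p * m * d g - of_int (int p) * (Var (v t) ^ q * e t) \<in> ?J"
    by metis
  have d_sum: "d (sum h I) - (\<Sum>i\<in>I. d (h i)) \<in> ?J" if "finite I" "\<And>i. i \<in> I \<Longrightarrow> h i \<in> ?S" for h :: "'t \<Rightarrow> ipoly" and I
    using that
  proof (induction I rule: finite_induct)
    case (insert i I)
    have "(d (h i + sum h I) - (d (h i) + d (sum h I))) + (d (sum h I) - (\<Sum>i\<in>I. d (h i))) \<in> ?J"
      using insert by (intro hyper_ideal_add d(2)) auto
    then show ?case using insert(1,2) by (simp add: algebra_simps)
  qed (use d(3)[of 0] in simp)
  define E where "E = (\<Sum>t\<in>T. Var (v t) ^ q * e t)"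
  have EV: "E \<in> ?S" unfolding E_def using ve M by (intro poly_carrier_sum poly_carrier_mult poly_carrier_power poly_carrier_Var) auto
  have A: "d ((\<Sum>t\<in>T. s t ^ p) * m * g) - (\<Sum>t\<in>T. s t ^ p) * m * d g - of_int (int p) * E \<in> ?J"
  proof -
    have "(d (\<Sum>t\<in>T. s t ^ p * m * g) - (\<Sum>t\<in>T. d (s t ^ p * m * g)))
        + (\<Sum>t\<in>T. d (s t ^ p * m * g) - s t ^ p * m * d g - of_int (int p) * (Var (v t) ^ q * e t)) \<in> ?J"
    proof (rule hyper_ideal_add[OF d_sum hyper_ideal_sum])
      show "s t ^ p * m * g \<in> ?S" if "t \<in> T" for t using sV[OF that] mV gV by simp
    qed (use fin(2) ve(3) in auto)
    then show ?thesis
      by (simp add: E_def sum_subtractf sum_distrib_left sum_distrib_right add_diff_eq)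
  qed
  have sum_eq: "(\<Sum>t\<in>T. s t ^ p) = f * f ^ (p - 1) - of_int (int p) * D"
    using D(2) p0(1) by (simp add: algebra_simps power_eq_if)
  \<comment> \<open>\<open>?x + p * ?y\<close> is a multiple of \<open>f\<close>, so
    \<open>d\<close> sends it into \<open>?J\<close>; additivity separates the two parts and pulls
    the factor \<open>p\<close> out.\<close>
  have B: "d ((\<Sum>t\<in>T. s t ^ p) * m * g) + of_int (int p) * d (D * m * g) \<in> ?J"
  proof -
    let ?x = "(\<Sum>t\<in>T. s t ^ p) * m * g" and ?y = "D * m * g"
    have x: "?x \<in> ?S" using sV mV gV by (intro poly_carrier_mult poly_carrier_sum) auto
    have y: "?y \<in> ?S" using D mV gV by simp
    have xy: "?x + of_nat p * ?y = f * (f ^ (p - 1) * m * g)"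
      by (simp add: sum_eq algebra_simps)
    have "f * (f ^ (p - 1) * m * g) \<in> ?J" using carrier_f mV gV by (intro hyper_ideal_gen) auto
    then have 1: "d (?x + of_nat p * ?y) \<in> ?J" unfolding xy using carrier_f mV gV by (intro d(3)) auto
    have 2: "d (?x + of_nat p * ?y) - (d ?x + d (of_nat p * ?y)) \<in> ?J" using x y by (intro d(2)) auto
    have 3: "d (of_nat p * ?y) - of_nat p * d ?y \<in> ?J" by (rule additive_mod_of_nat[OF d(2) y])
    have "d (?x + of_nat p * ?y) - (d (?x + of_nat p * ?y) - (d ?x + d (of_nat p * ?y))) - (d (of_nat p * ?y) - of_nat p * d ?y) \<in> ?J"
      by (rule hyper_ideal_diff[OF hyper_ideal_diff[OF 1 2] 3])
    then show ?thesis by (simp add: algebra_simps)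
  qed
  obtain z where z: "z \<in> poly_carrier M" "m = z ^ p"
    unfolding m_def by (rule prod_Var_power_is_power[OF p0(1) q(2)])
  have zV: "z \<in> ?S" using poly_carrier_mono[OF M z(1)] .
  \<comment> \<open>This value is going to be multiplied by \<open>p\<close>, so it matters only
    modulo \<open>f\<close> and \<open>p\<close>. There \<open>d\<close> is the trace, and
    \<open>m\<close> is a \<open>p\<close>-th power that can be taken out.\<close>
  have C: "d (D * m * g) - m * ?\<Phi> (g * D) \<in> ?I"
  proof -
    have "(d (D * m * g) - ?\<Phi> (D * m * g)) + (?\<Phi> (z ^ p * (g * D)) - z ^ p * ?\<Phi> (g * D)) \<in> ?I"
    proof (rule hyper_ideal_add)
      show "d (D * m * g) - ?\<Phi> (D * m * g) \<in> ?I" by (rule d(5)) (use D mV gV in simp)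
      show "?\<Phi> (z ^ p * (g * D)) - z ^ p * ?\<Phi> (g * D) \<in> ?I" by (rule power_lin) (use zV gV D in auto)
    qed
    moreover have e: "D * m * g = z ^ p * (g * D)" by (simp only: z(2) ac_simps)
    have "d (D * m * g) - m * ?\<Phi> (g * D) = (d (D * m * g) - ?\<Phi> (D * m * g)) + (?\<Phi> (z ^ p * (g * D)) - z ^ p * ?\<Phi> (g * D))"
      unfolding e by (simp add: z(2))
    ultimately show ?thesis by (simp only:)
  qed
  have X: "of_int (int p) * (m * ?\<Phi> (g * D) - D * m * d g + E) \<in> ?J"
  proof -
    have 1: "f * (f ^ (p - 1) * m * d g) \<in> ?J" using carrier_f mV d(1)[OF gV] by (intro hyper_ideal_gen) auto
    have "(d ((\<Sum>t\<in>T. s t ^ p) * m * g) + of_int (int p) * d (D * m * g))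
       - (d ((\<Sum>t\<in>T. s t ^ p) * m * g) - (\<Sum>t\<in>T. s t ^ p) * m * d g - of_int (int p) * E)
       - of_int (int p) * (d (D * m * g) - m * ?\<Phi> (g * D)) - f * (f ^ (p - 1) * m * d g) \<in> ?J"
      by (rule hyper_ideal_diff[OF hyper_ideal_diff[OF hyper_ideal_diff[OF B A] pI[OF C]] 1])
    then show ?thesis by (simp add: sum_eq algebra_simps)
  qed
  \<comment> \<open>The division by \<open>p\<close>, which turns the modulus \<open>p ^ 2\<close>
    into \<open>p\<close>.\<close>
  have "m * ?\<Phi> (g * D) - D * m * d g + E \<in> ?I"
  proof (rule hyper_ideal_cancel[OF _ carrier_f not_dvd_f X])
    show "m * ?\<Phi> (g * D) - D * m * d g + E \<in> ?S" using mV D(1) gV d(1)[OF gV] carrier_f EV by simp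
  qed (use p in simp)
  then have 1: "m * ?\<Phi> (g * D) - D * m * d g + E \<in> power_ideal V f (int p) M q" by (rule power_ideal_hyper)
  have 2: "E \<in> power_ideal V f (int p) M q"
    unfolding E_def using ve finM by (intro power_ideal_sum power_ideal_Var) auto
  have 3: "m * ?\<Phi> (g * D) \<in> power_ideal V f (int p) M q"
  proof -
    have "?\<Phi> (g * D) \<in> power_ideal V f (int p) M p"
      using Phi_S_f_g_homogeneous[OF D(1) wtD] by (simp add: mult.assoc)
    then obtain j c where jc: "j \<in> ?I" "\<forall>v\<in>M. c v \<in> ?S" "?\<Phi> (g * D) = j + (\<Sum>v\<in>M. Var v ^ p * c v)" by (rule power_idealE)
    have "m * ?\<Phi> (g * D) = m * j + (\<Sum>v\<in>M. (Var v ^ p * m) * c v)"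
      unfolding jc(3) by (simp add: algebra_simps sum_distrib_left)
    also have "\<dots> \<in> power_ideal V f (int p) M q"
    proof (intro power_ideal_add power_ideal_sum)
      show "m * j \<in> power_ideal V f (int p) M q" by (intro power_ideal_mult power_ideal_hyper jc(1) mV)
      fix v assume v: "v \<in> M"
      obtain z where z: "z \<in> poly_carrier M" "Var v ^ p * m = Var v ^ q * z ^ p"
        unfolding m_def by (rule prod_Var_power_factor[OF finM v q(1) p0(1) q(2)])
      have "Var v ^ q * (z ^ p * c v) \<in> power_ideal V f (int p) M q"
        using finM v poly_carrier_mono[OF M z(1)] bspec[OF jc(2) v] by (intro power_ideal_Var) auto
      then show "Var v ^ p * m * c v \<in> power_ideal V f (int p) M q" by (simp add: z(2) mult.assoc)
    qed
    finally show ?thesis .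
  qed
  have 4: "D * m * (d g - of_int (\<epsilon> t0 ^ (p - 1))) \<in> power_ideal V f (int p) M q"
  proof -
    have "?\<Phi> g - of_int (\<epsilon> t0 ^ (p - 1)) \<in> ?I"
      using Phi_S_f_g gV carrier_f p0 by (intro pcong_hyper_ideal) auto
    then have "(d g - ?\<Phi> g) + (?\<Phi> g - of_int (\<epsilon> t0 ^ (p - 1))) \<in> ?I" using d(5)[OF gV] by (intro hyper_ideal_add)
    then have "d g - of_int (\<epsilon> t0 ^ (p - 1)) \<in> ?I" by simp
    then show ?thesis using D mV by (intro power_ideal_mult power_ideal_hyper) auto
  qed
  have "m * ?\<Phi> (g * D) - (m * ?\<Phi> (g * D) - D * m * d g + E) + E - D * m * (d g - of_int (\<epsilon> t0 ^ (p - 1)))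
     \<in> power_ideal V f (int p) M q"
    by (rule power_ideal_diff[OF power_ideal_add[OF power_ideal_diff[OF 3 1] 2] 4])
  then have 5: "D * m * of_int (\<epsilon> t0 ^ (p - 1)) \<in> power_ideal V f (int p) M q"
    by (simp add: algebra_simps)
  have "D * m \<in> power_ideal V f (int p) M q"
  proof -
    have "\<epsilon> t0 ^ (p - 1) * \<epsilon> t0 ^ (p - 1) = 1"
      using \<epsilon>[OF t0(1)] by (auto simp: power_mult_distrib[symmetric])
    then have "of_int (\<epsilon> t0 ^ (p - 1)) * (D * m * of_int (\<epsilon> t0 ^ (p - 1))) = D * m"
      by (metis (no_types, opaque_lifting) mult.assoc mult.commute mult_1 of_int_1 of_int_mult)
    moreover have "of_int (\<epsilon> t0 ^ (p - 1)) * (D * m * of_int (\<epsilon> t0 ^ (p - 1))) \<in> power_ideal V f (int p) M q"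
      by (rule power_ideal_mult[OF 5 poly_carrier_of_int])
    ultimately show ?thesis by (simp only:)
  qed
  then have fin1: "D * (\<Prod>v\<in>M. Var v ^ (p ^ Suc (Suc k) - p)) \<in> power_ideal V f (int p) M (p ^ Suc (Suc k))"
    unfolding m_def q_def .
  have fin2: "of_int (int p) * D = f ^ p - (\<Sum>t\<in>T. Poly_Mapping.single (\<mu> t) (\<epsilon> t) ^ p)"
    using D(2) unfolding s_def by (rule sym)
  show thesis by (rule that[OF D(1) fin2 fin1])
qed

end

section \<open>Generic determinants\<close>

text \<open>Summation by parts. With \<open>p = Suc m\<close> the right side is a multiple of
  \<open>p\<close>; this is the source of the weights \<open>Suc k\<close> in the functionals
  below.\<close>

lemma sum_telescope_weighted:
  fixes a :: "nat \<Rightarrow> int"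
  shows "(\<Sum>k<m. int (Suc k) * (a k - a (Suc k))) - (\<Sum>k\<le>m. a k) = - int (Suc m) * a m"
  by (induction m) (auto simp: algebra_simps)

lemma sum_alternating_choose:
  assumes "m > 0"
  shows "(\<Sum>k\<le>m. (-1) ^ (m - k) * int (m choose k)) = 0"
proof -
  have "(\<Sum>k\<le>m. of_nat (m choose k) * 1 ^ k * (-1) ^ (m - k)) = (1 + (-1) :: int) ^ m"
    by (rule binomial_ring[symmetric])
  then show ?thesis using assms by (simp add: mult.commute power_0_left)
qed

lemma sum_alternating_choose_lessThan:
  assumes "m > 0"
  shows "(\<Sum>k<m. (-1) ^ (m - k) * int (m choose k)) = - 1"
  using sum_alternating_choose[OF assms] by (simp add: lessThan_Suc_atMost[symmetric])

lemma lookup_sum_Var_power: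
  assumes "finite M"
  shows "(\<Prod>v\<in>M. Var v ^ s) = Poly_Mapping.single (\<Sum>v\<in>M. Poly_Mapping.single v s) 1"
  using assms by (induction M rule: finite_induct) (auto simp: Var_power mult_single)

definition mon_of :: "(nat \<times> nat) set \<Rightarrow> (nat \<times> nat \<Rightarrow> nat) \<Rightarrow> mon" where
  "mon_of V e = (\<Sum>v\<in>V. Poly_Mapping.single v (e v))"

lemma lookup_mon_of: "finite V \<Longrightarrow> Poly_Mapping.lookup (mon_of V e) v = (if v \<in> V then e v else 0)"
  unfolding mon_of_def by (rule lookup_sum_singles)

lemma finite_gen_vars: "finite (gen_vars n)"
proof -
  have "gen_vars n = {..<n} \<times> {..<n}" by (auto simp: gen_vars_def)
  then show ?thesis by simp
qed

lemma prod_Var_graph: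
  "(\<Prod>i<n. Var (i, \<sigma> i)) = Poly_Mapping.single (\<Sum>i<n. Poly_Mapping.single (i, \<sigma> i) 1) 1"
  by (induction n) (auto simp: mult_single Var_def)

definition perm_mon :: "nat \<Rightarrow> (nat \<Rightarrow> nat) \<Rightarrow> mon" where
  "perm_mon n \<sigma> = (\<Sum>i<n. Poly_Mapping.single (i, \<sigma> i) 1)"

lemma lookup_perm_mon: "Poly_Mapping.lookup (perm_mon n \<sigma>) (i, j) = (if i < n \<and> \<sigma> i = j then 1 else 0)"
proof -
  have "Poly_Mapping.lookup (perm_mon n \<sigma>) (i, j) = (\<Sum>k<n. if k = i then (if \<sigma> i = j then 1 else 0) else 0)"
    unfolding perm_mon_def lookup_sum by (intro sum.cong refl) (auto simp: lookup_single when_def)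
  then show ?thesis by (simp add: sum.delta)
qed

lemma single_eq_of_int_mult: "Poly_Mapping.single m c = of_int c * (Poly_Mapping.single m 1 :: ipoly)"
  by (rule poly_mapping_eqI) (simp add: lookup_single when_def)

lemma det_poly_gen_eq:
  "det_poly n gen_entry = (\<Sum>\<sigma> | \<sigma> permutes {..<n}. Poly_Mapping.single (perm_mon n \<sigma>) (sign \<sigma>))"
  unfolding det_poly_def gen_entry_def prod_Var_graph perm_mon_def[symmetric]
  by (intro sum.cong refl single_eq_of_int_mult[symmetric])

definition gen_block :: "nat \<Rightarrow> (nat \<times> nat) set" where
  "gen_block n = {(i, j). 1 \<le> i \<and> i < n \<and> (j = 1 \<or> j = 2)}"

text \<open>A permutation uses each of the columns 1 and 2 once and row 0 once, which gives weight
  \<open>2 - 1\<close>. Outside \<open>gen_block\<close> a positive column contribution occurs only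
  in row 0, where it is cancelled.\<close>

definition gen_wt :: "nat \<times> nat \<Rightarrow> int" where
  "gen_wt = (\<lambda>(i, j). (if j = 1 \<or> j = 2 then 1 else 0) - (if i = 0 then 1 else 0))"

lemma wt_perm_mon:
  assumes n: "3 \<le> n" and \<sigma>: "\<sigma> permutes {..<n}"
  shows "wt (gen_vars n) gen_wt (perm_mon n \<sigma>) = 1"
proof -
  have V: "gen_vars n = Sigma {..<n} (\<lambda>_. {..<n})" by (auto simp: gen_vars_def)
  have img: "\<sigma> i < n" if "i < n" for i using permutes_in_image[OF \<sigma>, of i] that by simp
  have "wt (gen_vars n) gen_wt (perm_mon n \<sigma>)
      = (\<Sum>i<n. \<Sum>j<n. gen_wt (i, j) * int (Poly_Mapping.lookup (perm_mon n \<sigma>) (i, j)))"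
    unfolding wt_def V sum.cartesian_product by (intro sum.cong) auto
  also have "\<dots> = (\<Sum>i<n. gen_wt (i, \<sigma> i))"
  proof (rule sum.cong[OF refl])
    fix i assume i: "i \<in> {..<n}"
    have "(\<Sum>j<n. gen_wt (i, j) * int (Poly_Mapping.lookup (perm_mon n \<sigma>) (i, j))) = (\<Sum>j<n. if j = \<sigma> i then gen_wt (i, \<sigma> i) else 0)"
      using i by (intro sum.cong refl) (auto simp: lookup_perm_mon)
    then show "(\<Sum>j<n. gen_wt (i, j) * int (Poly_Mapping.lookup (perm_mon n \<sigma>) (i, j))) = gen_wt (i, \<sigma> i)"
      using img[of i] i by (simp add: sum.delta)
  qed
  also have "\<dots> = (\<Sum>i<n. if \<sigma> i = 1 \<or> \<sigma> i = 2 then 1 else 0) - (\<Sum>i<n. if i = 0 then 1 else 0)"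
    by (simp add: gen_wt_def sum_subtractf)
  also have "(\<Sum>i<n. if \<sigma> i = 1 \<or> \<sigma> i = 2 then 1 else (0::int)) = (\<Sum>j<n. if j = 1 \<or> j = 2 then 1 else 0)"
    using sum.permute[OF \<sigma>, of "\<lambda>j. if j = 1 \<or> j = 2 then 1 else (0::int)"] unfolding comp_def by (rule sym)
  also have "(\<Sum>j<n. if j = 1 \<or> j = 2 then 1 else (0::int)) = (\<Sum>j\<in>{1, 2 :: nat}. 1)"
    using n by (intro sum.mono_neutral_cong_right) auto
  finally show ?thesis using n by (simp add: sum.delta)
qed

lemma perm_mon_keys_subset_id:
  assumes "\<sigma> permutes {..<n}" "Poly_Mapping.keys (perm_mon n \<sigma>) \<subseteq> Poly_Mapping.keys (perm_mon n id)"
  shows "\<sigma> = id"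
proof
  fix i show "\<sigma> i = id i"
  proof (cases "i < n")
    case True
    then have "(i, \<sigma> i) \<in> Poly_Mapping.keys (perm_mon n \<sigma>)" by (simp add: in_keys_iff lookup_perm_mon)
    then have "(i, \<sigma> i) \<in> Poly_Mapping.keys (perm_mon n id)" using assms by blast
    then show ?thesis by (auto simp: in_keys_iff lookup_perm_mon split: if_splits)
  qed (use permutes_not_in[OF assms(1)] in auto)
qed

lemma multilinear_gen:
  assumes n: "3 \<le> n" and p: "prime p"
  shows "multilinear_hypersurface (gen_vars n) (gen_block n) p {\<sigma>. \<sigma> permutes {..<n}} (perm_mon n) sign gen_wt
    (det_poly n gen_entry) id"
proof
  show "finite {\<sigma>. \<sigma> permutes {..<n}}" by (rule finite_permutations) simp
  show "gen_block n \<subseteq> gen_vars n" using n by (auto simp: gen_block_def gen_vars_def)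
  show "sign \<sigma> = 1 \<or> sign \<sigma> = -1" for \<sigma> :: "nat \<Rightarrow> nat" by (simp add: sign_def)
  show "Poly_Mapping.keys (perm_mon n \<sigma>) \<subseteq> gen_vars n" if "\<sigma> \<in> {\<sigma>. \<sigma> permutes {..<n}}" for \<sigma>
  proof
    fix v assume "v \<in> Poly_Mapping.keys (perm_mon n \<sigma>)"
    moreover obtain i j where v: "v = (i, j)" by (cases v)
    ultimately have "i < n" "\<sigma> i = j" by (auto simp: in_keys_iff lookup_perm_mon split: if_splits)
    moreover have "\<sigma> i < n" using permutes_in_image[of \<sigma> "{..<n}" i] that \<open>i < n\<close> by simp
    ultimately show "v \<in> gen_vars n" by (simp add: v gen_vars_def)
  qed
  show "Poly_Mapping.lookup (perm_mon n \<sigma>) v \<le> 1" for \<sigma> v by (cases v) (simp add: lookup_perm_mon)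
  show "gen_wt v \<le> 0" if "v \<in> gen_vars n - gen_block n" for v
  proof -
    obtain i j where v: "v = (i, j)" by (cases v)
    show ?thesis using that unfolding v gen_vars_def gen_block_def gen_wt_def by auto
  qed
  show "finite (gen_vars n)" by (rule finite_gen_vars)
  show "prime p" by (rule p)
  show "det_poly n gen_entry = (\<Sum>\<sigma> | \<sigma> permutes {..<n}. Poly_Mapping.single (perm_mon n \<sigma>) (sign \<sigma>))"
    by (rule det_poly_gen_eq)
  show "wt (gen_vars n) gen_wt (perm_mon n \<sigma>) = 1" if "\<sigma> \<in> {\<sigma>. \<sigma> permutes {..<n}}" for \<sigma>
    by (rule wt_perm_mon[OF n]) (use that in simp)
  show "id \<in> {\<sigma>. \<sigma> permutes {..<n}}" by (simp add: permutes_id)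
  show "\<sigma> = id" if "\<sigma> \<in> {\<sigma>. \<sigma> permutes {..<n}}"
    "Poly_Mapping.keys (perm_mon n \<sigma>) \<subseteq> Poly_Mapping.keys (perm_mon n id)" for \<sigma>
    by (rule perm_mon_keys_subset_id) (use that in simp_all)
qed

text \<open>The exponents of the monomials on which the functional is supported: the nonzero entries of the top
  left block are \<open>r1, r2\<close> (row 0), \<open>c1, c2\<close> (column 0) and \<open>z11, \<dots>, z22\<close>; the remaining diagonal
  entries have exponent \<open>t\<close> and the entries below the block have exponent \<open>s\<close>.\<close>

definition gen_exp :: "nat \<Rightarrow> nat \<Rightarrow> nat \<Rightarrow> nat \<Rightarrow> nat \<Rightarrow> nat \<Rightarrow> nat \<Rightarrow> nat \<Rightarrow> nat \<Rightarrow> nat \<Rightarrow> nat \<times> nat \<Rightarrow> nat" where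
  "gen_exp s z22 z12 z21 z11 r1 r2 c1 c2 t = (\<lambda>(i, j).
     if 3 \<le> i then (if i = j then t else if j = 1 \<or> j = 2 then s else 0)
     else if i = 0 then (if j = 1 then r1 else if j = 2 then r2 else 0)
     else if i = 1 then (if j = 0 then c1 else if j = 1 then z11 else if j = 2 then z12 else 0)
     else (if j = 0 then c2 else if j = 1 then z21 else if j = 2 then z22 else 0))"

definition gen_mon :: "nat \<Rightarrow> nat \<Rightarrow> nat \<Rightarrow> nat \<Rightarrow> nat \<Rightarrow> nat \<Rightarrow> nat \<Rightarrow> nat \<Rightarrow> nat \<Rightarrow> nat \<Rightarrow> nat \<Rightarrow> mon" where
  "gen_mon n s z22 z12 z21 z11 r1 r2 c1 c2 t = mon_of (gen_vars n) (gen_exp s z22 z12 z21 z11 r1 r2 c1 c2 t)"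

lemma lookup_gen_mon:
  "Poly_Mapping.lookup (gen_mon n s z22 z12 z21 z11 r1 r2 c1 c2 t) (i, j)
    = (if i < n \<and> j < n then gen_exp s z22 z12 z21 z11 r1 r2 c1 c2 t (i, j) else 0)"
  by (simp add: gen_mon_def lookup_mon_of finite_gen_vars gen_vars_def)

text \<open>The permutations that move 0 and fix everything from 3 on. A \<open>gen_mon\<close> has
  exponent 0 at \<open>(0, 0)\<close>, so its divisors among the terms of the determinant come from
  these four.\<close>

definition "\<sigma>1 = (transpose 0 1 :: nat \<Rightarrow> nat)"
definition "\<sigma>2 = (transpose 0 1 \<circ> transpose 1 2 :: nat \<Rightarrow> nat)"
definition "\<sigma>3 = (transpose 0 2 \<circ> transpose 1 2 :: nat \<Rightarrow> nat)"
definition "\<sigma>4 = (transpose 0 2 :: nat \<Rightarrow> nat)"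

lemma \<sigma>_apply:
  "\<sigma>1 i = (if i = 0 then 1 else if i = 1 then 0 else i)"
  "\<sigma>2 i = (if i = 0 then 1 else if i = 1 then 2 else if i = 2 then 0 else i)"
  "\<sigma>3 i = (if i = 0 then 2 else if i = 1 then 0 else if i = 2 then 1 else i)"
  "\<sigma>4 i = (if i = 0 then 2 else if i = 2 then 0 else i)"
  by (auto simp: \<sigma>1_def \<sigma>2_def \<sigma>3_def \<sigma>4_def transpose_def)

lemma \<sigma>_sign: "sign \<sigma>1 = -1" "sign \<sigma>2 = 1" "sign \<sigma>3 = 1" "sign \<sigma>4 = -1"
  by (simp_all add: \<sigma>1_def \<sigma>2_def \<sigma>3_def \<sigma>4_def sign_compose permutation_swap_id sign_swap_id)

lemma \<sigma>_permutes:
  assumes "3 \<le> n"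
  shows "\<sigma>1 permutes {..<n}" "\<sigma>2 permutes {..<n}" "\<sigma>3 permutes {..<n}" "\<sigma>4 permutes {..<n}"
  unfolding \<sigma>1_def \<sigma>2_def \<sigma>3_def \<sigma>4_def
  by (intro permutes_compose permutes_swap_id; use assms in simp)+

lemma \<sigma>_cases:
  assumes \<sigma>: "\<sigma> permutes {..<n}" and n: "3 \<le> n"
    and fx: "\<And>j. 3 \<le> j \<Longrightarrow> j < n \<Longrightarrow> \<sigma> j = j" and 0: "\<sigma> 0 \<noteq> 0"
  shows "\<sigma> \<in> {\<sigma>1, \<sigma>2, \<sigma>3, \<sigma>4}"
proof -
  have fixed: "\<sigma> j = j" if "3 \<le> j" for j
  proof (cases "j < n")
    case True then show ?thesis using fx that by simp
  next
    case False then show ?thesis using permutes_not_in[OF \<sigma>, of j] by simp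
  qed
  have inj: "\<sigma> i = \<sigma> j \<longleftrightarrow> i = j" for i j using inj_eq[OF permutes_inj[OF \<sigma>]] .
  have lt: "\<sigma> i < 3" if "i < 3" for i
  proof (rule ccontr)
    assume "\<not> \<sigma> i < 3"
    then have "\<sigma> (\<sigma> i) = \<sigma> i" using fixed by simp
    then have "\<sigma> i = i" unfolding inj .
    then show False using \<open>\<not> \<sigma> i < 3\<close> that by simp
  qed
  have eqI: "\<sigma> = \<tau>" if "\<sigma> 0 = \<tau> 0" "\<sigma> 1 = \<tau> 1" "\<sigma> 2 = \<tau> 2" "\<And>i. 3 \<le> i \<Longrightarrow> \<tau> i = i" for \<tau>
  proof
    fix i :: nat
    consider "i = 0" | "i = 1" | "i = 2" | "3 \<le> i" by linarith
    then show "\<sigma> i = \<tau> i" using that fixed by cases auto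
  qed
  have l: "\<sigma> 0 < 3" "\<sigma> 1 < 3" "\<sigma> 2 < 3" using lt by auto
  have d: "\<sigma> 0 \<noteq> \<sigma> 1" "\<sigma> 0 \<noteq> \<sigma> 2" "\<sigma> 1 \<noteq> \<sigma> 2" unfolding inj by simp_all
  have "\<sigma> 0 = 1 \<or> \<sigma> 0 = 2" using l(1) 0 by linarith
  moreover have "\<sigma> 1 = 0 \<or> \<sigma> 1 = 1 \<or> \<sigma> 1 = 2" using l(2) by linarith
  moreover have "\<sigma> 2 = 0 \<or> \<sigma> 2 = 1 \<or> \<sigma> 2 = 2" using l(3) by linarith
  ultimately have "(\<sigma> 0 = 1 \<and> \<sigma> 1 = 0 \<and> \<sigma> 2 = 2) \<or> (\<sigma> 0 = 1 \<and> \<sigma> 1 = 2 \<and> \<sigma> 2 = 0)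
    \<or> (\<sigma> 0 = 2 \<and> \<sigma> 1 = 0 \<and> \<sigma> 2 = 1) \<or> (\<sigma> 0 = 2 \<and> \<sigma> 1 = 1 \<and> \<sigma> 2 = 0)"
    using d by (elim disjE) simp_all
  then show ?thesis
  proof (elim disjE)
    assume "\<sigma> 0 = 1 \<and> \<sigma> 1 = 0 \<and> \<sigma> 2 = 2"
    then have "\<sigma> = \<sigma>1" by (intro eqI) (simp_all add: \<sigma>_apply)
    then show ?thesis by simp
  next
    assume "\<sigma> 0 = 1 \<and> \<sigma> 1 = 2 \<and> \<sigma> 2 = 0"
    then have "\<sigma> = \<sigma>2" by (intro eqI) (simp_all add: \<sigma>_apply)
    then show ?thesis by simp
  next
    assume "\<sigma> 0 = 2 \<and> \<sigma> 1 = 0 \<and> \<sigma> 2 = 1"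
    then have "\<sigma> = \<sigma>3" by (intro eqI) (simp_all add: \<sigma>_apply)
    then show ?thesis by simp
  next
    assume "\<sigma> 0 = 2 \<and> \<sigma> 1 = 1 \<and> \<sigma> 2 = 0"
    then have "\<sigma> = \<sigma>4" by (intro eqI) (simp_all add: \<sigma>_apply)
    then show ?thesis by simp
  qed
qed

lemma \<sigma>_distinct: "\<sigma>1 \<noteq> \<sigma>2" "\<sigma>1 \<noteq> \<sigma>3" "\<sigma>1 \<noteq> \<sigma>4" "\<sigma>2 \<noteq> \<sigma>3" "\<sigma>2 \<noteq> \<sigma>4" "\<sigma>3 \<noteq> \<sigma>4"
proof -
  have "\<sigma>1 1 \<noteq> \<sigma>2 1" "\<sigma>1 0 \<noteq> \<sigma>3 0" "\<sigma>1 0 \<noteq> \<sigma>4 0" "\<sigma>2 0 \<noteq> \<sigma>3 0" "\<sigma>2 0 \<noteq> \<sigma>4 0" "\<sigma>3 1 \<noteq> \<sigma>4 1" by (simp_all add: \<sigma>_apply)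
  then show "\<sigma>1 \<noteq> \<sigma>2" "\<sigma>1 \<noteq> \<sigma>3" "\<sigma>1 \<noteq> \<sigma>4" "\<sigma>2 \<noteq> \<sigma>3" "\<sigma>2 \<noteq> \<sigma>4" "\<sigma>3 \<noteq> \<sigma>4" by fastforce+
qed

lemma gen_mon_split:
  assumes "3 \<le> n"
  shows "gen_mon n s (Suc z22) z12 z21 z11 (Suc r1) r2 (Suc c1) c2 (Suc t) = perm_mon n \<sigma>1 + gen_mon n s z22 z12 z21 z11 r1 r2 c1 c2 t"
    "gen_mon n s z22 (Suc z12) z21 z11 (Suc r1) r2 c1 (Suc c2) (Suc t) = perm_mon n \<sigma>2 + gen_mon n s z22 z12 z21 z11 r1 r2 c1 c2 t"
    "gen_mon n s z22 z12 (Suc z21) z11 r1 (Suc r2) (Suc c1) c2 (Suc t) = perm_mon n \<sigma>3 + gen_mon n s z22 z12 z21 z11 r1 r2 c1 c2 t"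
    "gen_mon n s z22 z12 z21 (Suc z11) r1 (Suc r2) c1 (Suc c2) (Suc t) = perm_mon n \<sigma>4 + gen_mon n s z22 z12 z21 z11 r1 r2 c1 c2 t"
proof -
  have *: "m = m'" if "\<And>i j. Poly_Mapping.lookup m (i, j) = Poly_Mapping.lookup m' (i, j)" for m m' :: mon
    using that by (intro poly_mapping_eqI) auto
  show "gen_mon n s (Suc z22) z12 z21 z11 (Suc r1) r2 (Suc c1) c2 (Suc t) = perm_mon n \<sigma>1 + gen_mon n s z22 z12 z21 z11 r1 r2 c1 c2 t"
    by (rule *) (use assms in \<open>auto simp: lookup_add lookup_gen_mon lookup_perm_mon gen_exp_def \<sigma>_apply\<close>)
  show "gen_mon n s z22 (Suc z12) z21 z11 (Suc r1) r2 c1 (Suc c2) (Suc t) = perm_mon n \<sigma>2 + gen_mon n s z22 z12 z21 z11 r1 r2 c1 c2 t"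
    by (rule *) (use assms in \<open>auto simp: lookup_add lookup_gen_mon lookup_perm_mon gen_exp_def \<sigma>_apply\<close>)
  show "gen_mon n s z22 z12 (Suc z21) z11 r1 (Suc r2) (Suc c1) c2 (Suc t) = perm_mon n \<sigma>3 + gen_mon n s z22 z12 z21 z11 r1 r2 c1 c2 t"
    by (rule *) (use assms in \<open>auto simp: lookup_add lookup_gen_mon lookup_perm_mon gen_exp_def \<sigma>_apply\<close>)
  show "gen_mon n s z22 z12 z21 (Suc z11) r1 (Suc r2) c1 (Suc c2) (Suc t) = perm_mon n \<sigma>4 + gen_mon n s z22 z12 z21 z11 r1 r2 c1 c2 t"
    by (rule *) (use assms in \<open>auto simp: lookup_add lookup_gen_mon lookup_perm_mon gen_exp_def \<sigma>_apply\<close>)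
qed

lemma gen_mon_not:
  assumes "3 \<le> n" "z = 0 \<or> r = 0 \<or> c = 0"
  shows "gen_mon n s z z12 z21 z11 r r2 c c2 t \<noteq> perm_mon n \<sigma>1 + m"
    "gen_mon n s z22 z z21 z11 r r2 c1 c t \<noteq> perm_mon n \<sigma>2 + m"
    "gen_mon n s z22 z12 z z11 r1 r c c2 t \<noteq> perm_mon n \<sigma>3 + m"
    "gen_mon n s z22 z12 z21 z r1 r c1 c t \<noteq> perm_mon n \<sigma>4 + m"
proof -
  have *: "m1 \<noteq> m2 + m" if "Poly_Mapping.lookup m1 v = 0" "Poly_Mapping.lookup m2 v = 1" for m1 m2 m :: mon and v
    using that by (metis lookup_add add_is_0 one_neq_zero)
  note s = lookup_gen_mon lookup_perm_mon gen_exp_def \<sigma>_apply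
  show "gen_mon n s z z12 z21 z11 r r2 c c2 t \<noteq> perm_mon n \<sigma>1 + m"
    using assms *[where v = "(2, 2)"] *[where v = "(0, 1)"] *[where v = "(1, 0)"] by (auto simp: s)
  show "gen_mon n s z22 z z21 z11 r r2 c1 c t \<noteq> perm_mon n \<sigma>2 + m"
    using assms *[where v = "(1, 2)"] *[where v = "(0, 1)"] *[where v = "(2, 0)"] by (auto simp: s)
  show "gen_mon n s z22 z12 z z11 r1 r c c2 t \<noteq> perm_mon n \<sigma>3 + m"
    using assms *[where v = "(2, 1)"] *[where v = "(0, 2)"] *[where v = "(1, 0)"] by (auto simp: s)
  show "gen_mon n s z22 z12 z21 z r1 r c1 c t \<noteq> perm_mon n \<sigma>4 + m"
    using assms *[where v = "(1, 1)"] *[where v = "(0, 2)"] *[where v = "(2, 0)"] by (auto simp: s)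
qed

text \<open>In a column \<open>j \<ge> 3\<close> only the diagonal exponent of a
  \<open>gen_mon\<close> can be positive, so \<sigma> fixes \<open>j\<close>; and the exponent 0 at
  \<open>(0, 0)\<close> forces \<sigma> to move 0.\<close>

lemma perm_mon_dvd_gen_mon:
  assumes \<sigma>: "\<sigma> permutes {..<n}" and n: "3 \<le> n" and eq: "gen_mon n s z22 z12 z21 z11 r1 r2 c1 c2 t = perm_mon n \<sigma> + m"
  shows "\<sigma> \<in> {\<sigma>1, \<sigma>2, \<sigma>3, \<sigma>4}"
proof (rule \<sigma>_cases[OF \<sigma> n])
  have pos: "gen_exp s z22 z12 z21 z11 r1 r2 c1 c2 t (i, \<sigma> i) > 0 \<and> \<sigma> i < n" if "i < n" for i
    using arg_cong[OF eq, of "\<lambda>m. Poly_Mapping.lookup m (i, \<sigma> i)"] that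
    by (auto simp: lookup_add lookup_gen_mon lookup_perm_mon split: if_splits)
  show "\<sigma> 0 \<noteq> 0" using pos[of 0] n by (auto simp: gen_exp_def split: if_splits)
  fix j assume j: "3 \<le> j" "j < n"
  obtain i where i: "\<sigma> i = j" using permutes_surj[OF \<sigma>] by (metis surjD)
  have "i < n" using i j permutes_not_in[OF \<sigma>, of i] by (cases "i < n") auto
  then show "\<sigma> j = j" using pos[of i] i j by (auto simp: gen_exp_def split: if_splits)
qed

text \<open>On these exponents multiplication by the determinant becomes a recursion with four
  summands. Each of the four permutations fixes all indices from 3 on, so the diagonal exponent
  drops by one in every summand.\<close>

lemma lookup_det_mult:
  fixes \<alpha> :: ipoly
  assumes n: "3 \<le> n"
  shows "Poly_Mapping.lookup (det_poly n gen_entry * \<alpha>) (gen_mon n s z22 z12 z21 z11 r1 r2 c1 c2 (Suc t)) =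
     - (if z22 = 0 \<or> r1 = 0 \<or> c1 = 0 then 0 else Poly_Mapping.lookup \<alpha> (gen_mon n s (z22 - 1) z12 z21 z11 (r1 - 1) r2 (c1 - 1) c2 t))
     + (if z12 = 0 \<or> r1 = 0 \<or> c2 = 0 then 0 else Poly_Mapping.lookup \<alpha> (gen_mon n s z22 (z12 - 1) z21 z11 (r1 - 1) r2 c1 (c2 - 1) t))
     + (if z21 = 0 \<or> r2 = 0 \<or> c1 = 0 then 0 else Poly_Mapping.lookup \<alpha> (gen_mon n s z22 z12 (z21 - 1) z11 r1 (r2 - 1) (c1 - 1) c2 t))
     - (if z11 = 0 \<or> r2 = 0 \<or> c2 = 0 then 0 else Poly_Mapping.lookup \<alpha> (gen_mon n s z22 z12 z21 (z11 - 1) r1 (r2 - 1) c1 (c2 - 1) t))"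
proof -
  let ?m = "gen_mon n s z22 z12 z21 z11 r1 r2 c1 c2 (Suc t)"
  let ?L = "\<lambda>\<sigma>. Poly_Mapping.lookup (Poly_Mapping.single (perm_mon n \<sigma>) (sign \<sigma>) * \<alpha>) ?m"
  have "Poly_Mapping.lookup (det_poly n gen_entry * \<alpha>) ?m = (\<Sum>\<sigma> | \<sigma> permutes {..<n}. ?L \<sigma>)"
    unfolding det_poly_gen_eq sum_distrib_right lookup_sum ..
  also have "\<dots> = (\<Sum>\<sigma>\<in>{\<sigma>1, \<sigma>2, \<sigma>3, \<sigma>4}. ?L \<sigma>)"
  proof (rule sum.mono_neutral_right)
    show "finite {\<sigma>. \<sigma> permutes {..<n}}" by (rule finite_permutations) simp
    show "{\<sigma>1, \<sigma>2, \<sigma>3, \<sigma>4} \<subseteq> {\<sigma>. \<sigma> permutes {..<n}}" using \<sigma>_permutes[OF n] by auto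
    show "\<forall>\<sigma>\<in>{\<sigma>. \<sigma> permutes {..<n}} - {\<sigma>1, \<sigma>2, \<sigma>3, \<sigma>4}. ?L \<sigma> = 0"
      using perm_mon_dvd_gen_mon[OF _ n] by (intro ballI lookup_single_mult_not) blast
  qed
  also have "\<dots> = ?L \<sigma>1 + ?L \<sigma>2 + ?L \<sigma>3 + ?L \<sigma>4"
    using \<sigma>_distinct by (simp only: sum.insert sum.empty finite.intros insert_iff empty_iff simp_thms add.assoc add_0_right)
  also have "?L \<sigma>1 = - (if z22 = 0 \<or> r1 = 0 \<or> c1 = 0 then 0 else Poly_Mapping.lookup \<alpha> (gen_mon n s (z22 - 1) z12 z21 z11 (r1 - 1) r2 (c1 - 1) c2 t))"
  proof (cases "z22 = 0 \<or> r1 = 0 \<or> c1 = 0")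
    case True
    then have "?L \<sigma>1 = 0" using gen_mon_not(1)[OF n True] by (intro lookup_single_mult_not)
    then show ?thesis using True by (simp only: if_True minus_zero)
  next
    case False
    then obtain a b c where "z22 = Suc a" "r1 = Suc b" "c1 = Suc c" by (metis not0_implies_Suc)
    then show ?thesis by (simp only: gen_mon_split(1)[OF n] lookup_single_mult_add \<sigma>_sign) simp
  qed
  also have "?L \<sigma>2 = (if z12 = 0 \<or> r1 = 0 \<or> c2 = 0 then 0 else Poly_Mapping.lookup \<alpha> (gen_mon n s z22 (z12 - 1) z21 z11 (r1 - 1) r2 c1 (c2 - 1) t))"
  proof (cases "z12 = 0 \<or> r1 = 0 \<or> c2 = 0")
    case True
    then have "?L \<sigma>2 = 0" using gen_mon_not(2)[OF n True] by (intro lookup_single_mult_not)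
    then show ?thesis using True by (simp only: if_True)
  next
    case False
    then obtain a b c where "z12 = Suc a" "r1 = Suc b" "c2 = Suc c" by (metis not0_implies_Suc)
    then show ?thesis by (simp only: gen_mon_split(2)[OF n] lookup_single_mult_add \<sigma>_sign) simp
  qed
  also have "?L \<sigma>3 = (if z21 = 0 \<or> r2 = 0 \<or> c1 = 0 then 0 else Poly_Mapping.lookup \<alpha> (gen_mon n s z22 z12 (z21 - 1) z11 r1 (r2 - 1) (c1 - 1) c2 t))"
  proof (cases "z21 = 0 \<or> r2 = 0 \<or> c1 = 0")
    case True
    then have "?L \<sigma>3 = 0" using gen_mon_not(3)[OF n True] by (intro lookup_single_mult_not)
    then show ?thesis using True by (simp only: if_True)
  next
    case False
    then obtain a b c where "z21 = Suc a" "r2 = Suc b" "c1 = Suc c" by (metis not0_implies_Suc)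
    then show ?thesis by (simp only: gen_mon_split(3)[OF n] lookup_single_mult_add \<sigma>_sign) simp
  qed
  also have "?L \<sigma>4 = - (if z11 = 0 \<or> r2 = 0 \<or> c2 = 0 then 0 else Poly_Mapping.lookup \<alpha> (gen_mon n s z22 z12 z21 (z11 - 1) r1 (r2 - 1) c1 (c2 - 1) t))"
  proof (cases "z11 = 0 \<or> r2 = 0 \<or> c2 = 0")
    case True
    then have "?L \<sigma>4 = 0" using gen_mon_not(4)[OF n True] by (intro lookup_single_mult_not)
    then show ?thesis using True by (simp only: if_True minus_zero)
  next
    case False
    then obtain a b c where "z11 = Suc a" "r2 = Suc b" "c2 = Suc c" by (metis not0_implies_Suc)
    then show ?thesis by (simp only: gen_mon_split(4)[OF n] lookup_single_mult_add \<sigma>_sign) simp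
  qed
  finally show ?thesis by (simp only: diff_conv_add_uminus)
qed

lemma gen_mon_zero: "gen_mon n 0 0 0 0 0 0 0 0 0 0 = 0"
  by (rule poly_mapping_eqI) (auto simp: gen_mon_def lookup_mon_of finite_gen_vars gen_exp_def)

text \<open>With \<open>r1 = 0\<close> only \<sigma>3 (sign +1) and \<sigma>4 (sign -1) contribute,
  so the coefficient is that of a power of a binomial.\<close>

lemma coefficient_det_power_1:
  assumes n: "3 \<le> n"
  shows "i + j = m \<Longrightarrow> Poly_Mapping.lookup (det_poly n gen_entry ^ m) (gen_mon n 0 0 0 i j 0 m i j m) = (-1) ^ j * int (m choose i)"
proof (induction m arbitrary: i j)
  case 0
  then show ?case by (simp add: gen_mon_zero)
next
  case (Suc m)
  note IH = Suc.IH
  show ?case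
  proof (cases i)
    case 0
    then show ?thesis using IH[of 0 m] Suc.prems by (simp add: lookup_det_mult[OF n])
  next
    case (Suc i')
    show ?thesis
    proof (cases j)
      case 0
      then show ?thesis using IH[of m 0] Suc Suc.prems by (simp add: lookup_det_mult[OF n])
    next
      case (Suc j')
      have "i' + j = m" "i + j' = m" using Suc Suc.prems \<open>i = Suc i'\<close> by auto
      then show ?thesis using IH[of i' j] IH[of i j'] Suc \<open>i = Suc i'\<close>
        by (simp add: lookup_det_mult[OF n] algebra_simps)
    qed
  qed
qed

text \<open>Here \<open>z22 = 1\<close>, \<open>z12 = 0\<close> and \<open>r1 = 1\<close> force
  \<sigma>1 to be used exactly once, in any of \<open>Suc m\<close> positions; the other factors
  contribute as in \<open>coefficient_det_power_1\<close>.\<close>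

lemma coefficient_det_power_2:
  assumes n: "3 \<le> n"
  shows "i + j = m \<Longrightarrow> Poly_Mapping.lookup (det_poly n gen_entry ^ Suc m) (gen_mon n 0 1 0 i j 1 m (Suc i) j (Suc m))
    = - ((-1) ^ j) * int (Suc m * (m choose i))"
proof (induction m arbitrary: i j)
  case 0
  then show ?case using gen_mon_zero[of n] lookup_det_mult[OF n, of 1 0 1 0 0 0 1 0 1 0 0] by simp
next
  case (Suc m)
  note IH = Suc.IH
  note C1 = coefficient_det_power_1[OF n Suc.prems]
  have step: "Poly_Mapping.lookup (det_poly n gen_entry ^ Suc (Suc m)) (gen_mon n 0 1 0 i j 1 (Suc m) (Suc i) j (Suc (Suc m)))
    = - ((-1) ^ j * int (Suc m choose i))
      + (if i = 0 then 0 else Poly_Mapping.lookup (det_poly n gen_entry ^ Suc m) (gen_mon n 0 1 0 (i - 1) j 1 m i j (Suc m)))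
      - (if j = 0 then 0 else Poly_Mapping.lookup (det_poly n gen_entry ^ Suc m) (gen_mon n 0 1 0 i (j - 1) 1 m (Suc i) (j - 1) (Suc m)))"
    unfolding power_Suc[of _ "Suc m"] lookup_det_mult[OF n] using C1 by simp
  show ?case
  proof (cases i)
    case 0
    then show ?thesis using IH[of 0 m] Suc.prems unfolding step by (simp add: algebra_simps)
  next
    case (Suc i')
    show ?thesis
    proof (cases j)
      case 0
      then show ?thesis using IH[of m 0] Suc Suc.prems unfolding step by (simp add: algebra_simps)
    next
      case (Suc j')
      have *: "i' + j = m" "i + j' = m" using Suc Suc.prems \<open>i = Suc i'\<close> by auto
      have "Poly_Mapping.lookup (det_poly n gen_entry ^ Suc (Suc m)) (gen_mon n 0 1 0 i j 1 (Suc m) (Suc i) j (Suc (Suc m)))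
        = - ((-1) ^ j * int (Suc m choose i)) + - ((-1) ^ j) * int (Suc m * (m choose i')) - (- ((-1) ^ j') * int (Suc m * (m choose i)))"
        unfolding step using IH[OF *(1)] IH[OF *(2)] Suc \<open>i = Suc i'\<close> by simp
      then show ?thesis using Suc \<open>i = Suc i'\<close> by (simp add: algebra_simps)
    qed
  qed
qed

text \<open>A test for the Cech class of \<open>D\<close>, valid modulo \<open>p = Suc m\<close>.
  The first and third sums detect \<open>D\<close>. The second and fourth contain an exponent
  \<open>s - 1\<close>, so they vanish on multiples of the block product; they cancel the boundary
  terms that the third sum leaves on multiples of the determinant.\<close>

definition gen_functional :: "nat \<Rightarrow> nat \<Rightarrow> nat \<Rightarrow> ipoly \<Rightarrow> int" where
  "gen_functional n s m P =
     (\<Sum>k<m. int (Suc k) * Poly_Mapping.lookup P (gen_mon n s s s (Suc k + s) (m - k + s) 0 (Suc m) (Suc k) (m - k) (Suc m)))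
   - (\<Sum>k<m. int (Suc k) * Poly_Mapping.lookup P (gen_mon n s (Suc s) (s - 1) (Suc k + s) (m - k + s) 0 (Suc m) (Suc (Suc k)) (m - Suc k) (Suc m)))
   + (\<Sum>k\<le>m. Poly_Mapping.lookup P (gen_mon n s (Suc s) s (k + s) (m - k + s) 1 m (Suc k) (m - k) (Suc m)))
   - (\<Sum>k<m. Poly_Mapping.lookup P (gen_mon n s (Suc s) (Suc k + s) (s - 1) (m - k + s) (Suc (Suc k)) (m - Suc k) 0 (Suc m) (Suc m)))"

lemma gen_functional_add: "gen_functional n s m (P + Q) = gen_functional n s m P + gen_functional n s m Q"
  by (simp add: gen_functional_def lookup_add sum.distrib distrib_left)

lemma gen_functional_of_int: "gen_functional n s m (of_int c * P) = c * gen_functional n s m P"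
  by (simp add: gen_functional_def sum_distrib_left right_diff_distrib distrib_left mult.left_commute)

lemma gen_functional_sum: "gen_functional n s m (sum g I) = (\<Sum>i\<in>I. gen_functional n s m (g i))"
  by (induction I rule: infinite_finite_induct) (auto simp: gen_functional_add, simp_all add: gen_functional_def)

text \<open>Each coefficient of a multiple of the determinant is a signed sum of coefficients of the
  cofactor \<alpha>. The families \<open>a\<close> and \<open>b\<close> are summed by
  \<open>sum_telescope_weighted\<close>, \<open>c\<close> and \<open>e\<close> telescope, and only a
  multiple of \<open>Suc m\<close> is left.\<close>

lemma gen_functional_det:
  assumes n: "3 \<le> n" and s: "s > 0" and m: "m > 0"
  shows "int (Suc m) dvd gen_functional n s m (det_poly n gen_entry * \<alpha>)"
proof -
  \<comment> \<open>The coefficients of \<alpha> reached by the recursion. The value 0 from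
    \<open>m\<close> on reproduces its guards, and at \<open>k = 0\<close> the third sum meets
    \<open>e 0\<close> in place of a previous \<open>c\<close>.\<close>
  define a where "a k = Poly_Mapping.lookup \<alpha> (gen_mon n s s s (k + s) (m - k + s) 0 m k (m - k) m)" for k
  define b where "b k = (if k < m then Poly_Mapping.lookup \<alpha> (gen_mon n s (Suc s) (s - 1) (k + s) (m - k + s) 0 m (Suc k) (m - 1 - k) m) else 0)" for k
  define c where "c k = (if k < m then Poly_Mapping.lookup \<alpha> (gen_mon n s (Suc s) s (k + s) (m - 1 - k + s) 1 (m - 1) (Suc k) (m - 1 - k) m) else 0)" for k
  define e where "e k = (if k < m then Poly_Mapping.lookup \<alpha> (gen_mon n s (Suc s) (k + s) (s - 1) (m - k + s) (Suc k) (m - 1 - k) 0 m m) else 0)" for k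
  let ?P = "det_poly n gen_entry * \<alpha>"
  have f1: "Poly_Mapping.lookup ?P (gen_mon n s s s (Suc k + s) (m - k + s) 0 (Suc m) (Suc k) (m - k) (Suc m)) = a k - a (Suc k)" if "k < m" for k
  proof -
    have "m - k + s - 1 = m - Suc k + s" "m - k - 1 = m - Suc k" "m - k + s \<noteq> 0" "m - k \<noteq> 0" using that by auto
    then show ?thesis unfolding lookup_det_mult[OF n] a_def by simp
  qed
  have f2: "Poly_Mapping.lookup ?P (gen_mon n s (Suc s) (s - 1) (Suc k + s) (m - k + s) 0 (Suc m) (Suc (Suc k)) (m - Suc k) (Suc m)) = b k - b (Suc k)" if "k < m" for k
  proof -
    have "m - k + s - 1 = m - Suc k + s" "m - Suc k - 1 = m - 1 - Suc k" "m - k + s \<noteq> 0" "m - 1 - k = m - Suc k" "(m - Suc k = 0) = (\<not> Suc k < m)"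
      using that by auto
    then show ?thesis using that unfolding lookup_det_mult[OF n] b_def by simp
  qed
  have f3: "Poly_Mapping.lookup ?P (gen_mon n s (Suc s) s (k + s) (m - k + s) 1 m (Suc k) (m - k) (Suc m))
      = - a k + b k + (if k = 0 then e 0 else c (k - 1)) - c k" if "k \<le> m" for k
  proof (cases k)
    case 0
    have "m - 1 + s = m + s - 1" using m by simp
    then show ?thesis using 0 m s unfolding lookup_det_mult[OF n] a_def b_def c_def e_def by simp
  next
    case (Suc k')
    have "m - k + s - 1 = m - 1 - k + s" if "k < m" using that by simp
    moreover have "m - k = m - 1 - k'" "k' < m" using Suc \<open>k \<le> m\<close> by auto
    ultimately show ?thesis using Suc m s \<open>k \<le> m\<close> unfolding lookup_det_mult[OF n] a_def b_def c_def e_def by simp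
  qed
  have f4: "Poly_Mapping.lookup ?P (gen_mon n s (Suc s) (Suc k + s) (s - 1) (m - k + s) (Suc (Suc k)) (m - Suc k) 0 (Suc m) (Suc m)) = e k - e (Suc k)" if "k < m" for k
  proof -
    have "m - k + s - 1 = m - Suc k + s" "m - Suc k - 1 = m - 1 - Suc k" "m - k + s \<noteq> 0" "m - 1 - k = m - Suc k" "(m - Suc k = 0) = (\<not> Suc k < m)"
      using that by auto
    then show ?thesis using that unfolding lookup_det_mult[OF n] e_def by simp
  qed
  have "gen_functional n s m ?P = (\<Sum>k<m. int (Suc k) * (a k - a (Suc k))) - (\<Sum>k<m. int (Suc k) * (b k - b (Suc k)))
     + (\<Sum>k\<le>m. - a k + b k + (if k = 0 then e 0 else c (k - 1)) - c k) - (\<Sum>k<m. e k - e (Suc k))"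
    unfolding gen_functional_def using f1 f2 f3 f4 by simp
  also have "(\<Sum>k\<le>m. - a k + b k + (if k = 0 then e 0 else c (k - 1)) - c k)
     = - (\<Sum>k\<le>m. a k) + (\<Sum>k\<le>m. b k) + e 0 - c m"
  proof -
    have "(\<Sum>k\<le>m. if k = 0 then e 0 else c (k - 1)) = e 0 + (\<Sum>k<m. c k)"
      by (simp only: lessThan_Suc_atMost[symmetric] sum.lessThan_Suc_shift) simp
    moreover have "(\<Sum>k\<le>m. c k) = (\<Sum>k<m. c k) + c m" by (simp add: lessThan_Suc_atMost[symmetric])
    ultimately show ?thesis by (simp add: sum.distrib sum_subtractf sum_negf)
  qed
  also have "(\<Sum>k<m. e k - e (Suc k)) = e 0 - e m" by (rule sum_lessThan_telescope')
  finally have "gen_functional n s m ?P = - int (Suc m) * a m + int (Suc m) * b m - c m + e m"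
    using sum_telescope_weighted[where m = m and a = a] sum_telescope_weighted[where m = m and a = b] by linarith
  moreover have "b m = 0" "c m = 0" "e m = 0" by (simp_all add: b_def c_def e_def)
  ultimately have "gen_functional n s m ?P = int (Suc m) * (- a m)" by (simp add: algebra_simps)
  then show ?thesis by (rule dvdI)
qed

text \<open>All block exponents in the support are at most \<open>s + m\<close>; for the exponent
  \<open>Suc s\<close> this uses \<open>m > 0\<close>.\<close>

lemma gen_functional_Var:
  assumes v: "v \<in> gen_block n" and m: "m > 0"
  shows "gen_functional n s m (Var v ^ (s + Suc m) * c) = 0"
proof -
  have *: "Poly_Mapping.lookup (Var v ^ (s + Suc m) * c) (gen_mon n s z22 z12 z21 z11 r1 r2 c1 c2 t) = 0"
    if "z22 < s + Suc m" "z12 < s + Suc m" "z21 < s + Suc m" "z11 < s + Suc m" for z22 z12 z21 z11 r1 r2 c1 c2 t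
  proof -
    obtain i j where ij: "v = (i, j)" "1 \<le> i" "i < n" "j = 1 \<or> j = 2" using v by (auto simp: gen_block_def)
    have "Poly_Mapping.lookup (gen_mon n s z22 z12 z21 z11 r1 r2 c1 c2 t) v < s + Suc m \<or> i = j \<and> 3 \<le> i"
      using that ij by (auto simp: lookup_gen_mon gen_exp_def)
    then have "Poly_Mapping.lookup (gen_mon n s z22 z12 z21 z11 r1 r2 c1 c2 t) v < s + Suc m" using ij by auto
    then have "gen_mon n s z22 z12 z21 z11 r1 r2 c1 c2 t \<noteq> Poly_Mapping.single v (s + Suc m) + m'" for m'
      by (auto simp: lookup_add)
    then show ?thesis unfolding Var_power by (rule lookup_single_mult_not)
  qed
  let ?P = "Var v ^ (s + Suc m) * c"
  have "Poly_Mapping.lookup ?P (gen_mon n s s s (Suc k + s) (m - k + s) 0 (Suc m) (Suc k) (m - k) (Suc m)) = 0"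
    "Poly_Mapping.lookup ?P (gen_mon n s (Suc s) (s - 1) (Suc k + s) (m - k + s) 0 (Suc m) (Suc (Suc k)) (m - Suc k) (Suc m)) = 0"
    "Poly_Mapping.lookup ?P (gen_mon n s (Suc s) (Suc k + s) (s - 1) (m - k + s) (Suc (Suc k)) (m - Suc k) 0 (Suc m) (Suc m)) = 0"
    if "k < m" for k by (rule *; use that m in simp)+
  moreover have "Poly_Mapping.lookup ?P (gen_mon n s (Suc s) s (k + s) (m - k + s) 1 m (Suc k) (m - k) (Suc m)) = 0"
    if "k \<le> m" for k by (rule *; use that m in simp)+
  ultimately show ?thesis unfolding gen_functional_def by simp
qed

lemma lookup_block_mult:
  assumes n: "3 \<le> n"
  shows "Poly_Mapping.lookup (D * (\<Prod>v\<in>gen_block n. Var v ^ s)) (gen_mon n s z22 z12 z21 z11 r1 r2 c1 c2 t)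
     = (if z22 < s \<or> z12 < s \<or> z21 < s \<or> z11 < s then 0
        else Poly_Mapping.lookup D (gen_mon n 0 (z22 - s) (z12 - s) (z21 - s) (z11 - s) r1 r2 c1 c2 t))"
proof -
  have fin: "finite (gen_block n)"
    by (rule finite_subset[OF _ finite_gen_vars[of n]]) (use n in \<open>auto simp: gen_block_def gen_vars_def\<close>)
  let ?B = "\<Sum>v\<in>gen_block n. Poly_Mapping.single v s"
  have B: "Poly_Mapping.lookup ?B (i, j) = (if 1 \<le> i \<and> i < n \<and> (j = 1 \<or> j = 2) then s else 0)" for i j
    by (simp only: lookup_sum_singles[OF fin]) (simp add: gen_block_def)
  have eq: "D * (\<Prod>v\<in>gen_block n. Var v ^ s) = Poly_Mapping.single ?B 1 * D"
    by (simp add: lookup_sum_Var_power[OF fin] mult.commute)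
  show ?thesis
  proof (cases "z22 < s \<or> z12 < s \<or> z21 < s \<or> z11 < s")
    case True
    have "gen_mon n s z22 z12 z21 z11 r1 r2 c1 c2 t \<noteq> ?B + m'" for m'
    proof
      assume e: "gen_mon n s z22 z12 z21 z11 r1 r2 c1 c2 t = ?B + m'"
      have "s \<le> Poly_Mapping.lookup (gen_mon n s z22 z12 z21 z11 r1 r2 c1 c2 t) (i, j)" if "1 \<le> i" "i < n" "j = 1 \<or> j = 2" for i j
        unfolding e lookup_add B using that by simp
      from this[of 1 1] this[of 1 2] this[of 2 1] this[of 2 2] True n show False
        by (auto simp: lookup_gen_mon gen_exp_def)
    qed
    then have "Poly_Mapping.lookup (Poly_Mapping.single ?B 1 * D) (gen_mon n s z22 z12 z21 z11 r1 r2 c1 c2 t) = 0"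
      by (rule lookup_single_mult_not)
    then show ?thesis unfolding eq using True by (simp only: if_True)
  next
    case False
    have "gen_mon n s z22 z12 z21 z11 r1 r2 c1 c2 t = ?B + gen_mon n 0 (z22 - s) (z12 - s) (z21 - s) (z11 - s) r1 r2 c1 c2 t"
    proof (rule poly_mapping_eqI)
      fix v :: "nat \<times> nat" obtain i j where v: "v = (i, j)" by (cases v)
      show "Poly_Mapping.lookup (gen_mon n s z22 z12 z21 z11 r1 r2 c1 c2 t) v = Poly_Mapping.lookup (?B + gen_mon n 0 (z22 - s) (z12 - s) (z21 - s) (z11 - s) r1 r2 c1 c2 t) v"
        using False n unfolding v lookup_add B lookup_gen_mon gen_exp_def by auto
    qed
    then show ?thesis unfolding eq using False by (simp only: if_False lookup_single_mult_add mult_1)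
  qed
qed

lemma perm_mon_power_ne:
  assumes "Poly_Mapping.lookup x v mod p \<noteq> 0"
  shows "Poly_Mapping.lookup (Poly_Mapping.single y c ^ p) x = (0::int)"
proof -
  have "Poly_Mapping.lookup (((+) y ^^ p) 0) v mod p = 0" by (simp add: lookup_funpow_add)
  then have "((+) y ^^ p) 0 \<noteq> x" using assms by auto
  then show ?thesis by (simp add: single_power lookup_single when_def)
qed

text \<open>The coefficients of \<open>D\<close> in the first sum are
  \<open>Suc m choose Suc k\<close> divided by \<open>Suc m\<close>, up to sign, and the weight
  \<open>Suc k\<close> turns them into \<open>m choose k\<close>. The alternating sum stops before
  \<open>k = m\<close>, where the monomial would be the \<open>p\<close>-th power of a term, so it
  equals -1 instead of 0. The third sum is a complete alternating sum and vanishes.\<close>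

lemma gen_functional_delta:
  assumes n: "3 \<le> n" and s: "s > 0" and m: "m > 0"
    and D: "of_int (int (Suc m)) * D = det_poly n gen_entry ^ Suc m
      - (\<Sum>\<sigma> | \<sigma> permutes {..<n}. Poly_Mapping.single (perm_mon n \<sigma>) (sign \<sigma>) ^ Suc m)"
  shows "gen_functional n s m (D * (\<Prod>v\<in>gen_block n. Var v ^ s)) = - 1"
proof -
  \<comment> \<open>The \<open>p\<close>-th powers of the terms have all exponents divisible by
    \<open>p\<close>, so a single exponent that is not divisible by \<open>p\<close> removes them
    from the coefficient.\<close>
  have D': "int (Suc m) * Poly_Mapping.lookup D x = Poly_Mapping.lookup (det_poly n gen_entry ^ Suc m) x"
    if "Poly_Mapping.lookup x v mod Suc m \<noteq> 0" for x v
  proof -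
    have "Poly_Mapping.lookup (of_int (int (Suc m)) * D) x = Poly_Mapping.lookup (det_poly n gen_entry ^ Suc m) x"
      unfolding D lookup_minus lookup_sum using perm_mon_power_ne[OF that] by (simp del: power_Suc)
    then show ?thesis by (simp only: lookup_of_int_mult)
  qed
  have d1: "int (Suc k) * Poly_Mapping.lookup D (gen_mon n 0 0 0 (Suc k) (m - k) 0 (Suc m) (Suc k) (m - k) (Suc m)) = (-1) ^ (m - k) * int (m choose k)"
    if k: "k < m" for k
  proof -
    let ?x = "gen_mon n 0 0 0 (Suc k) (m - k) 0 (Suc m) (Suc k) (m - k) (Suc m)"
    have "Poly_Mapping.lookup ?x (2, 1) mod Suc m \<noteq> 0" using k n by (simp add: lookup_gen_mon gen_exp_def)
    from D'[OF this] have "int (Suc m) * Poly_Mapping.lookup D ?x = (-1) ^ (m - k) * int (Suc m choose Suc k)"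
      using coefficient_det_power_1[OF n, of "Suc k" "m - k" "Suc m"] k by simp
    then have "int (Suc m) * (int (Suc k) * Poly_Mapping.lookup D ?x) = (-1) ^ (m - k) * int (Suc k * (Suc m choose Suc k))"
      by (simp add: algebra_simps)
    also have "\<dots> = int (Suc m) * ((-1) ^ (m - k) * int (m choose k))"
      unfolding Suc_times_binomial by (simp only: of_nat_mult ac_simps)
    finally show ?thesis by (subst (asm) mult_cancel_left) simp
  qed
  have d3: "Poly_Mapping.lookup D (gen_mon n 0 1 0 k (m - k) 1 m (Suc k) (m - k) (Suc m)) = - ((-1) ^ (m - k) * int (m choose k))"
    if k: "k \<le> m" for k
  proof -
    let ?x = "gen_mon n 0 1 0 k (m - k) 1 m (Suc k) (m - k) (Suc m)"
    have "Poly_Mapping.lookup ?x (2, 2) mod Suc m \<noteq> 0" using n m by (simp add: lookup_gen_mon gen_exp_def)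
    from D'[OF this] have "int (Suc m) * Poly_Mapping.lookup D ?x = - ((-1) ^ (m - k)) * int (Suc m * (m choose k))"
      using coefficient_det_power_2[OF n, of k "m - k" m] k by simp
    then have "int (Suc m) * Poly_Mapping.lookup D ?x = int (Suc m) * (- ((-1) ^ (m - k) * int (m choose k)))"
      by (simp only: of_nat_mult mult_minus_left mult_minus_right ac_simps)
    then show ?thesis by (subst (asm) mult_cancel_left) simp
  qed
  have "gen_functional n s m (D * (\<Prod>v\<in>gen_block n. Var v ^ s))
     = (\<Sum>k<m. int (Suc k) * Poly_Mapping.lookup D (gen_mon n 0 0 0 (Suc k) (m - k) 0 (Suc m) (Suc k) (m - k) (Suc m)))
       + (\<Sum>k\<le>m. Poly_Mapping.lookup D (gen_mon n 0 1 0 k (m - k) 1 m (Suc k) (m - k) (Suc m)))"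
  proof -
    let ?P = "D * (\<Prod>v\<in>gen_block n. Var v ^ s)"
    have ss: "Suc s - s = 1" "\<not> Suc s < s" "s - 1 < s" using s by auto
    note simps = lookup_block_mult[OF n] ss not_add_less2 less_irrefl simp_thms if_False if_True add_diff_cancel_right' diff_self_eq_0
    have "Poly_Mapping.lookup ?P (gen_mon n s s s (Suc k + s) (m - k + s) 0 (Suc m) (Suc k) (m - k) (Suc m))
        = Poly_Mapping.lookup D (gen_mon n 0 0 0 (Suc k) (m - k) 0 (Suc m) (Suc k) (m - k) (Suc m))"
      "Poly_Mapping.lookup ?P (gen_mon n s (Suc s) (s - 1) (Suc k + s) (m - k + s) 0 (Suc m) (Suc (Suc k)) (m - Suc k) (Suc m)) = 0"
      "Poly_Mapping.lookup ?P (gen_mon n s (Suc s) (Suc k + s) (s - 1) (m - k + s) (Suc (Suc k)) (m - Suc k) 0 (Suc m) (Suc m)) = 0"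
      "Poly_Mapping.lookup ?P (gen_mon n s (Suc s) s (k + s) (m - k + s) 1 m (Suc k) (m - k) (Suc m))
        = Poly_Mapping.lookup D (gen_mon n 0 1 0 k (m - k) 1 m (Suc k) (m - k) (Suc m))" for k
      by (simp_all only: simps)
    then show ?thesis unfolding gen_functional_def by (simp only: mult_zero_right sum.neutral_const diff_zero)
  qed
  also have "\<dots> = (\<Sum>k<m. (-1) ^ (m - k) * int (m choose k)) - (\<Sum>k\<le>m. (-1) ^ (m - k) * int (m choose k))"
    using d1 d3 by (simp add: sum_negf)
  finally show ?thesis using sum_alternating_choose[OF m] sum_alternating_choose_lessThan[OF m] by simp
qed

text \<open>The functional turns the relation from \<open>delta_mem_of_lift\<close> into an equation
  between -1 and a multiple of \<open>p\<close>.\<close>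

theorem generic_determinant_no_lift:
  assumes n: "3 \<le> n" and p: "prime p"
  shows "\<not> (lifts_to_mod_sq (hypersurface (gen_vars n) (det_poly n gen_entry)) p (frob_trace (gen_vars n) (det_poly n gen_entry) p)
    \<or> lifts_to_ring (hypersurface (gen_vars n) (det_poly n gen_entry)) p (frob_trace (gen_vars n) (det_poly n gen_entry) p))"
proof
  assume lift: "lifts_to_mod_sq (hypersurface (gen_vars n) (det_poly n gen_entry)) p (frob_trace (gen_vars n) (det_poly n gen_entry) p)
    \<or> lifts_to_ring (hypersurface (gen_vars n) (det_poly n gen_entry)) p (frob_trace (gen_vars n) (det_poly n gen_entry) p)"
  let ?f = "det_poly n gen_entry" and ?V = "gen_vars n" and ?M = "gen_block n"
  interpret multilinear_hypersurface ?V ?M p "{\<sigma>. \<sigma> permutes {..<n}}" "perm_mon n" sign gen_wt ?f id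
    by (rule multilinear_gen[OF n p])
  obtain k D where D: "D \<in> poly_carrier ?V"
    "of_int (int p) * D = ?f ^ p - (\<Sum>\<sigma> | \<sigma> permutes {..<n}. Poly_Mapping.single (perm_mon n \<sigma>) (sign \<sigma>) ^ p)"
    "D * (\<Prod>v\<in>?M. Var v ^ (p ^ Suc (Suc k) - p)) \<in> power_ideal ?V ?f (int p) ?M (p ^ Suc (Suc k))"
    by (rule delta_mem_of_lift[OF lift])
  obtain m where m: "p = Suc m" "m > 0" using prime_gt_1_nat[OF p] by (cases p) auto
  define s where "s = p ^ Suc (Suc k) - p"
  have "p < p ^ Suc (Suc k)" using prime_gt_1_nat[OF p] power_strict_increasing[of 1 "Suc (Suc k)" p] by simp
  then have s: "s > 0" "p ^ Suc (Suc k) = s + Suc m" by (auto simp: s_def m)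
  obtain j c where j: "j \<in> hyper_ideal ?V ?f (int p)" and e: "D * (\<Prod>v\<in>?M. Var v ^ s) = j + (\<Sum>v\<in>?M. Var v ^ (s + Suc m) * c v)"
  proof -
    have "D * (\<Prod>v\<in>?M. Var v ^ s) \<in> power_ideal ?V ?f (int p) ?M (s + Suc m)"
      using D(3) unfolding s_def[symmetric] unfolding s(2) .
    then show thesis using that by (elim power_idealE) blast
  qed
  obtain a b where ab: "j = ?f * a + of_int (int p) * b" using j by (elim hyper_idealE) blast
  have "- 1 = gen_functional n s m (D * (\<Prod>v\<in>?M. Var v ^ s))"
    using gen_functional_delta[OF n s(1) m(2) D(2)[unfolded m(1)]] by simp
  also have "\<dots> = gen_functional n s m (?f * a) + int p * gen_functional n s m b"
    unfolding e ab gen_functional_add gen_functional_sum gen_functional_of_int using gen_functional_Var[OF _ m(2)] by simp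
  finally have eq: "- 1 = gen_functional n s m (?f * a) + int p * gen_functional n s m b" .
  have "int p dvd gen_functional n s m (?f * a)" unfolding m(1) by (rule gen_functional_det[OF n s(1) m(2)])
  then have "int p dvd - 1" unfolding eq by simp
  then show False using p by simp
qed

section \<open>Pfaffians\<close>

lemma finite_alt_vars: "finite (alt_vars n)"
  by (rule finite_subset[of _ "{..<n} \<times> {..<n}"]) (auto simp: alt_vars_def)

text \<open>The matrix has size \<open>2 * g + 4\<close>.\<close>

definition matchings :: "nat \<Rightarrow> (nat \<Rightarrow> nat) set" where
  "matchings g = {\<sigma>. \<sigma> permutes {..<2 * g + 4} \<and> (\<forall>k < Suc (Suc g). \<sigma> (2 * k) < \<sigma> (2 * k + 1))
     \<and> (\<forall>k. k + 1 < Suc (Suc g) \<longrightarrow> \<sigma> (2 * k) < \<sigma> (2 * k + 2))}"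

lemma matchingsD:
  assumes "\<sigma> \<in> matchings g"
  shows "\<sigma> permutes {..<2 * g + 4}" "k < Suc (Suc g) \<Longrightarrow> \<sigma> (2 * k) < \<sigma> (2 * k + 1)"
    "k < Suc g \<Longrightarrow> \<sigma> (2 * k) < \<sigma> (2 * k + 2)" "\<sigma> i = \<sigma> j \<longleftrightarrow> i = j" "i < 2 * g + 4 \<Longrightarrow> \<sigma> i < 2 * g + 4"
proof -
  show 1: "\<sigma> permutes {..<2 * g + 4}" using assms by (simp add: matchings_def)
  show "k < Suc (Suc g) \<Longrightarrow> \<sigma> (2 * k) < \<sigma> (2 * k + 1)" using assms by (simp add: matchings_def)
  show "k < Suc g \<Longrightarrow> \<sigma> (2 * k) < \<sigma> (2 * k + 2)" using assms by (simp add: matchings_def)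
  show "\<sigma> i = \<sigma> j \<longleftrightarrow> i = j" by (rule inj_eq[OF permutes_inj[OF 1]])
  show "i < 2 * g + 4 \<Longrightarrow> \<sigma> i < 2 * g + 4" using permutes_in_image[OF 1, of i] by simp
qed

lemma matchings_strict:
  assumes \<sigma>: "\<sigma> \<in> matchings g" and "k < l" "l < Suc (Suc g)"
  shows "\<sigma> (2 * k) < \<sigma> (2 * l)"
  using assms(2,3)
proof (induction l)
  case (Suc l)
  have "\<sigma> (2 * l) < \<sigma> (2 * l + 2)" by (rule matchingsD(3)[OF \<sigma>]) (use Suc.prems in simp)
  moreover have "\<sigma> (2 * k) \<le> \<sigma> (2 * l)"
  proof (cases "k = l")
    case False
    then have "k < l" using Suc.prems by simp
    then show ?thesis using Suc.IH Suc.prems by simp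
  qed simp
  ultimately show ?case by simp
qed simp

text \<open>The least value not yet used must be the first entry of its pair, since pairs are
  increasing, and that pair must come next, since first entries increase.\<close>

lemma matchings_fix_even:
  assumes \<sigma>: "\<sigma> \<in> matchings g" and fx: "\<And>i. i < 2 * k \<Longrightarrow> \<sigma> i = i" and k: "k < Suc (Suc g)"
  shows "\<sigma> (2 * k) = 2 * k"
proof -
  note D = matchingsD[OF \<sigma>]
  have surj: "surj \<sigma>" by (rule permutes_surj[OF D(1)])
  obtain j where j: "\<sigma> j = 2 * k" using surj by (metis surjD)
  have jn: "j < 2 * g + 4"
  proof (rule ccontr)
    assume "\<not> j < 2 * g + 4"
    then have "\<sigma> j = j" using permutes_not_in[OF D(1), of j] by simp
    then show False using j k \<open>\<not> j < 2 * g + 4\<close> by simp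
  qed
  have jk: "2 * k \<le> j" using fx[of j] j by (cases "j < 2 * k") simp_all
  have small: False if "\<sigma> i < 2 * k" "2 * k \<le> i" for i
  proof -
    have "\<sigma> (\<sigma> i) = \<sigma> i" using fx[OF that(1)] .
    then have "\<sigma> i = i" using D(4)[of "\<sigma> i" i] by simp
    then show False using that by simp
  qed
  show ?thesis
  proof (cases "even j")
    case True
    then obtain l where l: "j = 2 * l" by blast
    show ?thesis
    proof (cases "l = k")
      case False
      then have "\<sigma> (2 * k) < \<sigma> (2 * l)" using l jk jn by (intro matchings_strict[OF \<sigma>]) auto
      then show ?thesis using small[of "2 * k"] j l by simp
    qed (use j l in simp)
  next
    case False
    then obtain l where l: "j = 2 * l + 1" by (auto elim: oddE)
    have "\<sigma> (2 * l) < \<sigma> (2 * l + 1)" by (rule D(2)) (use l jn in simp)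
    then show ?thesis using small[of "2 * l"] j l jk by simp
  qed
qed

text \<open>Iterates \<open>matchings_fix_even\<close>: the values at even positions are forced one
  after the other, so only the partners have to be known.\<close>

lemma matchings_fix_below:
  assumes \<sigma>: "\<sigma> \<in> matchings g" and partner: "\<And>k. k < l \<Longrightarrow> \<sigma> (2 * k) = 2 * k \<Longrightarrow> \<sigma> (2 * k + 1) = 2 * k + 1"
    and l: "l \<le> Suc (Suc g)"
  shows "i < 2 * l \<Longrightarrow> \<sigma> i = i"
  using partner l
proof (induction l arbitrary: i)
  case (Suc l)
  have fx: "\<sigma> i = i" if "i < 2 * l" for i using Suc that by simp
  have 1: "\<sigma> (2 * l) = 2 * l" by (rule matchings_fix_even[OF \<sigma> fx]) (use Suc.prems in simp_all)
  have 2: "\<sigma> (2 * l + 1) = 2 * l + 1" by (rule Suc.prems(2)[OF _ 1]) simp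
  have "i < 2 * l \<or> i = 2 * l \<or> i = 2 * l + 1" using Suc.prems(1) by presburger
  then show ?case by (elim disjE) (use fx 1 2 in simp_all)
qed simp

definition pf_mon :: "nat \<Rightarrow> (nat \<Rightarrow> nat) \<Rightarrow> mon" where
  "pf_mon g \<sigma> = (\<Sum>k<Suc (Suc g). Poly_Mapping.single (\<sigma> (2 * k), \<sigma> (2 * k + 1)) 1)"

lemma lookup_pf_mon:
  assumes \<sigma>: "\<sigma> \<in> matchings g"
  shows "Poly_Mapping.lookup (pf_mon g \<sigma>) (i, j) = (if \<exists>k<Suc (Suc g). \<sigma> (2 * k) = i \<and> \<sigma> (2 * k + 1) = j then 1 else 0)"
proof -
  have sum: "Poly_Mapping.lookup (pf_mon g \<sigma>) (i, j) = (\<Sum>k<Suc (Suc g). if \<sigma> (2 * k) = i \<and> \<sigma> (2 * k + 1) = j then 1 else 0)"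
    unfolding pf_mon_def lookup_sum by (intro sum.cong refl) (auto simp: lookup_single when_def)
  show ?thesis
  proof (cases "\<exists>k<Suc (Suc g). \<sigma> (2 * k) = i \<and> \<sigma> (2 * k + 1) = j")
    case True
    then obtain k where k: "k < Suc (Suc g)" "\<sigma> (2 * k) = i" "\<sigma> (2 * k + 1) = j" by blast
    have "(\<sigma> (2 * l) = i \<and> \<sigma> (2 * l + 1) = j) = (l = k)" for l
      using matchingsD(4)[OF \<sigma>, of "2 * l" "2 * k"] k by auto
    then have "Poly_Mapping.lookup (pf_mon g \<sigma>) (i, j) = (\<Sum>l<Suc (Suc g). if l = k then 1 else 0)"
      unfolding sum by (simp only:)
    also have "\<dots> = 1" using k(1) by (simp only: sum.delta finite_lessThan lessThan_iff if_True)
    finally show ?thesis using True by (simp only: if_True)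
  next
    case False
    then have "Poly_Mapping.lookup (pf_mon g \<sigma>) (i, j) = (\<Sum>k<Suc (Suc g). 0)"
      unfolding sum by (intro sum.cong refl) auto
    then show ?thesis using False by (simp only: if_False sum.neutral_const)
  qed
qed

lemma pf_poly_alt_eq:
  "pf_poly (2 * g + 4) alt_entry = (\<Sum>\<sigma>\<in>matchings g. Poly_Mapping.single (pf_mon g \<sigma>) (sign \<sigma>))"
proof -
  have half: "(2 * g + 4) div 2 = Suc (Suc g)" by simp
  have "(\<Prod>k<Suc (Suc g). alt_entry (\<sigma> (2 * k)) (\<sigma> (2 * k + 1))) = Poly_Mapping.single (pf_mon g \<sigma>) 1"
    if \<sigma>: "\<sigma> \<in> matchings g" for \<sigma>
  proof -
    have "(\<Prod>k<Suc (Suc g). alt_entry (\<sigma> (2 * k)) (\<sigma> (2 * k + 1))) = (\<Prod>k<Suc (Suc g). Var (\<sigma> (2 * k), \<sigma> (2 * k + 1)))"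
      using matchingsD(2)[OF \<sigma>] by (intro prod.cong refl) (simp add: alt_entry_def)
    also have "(\<Prod>k<m. Var (\<sigma> (2 * k), \<sigma> (2 * k + 1))) = Poly_Mapping.single (\<Sum>k<m. Poly_Mapping.single (\<sigma> (2 * k), \<sigma> (2 * k + 1)) 1) 1" for m
      by (induction m) (simp_all add: Var_def mult_single)
    finally show ?thesis unfolding pf_mon_def .
  qed
  then show ?thesis
    unfolding pf_poly_def half matchings_def[symmetric] by (intro sum.cong refl) (simp add: single_eq_of_int_mult[symmetric])
qed

text \<open>The odd indices together with one even index: \<open>g + 3\<close> of the
  \<open>2 * g + 4\<close> indices, one more than the number of pairs. Each pair counts its selected
  indices minus 1 in \<open>alt_wt\<close>, so the excess makes every term of weight 1.\<close>

definition pf_index :: "nat \<Rightarrow> nat \<Rightarrow> bool" where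
  "pf_index g i \<longleftrightarrow> odd i \<or> i = 2 * g + 2"

definition alt_block :: "nat \<Rightarrow> (nat \<times> nat) set" where
  "alt_block g = {(i, j) \<in> alt_vars (2 * g + 4). pf_index g i \<and> pf_index g j}"

definition alt_wt :: "nat \<Rightarrow> nat \<times> nat \<Rightarrow> int" where
  "alt_wt g = (\<lambda>(i, j). of_bool (pf_index g i) + of_bool (pf_index g j) - 1)"

lemma wt_single: "finite V \<Longrightarrow> v \<in> V \<Longrightarrow> wt V w (Poly_Mapping.single v k) = w v * int k"
proof -
  assume V: "finite V" "v \<in> V"
  have "wt V w (Poly_Mapping.single v k) = (\<Sum>u\<in>V. if u = v then w v * int k else 0)"
    unfolding wt_def by (intro sum.cong refl) (auto simp: lookup_single when_def)
  then show ?thesis using V by (simp add: sum.delta)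
qed

lemma wt_sum: "wt V w (sum m I) = (\<Sum>i\<in>I. wt V w (m i))"
  by (induction I rule: infinite_finite_induct) (auto simp: wt_add)

lemma sum_pairs: "(\<Sum>k<m. G (2 * k) + G (2 * k + 1)) = (\<Sum>i<2 * (m :: nat). G i :: int)"
  by (induction m) (simp_all add: add.assoc)

lemma wt_pf_mon:
  assumes \<sigma>: "\<sigma> \<in> matchings g"
  shows "wt (alt_vars (2 * g + 4)) (alt_wt g) (pf_mon g \<sigma>) = 1"
proof -
  define I where "I i = (of_bool (pf_index g i) :: int)" for i
  have "wt (alt_vars (2 * g + 4)) (alt_wt g) (pf_mon g \<sigma>) = (\<Sum>k<Suc (Suc g). alt_wt g (\<sigma> (2 * k), \<sigma> (2 * k + 1)))"
    unfolding pf_mon_def wt_sum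
  proof (rule sum.cong[OF refl])
    fix k assume k: "k \<in> {..<Suc (Suc g)}"
    have "(\<sigma> (2 * k), \<sigma> (2 * k + 1)) \<in> alt_vars (2 * g + 4)"
      using matchingsD(2)[OF \<sigma>, of k] matchingsD(5)[OF \<sigma>, of "2 * k + 1"] k by (simp add: alt_vars_def)
    then show "wt (alt_vars (2 * g + 4)) (alt_wt g) (Poly_Mapping.single (\<sigma> (2 * k), \<sigma> (2 * k + 1)) 1) = alt_wt g (\<sigma> (2 * k), \<sigma> (2 * k + 1))"
      by (simp add: wt_single[OF finite_alt_vars])
  qed
  also have "\<dots> = (\<Sum>k<Suc (Suc g). (I (\<sigma> (2 * k)) + I (\<sigma> (2 * k + 1))) - 1)"
    by (simp only: alt_wt_def I_def prod.case)
  also have "\<dots> = (\<Sum>k<Suc (Suc g). I (\<sigma> (2 * k)) + I (\<sigma> (2 * k + 1))) - int (Suc (Suc g))"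
    by (simp only: sum_subtractf sum_constant card_lessThan mult_1_right)
  also have "(\<Sum>k<Suc (Suc g). I (\<sigma> (2 * k)) + I (\<sigma> (2 * k + 1))) = (\<Sum>i<2 * Suc (Suc g). I (\<sigma> i))"
    by (rule sum_pairs)
  also have "(\<Sum>i<2 * Suc (Suc g). I (\<sigma> i)) = (\<Sum>i<2 * Suc (Suc g). I i)"
  proof -
    have "2 * Suc (Suc g) = 2 * g + 4" by simp
    then show ?thesis
      using sum.permute[OF matchingsD(1)[OF \<sigma>], of I] unfolding comp_def by (simp only:)
  qed
  also have "(\<Sum>i<2 * Suc (Suc g). I i) = (\<Sum>k<Suc (Suc g). I (2 * k) + I (2 * k + 1))"
    by (rule sum_pairs[symmetric])
  also have "\<dots> = (\<Sum>k<Suc (Suc g). (if k = Suc g then 1 else 0) + 1)"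
    by (intro sum.cong refl) (auto simp: I_def pf_index_def)
  also have "\<dots> = 1 + int (Suc (Suc g))"
    by (simp only: sum.distrib sum.delta sum_constant card_lessThan finite_lessThan lessThan_iff lessI if_True mult_1_right)
  finally show ?thesis by simp
qed

lemma id_matching: "id \<in> matchings g"
  by (auto simp: matchings_def permutes_id)

lemma pf_mon_keys_subset_id:
  assumes \<sigma>: "\<sigma> \<in> matchings g" and sub: "Poly_Mapping.keys (pf_mon g \<sigma>) \<subseteq> Poly_Mapping.keys (pf_mon g id)"
  shows "\<sigma> = id"
proof
  have partner: "\<sigma> (2 * k + 1) = 2 * k + 1" if k: "k < Suc (Suc g)" "\<sigma> (2 * k) = 2 * k" for k
  proof -
    have "(\<sigma> (2 * k), \<sigma> (2 * k + 1)) \<in> Poly_Mapping.keys (pf_mon g \<sigma>)"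
      unfolding in_keys_iff lookup_pf_mon[OF \<sigma>] using k(1) by auto
    then have "(\<sigma> (2 * k), \<sigma> (2 * k + 1)) \<in> Poly_Mapping.keys (pf_mon g id)" using sub by blast
    then show ?thesis
      unfolding in_keys_iff lookup_pf_mon[OF id_matching] using k(2) by (auto split: if_splits)
  qed
  fix i show "\<sigma> i = id i"
  proof (cases "i < 2 * Suc (Suc g)")
    case True
    then show ?thesis using matchings_fix_below[OF \<sigma> partner, of "Suc (Suc g)" i] by simp
  next
    case False
    then show ?thesis using permutes_not_in[OF matchingsD(1)[OF \<sigma>], of i] by simp
  qed
qed

lemma finite_matchings: "finite (matchings g)"
  by (rule finite_subset[OF _ finite_permutations[of "{..<2 * g + 4}"]]) (auto simp: matchings_def)

lemma multilinear_alt: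
  assumes p: "prime p"
  shows "multilinear_hypersurface (alt_vars (2 * g + 4)) (alt_block g) p (matchings g) (pf_mon g) sign (alt_wt g)
    (pf_poly (2 * g + 4) alt_entry) id"
proof
  show "finite (alt_vars (2 * g + 4))" by (rule finite_alt_vars)
  show "finite (matchings g)" by (rule finite_matchings)
  show "alt_block g \<subseteq> alt_vars (2 * g + 4)" by (auto simp: alt_block_def)
  show "prime p" by (rule p)
  show "pf_poly (2 * g + 4) alt_entry = (\<Sum>\<sigma>\<in>matchings g. Poly_Mapping.single (pf_mon g \<sigma>) (sign \<sigma>))" by (rule pf_poly_alt_eq)
  show "sign \<sigma> = 1 \<or> sign \<sigma> = -1" for \<sigma> :: "nat \<Rightarrow> nat" by (simp add: sign_def)
  show "Poly_Mapping.keys (pf_mon g \<sigma>) \<subseteq> alt_vars (2 * g + 4)" if \<sigma>: "\<sigma> \<in> matchings g" for \<sigma>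
  proof
    fix v assume v: "v \<in> Poly_Mapping.keys (pf_mon g \<sigma>)"
    obtain i j where ij: "v = (i, j)" by (cases v)
    obtain k where k: "k < Suc (Suc g)" "\<sigma> (2 * k) = i" "\<sigma> (2 * k + 1) = j"
      using v unfolding ij in_keys_iff lookup_pf_mon[OF \<sigma>] by (auto split: if_splits)
    then show "v \<in> alt_vars (2 * g + 4)"
      using matchingsD(2)[OF \<sigma> k(1)] matchingsD(5)[OF \<sigma>, of "2 * k + 1"] by (simp add: ij alt_vars_def)
  qed
  show "Poly_Mapping.lookup (pf_mon g \<sigma>) v \<le> 1" if "\<sigma> \<in> matchings g" for \<sigma> v
  proof -
    obtain i j where "v = (i, j)" by (cases v)
    then show ?thesis by (simp only: lookup_pf_mon[OF that]) simp
  qed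
  show "alt_wt g v \<le> 0" if "v \<in> alt_vars (2 * g + 4) - alt_block g" for v
  proof -
    obtain i j where v: "v = (i, j)" by (cases v)
    then have "\<not> pf_index g i \<or> \<not> pf_index g j" using that by (auto simp: alt_block_def)
    then show ?thesis unfolding v alt_wt_def by auto
  qed
  show "wt (alt_vars (2 * g + 4)) (alt_wt g) (pf_mon g \<sigma>) = 1" if "\<sigma> \<in> matchings g" for \<sigma> by (rule wt_pf_mon[OF that])
  show "id \<in> matchings g" by (rule id_matching)
  show "\<sigma> = id" if "\<sigma> \<in> matchings g" "Poly_Mapping.keys (pf_mon g \<sigma>) \<subseteq> Poly_Mapping.keys (pf_mon g id)" for \<sigma>
    by (rule pf_mon_keys_subset_id[OF that])
qed

text \<open>Exponents \<open>r1, r2, r3\<close> of the entries in row \<open>2 * g\<close> of the last \<open>4 \<times> 4\<close> block and \<open>m1, m2, m3\<close> of the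
  complementary entries; the entries \<open>(2 * k, 2 * k + 1)\<close> with \<open>k < g\<close> have exponent \<open>t\<close>.\<close>

definition alt_exp :: "nat \<Rightarrow> nat \<Rightarrow> nat \<Rightarrow> nat \<Rightarrow> nat \<Rightarrow> nat \<Rightarrow> nat \<Rightarrow> nat \<Rightarrow> nat \<Rightarrow> nat \<times> nat \<Rightarrow> nat" where
  "alt_exp g s m1 m2 m3 r1 r2 r3 t = (\<lambda>(i, j).
     if i = 2 * g then (if j = 2 * g + 1 then r1 else if j = 2 * g + 2 then r2 else if j = 2 * g + 3 then r3 else 0)
     else if i = 2 * g + 2 \<and> j = 2 * g + 3 then m1
     else if i = 2 * g + 1 \<and> j = 2 * g + 3 then m2
     else if i = 2 * g + 1 \<and> j = 2 * g + 2 then m3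
     else if pf_index g i then (if pf_index g j then s else 0)
     else if even i \<and> i < 2 * g \<and> j = Suc i then t else 0)"

definition alt_mon :: "nat \<Rightarrow> nat \<Rightarrow> nat \<Rightarrow> nat \<Rightarrow> nat \<Rightarrow> nat \<Rightarrow> nat \<Rightarrow> nat \<Rightarrow> nat \<Rightarrow> mon" where
  "alt_mon g s m1 m2 m3 r1 r2 r3 t = mon_of (alt_vars (2 * g + 4)) (alt_exp g s m1 m2 m3 r1 r2 r3 t)"

lemma lookup_alt_mon:
  "Poly_Mapping.lookup (alt_mon g s m1 m2 m3 r1 r2 r3 t) (i, j)
    = (if i < j \<and> j < 2 * g + 4 then alt_exp g s m1 m2 m3 r1 r2 r3 t (i, j) else 0)"
  unfolding alt_mon_def lookup_mon_of[OF finite_alt_vars] by (simp add: alt_vars_def)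

text \<open>With \<open>id\<close> these are the three perfect matchings of the last four indices
  that keep the pairs below \<open>2 * g\<close>; their signs are those of the Pfaffian of a 4
  \<times> 4 matrix.\<close>

definition \<tau>2 :: "nat \<Rightarrow> nat \<Rightarrow> nat" where "\<tau>2 g = transpose (2 * g + 1) (2 * g + 2)"
definition \<tau>3 :: "nat \<Rightarrow> nat \<Rightarrow> nat" where "\<tau>3 g = transpose (2 * g + 1) (2 * g + 3) \<circ> transpose (2 * g + 2) (2 * g + 3)"

lemma \<tau>_apply:
  "\<tau>2 g i = (if i = 2 * g + 1 then 2 * g + 2 else if i = 2 * g + 2 then 2 * g + 1 else i)"
  "\<tau>3 g i = (if i = 2 * g + 1 then 2 * g + 3 else if i = 2 * g + 2 then 2 * g + 1 else if i = 2 * g + 3 then 2 * g + 2 else i)"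
  by (auto simp: \<tau>2_def \<tau>3_def transpose_def)

lemma \<tau>_sign: "sign (\<tau>2 g) = -1" "sign (\<tau>3 g) = 1"
  by (simp_all add: \<tau>2_def \<tau>3_def sign_compose permutation_swap_id sign_swap_id)

lemma \<tau>_matching: "\<tau>2 g \<in> matchings g" "\<tau>3 g \<in> matchings g"
proof -
  have p: "\<tau>2 g permutes {..<2 * g + 4}" "\<tau>3 g permutes {..<2 * g + 4}"
    unfolding \<tau>2_def \<tau>3_def by (intro permutes_compose permutes_swap_id; simp)+
  have 1: "\<tau> (2 * k) < \<tau> (2 * k + 1)" if "k < Suc (Suc g)" "\<tau> = \<tau>2 g \<or> \<tau> = \<tau>3 g" for \<tau> k
  proof -
    have "k < g \<or> k = g \<or> k = Suc g" using that(1) by presburger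
    then show ?thesis using that(2) by (elim disjE) (simp_all add: \<tau>_apply)
  qed
  have 2: "\<tau> (2 * k) < \<tau> (2 * k + 2)" if "k < Suc g" "\<tau> = \<tau>2 g \<or> \<tau> = \<tau>3 g" for \<tau> k
  proof -
    have "k < g \<or> k = g" using that(1) by presburger
    then show ?thesis using that(2) by (elim disjE) (simp_all add: \<tau>_apply)
  qed
  show "\<tau>2 g \<in> matchings g" "\<tau>3 g \<in> matchings g" using p 1 2 by (auto simp: matchings_def)
qed

lemma \<tau>_distinct: "id \<noteq> \<tau>2 g" "id \<noteq> \<tau>3 g" "\<tau>2 g \<noteq> \<tau>3 g"
proof -
  have "id (2 * g + 1) \<noteq> \<tau>2 g (2 * g + 1)" "id (2 * g + 1) \<noteq> \<tau>3 g (2 * g + 1)" "\<tau>2 g (2 * g + 1) \<noteq> \<tau>3 g (2 * g + 1)"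
    by (simp_all add: \<tau>_apply)
  then show "id \<noteq> \<tau>2 g" "id \<noteq> \<tau>3 g" "\<tau>2 g \<noteq> \<tau>3 g" by fastforce+
qed

lemma ex_less_Suc_Suc: "(\<exists>k<Suc (Suc g). P k) \<longleftrightarrow> (\<exists>k<g. P k) \<or> P g \<or> P (Suc g)"
  by (auto simp: less_Suc_eq)

lemma ex_pair: "(\<exists>k<g. 2 * k = i \<and> 2 * k + 1 = j) \<longleftrightarrow> even i \<and> i < 2 * g \<and> j = Suc i"
  by (auto elim!: evenE)

lemma lookup_pf_mon_id:
  "Poly_Mapping.lookup (pf_mon g id) (i, j) = (if even i \<and> i < 2 * g \<and> j = Suc i \<or> i = 2 * g \<and> j = 2 * g + 1 \<or> i = 2 * g + 2 \<and> j = 2 * g + 3 then 1 else 0)"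
  unfolding lookup_pf_mon[OF id_matching] ex_less_Suc_Suc id_apply ex_pair by (intro if_cong refl) auto

lemma \<tau>_below: "k < g \<Longrightarrow> \<tau>2 g (2 * k) = 2 * k" "k < g \<Longrightarrow> \<tau>2 g (2 * k + 1) = 2 * k + 1"
  "k < g \<Longrightarrow> \<tau>3 g (2 * k) = 2 * k" "k < g \<Longrightarrow> \<tau>3 g (2 * k + 1) = 2 * k + 1"
  by (auto simp: \<tau>_apply)

lemma lookup_pf_mon_\<tau>2:
  "Poly_Mapping.lookup (pf_mon g (\<tau>2 g)) (i, j) = (if even i \<and> i < 2 * g \<and> j = Suc i \<or> i = 2 * g \<and> j = 2 * g + 2 \<or> i = 2 * g + 1 \<and> j = 2 * g + 3 then 1 else 0)"
proof -
  have "\<tau>2 g (2 * k) = i \<and> \<tau>2 g (2 * k + 1) = j \<longleftrightarrow> 2 * k = i \<and> 2 * k + 1 = j" if "k < g" for k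
    by (simp only: \<tau>_below(1,2)[OF that])
  then have "(\<exists>k<g. \<tau>2 g (2 * k) = i \<and> \<tau>2 g (2 * k + 1) = j) \<longleftrightarrow> (\<exists>k<g. 2 * k = i \<and> 2 * k + 1 = j)"
    by blast
  moreover have "\<tau>2 g (2 * g) = 2 * g" "\<tau>2 g (2 * g + 1) = 2 * g + 2" "\<tau>2 g (2 * Suc g) = 2 * g + 1" "\<tau>2 g (2 * Suc g + 1) = 2 * g + 3"
    by (simp_all add: \<tau>_apply)
  ultimately show ?thesis unfolding lookup_pf_mon[OF \<tau>_matching(1)] ex_less_Suc_Suc ex_pair
    by (simp only:) (intro if_cong refl, blast)
qed

lemma lookup_pf_mon_\<tau>3:
  "Poly_Mapping.lookup (pf_mon g (\<tau>3 g)) (i, j) = (if even i \<and> i < 2 * g \<and> j = Suc i \<or> i = 2 * g \<and> j = 2 * g + 3 \<or> i = 2 * g + 1 \<and> j = 2 * g + 2 then 1 else 0)"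
proof -
  have "\<tau>3 g (2 * k) = i \<and> \<tau>3 g (2 * k + 1) = j \<longleftrightarrow> 2 * k = i \<and> 2 * k + 1 = j" if "k < g" for k
    by (simp only: \<tau>_below(3,4)[OF that])
  then have "(\<exists>k<g. \<tau>3 g (2 * k) = i \<and> \<tau>3 g (2 * k + 1) = j) \<longleftrightarrow> (\<exists>k<g. 2 * k = i \<and> 2 * k + 1 = j)"
    by blast
  moreover have "\<tau>3 g (2 * g) = 2 * g" "\<tau>3 g (2 * g + 1) = 2 * g + 3" "\<tau>3 g (2 * Suc g) = 2 * g + 1" "\<tau>3 g (2 * Suc g + 1) = 2 * g + 2"
    by (simp_all add: \<tau>_apply)
  ultimately show ?thesis unfolding lookup_pf_mon[OF \<tau>_matching(2)] ex_less_Suc_Suc ex_pair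
    by (simp only:) (intro if_cong refl, blast)
qed

lemma alt_mon_split:
  "alt_mon g s (Suc m1) m2 m3 (Suc r1) r2 r3 (Suc t) = pf_mon g id + alt_mon g s m1 m2 m3 r1 r2 r3 t"
  "alt_mon g s m1 (Suc m2) m3 r1 (Suc r2) r3 (Suc t) = pf_mon g (\<tau>2 g) + alt_mon g s m1 m2 m3 r1 r2 r3 t"
  "alt_mon g s m1 m2 (Suc m3) r1 r2 (Suc r3) (Suc t) = pf_mon g (\<tau>3 g) + alt_mon g s m1 m2 m3 r1 r2 r3 t"
proof -
  have *: "m = m'" if "\<And>i j. Poly_Mapping.lookup m (i, j) = Poly_Mapping.lookup m' (i, j)" for m m' :: mon
    using that by (intro poly_mapping_eqI) auto
  note L = lookup_add lookup_alt_mon alt_exp_def pf_index_def prod.case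
  show "alt_mon g s (Suc m1) m2 m3 (Suc r1) r2 r3 (Suc t) = pf_mon g id + alt_mon g s m1 m2 m3 r1 r2 r3 t"
  proof (rule *)
    fix i j
    show "Poly_Mapping.lookup (alt_mon g s (Suc m1) m2 m3 (Suc r1) r2 r3 (Suc t)) (i, j) = Poly_Mapping.lookup (pf_mon g id + alt_mon g s m1 m2 m3 r1 r2 r3 t) (i, j)"
      unfolding L lookup_pf_mon_id
      by (cases "i = 2 * g", simp, cases "i = 2 * g + 1", simp, cases "i = 2 * g + 2", simp, simp)
  qed
  show "alt_mon g s m1 (Suc m2) m3 r1 (Suc r2) r3 (Suc t) = pf_mon g (\<tau>2 g) + alt_mon g s m1 m2 m3 r1 r2 r3 t"
  proof (rule *)
    fix i j
    show "Poly_Mapping.lookup (alt_mon g s m1 (Suc m2) m3 r1 (Suc r2) r3 (Suc t)) (i, j) = Poly_Mapping.lookup (pf_mon g (\<tau>2 g) + alt_mon g s m1 m2 m3 r1 r2 r3 t) (i, j)"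
      unfolding L lookup_pf_mon_\<tau>2
      by (cases "i = 2 * g", simp, cases "i = 2 * g + 1", simp, cases "i = 2 * g + 2", simp, simp)
  qed
  show "alt_mon g s m1 m2 (Suc m3) r1 r2 (Suc r3) (Suc t) = pf_mon g (\<tau>3 g) + alt_mon g s m1 m2 m3 r1 r2 r3 t"
  proof (rule *)
    fix i j
    show "Poly_Mapping.lookup (alt_mon g s m1 m2 (Suc m3) r1 r2 (Suc r3) (Suc t)) (i, j) = Poly_Mapping.lookup (pf_mon g (\<tau>3 g) + alt_mon g s m1 m2 m3 r1 r2 r3 t) (i, j)"
      unfolding L lookup_pf_mon_\<tau>3
      by (cases "i = 2 * g", simp, cases "i = 2 * g + 1", simp, cases "i = 2 * g + 2", simp, simp)
  qed
qed

lemma alt_mon_not: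
  assumes "z = 0 \<or> r = 0"
  shows "alt_mon g s z m2 m3 r r2 r3 t \<noteq> pf_mon g id + m"
    "alt_mon g s m1 z m3 r1 r r3 t \<noteq> pf_mon g (\<tau>2 g) + m"
    "alt_mon g s m1 m2 z r1 r2 r t \<noteq> pf_mon g (\<tau>3 g) + m"
proof -
  have *: "m1 \<noteq> m2 + m" if "Poly_Mapping.lookup m1 v = 0" "Poly_Mapping.lookup m2 v = 1" for m1 m2 m :: mon and v
    using that by (metis lookup_add add_is_0 one_neq_zero)
  note L = lookup_alt_mon alt_exp_def lookup_pf_mon_id lookup_pf_mon_\<tau>2 lookup_pf_mon_\<tau>3
  show "alt_mon g s z m2 m3 r r2 r3 t \<noteq> pf_mon g id + m"
    using assms *[where v = "(2 * g + 2, 2 * g + 3)"] *[where v = "(2 * g, 2 * g + 1)"] by (auto simp: L)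
  show "alt_mon g s m1 z m3 r1 r r3 t \<noteq> pf_mon g (\<tau>2 g) + m"
    using assms *[where v = "(2 * g + 1, 2 * g + 3)"] *[where v = "(2 * g, 2 * g + 2)"] by (auto simp: L)
  show "alt_mon g s m1 m2 z r1 r2 r t \<noteq> pf_mon g (\<tau>3 g) + m"
    using assms *[where v = "(2 * g + 1, 2 * g + 2)"] *[where v = "(2 * g, 2 * g + 3)"] by (auto simp: L)
qed

text \<open>In an even row \<open>2 * k\<close> with \<open>k < g\<close> only the entry
  \<open>(2 * k, 2 * k + 1)\<close> can have a positive exponent, so \<sigma> is the identity below
  \<open>2 * g\<close>. Normalization then gives \<sigma> fixing \<open>2 * g\<close>, which leaves
  three choices for its partner.\<close>

lemma matching_dvd_alt_mon:
  assumes \<sigma>: "\<sigma> \<in> matchings g" and eq: "alt_mon g s m1 m2 m3 r1 r2 r3 t = pf_mon g \<sigma> + m"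
  shows "\<sigma> \<in> {id, \<tau>2 g, \<tau>3 g}"
proof -
  note D = matchingsD[OF \<sigma>]
  have partner: "\<sigma> (2 * k + 1) = 2 * k + 1" if k: "k < g" "\<sigma> (2 * k) = 2 * k" for k
  proof -
    have "Poly_Mapping.lookup (pf_mon g \<sigma>) (2 * k, \<sigma> (2 * k + 1)) = 1"
      unfolding lookup_pf_mon[OF \<sigma>] using k by (auto intro!: exI[of _ k])
    then have "Poly_Mapping.lookup (alt_mon g s m1 m2 m3 r1 r2 r3 t) (2 * k, \<sigma> (2 * k + 1)) \<noteq> 0"
      unfolding eq lookup_add by simp
    then show ?thesis using k(1) by (auto simp: lookup_alt_mon alt_exp_def pf_index_def split: if_splits)
  qed
  have below: "\<sigma> i = i" if "i < 2 * g" for i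
    by (rule matchings_fix_below[OF \<sigma> partner _ that]) auto
  have N: "\<sigma> (2 * g) = 2 * g" by (rule matchings_fix_even[OF \<sigma> below]) auto
  have above: "\<sigma> i = i" if "2 * g + 4 \<le> i" for i using permutes_not_in[OF D(1), of i] that by simp
  have ge: "\<sigma> i > 2 * g" if "i > 2 * g" for i
  proof (rule ccontr)
    assume c: "\<not> \<sigma> i > 2 * g"
    have "\<sigma> (\<sigma> i) = \<sigma> i" using c below[of "\<sigma> i"] N by (cases "\<sigma> i = 2 * g") auto
    then have "\<sigma> i = i" using D(4)[of "\<sigma> i" i] by simp
    then show False using c that by simp
  qed
  have eqI: "\<sigma> = \<tau>" if "\<sigma> (2 * g + 1) = \<tau> (2 * g + 1)" "\<sigma> (2 * g + 2) = \<tau> (2 * g + 2)" "\<sigma> (2 * g + 3) = \<tau> (2 * g + 3)"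
    "\<And>i. i \<le> 2 * g \<Longrightarrow> \<tau> i = i" "\<And>i. 2 * g + 4 \<le> i \<Longrightarrow> \<tau> i = i" for \<tau>
  proof
    fix i
    have "i < 2 * g \<or> i = 2 * g \<or> i = 2 * g + 1 \<or> i = 2 * g + 2 \<or> i = 2 * g + 3 \<or> 2 * g + 4 \<le> i" by presburger
    then show "\<sigma> i = \<tau> i" using that below above N by (elim disjE) simp_all
  qed
  have lt: "\<sigma> (2 * g + 2) < \<sigma> (2 * g + 3)" 
  proof -
    have "2 * Suc g = 2 * g + 2" "2 * Suc g + 1 = 2 * g + 3" by simp_all
    then show ?thesis using D(2)[of "Suc g"] by (simp only: lessI)
  qed
  have r: "2 * g < \<sigma> (2 * g + 1)" "\<sigma> (2 * g + 1) < 2 * g + 4" "2 * g < \<sigma> (2 * g + 2)" "\<sigma> (2 * g + 2) < 2 * g + 4"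
     "2 * g < \<sigma> (2 * g + 3)" "\<sigma> (2 * g + 3) < 2 * g + 4" using ge D(5) by simp_all
  have d: "\<sigma> (2 * g + 1) \<noteq> \<sigma> (2 * g + 2)" "\<sigma> (2 * g + 1) \<noteq> \<sigma> (2 * g + 3)" unfolding D(4) by simp_all
  have "\<sigma> (2 * g + 1) = 2 * g + 1 \<or> \<sigma> (2 * g + 1) = 2 * g + 2 \<or> \<sigma> (2 * g + 1) = 2 * g + 3" using r(1,2) by linarith
  moreover have "\<sigma> (2 * g + 2) = 2 * g + 1 \<or> \<sigma> (2 * g + 2) = 2 * g + 2 \<or> \<sigma> (2 * g + 2) = 2 * g + 3" using r(3,4) by linarith
  moreover have "\<sigma> (2 * g + 3) = 2 * g + 1 \<or> \<sigma> (2 * g + 3) = 2 * g + 2 \<or> \<sigma> (2 * g + 3) = 2 * g + 3" using r(5,6) by linarith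
  ultimately have "\<sigma> (2 * g + 1) = 2 * g + 1 \<and> \<sigma> (2 * g + 2) = 2 * g + 2 \<and> \<sigma> (2 * g + 3) = 2 * g + 3
    \<or> \<sigma> (2 * g + 1) = 2 * g + 2 \<and> \<sigma> (2 * g + 2) = 2 * g + 1 \<and> \<sigma> (2 * g + 3) = 2 * g + 3
    \<or> \<sigma> (2 * g + 1) = 2 * g + 3 \<and> \<sigma> (2 * g + 2) = 2 * g + 1 \<and> \<sigma> (2 * g + 3) = 2 * g + 2"
    using lt d by (elim disjE) simp_all
  then show ?thesis
  proof (elim disjE)
    assume "\<sigma> (2 * g + 1) = 2 * g + 1 \<and> \<sigma> (2 * g + 2) = 2 * g + 2 \<and> \<sigma> (2 * g + 3) = 2 * g + 3"
    then have "\<sigma> = id" by (intro eqI) simp_all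
    then show ?thesis by simp
  next
    assume "\<sigma> (2 * g + 1) = 2 * g + 2 \<and> \<sigma> (2 * g + 2) = 2 * g + 1 \<and> \<sigma> (2 * g + 3) = 2 * g + 3"
    then have "\<sigma> = \<tau>2 g" by (intro eqI) (simp_all add: \<tau>_apply)
    then show ?thesis by simp
  next
    assume "\<sigma> (2 * g + 1) = 2 * g + 3 \<and> \<sigma> (2 * g + 2) = 2 * g + 1 \<and> \<sigma> (2 * g + 3) = 2 * g + 2"
    then have "\<sigma> = \<tau>3 g" by (intro eqI) (simp_all add: \<tau>_apply)
    then show ?thesis by simp
  qed
qed

text \<open>The counterpart of \<open>lookup_det_mult\<close>, with the three terms of a 4 \<times>
  4 Pfaffian.\<close>

lemma lookup_pf_mult:
  fixes \<alpha> :: ipoly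
  shows "Poly_Mapping.lookup (pf_poly (2 * g + 4) alt_entry * \<alpha>) (alt_mon g s m1 m2 m3 r1 r2 r3 (Suc t)) =
     (if m1 = 0 \<or> r1 = 0 then 0 else Poly_Mapping.lookup \<alpha> (alt_mon g s (m1 - 1) m2 m3 (r1 - 1) r2 r3 t))
     - (if m2 = 0 \<or> r2 = 0 then 0 else Poly_Mapping.lookup \<alpha> (alt_mon g s m1 (m2 - 1) m3 r1 (r2 - 1) r3 t))
     + (if m3 = 0 \<or> r3 = 0 then 0 else Poly_Mapping.lookup \<alpha> (alt_mon g s m1 m2 (m3 - 1) r1 r2 (r3 - 1) t))"
proof -
  let ?m = "alt_mon g s m1 m2 m3 r1 r2 r3 (Suc t)"
  let ?L = "\<lambda>\<sigma>. Poly_Mapping.lookup (Poly_Mapping.single (pf_mon g \<sigma>) (sign \<sigma>) * \<alpha>) ?m"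
  have "Poly_Mapping.lookup (pf_poly (2 * g + 4) alt_entry * \<alpha>) ?m = (\<Sum>\<sigma>\<in>matchings g. ?L \<sigma>)"
    unfolding pf_poly_alt_eq sum_distrib_right lookup_sum ..
  also have "\<dots> = (\<Sum>\<sigma>\<in>{id, \<tau>2 g, \<tau>3 g}. ?L \<sigma>)"
  proof (rule sum.mono_neutral_right[OF finite_matchings])
    show "{id, \<tau>2 g, \<tau>3 g} \<subseteq> matchings g" using \<tau>_matching id_matching by auto
    show "\<forall>\<sigma>\<in>matchings g - {id, \<tau>2 g, \<tau>3 g}. ?L \<sigma> = 0"
      using matching_dvd_alt_mon by (intro ballI lookup_single_mult_not) blast
  qed
  also have "\<dots> = ?L id + ?L (\<tau>2 g) + ?L (\<tau>3 g)"
    using \<tau>_distinct[of g] by (simp only: sum.insert sum.empty finite.intros insert_iff empty_iff simp_thms add.assoc add_0_right)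
  also have "?L id = (if m1 = 0 \<or> r1 = 0 then 0 else Poly_Mapping.lookup \<alpha> (alt_mon g s (m1 - 1) m2 m3 (r1 - 1) r2 r3 t))"
  proof (cases "m1 = 0 \<or> r1 = 0")
    case True
    then have "?L id = 0" using alt_mon_not(1)[OF True] by (intro lookup_single_mult_not)
    then show ?thesis using True by (simp only: if_True)
  next
    case False
    then obtain a b where "m1 = Suc a" "r1 = Suc b" by (metis not0_implies_Suc)
    then show ?thesis by (simp only: alt_mon_split(1) lookup_single_mult_add sign_id) simp
  qed
  also have "?L (\<tau>2 g) = - (if m2 = 0 \<or> r2 = 0 then 0 else Poly_Mapping.lookup \<alpha> (alt_mon g s m1 (m2 - 1) m3 r1 (r2 - 1) r3 t))"
  proof (cases "m2 = 0 \<or> r2 = 0")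
    case True
    then have "?L (\<tau>2 g) = 0" using alt_mon_not(2)[OF True] by (intro lookup_single_mult_not)
    then show ?thesis using True by (simp only: if_True minus_zero)
  next
    case False
    then obtain a b where "m2 = Suc a" "r2 = Suc b" by (metis not0_implies_Suc)
    then show ?thesis by (simp only: alt_mon_split(2) lookup_single_mult_add \<tau>_sign) simp
  qed
  also have "?L (\<tau>3 g) = (if m3 = 0 \<or> r3 = 0 then 0 else Poly_Mapping.lookup \<alpha> (alt_mon g s m1 m2 (m3 - 1) r1 r2 (r3 - 1) t))"
  proof (cases "m3 = 0 \<or> r3 = 0")
    case True
    then have "?L (\<tau>3 g) = 0" using alt_mon_not(3)[OF True] by (intro lookup_single_mult_not)
    then show ?thesis using True by (simp only: if_True)
  next
    case False
    then obtain a b where "m3 = Suc a" "r3 = Suc b" by (metis not0_implies_Suc)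
    then show ?thesis by (simp only: alt_mon_split(3) lookup_single_mult_add \<tau>_sign) simp
  qed
  finally show ?thesis by (simp only: diff_conv_add_uminus)
qed

lemma alt_mon_zero: "alt_mon g 0 0 0 0 0 0 0 0 = 0"
proof (rule poly_mapping_eqI)
  fix v :: "nat \<times> nat" obtain i j where v: "v = (i, j)" by (cases v)
  show "Poly_Mapping.lookup (alt_mon g 0 0 0 0 0 0 0 0) v = Poly_Mapping.lookup 0 v"
    unfolding v lookup_alt_mon alt_exp_def by simp
qed

text \<open>With \<open>r1 = 0\<close> only \<open>\<tau>2\<close> (sign -1) and
  \<open>\<tau>3\<close> (sign +1) contribute, again a power of a binomial. In
  \<open>coefficient_pf_power_2\<close> the identity is used exactly once in addition.\<close>

lemma coefficient_pf_power_1: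
  "i + j = m \<Longrightarrow> Poly_Mapping.lookup (pf_poly (2 * g + 4) alt_entry ^ m) (alt_mon g 0 0 j i 0 j i m) = (-1) ^ j * int (m choose i)"
proof (induction m arbitrary: i j)
  case 0
  then show ?case by (simp add: alt_mon_zero)
next
  case (Suc m)
  note IH = Suc.IH
  show ?case
  proof (cases i)
    case 0
    then show ?thesis using IH[of 0 m] Suc.prems by (simp add: lookup_pf_mult)
  next
    case (Suc i')
    show ?thesis
    proof (cases j)
      case 0
      then show ?thesis using IH[of m 0] Suc Suc.prems by (simp add: lookup_pf_mult)
    next
      case (Suc j')
      have "i' + j = m" "i + j' = m" using Suc Suc.prems \<open>i = Suc i'\<close> by auto
      then show ?thesis using IH[of i' j] IH[of i j'] Suc \<open>i = Suc i'\<close>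
        unfolding power_Suc lookup_pf_mult by (simp add: algebra_simps)
    qed
  qed
qed

lemma coefficient_pf_power_2:
  "i + j = m \<Longrightarrow> Poly_Mapping.lookup (pf_poly (2 * g + 4) alt_entry ^ Suc m) (alt_mon g 0 1 j i 1 j i (Suc m))
    = (-1) ^ j * int (Suc m * (m choose i))"
proof (induction m arbitrary: i j)
  case 0
  then show ?case using alt_mon_zero[of g] lookup_pf_mult[of g 1 0 1 0 0 1 0 0 0] by simp
next
  case (Suc m)
  note IH = Suc.IH
  note C1 = coefficient_pf_power_1[OF Suc.prems, of g]
  have step: "Poly_Mapping.lookup (pf_poly (2 * g + 4) alt_entry ^ Suc (Suc m)) (alt_mon g 0 1 j i 1 j i (Suc (Suc m)))
    = (-1) ^ j * int (Suc m choose i)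
      - (if j = 0 then 0 else Poly_Mapping.lookup (pf_poly (2 * g + 4) alt_entry ^ Suc m) (alt_mon g 0 1 (j - 1) i 1 (j - 1) i (Suc m)))
      + (if i = 0 then 0 else Poly_Mapping.lookup (pf_poly (2 * g + 4) alt_entry ^ Suc m) (alt_mon g 0 1 j (i - 1) 1 j (i - 1) (Suc m)))"
    unfolding power_Suc[of _ "Suc m"] lookup_pf_mult using C1 by simp
  show ?case
  proof (cases i)
    case 0
    then show ?thesis using IH[of 0 m] Suc.prems unfolding step by (simp add: algebra_simps)
  next
    case (Suc i')
    show ?thesis
    proof (cases j)
      case 0
      then show ?thesis using IH[of m 0] Suc Suc.prems unfolding step by (simp add: algebra_simps)
    next
      case (Suc j')
      have *: "i' + j = m" "i + j' = m" using Suc Suc.prems \<open>i = Suc i'\<close> by auto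
      have "Poly_Mapping.lookup (pf_poly (2 * g + 4) alt_entry ^ Suc (Suc m)) (alt_mon g 0 1 j i 1 j i (Suc (Suc m)))
        = (-1) ^ j * int (Suc m choose i) - (-1) ^ j' * int (Suc m * (m choose i)) + (-1) ^ j * int (Suc m * (m choose i'))"
        unfolding step using IH[OF *(1)] IH[OF *(2)] Suc \<open>i = Suc i'\<close> by simp
      then show ?thesis using Suc \<open>i = Suc i'\<close> by (simp add: algebra_simps)
    qed
  qed
qed

text \<open>At \<open>k = 0\<close> the exponent \<open>r3\<close> is 0, so the recursion leaves no
  boundary term there; this is why no correcting sums with exponent \<open>s - 1\<close> occur, in
  contrast to \<open>gen_functional\<close>.\<close>

definition alt_functional :: "nat \<Rightarrow> nat \<Rightarrow> nat \<Rightarrow> ipoly \<Rightarrow> int" where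
  "alt_functional g s m P =
     (\<Sum>k<m. int (Suc k) * Poly_Mapping.lookup P (alt_mon g s s (m - k + s) (Suc k + s) 0 (m - k) (Suc k) (Suc m)))
   - (\<Sum>k\<le>m. Poly_Mapping.lookup P (alt_mon g s (Suc s) (m - k + s) (k + s) 1 (m - k) k (Suc m)))"

lemma alt_functional_add: "alt_functional g s m (P + Q) = alt_functional g s m P + alt_functional g s m Q"
  by (simp add: alt_functional_def lookup_add sum.distrib distrib_left)

lemma alt_functional_of_int: "alt_functional g s m (of_int c * P) = c * alt_functional g s m P"
  by (simp add: alt_functional_def sum_distrib_left right_diff_distrib distrib_left mult.left_commute)

lemma alt_functional_sum: "alt_functional g s m (sum h I) = (\<Sum>i\<in>I. alt_functional g s m (h i))"
  by (induction I rule: infinite_finite_induct) (auto simp: alt_functional_add, simp_all add: alt_functional_def)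

lemma alt_functional_pf:
  assumes s: "s > 0" and m: "m > 0"
  shows "int (Suc m) dvd alt_functional g s m (pf_poly (2 * g + 4) alt_entry * \<alpha>)"
proof -
  define a where "a k = Poly_Mapping.lookup \<alpha> (alt_mon g s s (m - k + s) (k + s) 0 (m - k) k m)" for k
  define c where "c k = (if k < m then Poly_Mapping.lookup \<alpha> (alt_mon g s (Suc s) (m - 1 - k + s) (k + s) 1 (m - 1 - k) k m) else 0)" for k
  let ?P = "pf_poly (2 * g + 4) alt_entry * \<alpha>"
  have f1: "Poly_Mapping.lookup ?P (alt_mon g s s (m - k + s) (Suc k + s) 0 (m - k) (Suc k) (Suc m)) = a k - a (Suc k)" if "k < m" for k
  proof -
    have "m - k + s - 1 = m - Suc k + s" "m - k - 1 = m - Suc k" "m - k + s \<noteq> 0" "m - k \<noteq> 0" using that by auto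
    then show ?thesis unfolding lookup_pf_mult a_def by simp
  qed
  have f3: "Poly_Mapping.lookup ?P (alt_mon g s (Suc s) (m - k + s) (k + s) 1 (m - k) k (Suc m))
      = a k - c k + (if k = 0 then 0 else c (k - 1))" if "k \<le> m" for k
  proof (cases k)
    case 0
    have "m - 1 + s = m + s - 1" using m by simp
    then show ?thesis using 0 m s unfolding lookup_pf_mult a_def c_def by simp
  next
    case (Suc k')
    have "m - k + s - 1 = m - 1 - k + s" if "k < m" using that by simp
    moreover have "m - k = m - 1 - k'" "k' < m" using Suc \<open>k \<le> m\<close> by auto
    ultimately show ?thesis using Suc m s \<open>k \<le> m\<close> unfolding lookup_pf_mult a_def c_def by simp
  qed
  have "alt_functional g s m ?P = (\<Sum>k<m. int (Suc k) * (a k - a (Suc k))) - (\<Sum>k\<le>m. a k - c k + (if k = 0 then 0 else c (k - 1)))"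
    unfolding alt_functional_def using f1 f3 by simp
  also have "(\<Sum>k\<le>m. a k - c k + (if k = 0 then 0 else c (k - 1))) = (\<Sum>k\<le>m. a k) - c m"
  proof -
    have "(\<Sum>k\<le>m. if k = 0 then 0 else c (k - 1)) = (\<Sum>k<m. c k)"
      by (simp only: lessThan_Suc_atMost[symmetric] sum.lessThan_Suc_shift) simp
    moreover have "(\<Sum>k\<le>m. c k) = (\<Sum>k<m. c k) + c m" by (simp add: lessThan_Suc_atMost[symmetric])
    ultimately show ?thesis by (simp add: sum.distrib sum_subtractf)
  qed
  finally have "alt_functional g s m ?P = - int (Suc m) * a m + c m"
    using sum_telescope_weighted[where m = m and a = a] by linarith
  moreover have "c m = 0" by (simp add: c_def)
  ultimately have "alt_functional g s m ?P = int (Suc m) * (- a m)" by (simp add: algebra_simps)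
  then show ?thesis by (rule dvdI)
qed

lemma alt_functional_Var:
  assumes v: "v \<in> alt_block g" and m: "m > 0"
  shows "alt_functional g s m (Var v ^ (s + Suc m) * c) = 0"
proof -
  have *: "Poly_Mapping.lookup (Var v ^ (s + Suc m) * c) (alt_mon g s m1 m2 m3 r1 r2 r3 t) = 0"
    if "m1 < s + Suc m" "m2 < s + Suc m" "m3 < s + Suc m" for m1 m2 m3 r1 r2 r3 t
  proof -
    obtain i j where ij: "v = (i, j)" "pf_index g i" "pf_index g j" using v by (auto simp: alt_block_def)
    then have "i \<noteq> 2 * g" by (auto simp: pf_index_def)
    then have "Poly_Mapping.lookup (alt_mon g s m1 m2 m3 r1 r2 r3 t) v < s + Suc m"
      using that ij by (simp add: lookup_alt_mon alt_exp_def)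
    then have "alt_mon g s m1 m2 m3 r1 r2 r3 t \<noteq> Poly_Mapping.single v (s + Suc m) + m'" for m'
      by (auto simp: lookup_add)
    then show ?thesis unfolding Var_power by (rule lookup_single_mult_not)
  qed
  let ?P = "Var v ^ (s + Suc m) * c"
  have "Poly_Mapping.lookup ?P (alt_mon g s s (m - k + s) (Suc k + s) 0 (m - k) (Suc k) (Suc m)) = 0" if "k < m" for k
    by (rule *; use that m in simp)
  moreover have "Poly_Mapping.lookup ?P (alt_mon g s (Suc s) (m - k + s) (k + s) 1 (m - k) k (Suc m)) = 0"
    if "k \<le> m" for k by (rule *; use that m in simp)
  ultimately show ?thesis unfolding alt_functional_def by simp
qed

lemma lookup_alt_block_mult:
  "Poly_Mapping.lookup (D * (\<Prod>v\<in>alt_block g. Var v ^ s)) (alt_mon g s (m1 + s) (m2 + s) (m3 + s) r1 r2 r3 t)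
     = Poly_Mapping.lookup D (alt_mon g 0 m1 m2 m3 r1 r2 r3 t)"
proof -
  have fin: "finite (alt_block g)"
    by (rule finite_subset[OF _ finite_alt_vars[of "2 * g + 4"]]) (auto simp: alt_block_def)
  let ?B = "\<Sum>v\<in>alt_block g. Poly_Mapping.single v s"
  have B: "Poly_Mapping.lookup ?B (i, j) = (if i < j \<and> j < 2 * g + 4 \<and> pf_index g i \<and> pf_index g j then s else 0)" for i j
    by (simp only: lookup_sum_singles[OF fin]) (simp add: alt_block_def alt_vars_def)
  have eq: "D * (\<Prod>v\<in>alt_block g. Var v ^ s) = Poly_Mapping.single ?B 1 * D"
    by (simp add: lookup_sum_Var_power[OF fin] mult.commute)
  have "alt_mon g s (m1 + s) (m2 + s) (m3 + s) r1 r2 r3 t = ?B + alt_mon g 0 m1 m2 m3 r1 r2 r3 t"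
  proof (rule poly_mapping_eqI)
    fix v :: "nat \<times> nat" obtain i j where v: "v = (i, j)" by (cases v)
    show "Poly_Mapping.lookup (alt_mon g s (m1 + s) (m2 + s) (m3 + s) r1 r2 r3 t) v = Poly_Mapping.lookup (?B + alt_mon g 0 m1 m2 m3 r1 r2 r3 t) v"
    proof (cases "i = 2 * g + 2 \<and> i < j \<and> j < 2 * g + 4")
      case True
      then have "i = 2 * g + 2" "j = 2 * g + 3" by presburger+
      then show ?thesis unfolding v lookup_add B lookup_alt_mon alt_exp_def pf_index_def prod.case by simp
    next
      case False
      then show ?thesis unfolding v lookup_add B lookup_alt_mon alt_exp_def pf_index_def prod.case
        by (cases "i = 2 * g"; cases "i = 2 * g + 1"; cases "i = 2 * g + 2"; auto)
    qed
  qed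
  then show ?thesis unfolding eq by (simp only: lookup_single_mult_add mult_1)
qed

text \<open>As for the determinant: the first alternating sum lacks its last term and gives -1, the
  second is complete and gives 0.\<close>

lemma alt_functional_delta:
  assumes s: "s > 0" and m: "m > 0"
    and D: "of_int (int (Suc m)) * D = pf_poly (2 * g + 4) alt_entry ^ Suc m
      - (\<Sum>\<sigma>\<in>matchings g. Poly_Mapping.single (pf_mon g \<sigma>) (sign \<sigma>) ^ Suc m)"
  shows "alt_functional g s m (D * (\<Prod>v\<in>alt_block g. Var v ^ s)) = - 1"
proof -
  have D': "int (Suc m) * Poly_Mapping.lookup D x = Poly_Mapping.lookup (pf_poly (2 * g + 4) alt_entry ^ Suc m) x"
    if "Poly_Mapping.lookup x v mod Suc m \<noteq> 0" for x v
  proof -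
    have "Poly_Mapping.lookup (of_int (int (Suc m)) * D) x = Poly_Mapping.lookup (pf_poly (2 * g + 4) alt_entry ^ Suc m) x"
      unfolding D lookup_minus lookup_sum using perm_mon_power_ne[OF that] by (simp del: power_Suc)
    then show ?thesis by (simp only: lookup_of_int_mult)
  qed
  have d1: "int (Suc k) * Poly_Mapping.lookup D (alt_mon g 0 0 (m - k) (Suc k) 0 (m - k) (Suc k) (Suc m)) = (-1) ^ (m - k) * int (m choose k)"
    if k: "k < m" for k
  proof -
    let ?x = "alt_mon g 0 0 (m - k) (Suc k) 0 (m - k) (Suc k) (Suc m)"
    have "Poly_Mapping.lookup ?x (2 * g, 2 * g + 3) mod Suc m \<noteq> 0" using k by (simp add: lookup_alt_mon alt_exp_def)
    from D'[OF this] have "int (Suc m) * Poly_Mapping.lookup D ?x = (-1) ^ (m - k) * int (Suc m choose Suc k)"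
      using coefficient_pf_power_1[of "Suc k" "m - k" "Suc m" g] k by simp
    then have "int (Suc m) * (int (Suc k) * Poly_Mapping.lookup D ?x) = (-1) ^ (m - k) * int (Suc k * (Suc m choose Suc k))"
      by (simp add: algebra_simps)
    also have "\<dots> = int (Suc m) * ((-1) ^ (m - k) * int (m choose k))"
      unfolding Suc_times_binomial by (simp only: of_nat_mult ac_simps)
    finally show ?thesis by (subst (asm) mult_cancel_left) simp
  qed
  have d3: "Poly_Mapping.lookup D (alt_mon g 0 1 (m - k) k 1 (m - k) k (Suc m)) = (-1) ^ (m - k) * int (m choose k)"
    if k: "k \<le> m" for k
  proof -
    let ?x = "alt_mon g 0 1 (m - k) k 1 (m - k) k (Suc m)"
    have "Poly_Mapping.lookup ?x (2 * g, 2 * g + 1) mod Suc m \<noteq> 0" using m by (simp add: lookup_alt_mon alt_exp_def)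
    from D'[OF this] have "int (Suc m) * Poly_Mapping.lookup D ?x = (-1) ^ (m - k) * int (Suc m * (m choose k))"
      using coefficient_pf_power_2[of k "m - k" m g] k by simp
    then have "int (Suc m) * Poly_Mapping.lookup D ?x = int (Suc m) * ((-1) ^ (m - k) * int (m choose k))"
      by (simp only: of_nat_mult ac_simps)
    then show ?thesis by (subst (asm) mult_cancel_left) simp
  qed
  have "alt_functional g s m (D * (\<Prod>v\<in>alt_block g. Var v ^ s))
     = (\<Sum>k<m. int (Suc k) * Poly_Mapping.lookup D (alt_mon g 0 0 (m - k) (Suc k) 0 (m - k) (Suc k) (Suc m)))
       - (\<Sum>k\<le>m. Poly_Mapping.lookup D (alt_mon g 0 1 (m - k) k 1 (m - k) k (Suc m)))"
    unfolding alt_functional_def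
    using lookup_alt_block_mult[where D = D and g = g and s = s and ?m1.0 = 0]
      lookup_alt_block_mult[where D = D and g = g and s = s and ?m1.0 = 1] by (simp only: add_0 plus_1_eq_Suc)
  also have "\<dots> = (\<Sum>k<m. (-1) ^ (m - k) * int (m choose k)) - (\<Sum>k\<le>m. (-1) ^ (m - k) * int (m choose k))"
    using d1 d3 by simp
  finally show ?thesis using sum_alternating_choose[OF m] sum_alternating_choose_lessThan[OF m] by simp
qed

theorem pfaffian_no_lift:
  assumes p: "prime p" and n: "n = 2 * g + 4"
  shows "\<not> (lifts_to_mod_sq (hypersurface (alt_vars n) (pf_poly n alt_entry)) p (frob_trace (alt_vars n) (pf_poly n alt_entry) p)
    \<or> lifts_to_ring (hypersurface (alt_vars n) (pf_poly n alt_entry)) p (frob_trace (alt_vars n) (pf_poly n alt_entry) p))"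
proof
  let ?f = "pf_poly (2 * g + 4) alt_entry" and ?V = "alt_vars (2 * g + 4)" and ?M = "alt_block g"
  assume "lifts_to_mod_sq (hypersurface (alt_vars n) (pf_poly n alt_entry)) p (frob_trace (alt_vars n) (pf_poly n alt_entry) p)
    \<or> lifts_to_ring (hypersurface (alt_vars n) (pf_poly n alt_entry)) p (frob_trace (alt_vars n) (pf_poly n alt_entry) p)"
  then have lift: "lifts_to_mod_sq (hypersurface ?V ?f) p (frob_trace ?V ?f p) \<or> lifts_to_ring (hypersurface ?V ?f) p (frob_trace ?V ?f p)"
    unfolding n .
  interpret multilinear_hypersurface ?V ?M p "matchings g" "pf_mon g" sign "alt_wt g" ?f id
    by (rule multilinear_alt[OF p])
  obtain k D where D: "D \<in> poly_carrier ?V"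
    "of_int (int p) * D = ?f ^ p - (\<Sum>\<sigma>\<in>matchings g. Poly_Mapping.single (pf_mon g \<sigma>) (sign \<sigma>) ^ p)"
    "D * (\<Prod>v\<in>?M. Var v ^ (p ^ Suc (Suc k) - p)) \<in> power_ideal ?V ?f (int p) ?M (p ^ Suc (Suc k))"
    by (rule delta_mem_of_lift[OF lift])
  obtain m where m: "p = Suc m" "m > 0" using prime_gt_1_nat[OF p] by (cases p) auto
  define s where "s = p ^ Suc (Suc k) - p"
  have "p < p ^ Suc (Suc k)" using prime_gt_1_nat[OF p] power_strict_increasing[of 1 "Suc (Suc k)" p] by simp
  then have s: "s > 0" "p ^ Suc (Suc k) = s + Suc m" by (auto simp: s_def m)
  obtain j c where j: "j \<in> hyper_ideal ?V ?f (int p)" and e: "D * (\<Prod>v\<in>?M. Var v ^ s) = j + (\<Sum>v\<in>?M. Var v ^ (s + Suc m) * c v)"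
  proof -
    have "D * (\<Prod>v\<in>?M. Var v ^ s) \<in> power_ideal ?V ?f (int p) ?M (s + Suc m)"
      using D(3) unfolding s_def[symmetric] unfolding s(2) .
    then show thesis using that by (elim power_idealE) blast
  qed
  obtain a b where ab: "j = ?f * a + of_int (int p) * b" using j by (elim hyper_idealE) blast
  have "- 1 = alt_functional g s m (D * (\<Prod>v\<in>?M. Var v ^ s))"
    using alt_functional_delta[OF s(1) m(2) D(2)[unfolded m(1)]] by simp
  also have "\<dots> = alt_functional g s m (?f * a) + int p * alt_functional g s m b"
    unfolding e ab alt_functional_add alt_functional_sum alt_functional_of_int using alt_functional_Var[OF _ m(2)] by simp
  finally have eq: "- 1 = alt_functional g s m (?f * a) + int p * alt_functional g s m b" .
  have "int p dvd alt_functional g s m (?f * a)" unfolding m(1) by (rule alt_functional_pf[OF s(1) m(2)])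
  then have "int p dvd - 1" unfolding eq by simp
  then show False using p by simp
qed

section \<open>The symmetric determinant at the prime 2\<close>

definition "\<sigma>5 = (transpose 1 2 :: nat \<Rightarrow> nat)"

lemma permutes_3: "{\<sigma>. \<sigma> permutes {..<3::nat}} = {id, \<sigma>1, \<sigma>2, \<sigma>3, \<sigma>4, \<sigma>5}"
proof
  show "{id, \<sigma>1, \<sigma>2, \<sigma>3, \<sigma>4, \<sigma>5} \<subseteq> {\<sigma>. \<sigma> permutes {..<3::nat}}"
    using \<sigma>_permutes[of 3] by (simp add: \<sigma>5_def permutes_id permutes_swap_id)
  show "{\<sigma>. \<sigma> permutes {..<3::nat}} \<subseteq> {id, \<sigma>1, \<sigma>2, \<sigma>3, \<sigma>4, \<sigma>5}"
  proof
    fix \<sigma> assume "\<sigma> \<in> {\<sigma>. \<sigma> permutes {..<3::nat}}"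
    then have \<sigma>: "\<sigma> permutes {..<3}" by simp
    show "\<sigma> \<in> {id, \<sigma>1, \<sigma>2, \<sigma>3, \<sigma>4, \<sigma>5}"
    proof (cases "\<sigma> 0 = 0")
      case False
      have "\<sigma> \<in> {\<sigma>1, \<sigma>2, \<sigma>3, \<sigma>4}" by (rule \<sigma>_cases[OF \<sigma> _ _ False]) simp_all
      then show ?thesis by blast
    next
      case True
      have inj: "\<sigma> i = \<sigma> j \<longleftrightarrow> i = j" for i j by (rule inj_eq[OF permutes_inj[OF \<sigma>]])
      have out: "\<sigma> i = i" if "3 \<le> i" for i using permutes_not_in[OF \<sigma>, of i] that by simp
      have l: "\<sigma> 1 < 3" "\<sigma> 2 < 3" using permutes_in_image[OF \<sigma>] by simp_all
      have d: "\<sigma> 1 \<noteq> \<sigma> 0" "\<sigma> 2 \<noteq> \<sigma> 0" "\<sigma> 1 \<noteq> \<sigma> 2" unfolding inj by simp_all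
      have "\<sigma> 1 = 1 \<or> \<sigma> 1 = 2" using l(1) d(1) True by linarith
      moreover have "\<sigma> 2 = 1 \<or> \<sigma> 2 = 2" using l(2) d(2) True by linarith
      ultimately have "\<sigma> 1 = 1 \<and> \<sigma> 2 = 2 \<or> \<sigma> 1 = 2 \<and> \<sigma> 2 = 1" using d(3) by (elim disjE) simp_all
      moreover have eqI: "\<sigma> = \<tau>" if "\<sigma> 1 = \<tau> 1" "\<sigma> 2 = \<tau> 2" "\<tau> 0 = 0" "\<And>i. 3 \<le> i \<Longrightarrow> \<tau> i = i" for \<tau>
      proof
        fix i :: nat
        have "i = 0 \<or> i = 1 \<or> i = 2 \<or> 3 \<le> i" by presburger
        then show "\<sigma> i = \<tau> i" using that True out by (elim disjE) simp_all
      qed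
      ultimately have "\<sigma> = id \<or> \<sigma> = \<sigma>5"
      proof (elim disjE)
        assume "\<sigma> 1 = 1 \<and> \<sigma> 2 = 2" then have "\<sigma> = id" by (intro eqI) simp_all then show ?thesis by simp
      next
        assume "\<sigma> 1 = 2 \<and> \<sigma> 2 = 1" then have "\<sigma> = \<sigma>5" by (intro eqI) (simp_all add: \<sigma>5_def transpose_def) then show ?thesis by simp
      qed
      then show ?thesis by blast
    qed
  qed
qed

lemma det_poly_3:
  "det_poly 3 A = A 0 0 * A 1 1 * A 2 2 - A 0 1 * A 1 0 * A 2 2 + A 0 1 * A 1 2 * A 2 0
     + A 0 2 * A 1 0 * A 2 1 - A 0 2 * A 1 1 * A 2 0 - A 0 0 * A 1 2 * A 2 1"
proof -
  have prod: "(\<Prod>i<3. F i) = F 0 * F 1 * F 2" for F :: "nat \<Rightarrow> ipoly" by (simp add: numeral_3_eq_3 numeral_2_eq_2 ac_simps)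
  have "id 1 \<noteq> \<sigma>5 1" "id 0 \<noteq> \<sigma>1 0" "id 0 \<noteq> \<sigma>2 0" "id 0 \<noteq> \<sigma>3 0" "id 0 \<noteq> \<sigma>4 0" "\<sigma>5 0 \<noteq> \<sigma>1 0" "\<sigma>5 0 \<noteq> \<sigma>2 0" "\<sigma>5 0 \<noteq> \<sigma>3 0" "\<sigma>5 0 \<noteq> \<sigma>4 0"
    by (simp_all add: \<sigma>_apply \<sigma>5_def transpose_def)
  then have ne: "id \<noteq> \<sigma>5" "id \<noteq> \<sigma>1" "id \<noteq> \<sigma>2" "id \<noteq> \<sigma>3" "id \<noteq> \<sigma>4" "\<sigma>5 \<noteq> \<sigma>1" "\<sigma>5 \<noteq> \<sigma>2" "\<sigma>5 \<noteq> \<sigma>3" "\<sigma>5 \<noteq> \<sigma>4" by fastforce+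
  have "det_poly 3 A = (\<Sum>\<sigma>\<in>{id, \<sigma>1, \<sigma>2, \<sigma>3, \<sigma>4, \<sigma>5}. of_int (sign \<sigma>) * (A 0 (\<sigma> 0) * A 1 (\<sigma> 1) * A 2 (\<sigma> 2)))"
    unfolding det_poly_def permutes_3 prod ..
  also have "\<dots> = of_int (sign (id::nat \<Rightarrow> nat)) * (A 0 (id 0) * A 1 (id 1) * A 2 (id 2)) + (of_int (sign \<sigma>1) * (A 0 (\<sigma>1 0) * A 1 (\<sigma>1 1) * A 2 (\<sigma>1 2))
     + (of_int (sign \<sigma>2) * (A 0 (\<sigma>2 0) * A 1 (\<sigma>2 1) * A 2 (\<sigma>2 2)) + (of_int (sign \<sigma>3) * (A 0 (\<sigma>3 0) * A 1 (\<sigma>3 1) * A 2 (\<sigma>3 2))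
     + (of_int (sign \<sigma>4) * (A 0 (\<sigma>4 0) * A 1 (\<sigma>4 1) * A 2 (\<sigma>4 2)) + of_int (sign \<sigma>5) * (A 0 (\<sigma>5 0) * A 1 (\<sigma>5 1) * A 2 (\<sigma>5 2))))))"
    using ne ne[symmetric] \<sigma>_distinct
    by (simp only: sum.insert sum.empty finite.intros insert_iff empty_iff simp_thms add_0_right)
  also have "sign \<sigma>5 = -1" by (simp add: \<sigma>5_def sign_swap_id)
  finally have "det_poly 3 A = of_int 1 * (A 0 (id 0) * A 1 (id 1) * A 2 (id 2)) + (of_int (- 1) * (A 0 (\<sigma>1 0) * A 1 (\<sigma>1 1) * A 2 (\<sigma>1 2))
     + (of_int 1 * (A 0 (\<sigma>2 0) * A 1 (\<sigma>2 1) * A 2 (\<sigma>2 2)) + (of_int 1 * (A 0 (\<sigma>3 0) * A 1 (\<sigma>3 1) * A 2 (\<sigma>3 2))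
     + (of_int (- 1) * (A 0 (\<sigma>4 0) * A 1 (\<sigma>4 1) * A 2 (\<sigma>4 2)) + of_int (- 1) * (A 0 (\<sigma>5 0) * A 1 (\<sigma>5 1) * A 2 (\<sigma>5 2))))))"
    unfolding \<sigma>_sign sign_id .
  then show ?thesis by (simp add: \<sigma>_apply \<sigma>5_def transpose_def)
qed

lemma sym_vars_3: "sym_vars 3 = {(0, 0), (1, 1), (2, 2), (1, 2), (0, 2), (0, 1)}"
proof -
  have "i \<le> j \<and> j < 3 \<longleftrightarrow> (i, j) \<in> {(0, 0), (1, 1), (2, 2), (1, 2), (0, 2), (0, 1)}" for i j :: nat by auto
  then show ?thesis by (auto simp: sym_vars_def)
qed

text \<open>The slots are the diagonal entries followed by the off-diagonal entries opposite to
  them. They are written a, b, c and d, e, h below, so that the determinant is \<open>a * b * c + 2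
  * d * e * h - a * d ^ 2 - b * e ^ 2 - c * h ^ 2\<close>.\<close>

definition smon :: "nat \<Rightarrow> nat \<Rightarrow> nat \<Rightarrow> nat \<Rightarrow> nat \<Rightarrow> nat \<Rightarrow> mon" where
  "smon i j k l m n = Poly_Mapping.single (0, 0) i + Poly_Mapping.single (1, 1) j + Poly_Mapping.single (2, 2) k
     + Poly_Mapping.single (1, 2) l + Poly_Mapping.single (0, 2) m + Poly_Mapping.single (0, 1) n"

definition sterm :: "int \<Rightarrow> nat \<Rightarrow> nat \<Rightarrow> nat \<Rightarrow> nat \<Rightarrow> nat \<Rightarrow> nat \<Rightarrow> ipoly" where
  "sterm c i j k l m n = Poly_Mapping.single (smon i j k l m n) c"

lemma lookup_smon:
  "Poly_Mapping.lookup (smon i j k l m n) v = (if v = (0, 0) then i else if v = (1, 1) then j else if v = (2, 2) then k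
     else if v = (1, 2) then l else if v = (0, 2) then m else if v = (0, 1) then n else 0)"
  by (auto simp: smon_def lookup_add lookup_single when_def)

lemma smon_add: "smon i j k l m n + smon i' j' k' l' m' n' = smon (i + i') (j + j') (k + k') (l + l') (m + m') (n + n')"
  by (simp add: smon_def single_add ac_simps)

lemma smon_diff: "smon i j k l m n - smon i' j' k' l' m' n' = smon (i - i') (j - j') (k - k') (l - l') (m - m') (n - n')"
  by (rule poly_mapping_eqI) (simp add: lookup_minus lookup_smon)

lemma sterm_mult: "sterm c i j k l m n * sterm c' i' j' k' l' m' n' = sterm (c * c') (i + i') (j + j') (k + k') (l + l') (m + m') (n + n')"
  by (simp add: sterm_def mult_single smon_add)

lemma sterm_power: "sterm 1 i j k l m n ^ r = sterm 1 (r * i) (r * j) (r * k) (r * l) (r * m) (r * n)"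
proof (induction r)
  case 0
  show ?case by (simp add: sterm_def smon_def)
next
  case (Suc r)
  then show ?case by (simp add: sterm_mult)
qed

lemma sterm_carrier [simp]: "sterm c i j k l m n \<in> poly_carrier (sym_vars 3)"
  unfolding sterm_def by (rule poly_carrier_single) (auto simp: in_keys_iff lookup_smon sym_vars_3 split: if_splits)

lemma Var_sterm:
  "Var (0, 0) = sterm 1 1 0 0 0 0 0" "Var (1, 1) = sterm 1 0 1 0 0 0 0" "Var (2, 2) = sterm 1 0 0 1 0 0 0"
  "Var (1, 2) = sterm 1 0 0 0 1 0 0" "Var (0, 2) = sterm 1 0 0 0 0 1 0" "Var (0, 1) = sterm 1 0 0 0 0 0 1"
  by (simp_all add: Var_def sterm_def smon_def)

lemma lookup_sterm_mult:
  "Poly_Mapping.lookup (sterm c i j k l m n * \<alpha>) (smon i' j' k' l' m' n') =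
    (if i \<le> i' \<and> j \<le> j' \<and> k \<le> k' \<and> l \<le> l' \<and> m \<le> m' \<and> n \<le> n'
     then c * Poly_Mapping.lookup \<alpha> (smon (i' - i) (j' - j) (k' - k) (l' - l) (m' - m) (n' - n)) else 0)"
proof -
  have "(\<forall>v. Poly_Mapping.lookup (smon i j k l m n) v \<le> Poly_Mapping.lookup (smon i' j' k' l' m' n') v)
     \<longleftrightarrow> i \<le> i' \<and> j \<le> j' \<and> k \<le> k' \<and> l \<le> l' \<and> m \<le> m' \<and> n \<le> n'" (is "?L \<longleftrightarrow> ?R")
  proof
    assume L: ?L
    show ?R using L[rule_format, of "(0, 0)"] L[rule_format, of "(1, 1)"] L[rule_format, of "(2, 2)"]
        L[rule_format, of "(1, 2)"] L[rule_format, of "(0, 2)"] L[rule_format, of "(0, 1)"] by (simp add: lookup_smon)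
  qed (simp add: lookup_smon)
  then show ?thesis unfolding sterm_def lookup_single_mult smon_diff by (simp only:)
qed

abbreviation sdet :: ipoly where "sdet \<equiv> det_poly 3 sym_entry"

lemma sdet_eq:
  "sdet = sterm 1 1 1 1 0 0 0 + sterm 2 0 0 0 1 1 1 + sterm (-1) 1 0 0 2 0 0 + sterm (-1) 0 1 0 0 2 0 + sterm (-1) 0 0 1 0 0 2"
proof -
  have 2: "sterm 2 0 0 0 1 1 1 = sterm 1 0 0 0 1 1 1 + sterm 1 0 0 0 1 1 1" by (simp add: sterm_def single_add[symmetric])
  have m: "sterm (- 1) i j k l m n = - sterm 1 i j k l m n" for i j k l m n by (simp add: sterm_def single_uminus)
  have en: "sym_entry 0 0 = sterm 1 1 0 0 0 0 0" "sym_entry 1 1 = sterm 1 0 1 0 0 0 0" "sym_entry 2 2 = sterm 1 0 0 1 0 0 0"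
    "sym_entry 1 2 = sterm 1 0 0 0 1 0 0" "sym_entry 2 1 = sterm 1 0 0 0 1 0 0" "sym_entry 0 2 = sterm 1 0 0 0 0 1 0"
    "sym_entry 2 0 = sterm 1 0 0 0 0 1 0" "sym_entry 0 1 = sterm 1 0 0 0 0 0 1" "sym_entry 1 0 = sterm 1 0 0 0 0 0 1"
    by (simp_all add: sym_entry_def Var_sterm min_def max_def del: One_nat_def)
  show ?thesis
    unfolding det_poly_3 2 m en sterm_mult by (simp add: numeral_2_eq_2 algebra_simps)
qed

lemma sdet_carrier: "sdet \<in> poly_carrier (sym_vars 3)"
  unfolding sdet_eq by simp

lemma Phi_S_sterm:
  "Phi_S (sym_vars 3) 2 (sterm c i j k l m n) = sterm (c * int (i * j * k * l * m * n)) (i - 1) (j - 1) (k - 1) (l - 1) (m - 1) (n - 1)"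
proof -
  have "(\<Sum>v\<in>sym_vars 3. Poly_Mapping.single v (2 - 1)) = smon 1 1 1 1 1 1"
    unfolding sym_vars_3 smon_def by (simp add: add.assoc)
  moreover have "(\<Prod>v\<in>sym_vars 3. int (Poly_Mapping.lookup (smon i j k l m n) v choose (2 - 1))) = int (i * j * k * l * m * n)"
    unfolding sym_vars_3 by (simp add: lookup_smon)
  ultimately show ?thesis unfolding sterm_def Phi_S_single by (simp only: smon_diff)
qed

lemma pcong_sterm: "[c = c'] (mod p) \<Longrightarrow> pcong p (sterm c i j k l m n) (sterm c' i j k l m n)"
  unfolding pcong_poly_iff by (auto simp: sterm_def lookup_single when_def)

lemma sterm_zero [simp]: "sterm 0 i j k l m n = 0" by (simp add: sterm_def)

text \<open>For \<open>p = 2\<close> the binomial coefficients are the exponents themselves. Modulo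
  2 the term with coefficient 2 drops out, signs disappear and \<open>l + 2\<close> counts as
  \<open>l\<close>. Truncated exponents are harmless, because their coefficient contains the factor
  0.\<close>

lemma Phi_S_sdet_sterm:
  "pcong 2 (Phi_S (sym_vars 3) 2 (sdet * sterm x i j k l m n))
    (sterm (x * int ((i + 1) * (j + 1) * (k + 1) * l * m * n)) i j k (l - 1) (m - 1) (n - 1)
     + sterm (x * int ((i + 1) * j * k * l * m * n)) i (j - 1) (k - 1) (l + 1) (m - 1) (n - 1)
     + sterm (x * int (i * (j + 1) * k * l * m * n)) (i - 1) j (k - 1) (l - 1) (m + 1) (n - 1)
     + sterm (x * int (i * j * (k + 1) * l * m * n)) (i - 1) (j - 1) k (l - 1) (m - 1) (n + 1))"
proof -
  have e: "Phi_S (sym_vars 3) 2 (sdet * sterm x i j k l m n)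
    = sterm (x * int ((i + 1) * (j + 1) * (k + 1) * l * m * n)) i j k (l - 1) (m - 1) (n - 1)
     + sterm (2 * x * int (i * j * k * (l + 1) * (m + 1) * (n + 1))) (i - 1) (j - 1) (k - 1) l m n
     + sterm (- x * int ((i + 1) * j * k * (l + 2) * m * n)) i (j - 1) (k - 1) (l + 1) (m - 1) (n - 1)
     + sterm (- x * int (i * (j + 1) * k * l * (m + 2) * n)) (i - 1) j (k - 1) (l - 1) (m + 1) (n - 1)
     + sterm (- x * int (i * j * (k + 1) * l * m * (n + 2))) (i - 1) (j - 1) k (l - 1) (m - 1) (n + 1)"
    unfolding sdet_eq distrib_right Phi_S_add sterm_mult Phi_S_sterm
    by (simp add: add.commute)
  have c: "[- x * int (a * b * c * d * e * f) = x * int (a' * b * c * d' * e' * f')] (mod 2)"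
    if "even (a * b * c * d * e * f) = even (a' * b * c * d' * e' * f')" for a a' b c d d' e e' f f'
    using that by (simp only: cong_iff_dvd_diff) auto
  show ?thesis unfolding e
  proof -
    have "pcong 2 (sterm (2 * x * int (i * j * k * (l + 1) * (m + 1) * (n + 1))) (i - 1) (j - 1) (k - 1) l m n) (sterm 0 (i - 1) (j - 1) (k - 1) l m n)"
      by (rule pcong_sterm) (simp add: cong_0_iff)
    moreover have "pcong 2 (sterm (- x * int ((i + 1) * j * k * (l + 2) * m * n)) i (j - 1) (k - 1) (l + 1) (m - 1) (n - 1))
       (sterm (x * int ((i + 1) * j * k * l * m * n)) i (j - 1) (k - 1) (l + 1) (m - 1) (n - 1))"
      by (rule pcong_sterm) (auto simp: cong_iff_dvd_diff)
    moreover have "pcong 2 (sterm (- x * int (i * (j + 1) * k * l * (m + 2) * n)) (i - 1) j (k - 1) (l - 1) (m + 1) (n - 1))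
       (sterm (x * int (i * (j + 1) * k * l * m * n)) (i - 1) j (k - 1) (l - 1) (m + 1) (n - 1))"
      by (rule pcong_sterm) (auto simp: cong_iff_dvd_diff)
    moreover have "pcong 2 (sterm (- x * int (i * j * (k + 1) * l * m * (n + 2))) (i - 1) (j - 1) k (l - 1) (m - 1) (n + 1))
       (sterm (x * int (i * j * (k + 1) * l * m * n)) (i - 1) (j - 1) k (l - 1) (m - 1) (n + 1))"
      by (rule pcong_sterm) (auto simp: cong_iff_dvd_diff)
    ultimately have "pcong 2 (sterm (x * int ((i + 1) * (j + 1) * (k + 1) * l * m * n)) i j k (l - 1) (m - 1) (n - 1)
     + sterm (2 * x * int (i * j * k * (l + 1) * (m + 1) * (n + 1))) (i - 1) (j - 1) (k - 1) l m n
     + sterm (- x * int ((i + 1) * j * k * (l + 2) * m * n)) i (j - 1) (k - 1) (l + 1) (m - 1) (n - 1)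
     + sterm (- x * int (i * (j + 1) * k * l * (m + 2) * n)) (i - 1) j (k - 1) (l - 1) (m + 1) (n - 1)
     + sterm (- x * int (i * j * (k + 1) * l * m * (n + 2))) (i - 1) (j - 1) k (l - 1) (m - 1) (n + 1))
    (sterm (x * int ((i + 1) * (j + 1) * (k + 1) * l * m * n)) i j k (l - 1) (m - 1) (n - 1) + sterm 0 (i - 1) (j - 1) (k - 1) l m n
     + sterm (x * int ((i + 1) * j * k * l * m * n)) i (j - 1) (k - 1) (l + 1) (m - 1) (n - 1)
     + sterm (x * int (i * (j + 1) * k * l * m * n)) (i - 1) j (k - 1) (l - 1) (m + 1) (n - 1)
     + sterm (x * int (i * j * (k + 1) * l * m * n)) (i - 1) (j - 1) k (l - 1) (m - 1) (n + 1))"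
      by (intro pcong_add pcong_refl)
    then show "pcong 2 (sterm (x * int ((i + 1) * (j + 1) * (k + 1) * l * m * n)) i j k (l - 1) (m - 1) (n - 1)
     + sterm (2 * x * int (i * j * k * (l + 1) * (m + 1) * (n + 1))) (i - 1) (j - 1) (k - 1) l m n
     + sterm (- x * int ((i + 1) * j * k * (l + 2) * m * n)) i (j - 1) (k - 1) (l + 1) (m - 1) (n - 1)
     + sterm (- x * int (i * (j + 1) * k * l * (m + 2) * n)) (i - 1) j (k - 1) (l - 1) (m + 1) (n - 1)
     + sterm (- x * int (i * j * (k + 1) * l * m * (n + 2))) (i - 1) (j - 1) k (l - 1) (m - 1) (n + 1))
    (sterm (x * int ((i + 1) * (j + 1) * (k + 1) * l * m * n)) i j k (l - 1) (m - 1) (n - 1)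
     + sterm (x * int ((i + 1) * j * k * l * m * n)) i (j - 1) (k - 1) (l + 1) (m - 1) (n - 1)
     + sterm (x * int (i * (j + 1) * k * l * m * n)) (i - 1) j (k - 1) (l - 1) (m + 1) (n - 1)
     + sterm (x * int (i * j * (k + 1) * l * m * n)) (i - 1) (j - 1) k (l - 1) (m - 1) (n + 1))"
      by (simp only: sterm_zero add_0_right)
  qed
qed

text \<open>The diagonal exponents stay at most \<open>2 * u + 1\<close>, below
  \<open>q = 2 * u + 2\<close>, so multiples of \<open>q\<close>-th powers of diagonal variables are
  invisible. The four families are linked by the terms of the determinant so that modulo 2 they
  cancel up to a telescoping sum in \<open>y\<close>.\<close>

definition sym_functional :: "nat \<Rightarrow> ipoly \<Rightarrow> int" where
  "sym_functional u P = (\<Sum>y\<le>u.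
      Poly_Mapping.lookup P (smon (2 * u + 1 - 2 * y) (2 * u + 1 - 2 * y) (2 * u) 2 2 (4 * y))
    + Poly_Mapping.lookup P (smon (2 * u - 2 * y) (2 * u - 2 * y) (2 * u) 2 2 (4 * y + 2))
    + Poly_Mapping.lookup P (smon (2 * u - 2 * y) (2 * u + 1 - 2 * y) (2 * u + 1) 0 2 (4 * y + 2))
    + Poly_Mapping.lookup P (smon (2 * u + 1 - 2 * y) (2 * u - 2 * y) (2 * u + 1) 2 0 (4 * y + 2)))"

lemma sym_functional_add: "sym_functional u (P + Q) = sym_functional u P + sym_functional u Q"
  by (simp add: sym_functional_def lookup_add sum.distrib)

lemma sym_functional_of_int: "sym_functional u (of_int c * P) = c * sym_functional u P"
  by (simp add: sym_functional_def sum_distrib_left distrib_left)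

lemma lookup_sdet_mult:
  "Poly_Mapping.lookup (sdet * \<alpha>) (smon i j k l m n) =
     (if 1 \<le> i \<and> 1 \<le> j \<and> 1 \<le> k then Poly_Mapping.lookup \<alpha> (smon (i - 1) (j - 1) (k - 1) l m n) else 0)
   + 2 * (if 1 \<le> l \<and> 1 \<le> m \<and> 1 \<le> n then Poly_Mapping.lookup \<alpha> (smon i j k (l - 1) (m - 1) (n - 1)) else 0)
   - (if 1 \<le> i \<and> 2 \<le> l then Poly_Mapping.lookup \<alpha> (smon (i - 1) j k (l - 2) m n) else 0)
   - (if 1 \<le> j \<and> 2 \<le> m then Poly_Mapping.lookup \<alpha> (smon i (j - 1) k l (m - 2) n) else 0)
   - (if 1 \<le> k \<and> 2 \<le> n then Poly_Mapping.lookup \<alpha> (smon i j (k - 1) l m (n - 2)) else 0)"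
  unfolding sdet_eq distrib_right lookup_add lookup_sterm_mult by simp

text \<open>For fixed \<open>y\<close> each of the coefficients \<open>A\<close>, \<open>B\<close>,
  \<open>C\<close>, \<open>B'\<close>, \<open>C'\<close> and \<open>Z\<close> of \<alpha> occurs
  twice among the four summands, so it disappears modulo 2. Only the family \<open>b11\<close>
  survives, as a difference of consecutive values, and it is 0 at both ends.\<close>

lemma sym_functional_sdet:
  assumes u: "u > 0"
  shows "even (sym_functional u (sdet * \<alpha>))"
proof -
  define b11 where "b11 y = (if y = 0 \<or> y > u then 0 else Poly_Mapping.lookup \<alpha> (smon (2 * u + 1 - 2 * y) (2 * u + 1 - 2 * y) (2 * u - 1) 2 2 (4 * y - 2)))" for y
  let ?P = "sdet * \<alpha>"
  have step: "even (Poly_Mapping.lookup ?P (smon (2 * u + 1 - 2 * y) (2 * u + 1 - 2 * y) (2 * u) 2 2 (4 * y))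
    + Poly_Mapping.lookup ?P (smon (2 * u - 2 * y) (2 * u - 2 * y) (2 * u) 2 2 (4 * y + 2))
    + Poly_Mapping.lookup ?P (smon (2 * u - 2 * y) (2 * u + 1 - 2 * y) (2 * u + 1) 0 2 (4 * y + 2))
    + Poly_Mapping.lookup ?P (smon (2 * u + 1 - 2 * y) (2 * u - 2 * y) (2 * u + 1) 2 0 (4 * y + 2))
    - (b11 (Suc y) - b11 y))" if y: "y \<le> u" for y
  proof -
    define A where "A = Poly_Mapping.lookup \<alpha> (smon (2 * u - 2 * y) (2 * u - 2 * y) (2 * u - 1) 2 2 (4 * y))"
    define B where "B = Poly_Mapping.lookup \<alpha> (smon (2 * u - 2 * y) (2 * u + 1 - 2 * y) (2 * u) 0 2 (4 * y))"
    define C where "C = Poly_Mapping.lookup \<alpha> (smon (2 * u + 1 - 2 * y) (2 * u - 2 * y) (2 * u) 2 0 (4 * y))"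
    define B' where "B' = (if y < u then Poly_Mapping.lookup \<alpha> (smon (2 * u - 2 * y - 1) (2 * u - 2 * y) (2 * u) 0 2 (4 * y + 2)) else 0)"
    define C' where "C' = (if y < u then Poly_Mapping.lookup \<alpha> (smon (2 * u - 2 * y) (2 * u - 2 * y - 1) (2 * u) 2 0 (4 * y + 2)) else 0)"
    define Z where "Z = Poly_Mapping.lookup \<alpha> (smon (2 * u - 2 * y) (2 * u - 2 * y) (2 * u + 1) 0 0 (4 * y + 2))"
    have n: "2 * u + 1 - 2 * y - 1 = 2 * u - 2 * y" "(1 \<le> 2 * u + 1 - 2 * y) = True" "(1 \<le> 2 * u) = True" "(1 \<le> 2 * u - 2 * y) = (y < u)" "4 * y + 2 - 2 = 4 * y" "2 * u + 1 - 1 = 2 * u"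
      "(1 \<le> 2 * u + 1) = True" "(2 \<le> 4 * y + 2) = True" "(2 \<le> 4 * y) = (y \<noteq> 0)" "2 - 2 = (0::nat)" "(2 \<le> (0::nat)) = False" "(2 \<le> (2::nat)) = True" "(1 \<le> (0::nat)) = False"
      using y u by auto
    have 1: "even (Poly_Mapping.lookup ?P (smon (2 * u + 1 - 2 * y) (2 * u + 1 - 2 * y) (2 * u) 2 2 (4 * y)) - (A - B - C - b11 y))"
      unfolding lookup_sdet_mult n simp_thms if_True if_False A_def B_def C_def b11_def using y by (cases "y = 0") simp_all
    have 2: "even (Poly_Mapping.lookup ?P (smon (2 * u - 2 * y) (2 * u - 2 * y) (2 * u) 2 2 (4 * y + 2)) - (b11 (Suc y) - B' - C' - A))"
    proof (cases "y < u")
      case True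
      have "2 * u + 1 - 2 * Suc y = 2 * u - 2 * y - 1" "4 * Suc y - 2 = 4 * y + 2" "\<not> Suc y > u" using True by auto
      then have "b11 (Suc y) = Poly_Mapping.lookup \<alpha> (smon (2 * u - 2 * y - 1) (2 * u - 2 * y - 1) (2 * u - 1) 2 2 (4 * y + 2))"
        by (simp only: b11_def nat.simps simp_thms if_False)
      then show ?thesis using True unfolding lookup_sdet_mult n simp_thms if_True if_False A_def B'_def C'_def by simp
    next
      case False
      then have "b11 (Suc y) = 0" by (simp add: b11_def)
      then show ?thesis using False unfolding lookup_sdet_mult n simp_thms if_True if_False A_def B'_def C'_def by simp
    qed
    have 3: "even (Poly_Mapping.lookup ?P (smon (2 * u - 2 * y) (2 * u + 1 - 2 * y) (2 * u + 1) 0 2 (4 * y + 2)) - (B' - Z - B))"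
      unfolding lookup_sdet_mult n simp_thms if_True if_False B_def B'_def Z_def by simp
    have 4: "even (Poly_Mapping.lookup ?P (smon (2 * u + 1 - 2 * y) (2 * u - 2 * y) (2 * u + 1) 2 0 (4 * y + 2)) - (C' - Z - C))"
      unfolding lookup_sdet_mult n simp_thms if_True if_False C_def C'_def Z_def by simp
    have "even ((Poly_Mapping.lookup ?P (smon (2 * u + 1 - 2 * y) (2 * u + 1 - 2 * y) (2 * u) 2 2 (4 * y)) - (A - B - C - b11 y))
      + (Poly_Mapping.lookup ?P (smon (2 * u - 2 * y) (2 * u - 2 * y) (2 * u) 2 2 (4 * y + 2)) - (b11 (Suc y) - B' - C' - A))
      + (Poly_Mapping.lookup ?P (smon (2 * u - 2 * y) (2 * u + 1 - 2 * y) (2 * u + 1) 0 2 (4 * y + 2)) - (B' - Z - B))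
      + (Poly_Mapping.lookup ?P (smon (2 * u + 1 - 2 * y) (2 * u - 2 * y) (2 * u + 1) 2 0 (4 * y + 2)) - (C' - Z - C))
      - 2 * (Z + B + C))"
      by (intro dvd_diff dvd_add 1 2 3 4) simp
    moreover have eq: "(x1 - (A - B - C - b)) + (x2 - (b' - B' - C' - A)) + (x3 - (B' - Z - B)) + (x4 - (C' - Z - C)) - 2 * (Z + B + C)
        = x1 + x2 + x3 + x4 - (b' - b)" for x1 x2 x3 x4 b b' :: int by simp
    ultimately show ?thesis by (simp only: eq)
  qed
  have "even (\<Sum>y\<le>u. Poly_Mapping.lookup ?P (smon (2 * u + 1 - 2 * y) (2 * u + 1 - 2 * y) (2 * u) 2 2 (4 * y))
    + Poly_Mapping.lookup ?P (smon (2 * u - 2 * y) (2 * u - 2 * y) (2 * u) 2 2 (4 * y + 2))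
    + Poly_Mapping.lookup ?P (smon (2 * u - 2 * y) (2 * u + 1 - 2 * y) (2 * u + 1) 0 2 (4 * y + 2))
    + Poly_Mapping.lookup ?P (smon (2 * u + 1 - 2 * y) (2 * u - 2 * y) (2 * u + 1) 2 0 (4 * y + 2)) - (b11 (Suc y) - b11 y))"
    by (rule dvd_sum) (use step in simp)
  also have "(\<Sum>y\<le>u. Poly_Mapping.lookup ?P (smon (2 * u + 1 - 2 * y) (2 * u + 1 - 2 * y) (2 * u) 2 2 (4 * y))
    + Poly_Mapping.lookup ?P (smon (2 * u - 2 * y) (2 * u - 2 * y) (2 * u) 2 2 (4 * y + 2))
    + Poly_Mapping.lookup ?P (smon (2 * u - 2 * y) (2 * u + 1 - 2 * y) (2 * u + 1) 0 2 (4 * y + 2))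
    + Poly_Mapping.lookup ?P (smon (2 * u + 1 - 2 * y) (2 * u - 2 * y) (2 * u + 1) 2 0 (4 * y + 2)) - (b11 (Suc y) - b11 y))
    = sym_functional u ?P - (\<Sum>y<Suc u. b11 (Suc y) - b11 y)"
    unfolding sym_functional_def lessThan_Suc_atMost by (rule sum_subtractf)
  also have "(\<Sum>y<Suc u. b11 (Suc y) - b11 y) = b11 (Suc u) - b11 0" by (rule sum_lessThan_telescope)
  also have "b11 (Suc u) - b11 0 = 0" by (simp add: b11_def)
  finally show ?thesis by simp
qed

lemma sym_functional_Var:
  assumes "v \<in> {(0, 0), (1, 1), (2, 2)}"
  shows "sym_functional u (Var v ^ (2 * u + 2) * c) = 0"
proof -
  have "Var v ^ (2 * u + 2) \<in> {sterm 1 (2 * u + 2) 0 0 0 0 0, sterm 1 0 (2 * u + 2) 0 0 0 0, sterm 1 0 0 (2 * u + 2) 0 0 0}"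
    using assms by (elim insertE emptyE) (simp_all only: Var_sterm sterm_power mult_1_right mult_0_right insert_iff simp_thms)
  moreover have "(2 * u + 2 \<le> 2 * u + 1 - 2 * y) = False" "(2 * u + 2 \<le> 2 * u - 2 * y) = False" "(2 * u + 2 \<le> 2 * u) = False" "(2 * u + 2 \<le> 2 * u + 1) = False" for y
    by auto
  ultimately show ?thesis unfolding sym_functional_def
    by (elim insertE emptyE) (simp_all only: lookup_sterm_mult simp_thms if_False add_0_right sum.neutral_const)
qed

text \<open>With \<open>X = a * (b * c - d ^ 2)\<close>, \<open>Y = b * e ^ 2\<close> and
  \<open>Z = c * h ^ 2\<close> this is \<open>X * (Y + Z) - Y * Z\<close>, half of
  \<open>X ^ 2 + Y ^ 2 + Z ^ 2 - (X - Y - Z) ^ 2\<close>. It takes the place of the polynomial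
  \<open>D\<close> of the multilinear case.\<close>

definition sym_cross :: ipoly where
  "sym_cross = sterm 1 1 2 1 0 2 0 + sterm 1 1 1 2 0 0 2 + sterm (-1) 1 1 0 2 2 0 + sterm (-1) 1 0 1 2 0 2 + sterm (-1) 0 1 1 0 2 2"

text \<open>For \<open>y > 0\<close> the exponent of the last variable is too large, and for
  \<open>y = 0\<close> the functional meets exactly the three terms of \<open>sym_cross\<close> with
  coefficient -1.\<close>

lemma sym_functional_cross:
  assumes u: "u > 0"
  shows "odd (sym_functional u (sym_cross * sterm 1 (2 * u) (2 * u) (2 * u) 0 0 0))"
proof -
  have l: "Poly_Mapping.lookup (sterm c i j k l m n) (smon i' j' k' l' m' n') = (if i = i' \<and> j = j' \<and> k = k' \<and> l = l' \<and> m = m' \<and> n = n' then c else 0)" for c i j k l m n i' j' k' l' m' n'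
  proof -
    have "smon i j k l m n = smon i' j' k' l' m' n' \<longleftrightarrow> i = i' \<and> j = j' \<and> k = k' \<and> l = l' \<and> m = m' \<and> n = n'" (is "?L \<longleftrightarrow> ?R")
    proof
      assume ?L
      from arg_cong[OF this, of "\<lambda>m. Poly_Mapping.lookup m (0, 0)"] arg_cong[OF this, of "\<lambda>m. Poly_Mapping.lookup m (1, 1)"]
        arg_cong[OF this, of "\<lambda>m. Poly_Mapping.lookup m (2, 2)"] arg_cong[OF this, of "\<lambda>m. Poly_Mapping.lookup m (1, 2)"]
        arg_cong[OF this, of "\<lambda>m. Poly_Mapping.lookup m (0, 2)"] arg_cong[OF this, of "\<lambda>m. Poly_Mapping.lookup m (0, 1)"]
      show ?R by (simp add: lookup_smon)
    qed simp
    then show ?thesis by (simp add: sterm_def lookup_single when_def)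
  qed
  have "sym_functional u (sym_cross * sterm 1 (2 * u) (2 * u) (2 * u) 0 0 0) = (\<Sum>y\<le>u. if y = 0 then -3 else 0)"
    unfolding sym_functional_def sym_cross_def distrib_right sterm_mult lookup_add l
    by (intro sum.cong refl) (use u in auto)
  then show ?thesis by (simp add: sum.delta)
qed

lemma sterm_eq:
  "sterm x i j k l m n = of_int x * (Var (0, 0) ^ i * Var (1, 1) ^ j * Var (2, 2) ^ k * Var (1, 2) ^ l * Var (0, 2) ^ m * Var (0, 1) ^ n)"
proof -
  have "of_int x * sterm 1 i j k l m n = sterm x i j k l m n"
    by (rule poly_mapping_eqI) (simp only: lookup_of_int_mult, simp add: sterm_def lookup_single when_def)
  then show ?thesis by (simp add: Var_sterm sterm_power sterm_mult del: One_nat_def)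
qed

lemma sdet_Var:
  "sdet = Var (0, 0) * Var (1, 1) * Var (2, 2) + 2 * Var (1, 2) * Var (0, 2) * Var (0, 1)
     - Var (0, 0) * Var (1, 2) ^ 2 - Var (1, 1) * Var (0, 2) ^ 2 - Var (2, 2) * Var (0, 1) ^ 2"
  unfolding sdet_eq sterm_eq by (simp add: mult.assoc)

lemma not_prime_dvd_sdet:
  assumes "prime (p::int)" shows "\<not> of_int p dvd sdet"
proof
  assume "of_int p dvd sdet"
  then have "p dvd Poly_Mapping.lookup (sdet * 1) (smon 1 1 1 0 0 0)"
    unfolding of_int_dvd_poly_iff by simp
  moreover have "smon 0 0 0 0 0 0 = 0" by (simp add: smon_def)
  ultimately have "p dvd 1" unfolding lookup_sdet_mult by simp
  then show False using assms not_prime_unit by blast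
qed

text \<open>Here \<open>f\<close> is \<open>X - Y - Z + 2 * d * e * h\<close>, hence \<open>f * (f -
  4 * d * e * h) = (X - Y - Z) ^ 2 - 4 * (d * e * h) ^ 2\<close>. A sum of three squares is thus
  twice the cross term modulo \<open>f\<close> and 4. The other letters stand for powers of the
  diagonal variables and for the error terms of \<open>d\<close>.\<close>

lemma sym_cross_identity:
  fixes a b c d e h A B C f :: "'a::comm_ring_1"
  assumes f: "f = a * b * c + 2 * d * e * h - a * d ^ 2 - b * e ^ 2 - c * h ^ 2"
  shows "2 * ((A * B * C) * (a * (b * c - d ^ 2) * (b * e ^ 2 + c * h ^ 2) - b * c * e ^ 2 * h ^ 2)
       + A * a ^ 2 * ea + B * b ^ 2 * eb + C * c ^ 2 * ec)
    = A * a ^ 2 * (B * C * (b * c - d ^ 2) ^ 2 + f * xa + 2 * ea) + B * b ^ 2 * (A * C * (e ^ 2) ^ 2 + f * xb + 2 * eb)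
      + C * c ^ 2 * (A * B * (h ^ 2) ^ 2 + f * xc + 2 * ec)
      - f * (A * a ^ 2 * xa + B * b ^ 2 * xb + C * c ^ 2 * xc + A * B * C * (f - 4 * d * e * h)) - 4 * (A * B * C * (d * e * h) ^ 2)"
proof -
  define X Y Z where "X = a * (b * c - d ^ 2)" and "Y = b * e ^ 2" and "Z = c * h ^ 2"
  have f': "f = X - Y - Z + 2 * (d * e * h)" unfolding f X_def Y_def Z_def by (simp add: algebra_simps)
  have sq: "a ^ 2 * (b * c - d ^ 2) ^ 2 = X ^ 2" "b ^ 2 * (e ^ 2) ^ 2 = Y ^ 2" "c ^ 2 * (h ^ 2) ^ 2 = Z ^ 2"
    by (simp_all add: X_def Y_def Z_def power_mult_distrib)
  have YZ: "b * c * e ^ 2 * h ^ 2 = Y * Z" by (simp add: Y_def Z_def algebra_simps)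
  have "f * (f - 4 * d * e * h) = (X - Y - Z) ^ 2 - 4 * (d * e * h) ^ 2"
    unfolding f' by (simp add: algebra_simps power2_eq_square)
  then have *: "X ^ 2 + Y ^ 2 + Z ^ 2 - f * (f - 4 * d * e * h) - 4 * (d * e * h) ^ 2 = 2 * (X * (Y + Z) - Y * Z)"
    by (simp add: algebra_simps power2_eq_square)
  have "A * a ^ 2 * (B * C * (b * c - d ^ 2) ^ 2 + f * xa + 2 * ea) + B * b ^ 2 * (A * C * (e ^ 2) ^ 2 + f * xb + 2 * eb)
      + C * c ^ 2 * (A * B * (h ^ 2) ^ 2 + f * xc + 2 * ec)
      - f * (A * a ^ 2 * xa + B * b ^ 2 * xb + C * c ^ 2 * xc + A * B * C * (f - 4 * d * e * h)) - 4 * (A * B * C * (d * e * h) ^ 2)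
    = A * B * C * (a ^ 2 * (b * c - d ^ 2) ^ 2 + b ^ 2 * (e ^ 2) ^ 2 + c ^ 2 * (h ^ 2) ^ 2 - f * (f - 4 * d * e * h) - 4 * (d * e * h) ^ 2)
      + 2 * (A * a ^ 2 * ea + B * b ^ 2 * eb + C * c ^ 2 * ec)"
    by (simp only: ring_distribs ac_simps) (simp add: algebra_simps)
  also have "\<dots> = A * B * C * (2 * (X * (Y + Z) - Y * Z)) + 2 * (A * a ^ 2 * ea + B * b ^ 2 * eb + C * c ^ 2 * ec)"
    unfolding sq * ..
  finally show ?thesis unfolding X_def[symmetric] Y_def[symmetric] Z_def[symmetric] YZ by (simp add: algebra_simps)
qed

text \<open>The terms of the determinant are neither squarefree nor all of coefficient
  \<plusminus>1, so the comparison behind \<open>delta_mem_of_lift\<close> is repeated directly for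
  \<open>sdet * ?M\<close>, a multiple of \<open>sdet\<close> itself instead of its square.\<close>

theorem symmetric_determinant_no_lift:
  "\<not> lifts_to_mod_sq (hypersurface (sym_vars 3) sdet) 2 (frob_trace (sym_vars 3) sdet 2)
   \<and> \<not> lifts_to_ring (hypersurface (sym_vars 3) sdet) 2 (frob_trace (sym_vars 3) sdet 2)"
proof (rule ccontr)
  assume "\<not> ?thesis"
  then have lift: "lifts_to_mod_sq (hypersurface (sym_vars 3) sdet) 2 (frob_trace (sym_vars 3) sdet 2)
     \<or> lifts_to_ring (hypersurface (sym_vars 3) sdet) 2 (frob_trace (sym_vars 3) sdet 2)" by blast
  let ?S = "poly_carrier (sym_vars 3)" and ?I4 = "hyper_ideal (sym_vars 3) sdet 4" and ?I2 = "hyper_ideal (sym_vars 3) sdet 2"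
  have fin: "finite (sym_vars 3)" by (simp add: sym_vars_3)
  have p4: "int 2 ^ 2 = 4" "int 2 = 2" "2 - 1 = (1::nat)" "(2::int) ^ 2 = 4" by simp_all
  obtain d k where "\<forall>x\<in>?S. d x \<in> ?S"
    "\<forall>x\<in>?S. \<forall>y\<in>?S. d (x + y) - (d x + d y) \<in> hyper_ideal (sym_vars 3) sdet (int 2 ^ 2)"
    "\<forall>x\<in>?S. x \<in> hyper_ideal (sym_vars 3) sdet (int 2 ^ 2) \<longrightarrow> d x \<in> hyper_ideal (sym_vars 3) sdet (int 2 ^ 2)"
    "\<forall>a\<in>?S. \<forall>x\<in>?S. d (a ^ (2 ^ Suc (Suc k)) * x) - a ^ (2 ^ Suc (Suc k)) * d x \<in> hyper_ideal (sym_vars 3) sdet (int 2 ^ 2)"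
    "\<forall>x\<in>?S. d x - Phi_S (sym_vars 3) 2 (sdet ^ (2 - 1) * x) \<in> hyper_ideal (sym_vars 3) sdet (int 2)"
    using frobenius_lift_data[OF sdet_carrier two_is_prime_nat fin lift] by blast
  note data = this[unfolded p4 power_one_right]
  \<comment> \<open>With this choice \<open>q = 2 * u + 2\<close>, so that
    \<open>q - 1 = 2 * u + 1\<close> and \<open>q - 2 = 2 * u\<close>, the exponents that occur
    below.\<close>
  define u :: nat where "u = 2 ^ Suc k - 1"
  have "(1::nat) \<le> 2 ^ k" by simp
  then have u: "u > 0" and q: "2 ^ Suc (Suc k) = 2 * u + 2" unfolding u_def power_Suc by linarith+
  note data = data[unfolded q]
  let ?a = "Var (0, 0)" and ?b = "Var (1, 1)" and ?c = "Var (2, 2)" and ?d = "Var (1, 2)" and ?e = "Var (0, 2)" and ?h = "Var (0, 1)"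
  have V [simp]: "?a \<in> ?S" "?b \<in> ?S" "?c \<in> ?S" "?d \<in> ?S" "?e \<in> ?S" "?h \<in> ?S"
    unfolding Var_sterm by (rule sterm_carrier)+
  have two: "of_int 2 = (2::ipoly)" "of_int 4 = (4::ipoly)" by simp_all
  have numS [simp]: "(numeral n :: ipoly) \<in> ?S" for n
    using poly_carrier_of_int[of "numeral n" "sym_vars 3"] by simp
  note S = poly_carrier_add poly_carrier_mult poly_carrier_diff poly_carrier_power
  have key: "\<exists>x y. x \<in> ?S \<and> y \<in> ?S \<and> d z = G + sdet * x + 2 * y"
    if z: "z \<in> ?S" and G: "G \<in> ?S" and P: "pcong 2 (Phi_S (sym_vars 3) 2 (sdet * z)) G" for z G
  proof -
    have "Phi_S (sym_vars 3) 2 (sdet * z) \<in> ?S" by (intro Phi_S_carrier S sdet_carrier z)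
    then have "Phi_S (sym_vars 3) 2 (sdet * z) - G \<in> ?I2" using P G by (intro pcong_hyper_ideal) auto
    moreover have "d z - Phi_S (sym_vars 3) 2 (sdet * z) \<in> ?I2" using data(5) z by blast
    ultimately have "(d z - Phi_S (sym_vars 3) 2 (sdet * z)) + (Phi_S (sym_vars 3) 2 (sdet * z) - G) \<in> ?I2"
      by (intro hyper_ideal_add)
    then have "d z - G \<in> ?I2" by simp
    then obtain x y where "x \<in> ?S" "y \<in> ?S" "d z - G = sdet * x + of_int 2 * y" by (rule hyper_idealE)
    then show ?thesis unfolding two by (intro exI[of _ x] exI[of _ y]) (simp add: algebra_simps)
  qed
  \<comment> \<open>\<open>sdet * ?M\<close> with
    \<open>?M = (a * b * c) ^ (q - 1) * d * e * h\<close> splits as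
    \<open>a ^ q * ca + b ^ q * cb + c ^ q * cc + 2 * W\<close>. The factor \<open>d * e * h\<close>
    makes the traces nonzero. The term from \<open>a * b * c\<close> is joined to \<open>ca\<close>,
    so that the trace of \<open>sdet * ca\<close> contains the square of
    \<open>b * c - d ^ 2\<close>.\<close>
  define ca where "ca = sterm 1 0 (2 * u + 2) (2 * u + 2) 1 1 1 + sterm (-1) 0 (2 * u + 1) (2 * u + 1) 3 1 1"
  define cb where "cb = sterm (-1) (2 * u + 1) 0 (2 * u + 1) 1 3 1"
  define cc where "cc = sterm (-1) (2 * u + 1) (2 * u + 1) 0 1 1 3"
  define W where "W = sterm 1 (2 * u + 1) (2 * u + 1) (2 * u + 1) 2 2 2"
  have cS: "ca \<in> ?S" "cb \<in> ?S" "cc \<in> ?S" "W \<in> ?S"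
    unfolding ca_def cb_def cc_def W_def by (intro S sterm_carrier)+
  have Ga: "pcong 2 (Phi_S (sym_vars 3) 2 (sdet * ca)) (?b ^ (2 * u) * ?c ^ (2 * u) * (?b * ?c - ?d ^ 2) ^ 2)"
  proof -
    have c1: "[1 * int ((0 + 1) * (2 * u + 2 + 1) * (2 * u + 2 + 1) * 1 * 1 * 1) = 1] (mod 2)"
      "[1 * int ((0 + 1) * (2 * u + 2) * (2 * u + 2) * 1 * 1 * 1) = 0] (mod 2)"
      "[1 * int (0 * (2 * u + 2 + 1) * (2 * u + 2) * 1 * 1 * 1) = 0] (mod 2)"
      "[- 1 * int ((0 + 1) * (2 * u + 1 + 1) * (2 * u + 1 + 1) * 3 * 1 * 1) = 0] (mod 2)"
      "[- 1 * int ((0 + 1) * (2 * u + 1) * (2 * u + 1) * 3 * 1 * 1) = 1] (mod 2)"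
      "[- 1 * int (0 * (2 * u + 1 + 1) * (2 * u + 1) * 3 * 1 * 1) = 0] (mod 2)"
      "[1 * int (0 * (2 * u + 2) * (2 * u + 2 + 1) * 1 * 1 * 1) = 0] (mod 2)"
      "[- 1 * int (0 * (2 * u + 1) * (2 * u + 1 + 1) * 3 * 1 * 1) = 0] (mod 2)"
      by (auto simp: cong_iff_dvd_diff)
    have "pcong 2 (Phi_S (sym_vars 3) 2 (sdet * sterm 1 0 (2 * u + 2) (2 * u + 2) 1 1 1))
        (sterm 1 0 (2 * u + 2) (2 * u + 2) (1 - 1) (1 - 1) (1 - 1) + sterm 0 0 (2 * u + 2 - 1) (2 * u + 2 - 1) (1 + 1) (1 - 1) (1 - 1)
          + sterm 0 (0 - 1) (2 * u + 2) (2 * u + 2 - 1) (1 - 1) (1 + 1) (1 - 1) + sterm 0 (0 - 1) (2 * u + 2 - 1) (2 * u + 2) (1 - 1) (1 - 1) (1 + 1))"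
      by (rule pcong_trans[OF Phi_S_sdet_sterm]) (intro pcong_add pcong_sterm c1)
    moreover have "pcong 2 (Phi_S (sym_vars 3) 2 (sdet * sterm (- 1) 0 (2 * u + 1) (2 * u + 1) 3 1 1))
        (sterm 0 0 (2 * u + 1) (2 * u + 1) (3 - 1) (1 - 1) (1 - 1) + sterm 1 0 (2 * u + 1 - 1) (2 * u + 1 - 1) (3 + 1) (1 - 1) (1 - 1)
          + sterm 0 (0 - 1) (2 * u + 1) (2 * u + 1 - 1) (3 - 1) (1 + 1) (1 - 1) + sterm 0 (0 - 1) (2 * u + 1 - 1) (2 * u + 1) (3 - 1) (1 - 1) (1 + 1))"
      by (rule pcong_trans[OF Phi_S_sdet_sterm]) (intro pcong_add pcong_sterm c1)
    ultimately have "pcong 2 (Phi_S (sym_vars 3) 2 (sdet * ca)) (sterm 1 0 (2 * u + 2) (2 * u + 2) 0 0 0 + sterm 1 0 (2 * u) (2 * u) 4 0 0)"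
      unfolding ca_def distrib_left Phi_S_add by (auto dest: pcong_add)
    moreover have "pcong 2 (sterm 1 0 (2 * u + 2) (2 * u + 2) 0 0 0 + sterm 1 0 (2 * u) (2 * u) 4 0 0)
        (?b ^ (2 * u) * ?c ^ (2 * u) * (?b * ?c - ?d ^ 2) ^ 2)"
    proof -
      have "sterm 1 0 (2 * u + 2) (2 * u + 2) 0 0 0 + sterm 1 0 (2 * u) (2 * u) 4 0 0
         - ?b ^ (2 * u) * ?c ^ (2 * u) * (?b * ?c - ?d ^ 2) ^ 2 = 2 * (?b ^ (2 * u) * ?c ^ (2 * u) * ?b * ?c * ?d ^ 2)"
        unfolding sterm_eq power_add by (simp add: algebra_simps power2_eq_square power4_eq_xxxx)
      then show ?thesis unfolding pcong_def by simp
    qed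
    ultimately show ?thesis by (rule pcong_trans)
  qed
  have Gb: "pcong 2 (Phi_S (sym_vars 3) 2 (sdet * cb)) (?a ^ (2 * u) * ?c ^ (2 * u) * (?e ^ 2) ^ 2)"
  proof -
    have c1: "[- 1 * int ((2 * u + 1 + 1) * (0 + 1) * (2 * u + 1 + 1) * 1 * 3 * 1) = 0] (mod 2)"
      "[- 1 * int ((2 * u + 1 + 1) * 0 * (2 * u + 1) * 1 * 3 * 1) = 0] (mod 2)"
      "[- 1 * int ((2 * u + 1) * (0 + 1) * (2 * u + 1) * 1 * 3 * 1) = 1] (mod 2)"
      "[- 1 * int ((2 * u + 1) * 0 * (2 * u + 1 + 1) * 1 * 3 * 1) = 0] (mod 2)"
      by (auto simp: cong_iff_dvd_diff)
    have "pcong 2 (Phi_S (sym_vars 3) 2 (sdet * cb))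
        (sterm 0 (2 * u + 1) 0 (2 * u + 1) (1 - 1) (3 - 1) (1 - 1) + sterm 0 (2 * u + 1) (0 - 1) (2 * u + 1 - 1) (1 + 1) (3 - 1) (1 - 1)
          + sterm 1 (2 * u + 1 - 1) 0 (2 * u + 1 - 1) (1 - 1) (3 + 1) (1 - 1) + sterm 0 (2 * u + 1 - 1) (0 - 1) (2 * u + 1) (1 - 1) (3 - 1) (1 + 1))"
      unfolding cb_def by (rule pcong_trans[OF Phi_S_sdet_sterm]) (intro pcong_add pcong_sterm c1)
    moreover have "sterm 1 (2 * u) 0 (2 * u) 0 4 0 = ?a ^ (2 * u) * ?c ^ (2 * u) * (?e ^ 2) ^ 2"
      unfolding sterm_eq by (simp add: power_mult[symmetric])
    ultimately show ?thesis by simp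
  qed
  have Gc: "pcong 2 (Phi_S (sym_vars 3) 2 (sdet * cc)) (?a ^ (2 * u) * ?b ^ (2 * u) * (?h ^ 2) ^ 2)"
  proof -
    have c1: "[- 1 * int ((2 * u + 1 + 1) * (2 * u + 1 + 1) * (0 + 1) * 1 * 1 * 3) = 0] (mod 2)"
      "[- 1 * int ((2 * u + 1 + 1) * (2 * u + 1) * 0 * 1 * 1 * 3) = 0] (mod 2)"
      "[- 1 * int ((2 * u + 1) * (2 * u + 1 + 1) * 0 * 1 * 1 * 3) = 0] (mod 2)"
      "[- 1 * int ((2 * u + 1) * (2 * u + 1) * (0 + 1) * 1 * 1 * 3) = 1] (mod 2)"
      by (auto simp: cong_iff_dvd_diff)
    have "pcong 2 (Phi_S (sym_vars 3) 2 (sdet * cc))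
        (sterm 0 (2 * u + 1) (2 * u + 1) 0 (1 - 1) (1 - 1) (3 - 1) + sterm 0 (2 * u + 1) (2 * u + 1 - 1) (0 - 1) (1 + 1) (1 - 1) (3 - 1)
          + sterm 0 (2 * u + 1 - 1) (2 * u + 1) (0 - 1) (1 - 1) (1 + 1) (3 - 1) + sterm 1 (2 * u + 1 - 1) (2 * u + 1 - 1) 0 (1 - 1) (1 - 1) (3 + 1))"
      unfolding cc_def by (rule pcong_trans[OF Phi_S_sdet_sterm]) (intro pcong_add pcong_sterm c1)
    moreover have "sterm 1 (2 * u) (2 * u) 0 0 0 4 = ?a ^ (2 * u) * ?b ^ (2 * u) * (?h ^ 2) ^ 2"
      unfolding sterm_eq by (simp add: power_mult[symmetric])
    ultimately show ?thesis by simp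
  qed
  \<comment> \<open>The remaining part is \<open>W + W\<close>, so \<open>d\<close> of it is twice
    \<open>d W\<close>; as the trace vanishes modulo 2, it contributes nothing modulo
    \<open>sdet\<close> and 4.\<close>
  have GW: "pcong 2 (Phi_S (sym_vars 3) 2 (sdet * W)) 0"
  proof -
    let ?v = "2 * u + 1"
    have c1: "[1 * int (x * y * z * 2 * 2 * 2) = 0] (mod 2)" for x y z by (auto simp: cong_0_iff)
    have "pcong 2 (Phi_S (sym_vars 3) 2 (sdet * W))
        (sterm 0 ?v ?v ?v (2 - 1) (2 - 1) (2 - 1) + sterm 0 ?v (?v - 1) (?v - 1) (2 + 1) (2 - 1) (2 - 1)
          + sterm 0 (?v - 1) ?v (?v - 1) (2 - 1) (2 + 1) (2 - 1) + sterm 0 (?v - 1) (?v - 1) ?v (2 - 1) (2 - 1) (2 + 1))"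
      unfolding W_def by (rule pcong_trans[OF Phi_S_sdet_sterm]) (intro pcong_add pcong_sterm c1)
    then show ?thesis by simp
  qed
  have GS: "?b ^ (2 * u) * ?c ^ (2 * u) * (?b * ?c - ?d ^ 2) ^ 2 \<in> ?S" "?a ^ (2 * u) * ?c ^ (2 * u) * (?e ^ 2) ^ 2 \<in> ?S"
    "?a ^ (2 * u) * ?b ^ (2 * u) * (?h ^ 2) ^ 2 \<in> ?S" by (intro S V)+
  obtain xa ea where ea: "xa \<in> ?S" "ea \<in> ?S" "d ca = ?b ^ (2 * u) * ?c ^ (2 * u) * (?b * ?c - ?d ^ 2) ^ 2 + sdet * xa + 2 * ea"
    using key[OF cS(1) GS(1) Ga] by blast
  obtain xb eb where eb: "xb \<in> ?S" "eb \<in> ?S" "d cb = ?a ^ (2 * u) * ?c ^ (2 * u) * (?e ^ 2) ^ 2 + sdet * xb + 2 * eb"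
    using key[OF cS(2) GS(2) Gb] by blast
  obtain xc ec where ec: "xc \<in> ?S" "ec \<in> ?S" "d cc = ?a ^ (2 * u) * ?b ^ (2 * u) * (?h ^ 2) ^ 2 + sdet * xc + 2 * ec"
    using key[OF cS(3) GS(3) Gc] by blast
  obtain xw ew where ew: "xw \<in> ?S" "ew \<in> ?S" "d W = 0 + sdet * xw + 2 * ew"
    using key[OF cS(4) _ GW] by auto
  let ?q = "2 * u + 2"
  let ?M = "sterm 1 (2 * u + 1) (2 * u + 1) (2 * u + 1) 1 1 1"
  let ?ta = "?a ^ ?q * ca" and ?tb = "?b ^ ?q * cb" and ?tc = "?c ^ ?q * cc"
  have T: "?ta \<in> ?S" "?tb \<in> ?S" "?tc \<in> ?S" by (intro S V cS)+
  have C: "?ta + (?tb + (?tc + (W + W))) = sdet * ?M"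
    unfolding ca_def cb_def cc_def W_def sdet_Var sterm_eq power_add
    by (simp add: algebra_simps power2_eq_square power3_eq_cube)
  have "sdet * ?M \<in> ?I4" by (rule hyper_idealI[of ?M _ 0]) (simp_all add: sdet_carrier)
  moreover have MS: "sdet * ?M \<in> ?S" by (intro S sdet_carrier sterm_carrier)
  ultimately have 0: "d (?ta + (?tb + (?tc + (W + W)))) \<in> ?I4" unfolding C using data(3) by blast
  have 1: "d (?ta + (?tb + (?tc + (W + W)))) - (d ?ta + d (?tb + (?tc + (W + W)))) \<in> ?I4"
    "d (?tb + (?tc + (W + W))) - (d ?tb + d (?tc + (W + W))) \<in> ?I4"
    "d (?tc + (W + W)) - (d ?tc + d (W + W)) \<in> ?I4" "d (W + W) - (d W + d W) \<in> ?I4"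
    by (intro bspec[OF bspec[OF data(2)]] S T cS)+
  have 2: "d ?ta - ?a ^ ?q * d ca \<in> ?I4" "d ?tb - ?b ^ ?q * d cb \<in> ?I4" "d ?tc - ?c ^ ?q * d cc \<in> ?I4"
    using data(4) cS V by blast+
  have 3: "d W + d W \<in> ?I4" unfolding ew(3)
    by (rule hyper_idealI[of "2 * xw" _ ew]) (simp_all add: ew S sdet_carrier algebra_simps)
  have "d (?ta + (?tb + (?tc + (W + W)))) - (d (?ta + (?tb + (?tc + (W + W)))) - (d ?ta + d (?tb + (?tc + (W + W)))))
    - (d (?tb + (?tc + (W + W))) - (d ?tb + d (?tc + (W + W)))) - (d (?tc + (W + W)) - (d ?tc + d (W + W)))
    - (d (W + W) - (d W + d W)) - (d W + d W) - (d ?ta - ?a ^ ?q * d ca) - (d ?tb - ?b ^ ?q * d cb) - (d ?tc - ?c ^ ?q * d cc) \<in> ?I4"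
    by (intro hyper_ideal_diff 0 1 2 3)
  then have 4: "?a ^ ?q * d ca + ?b ^ ?q * d cb + ?c ^ ?q * d cc \<in> ?I4" by (simp only: algebra_simps) simp
  let ?A = "?a ^ (2 * u)" and ?B = "?b ^ (2 * u)" and ?C = "?c ^ (2 * u)"
  let ?E = "?A * ?a ^ 2 * ea + ?B * ?b ^ 2 * eb + ?C * ?c ^ 2 * ec"
  let ?Cr = "?a * (?b * ?c - ?d ^ 2) * (?b * ?e ^ 2 + ?c * ?h ^ 2) - ?b * ?c * ?e ^ 2 * ?h ^ 2"
  let ?r = "?A * ?a ^ 2 * xa + ?B * ?b ^ 2 * xb + ?C * ?c ^ 2 * xc + ?A * ?B * ?C * (sdet - 4 * ?d * ?e * ?h)"
  let ?s = "?A * ?B * ?C * (?d * ?e * ?h) ^ 2"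
  let ?x = "?A * ?B * ?C * ?Cr + ?A * ?a ^ 2 * ea + ?B * ?b ^ 2 * eb + ?C * ?c ^ 2 * ec"
  have rs: "?r \<in> ?S" "?s \<in> ?S" "?x \<in> ?S" by (intro S V ea eb ec sdet_carrier numS)+
  \<comment> \<open>The right side lies in the ideal of \<open>sdet\<close> and 4. Cancelling 2
    leaves the cross term modulo 2, \<open>sdet\<close> and \<open>q\<close>-th powers of the
    diagonal variables, which the functional refutes.\<close>
  have "2 * ?x = ?a ^ ?q * d ca + ?b ^ ?q * d cb + ?c ^ ?q * d cc - sdet * ?r - 4 * ?s"
    unfolding ea(3) eb(3) ec(3) power_add by (rule sym_cross_identity[OF sdet_Var])
  moreover have "sdet * ?r \<in> ?I4" by (rule hyper_idealI[of ?r _ 0]) (use rs in simp_all)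
  moreover have "4 * ?s \<in> ?I4" by (rule hyper_idealI[of 0 _ ?s]) (use rs in simp_all)
  ultimately have "of_int 2 * ?x \<in> hyper_ideal (sym_vars 3) sdet (2 ^ 2)"
    unfolding two p4 using 4 by (simp only: hyper_ideal_diff)
  moreover have p2: "prime (2::int)" by simp
  ultimately have "?x \<in> ?I2" using not_prime_dvd_sdet[OF p2] sdet_carrier rs(3) hyper_ideal_cancel by blast
  then obtain \<alpha> \<beta> where ab: "?x = sdet * \<alpha> + of_int 2 * \<beta>" by (rule hyper_idealE)
  have Cr: "?A * ?B * ?C * ?Cr = sym_cross * sterm 1 (2 * u) (2 * u) (2 * u) 0 0 0"
    unfolding sym_cross_def sterm_eq by (simp add: algebra_simps power2_eq_square)
  have z: "v \<in> {(0, 0), (1, 1), (2, 2)} \<Longrightarrow> sym_functional u (Var v ^ (2 * u) * Var v ^ 2 * c) = 0" for v c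
    using sym_functional_Var[of v u c] unfolding power_add .
  have "sym_functional u ?x = sym_functional u (sym_cross * sterm 1 (2 * u) (2 * u) (2 * u) 0 0 0)"
    unfolding Cr sym_functional_add by (simp add: z del: One_nat_def)
  moreover have "even (sym_functional u ?x)"
    unfolding ab sym_functional_add sym_functional_of_int using sym_functional_sdet[OF u] by simp
  ultimately show False using sym_functional_cross[OF u] by simp
qed

section \<open>Substitution homomorphisms\<close>

lemma prod_Var_power:
  "finite A \<Longrightarrow> (\<Prod>v\<in>A. Var v ^ k v) = Poly_Mapping.single (\<Sum>v\<in>A. Poly_Mapping.single v (k v)) 1"
  by (induction A rule: finite_induct) (auto simp: Var_power mult_single)

lemma of_int_mult_single: "of_int c * Poly_Mapping.single (m::mon) (d::int) = Poly_Mapping.single m (c * d)"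
  by (rule poly_mapping_eqI) (simp only: lookup_of_int_mult, simp add: lookup_single when_def)

lemma single_eq_prod:
  "Poly_Mapping.single m c = of_int c * (\<Prod>v\<in>Poly_Mapping.keys m. Var v ^ Poly_Mapping.lookup m v)"
proof -
  have "(\<Sum>v\<in>Poly_Mapping.keys m. Poly_Mapping.single v (Poly_Mapping.lookup m v)) = m"
    by (rule poly_mapping_eqI) (simp add: lookup_sum_singles in_keys_iff)
  then show ?thesis by (simp add: prod_Var_power of_int_mult_single)
qed

lemma poly_carrier_induct [consumes 1, case_names of_int add Var]:
  assumes x: "x \<in> poly_carrier V" and c: "\<And>c. P (of_int c)"
    and add: "\<And>x y. x \<in> poly_carrier V \<Longrightarrow> y \<in> poly_carrier V \<Longrightarrow> P x \<Longrightarrow> P y \<Longrightarrow> P (x + y)"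
    and mult: "\<And>v x. v \<in> V \<Longrightarrow> x \<in> poly_carrier V \<Longrightarrow> P x \<Longrightarrow> P (Var v * x)"
  shows "P x"
proof -
  have single: "P (Poly_Mapping.single m c)" if m: "Poly_Mapping.keys m \<subseteq> V" for m c
  proof -
    have power: "P (Var v ^ n * y) \<and> Var v ^ n * y \<in> poly_carrier V" if "v \<in> V" "y \<in> poly_carrier V" "P y" for v n y
      by (induction n) (use that mult in \<open>auto simp: mult.assoc\<close>)
    have "P ((\<Prod>v\<in>A. Var v ^ Poly_Mapping.lookup m v) * of_int c) \<and> (\<Prod>v\<in>A. Var v ^ Poly_Mapping.lookup m v) * of_int c \<in> poly_carrier V"
      if "finite A" "A \<subseteq> V" for A
      using that
    proof (induction A rule: finite_induct)
      case empty
      then show ?case by (simp add: c)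
    next
      case (insert v A)
      then show ?case using power[of v "(\<Prod>v\<in>A. Var v ^ Poly_Mapping.lookup m v) * of_int c" "Poly_Mapping.lookup m v"] by (simp add: mult.assoc)
    qed
    from this[OF finite_keys m] show ?thesis unfolding single_eq_prod by (simp add: mult.commute)
  qed
  have "P (sum (\<lambda>m. Poly_Mapping.single m (Poly_Mapping.lookup x m)) A) \<and> sum (\<lambda>m. Poly_Mapping.single m (Poly_Mapping.lookup x m)) A \<in> poly_carrier V"
    if "finite A" "A \<subseteq> Poly_Mapping.keys x" for A
    using that
  proof (induction A rule: finite_induct)
    case empty
    then show ?case using c[of 0] by simp
  next
    case (insert m A)
    then have m: "Poly_Mapping.keys m \<subseteq> V" using x by (auto simp: poly_carrier_def)
    show ?case using insert single[OF m] poly_carrier_single[OF m] by (simp add: add)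
  qed
  from this[OF finite_keys order_refl] show ?thesis by (simp flip: poly_sum_monomials)
qed

lemma poly_carrier_UNIV [simp]: "x \<in> poly_carrier UNIV" by (simp add: poly_carrier_def)

definition mon_ev :: "(nat \<times> nat \<Rightarrow> ipoly) \<Rightarrow> mon \<Rightarrow> ipoly" where
  "mon_ev \<phi> m = (\<Prod>v\<in>Poly_Mapping.keys m. \<phi> v ^ Poly_Mapping.lookup m v)"

definition ev :: "(nat \<times> nat \<Rightarrow> ipoly) \<Rightarrow> ipoly \<Rightarrow> ipoly" where
  "ev \<phi> = frag_extend (mon_ev \<phi>)"

lemma mon_ev_superset: "finite A \<Longrightarrow> Poly_Mapping.keys m \<subseteq> A \<Longrightarrow> mon_ev \<phi> m = (\<Prod>v\<in>A. \<phi> v ^ Poly_Mapping.lookup m v)"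
  unfolding mon_ev_def by (rule prod.mono_neutral_left) (auto simp: in_keys_iff)

lemma mon_ev_add: "mon_ev \<phi> (m + n) = mon_ev \<phi> m * mon_ev \<phi> n"
proof -
  let ?A = "Poly_Mapping.keys m \<union> Poly_Mapping.keys n"
  have "Poly_Mapping.keys (m + n) \<subseteq> ?A" by (rule Poly_Mapping.keys_add)
  then show ?thesis by (simp add: mon_ev_superset[of ?A] lookup_add power_add prod.distrib)
qed

lemma ev_add: "ev \<phi> (x + y) = ev \<phi> x + ev \<phi> y"
  and ev_diff: "ev \<phi> (x - y) = ev \<phi> x - ev \<phi> y"
  and ev_minus: "ev \<phi> (- x) = - ev \<phi> x"
  and ev_zero [simp]: "ev \<phi> 0 = 0"
  unfolding ev_def by (simp_all add: frag_extend_add frag_extend_diff frag_extend_minus)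

lemma frag_cmul_eq: "frag_cmul c (y::ipoly) = of_int c * y" by (rule poly_mapping_eqI) simp

lemma ev_single: "ev \<phi> (Poly_Mapping.single m c) = of_int c * mon_ev \<phi> m"
  by (cases "c = 0") (simp_all add: ev_def frag_extend_def frag_cmul_eq)

lemma ev_sum: "ev \<phi> (sum g I) = (\<Sum>i\<in>I. ev \<phi> (g i))"
  by (induction I rule: infinite_finite_induct) (auto simp: ev_add)

lemma ev_Var [simp]: "ev \<phi> (Var v) = \<phi> v"
  by (simp add: Var_def ev_single mon_ev_def)

lemma ev_mult: "ev \<phi> (x * y) = ev \<phi> x * ev \<phi> y"
proof -
  have 1: "ev \<phi> (Poly_Mapping.single m c * Poly_Mapping.single n d) = ev \<phi> (Poly_Mapping.single m c) * ev \<phi> (Poly_Mapping.single n d)" for m c n d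
    by (simp add: mult_single ev_single mon_ev_add)
  have 2: "ev \<phi> (Poly_Mapping.single m c * y) = ev \<phi> (Poly_Mapping.single m c) * ev \<phi> y" for m c
    by (subst (1 2) poly_sum_monomials[of y]) (simp only: sum_distrib_left ev_sum 1)
  show ?thesis by (subst (1 2) poly_sum_monomials[of x]) (simp only: sum_distrib_right ev_sum 2)
qed

lemma ev_of_int [simp]: "ev \<phi> (of_int c) = of_int c"
proof -
  have "of_int c = Poly_Mapping.single (0::mon) c" using of_int_mult_single[of c 0 1] by (simp add: single_one)
  then show ?thesis by (simp add: ev_single mon_ev_def)
qed

lemma ev_one [simp]: "ev \<phi> 1 = 1" using ev_of_int[of \<phi> 1] by simp

lemma ev_numeral [simp]: "ev \<phi> (numeral n) = numeral n" using ev_of_int[of \<phi> "numeral n"] by simp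

lemma ev_power: "ev \<phi> (x ^ n) = ev \<phi> x ^ n" by (induction n) (auto simp: ev_mult)

lemmas ev_simps = ev_add ev_diff ev_minus ev_mult ev_power

lemma ev_comp: "ev \<psi> (ev \<phi> x) = ev (\<lambda>v. ev \<psi> (\<phi> v)) x"
proof -
  have "x \<in> poly_carrier UNIV" by simp
  then show ?thesis by (induction x rule: poly_carrier_induct) (auto simp: ev_simps)
qed

lemma ev_cong:
  assumes "x \<in> poly_carrier V" "\<And>v. v \<in> V \<Longrightarrow> \<phi> v = \<psi> v"
  shows "ev \<phi> x = ev \<psi> x"
  using assms(1) by (induction x rule: poly_carrier_induct) (auto simp: ev_simps assms(2))

lemma ev_ident [simp]: "ev Var x = x"
proof -
  have "x \<in> poly_carrier UNIV" by simp
  then show ?thesis by (induction x rule: poly_carrier_induct) (auto simp: ev_simps)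
qed

lemma ev_carrier:
  assumes "x \<in> poly_carrier V" "\<And>v. v \<in> V \<Longrightarrow> \<phi> v \<in> poly_carrier W"
  shows "ev \<phi> x \<in> poly_carrier W"
  using assms(1) by (induction x rule: poly_carrier_induct) (auto simp: ev_simps assms(2))

lemma ev_dvd: "of_int p dvd x \<Longrightarrow> of_int p dvd ev \<phi> x"
  by (auto elim!: dvdE simp: ev_mult)

lemma pcong_ev: "pcong p x y \<Longrightarrow> pcong p (ev \<phi> x) (ev \<phi> y)"
  unfolding pcong_def by (simp only: ev_diff[symmetric] ev_dvd)

definition kill :: "nat \<times> nat \<Rightarrow> ipoly \<Rightarrow> ipoly" where
  "kill v = ev (Var(v := 0))"

lemma kill_carrier: "x \<in> poly_carrier V \<Longrightarrow> kill v x \<in> poly_carrier V"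
  unfolding kill_def by (rule ev_carrier) auto

lemma kill_decomp:
  assumes "x \<in> poly_carrier V" "v \<in> V"
  shows "\<exists>y\<in>poly_carrier V. x = kill v x + Var v * y"
  using assms(1)
proof (induction x rule: poly_carrier_induct)
  case (of_int c)
  show ?case by (intro bexI[of _ 0]) (auto simp: kill_def)
next
  case (add x y)
  then obtain x' y' where "x' \<in> poly_carrier V" "y' \<in> poly_carrier V" "x = kill v x + Var v * x'" "y = kill v y + Var v * y'" by blast
  then show ?case by (intro bexI[of _ "x' + y'"]) (simp_all add: kill_def ev_simps algebra_simps)
next
  case (Var w x)
  then obtain x' where x': "x' \<in> poly_carrier V" "x = kill v x + Var v * x'" by blast
  show ?case
  proof (cases "w = v")
    case True
    then show ?thesis using Var(2) by (intro bexI[of _ x]) (simp_all add: kill_def ev_simps)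
  next
    case False
    have "Var w * x = Var w * kill v x + Var v * (Var w * x')" using x'(2) by (metis (no_types) distrib_left mult.left_commute)
    also have "Var w * kill v x = kill v (Var w * x)" using False by (simp add: kill_def ev_simps)
    finally show ?thesis using x'(1) Var(1) by (intro bexI[of _ "Var w * x'"] poly_carrier_mult poly_carrier_Var)
  qed
qed

section \<open>Coprimality modulo p\<close>

text \<open>Modulo \<open>p\<close>, \<open>E\<close> is a nonzerodivisor on the quotient by
  \<open>D\<close>. This form of coprimality gives the divisibility used in the extension step
  without appeal to unique factorization.\<close>

definition cop :: "int \<Rightarrow> ipoly \<Rightarrow> ipoly \<Rightarrow> bool" where
  "cop p D E \<longleftrightarrow> (\<forall>M N. pcong p (M * E) (D * N) \<longrightarrow> (\<exists>Q. pcong p M (D * Q)))"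

lemma not_dvd_Var: "p = 0 \<or> prime p \<Longrightarrow> \<not> of_int p dvd Var v"
proof
  assume p: "p = 0 \<or> prime p" and "of_int p dvd Var v"
  then have "p dvd Poly_Mapping.lookup (Var v) (Poly_Mapping.single v 1)" unfolding of_int_dvd_poly_iff by blast
  then have "p dvd 1" by (simp add: Var_def)
  then show False using p not_prime_unit by auto
qed

text \<open>Setting the variable to 0 leaves a product congruent to 0 in which the factor from
  \<open>D\<close> is nonzero modulo \<open>p\<close>; hence \<open>M\<close> becomes 0 at
  \<open>v = 0\<close>, that is, divisible by \<open>Var v\<close>.\<close>

lemma cop_kill:
  assumes p: "p = 0 \<or> prime p" and D: "\<not> of_int p dvd kill v D"
  shows "cop p (Var v) D"
  unfolding cop_def
proof (intro allI impI)
  fix M N assume "pcong p (M * D) (Var v * N)"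
  then have "pcong p (kill v (M * D)) (kill v (Var v * N))" unfolding kill_def by (rule pcong_ev)
  then have "of_int p dvd kill v M * kill v D" by (simp add: kill_def ev_simps pcong_0_iff)
  then have M: "of_int p dvd kill v M" using of_int_dvd_multD[OF p] D by blast
  obtain y where "M = kill v M + Var v * y" using kill_decomp[of M UNIV v] by auto
  then have "M - Var v * y = kill v M" by (metis add_diff_cancel_right')
  then show "\<exists>Q. pcong p M (Var v * Q)" unfolding pcong_def using M by metis
qed

lemma cop_sym:
  assumes p: "p = 0 \<or> prime p" and c: "cop p D E" and D: "\<not> of_int p dvd D"
  shows "cop p E D"
  unfolding cop_def
proof (intro allI impI)
  fix M N assume *: "pcong p (M * D) (E * N)"
  then have "pcong p (N * E) (D * M)" by (simp add: mult.commute pcong_sym)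
  then obtain Q where Q: "pcong p N (D * Q)" using c unfolding cop_def by blast
  have "pcong p (M * D) (E * (D * Q))" by (rule pcong_trans[OF *]) (intro pcong_mult pcong_refl Q)
  then have "pcong p (D * M) (D * (E * Q))" by (simp add: ac_simps)
  then show "\<exists>Q. pcong p M (E * Q)" using pcong_cancel[OF p _ D] by blast
qed

lemma cop_mult_right:
  assumes "cop p D E" "cop p D F"
  shows "cop p D (E * F)"
  unfolding cop_def
proof (intro allI impI)
  fix M N assume "pcong p (M * (E * F)) (D * N)"
  then have "pcong p (M * E * F) (D * N)" by (simp add: mult.assoc)
  then obtain Q where "pcong p (M * E) (D * Q)" using assms(2) unfolding cop_def by blast
  then show "\<exists>Q. pcong p M (D * Q)" using assms(1) unfolding cop_def by blast
qed

lemma cop_one_right: "cop p D 1" unfolding cop_def by auto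

lemma cop_power_right: "cop p D E \<Longrightarrow> cop p D (E ^ n)"
  by (induction n) (auto intro: cop_mult_right cop_one_right)

lemma cop_mult_left:
  assumes p: "p = 0 \<or> prime p" and D: "\<not> of_int p dvd D" and c: "cop p D F" "cop p E F"
  shows "cop p (D * E) F"
  unfolding cop_def
proof (intro allI impI)
  fix M N assume *: "pcong p (M * F) (D * E * N)"
  then have "pcong p (M * F) (D * (E * N))" by (simp add: mult.assoc)
  then obtain Q where Q: "pcong p M (D * Q)" using c(1) unfolding cop_def by blast
  have "pcong p (D * Q * F) (D * E * N)" by (rule pcong_trans[OF _ *]) (intro pcong_mult pcong_refl pcong_sym[OF Q])
  then have "pcong p (D * (Q * F)) (D * (E * N))" by (simp add: ac_simps)
  then have "pcong p (Q * F) (E * N)" using pcong_cancel[OF p _ D] by blast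
  then obtain Q' where "pcong p Q (E * Q')" using c(2) unfolding cop_def by blast
  then have "pcong p (D * Q) (D * (E * Q'))" by (intro pcong_mult pcong_refl)
  then have "pcong p M (D * (E * Q'))" by (rule pcong_trans[OF Q])
  then show "\<exists>Q. pcong p M (D * E * Q)" by (auto simp: mult.assoc)
qed

lemma cop_power_left:
  assumes p: "p = 0 \<or> prime p" and D: "\<not> of_int p dvd D" and c: "cop p D F"
  shows "cop p (D ^ n) F"
proof (induction n)
  case 0
  show ?case unfolding cop_def by (auto intro: pcong_refl)
next
  case (Suc n)
  show ?case unfolding power_Suc by (rule cop_mult_left[OF p D c Suc])
qed

section \<open>The parametrization of the symmetric hypersurface and its kernel\<close>

text \<open>\<open>Var (0, i)\<close> plays u_i and \<open>Var (1, i)\<close> plays v_i. The image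
  of the generic symmetric matrix is u v^T + v u^T, of rank at most 2; its diagonal entries are
  \<open>2 * u_i * v_i\<close>.\<close>

definition sym_iota :: "ipoly \<Rightarrow> ipoly" where
  "sym_iota = ev (\<lambda>(i, j). Var (0, i) * Var (1, j) + Var (0, j) * Var (1, i))"

text \<open>Sets v_0 = 1 and shifts u_1, u_2 so that the entries x_01 and x_02 become free
  variables, while x_00 becomes \<open>2 * u_0\<close>. Only the three entries not in row 0 remain
  complicated.\<close>

definition chart :: "nat \<times> nat \<Rightarrow> ipoly" where
  "chart v = (if v = (0, 1) then Var (0, 1) - Var (0, 0) * Var (1, 1)
     else if v = (0, 2) then Var (0, 2) - Var (0, 0) * Var (1, 2)
     else if v = (1, 0) then 1 else Var v)"

definition sym_chart :: "ipoly \<Rightarrow> ipoly" where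
  "sym_chart x = ev chart (sym_iota x)"

lemma sym_iota_sdet: "sym_iota sdet = 0"
  unfolding sdet_Var sym_iota_def by (simp add: ev_simps algebra_simps power2_eq_square)

lemma sym_chart_sdet: "sym_chart sdet = 0" by (simp add: sym_chart_def sym_iota_sdet)

lemma sym_iota_simps:
  "sym_iota (x + y) = sym_iota x + sym_iota y" "sym_iota (x - y) = sym_iota x - sym_iota y"
  "sym_iota (x * y) = sym_iota x * sym_iota y" "sym_iota (x ^ n) = sym_iota x ^ n"
  "sym_iota (of_int c) = of_int c" "sym_iota (numeral k) = numeral k" "sym_iota 1 = 1" "sym_iota 0 = 0"
  "sym_iota (Var (i, j)) = Var (0, i) * Var (1, j) + Var (0, j) * Var (1, i)"
  by (simp_all add: sym_iota_def ev_simps)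

lemma sym_chart_simps:
  "sym_chart (x + y) = sym_chart x + sym_chart y" "sym_chart (x * y) = sym_chart x * sym_chart y"
  "sym_chart (x ^ n) = sym_chart x ^ n" "sym_chart (of_int c) = of_int c"
  by (simp_all add: sym_chart_def sym_iota_simps ev_simps)

text \<open>The degree in v_1 and v_2. In the chart the entries x_11, x_12, x_22 have as highest
  parts -2 times \<open>u_0 * v_1 ^ 2\<close>, \<open>u_0 * v_1 * v_2\<close> and
  \<open>u_0 * v_2 ^ 2\<close>.\<close>

definition vdeg :: "mon \<Rightarrow> nat" where
  "vdeg m = Poly_Mapping.lookup m (1, 1) + Poly_Mapping.lookup m (1, 2)"

lemma vdeg_smon [simp]: "vdeg (smon i j k l m n) = j + l"
  by (simp add: vdeg_def lookup_smon)

definition leads :: "ipoly \<Rightarrow> int \<Rightarrow> mon \<Rightarrow> bool" where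
  "leads X c x \<longleftrightarrow> (\<forall>m\<in>Poly_Mapping.keys (X - Poly_Mapping.single x c). vdeg m < vdeg x)"

lemma vdeg_add: "vdeg (m + n) = vdeg m + vdeg n" by (simp add: vdeg_def lookup_add)

lemma leads_mult:
  assumes "leads X c x" "leads Y d y"
  shows "leads (X * Y) (c * d) (x + y)"
  unfolding leads_def
proof
  fix m assume m: "m \<in> Poly_Mapping.keys (X * Y - Poly_Mapping.single (x + y) (c * d))"
  define A where "A = X - Poly_Mapping.single x c"
  define B where "B = Y - Poly_Mapping.single y d"
  have "X * Y - Poly_Mapping.single (x + y) (c * d) = A * B + (Poly_Mapping.single x c * B + A * Poly_Mapping.single y d)"
    unfolding A_def B_def by (simp add: mult_single[symmetric] algebra_simps)
  then have "m \<in> Poly_Mapping.keys (A * B) \<union> (Poly_Mapping.keys (Poly_Mapping.single x c * B) \<union> Poly_Mapping.keys (A * Poly_Mapping.single y d))"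
    using m subsetD[OF Poly_Mapping.keys_add, of m "A * B" "Poly_Mapping.single x c * B + A * Poly_Mapping.single y d"]
      subsetD[OF Poly_Mapping.keys_add, of m "Poly_Mapping.single x c * B" "A * Poly_Mapping.single y d"] by (simp only: Un_iff) blast
  moreover have "\<exists>k l. k \<in> Poly_Mapping.keys P \<and> l \<in> Poly_Mapping.keys Q \<and> m = k + l" if "m \<in> Poly_Mapping.keys (P * Q)" for P Q :: ipoly
    using subsetD[OF Poly_Mapping.keys_mult that] by blast
  ultimately obtain k l where kl: "m = k + l" "k \<in> Poly_Mapping.keys A \<and> l \<in> Poly_Mapping.keys B \<or> k = x \<and> l \<in> Poly_Mapping.keys B \<or> k \<in> Poly_Mapping.keys A \<and> l = y"
    by (elim UnE) (fastforce split: if_splits)+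
  have "vdeg k < vdeg x" if "k \<in> Poly_Mapping.keys A" for k using assms(1) that unfolding leads_def A_def by blast
  moreover have "vdeg l < vdeg y" if "l \<in> Poly_Mapping.keys B" for l using assms(2) that unfolding leads_def B_def by blast
  ultimately show "vdeg m < vdeg (x + y)" using kl by (auto simp: vdeg_add intro: add_strict_mono)
qed

lemma leads_power:
  assumes "leads X c (smon i j k l m n)"
  shows "leads (X ^ r) (c ^ r) (smon (r * i) (r * j) (r * k) (r * l) (r * m) (r * n))"
proof (induction r)
  case 0
  have "Poly_Mapping.single (smon 0 0 0 0 0 0) (1::int) = 1" by (simp add: smon_def single_one)
  then show ?case by (simp add: leads_def)
next
  case (Suc r)
  show ?case using leads_mult[OF assms Suc] by (simp add: smon_add)
qed

lemma leads_sterm: "leads (sterm c i j k l m n) c (smon i j k l m n)"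
  by (simp add: leads_def sterm_def)

lemma leads_add:
  assumes "leads X c x" "\<And>m. m \<in> Poly_Mapping.keys Y \<Longrightarrow> vdeg m < vdeg x"
  shows "leads (X + Y) c x"
proof -
  have eq: "X + Y - Poly_Mapping.single x c = (X - Poly_Mapping.single x c) + Y" by simp
  show ?thesis unfolding leads_def eq
    using assms Poly_Mapping.keys_add[of "X - Poly_Mapping.single x c" Y] unfolding leads_def by auto
qed

lemma keys_sterm: "m \<in> Poly_Mapping.keys (sterm c i j k l r n) \<Longrightarrow> m = smon i j k l r n"
  by (auto simp: sterm_def split: if_splits)

text \<open>On the chart side the slots of \<open>smon\<close> stand for u_0, v_1, an absent
  variable, v_2, u_2 and u_1. Apart from \<open>x\<close> the leading coefficient is a power of 2 up
  to sign, which is where odd primes enter.\<close>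

lemma leads_sym_chart:
  "leads (sym_chart (sterm x i j k l m n)) (x * (2 ^ i * (- 2) ^ j * (- 2) ^ k * (- 2) ^ l))
     (smon (i + j + k + l) (2 * j + l) 0 (2 * k + l) m n)"
proof -
  have V: "sym_chart (Var (0, 0)) = sterm 2 1 0 0 0 0 0"
    "sym_chart (Var (1, 1)) = sterm (- 2) 1 2 0 0 0 0 + sterm 2 0 1 0 0 0 1"
    "sym_chart (Var (2, 2)) = sterm (- 2) 1 0 0 2 0 0 + sterm 2 0 0 0 1 1 0"
    "sym_chart (Var (1, 2)) = sterm (- 2) 1 1 0 1 0 0 + (sterm 1 0 0 0 1 0 1 + sterm 1 0 1 0 0 1 0)"
    "sym_chart (Var (0, 2)) = sterm 1 0 0 0 0 1 0" "sym_chart (Var (0, 1)) = sterm 1 0 0 0 0 0 1"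
    unfolding sym_chart_def sym_iota_simps sterm_eq
    by (simp_all add: ev_simps chart_def algebra_simps power2_eq_square)
  have a: "leads (sym_chart (Var (0, 0))) 2 (smon 1 0 0 0 0 0)" unfolding V by (rule leads_sterm)
  have b: "leads (sym_chart (Var (1, 1))) (- 2) (smon 1 2 0 0 0 0)" unfolding V
    by (rule leads_add[OF leads_sterm]) (auto dest!: keys_sterm)
  have c: "leads (sym_chart (Var (2, 2))) (- 2) (smon 1 0 0 2 0 0)" unfolding V
    by (rule leads_add[OF leads_sterm]) (auto dest!: keys_sterm)
  have d: "leads (sym_chart (Var (1, 2))) (- 2) (smon 1 1 0 1 0 0)" unfolding V
    by (rule leads_add[OF leads_sterm]) (use Poly_Mapping.keys_add[of "sterm 1 0 0 0 1 0 1" "sterm 1 0 1 0 0 1 0"] in \<open>auto dest!: keys_sterm\<close>)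
  have e: "leads (sym_chart (Var (0, 2))) 1 (smon 0 0 0 0 1 0)" unfolding V by (rule leads_sterm)
  have h: "leads (sym_chart (Var (0, 1))) 1 (smon 0 0 0 0 0 1)" unfolding V by (rule leads_sterm)
  have x: "leads (of_int x) x (smon 0 0 0 0 0 0)"
    using leads_sterm[of x 0 0 0 0 0 0] by (simp add: sterm_eq)
  from leads_mult[OF x leads_mult[OF leads_mult[OF leads_mult[OF leads_mult[OF leads_mult[OF leads_power[OF a, of i] leads_power[OF b, of j]]
    leads_power[OF c, of k]] leads_power[OF d, of l]] leads_power[OF e, of m]] leads_power[OF h, of n]]]
  show ?thesis unfolding sterm_eq sym_chart_simps smon_add by (simp add: ac_simps)
qed

lemma mon_eq_smon:
  assumes "Poly_Mapping.keys m \<subseteq> sym_vars 3"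
  shows "m = smon (Poly_Mapping.lookup m (0, 0)) (Poly_Mapping.lookup m (1, 1)) (Poly_Mapping.lookup m (2, 2))
    (Poly_Mapping.lookup m (1, 2)) (Poly_Mapping.lookup m (0, 2)) (Poly_Mapping.lookup m (0, 1))"
proof (rule poly_mapping_eqI)
  fix v
  show "Poly_Mapping.lookup m v = Poly_Mapping.lookup (smon (Poly_Mapping.lookup m (0, 0)) (Poly_Mapping.lookup m (1, 1)) (Poly_Mapping.lookup m (2, 2))
    (Poly_Mapping.lookup m (1, 2)) (Poly_Mapping.lookup m (0, 2)) (Poly_Mapping.lookup m (0, 1))) v"
  proof (cases "v \<in> sym_vars 3")
    case True
    then show ?thesis unfolding sym_vars_3 by (elim insertE emptyE) (simp_all add: lookup_smon)
  next
    case False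
    then have "Poly_Mapping.lookup m v = 0" using assms by (auto simp: in_keys_iff)
    then show ?thesis using False unfolding sym_vars_3 lookup_smon by simp
  qed
qed

lemma dvd_two_power_cancel:
  assumes "P = 0 \<or> prime (P::int) \<and> P \<noteq> 2" "P dvd x * (2 ^ i * (- 2) ^ j * (- 2) ^ k * (- 2) ^ l)"
  shows "P dvd x"
proof (cases "P = 0")
  case False
  then have P: "prime P" "P \<noteq> 2" using assms by auto
  then have "\<not> P dvd 2" using primes_dvd_imp_eq[of P 2] by auto
  moreover from this have "\<not> P dvd - 2" by simp
  ultimately have "\<not> P dvd 2 ^ n" "\<not> P dvd (- 2) ^ n" for n using prime_dvd_power[OF P(1)] by blast+
  then show ?thesis using assms(2) by (simp only: prime_dvd_mult_iff[OF P(1)] simp_thms)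
qed (use assms in auto)

text \<open>If the exponent of x_12 is at most 1, the parity of the exponent of v_1 in the leading
  monomial reveals it, and then the whole monomial is determined. Hence terms of maximal leading
  degree with coefficient prime to \<open>P\<close> cannot cancel.\<close>

lemma sym_chart_independent:
  assumes P: "P = 0 \<or> prime P \<and> P \<noteq> 2" and r: "r \<in> poly_carrier (sym_vars 3)"
    and d: "\<And>m. m \<in> Poly_Mapping.keys r \<Longrightarrow> Poly_Mapping.lookup m (1, 2) \<le> 1"
    and dvd: "of_int P dvd sym_chart r"
  shows "of_int P dvd r"
proof (rule ccontr)
  assume neg: "\<not> of_int P dvd r"
  define K where "K = {m \<in> Poly_Mapping.keys r. \<not> P dvd Poly_Mapping.lookup r m}"
  define top where "top m = smon (Poly_Mapping.lookup m (0, 0) + Poly_Mapping.lookup m (1, 1) + Poly_Mapping.lookup m (2, 2) + Poly_Mapping.lookup m (1, 2))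
    (2 * Poly_Mapping.lookup m (1, 1) + Poly_Mapping.lookup m (1, 2)) 0 (2 * Poly_Mapping.lookup m (2, 2) + Poly_Mapping.lookup m (1, 2))
    (Poly_Mapping.lookup m (0, 2)) (Poly_Mapping.lookup m (0, 1))" for m :: mon
  define co :: "mon \<Rightarrow> int" where "co m = 2 ^ Poly_Mapping.lookup m (0, 0) * (- 2) ^ Poly_Mapping.lookup m (1, 1) * (- 2) ^ Poly_Mapping.lookup m (2, 2) * (- 2) ^ Poly_Mapping.lookup m (1, 2)" for m :: mon
  obtain m where "\<not> P dvd Poly_Mapping.lookup r m" using neg unfolding of_int_dvd_poly_iff by blast
  then have "m \<in> K" unfolding K_def by (simp add: in_keys_iff) (metis dvd_0_right)
  then have ne: "(\<lambda>m. vdeg (top m)) ` K \<noteq> {}" by blast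
  have fin: "finite ((\<lambda>m. vdeg (top m)) ` K)" unfolding K_def by simp
  have le: "vdeg (top m) \<le> Max ((\<lambda>m. vdeg (top m)) ` K)" if "m \<in> K" for m
    by (rule Max_ge[OF fin imageI[OF that]])
  have "Max ((\<lambda>m. vdeg (top m)) ` K) \<in> (\<lambda>m. vdeg (top m)) ` K" by (rule Max_in[OF fin ne])
  then obtain m0 where m0': "m0 \<in> K" "Max ((\<lambda>m. vdeg (top m)) ` K) = vdeg (top m0)" by (rule imageE)
  note m0 = m0'(1) le[unfolded m0'(2)]
  have kV: "Poly_Mapping.keys m \<subseteq> sym_vars 3" if "m \<in> Poly_Mapping.keys r" for m
    using r that by (auto simp: poly_carrier_def)
  let ?t = "\<lambda>m. sym_chart (Poly_Mapping.single m (Poly_Mapping.lookup r m))"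
  have lead: "leads (?t m) (Poly_Mapping.lookup r m * co m) (top m)" if "m \<in> Poly_Mapping.keys r" for m
  proof -
    let ?l = "Poly_Mapping.lookup m"
    have "leads (sym_chart (sterm (Poly_Mapping.lookup r m) (?l (0, 0)) (?l (1, 1)) (?l (2, 2)) (?l (1, 2)) (?l (0, 2)) (?l (0, 1))))
        (Poly_Mapping.lookup r m * co m) (top m)" unfolding co_def top_def by (rule leads_sym_chart)
    then show ?thesis unfolding sterm_def mon_eq_smon[OF kV[OF that], symmetric] .
  qed
  have inj: "m = m0" if "m \<in> Poly_Mapping.keys r" "top m = top m0" for m
  proof -
    have m0r: "m0 \<in> Poly_Mapping.keys r" using m0(1) unfolding K_def by simp
    have "Poly_Mapping.lookup (top m) v = Poly_Mapping.lookup (top m0) v" for v using that(2) by simp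
    from this[of "(0, 0)"] this[of "(1, 1)"] this[of "(1, 2)"] this[of "(0, 2)"] this[of "(0, 1)"]
    have eq: "Poly_Mapping.lookup m (0, 0) + Poly_Mapping.lookup m (1, 1) + Poly_Mapping.lookup m (2, 2) + Poly_Mapping.lookup m (1, 2)
        = Poly_Mapping.lookup m0 (0, 0) + Poly_Mapping.lookup m0 (1, 1) + Poly_Mapping.lookup m0 (2, 2) + Poly_Mapping.lookup m0 (1, 2)"
      "2 * Poly_Mapping.lookup m (1, 1) + Poly_Mapping.lookup m (1, 2) = 2 * Poly_Mapping.lookup m0 (1, 1) + Poly_Mapping.lookup m0 (1, 2)"
      "2 * Poly_Mapping.lookup m (2, 2) + Poly_Mapping.lookup m (1, 2) = 2 * Poly_Mapping.lookup m0 (2, 2) + Poly_Mapping.lookup m0 (1, 2)"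
      "Poly_Mapping.lookup m (0, 2) = Poly_Mapping.lookup m0 (0, 2)" "Poly_Mapping.lookup m (0, 1) = Poly_Mapping.lookup m0 (0, 1)"
      unfolding top_def lookup_smon by simp_all
    have "Poly_Mapping.lookup m (1, 2) = Poly_Mapping.lookup m0 (1, 2)"
      using eq(2) d[OF that(1)] d[OF m0r] by presburger
    moreover from this have "Poly_Mapping.lookup m (1, 1) = Poly_Mapping.lookup m0 (1, 1)" "Poly_Mapping.lookup m (2, 2) = Poly_Mapping.lookup m0 (2, 2)"
      using eq by linarith+
    ultimately have "Poly_Mapping.lookup m (0, 0) = Poly_Mapping.lookup m0 (0, 0)" using eq(1) by linarith
    note eqs = this \<open>Poly_Mapping.lookup m (1, 2) = _\<close> \<open>Poly_Mapping.lookup m (1, 1) = _\<close> \<open>Poly_Mapping.lookup m (2, 2) = _\<close> eq(4,5)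
    show ?thesis
      by (rule trans[OF mon_eq_smon[OF kV[OF that(1)]] trans[OF _ mon_eq_smon[OF kV[OF m0r], symmetric]]]) (simp only: eqs)
  qed
  \<comment> \<open>A term of \<open>K\<close> has leading degree at most that of \<open>m0\<close>,
    so it reaches the monomial \<open>top m0\<close> only as its own leading monomial; all other
    terms are divisible by \<open>P\<close>.\<close>
  have each: "P dvd Poly_Mapping.lookup (?t m) (top m0) - (if m = m0 then Poly_Mapping.lookup r m0 * co m0 else 0)"
    if m: "m \<in> Poly_Mapping.keys r" for m
  proof (cases "m \<in> K")
    case True
    have "top m0 \<notin> Poly_Mapping.keys (?t m - Poly_Mapping.single (top m) (Poly_Mapping.lookup r m * co m))"
      using lead[OF m] m0(2)[OF True] unfolding leads_def by (meson leD)
    then have "Poly_Mapping.lookup (?t m) (top m0) = (if top m = top m0 then Poly_Mapping.lookup r m * co m else 0)"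
      by (simp add: in_keys_iff lookup_minus lookup_single when_def split: if_splits)
    then show ?thesis using inj[OF m] by auto
  next
    case False
    then have "P dvd Poly_Mapping.lookup r m" "m \<noteq> m0" using m m0(1) unfolding K_def by auto
    moreover from this have "of_int P dvd Poly_Mapping.single m (Poly_Mapping.lookup r m)"
      unfolding of_int_dvd_poly_iff by (simp add: lookup_single when_def)
    then have "of_int P dvd ?t m" unfolding sym_chart_def sym_iota_def by (intro ev_dvd)
    ultimately show ?thesis unfolding of_int_dvd_poly_iff by simp
  qed
  have "sym_chart r = (\<Sum>m\<in>Poly_Mapping.keys r. ?t m)"
    unfolding sym_chart_def sym_iota_def by (subst (1) poly_sum_monomials) (simp only: ev_sum)
  then have "Poly_Mapping.lookup (sym_chart r) (top m0) = (\<Sum>m\<in>Poly_Mapping.keys r. Poly_Mapping.lookup (?t m) (top m0))"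
    by (simp add: lookup_sum)
  moreover have "P dvd (\<Sum>m\<in>Poly_Mapping.keys r. Poly_Mapping.lookup (?t m) (top m0) - (if m = m0 then Poly_Mapping.lookup r m0 * co m0 else 0))"
    by (intro dvd_sum each)
  moreover have "(\<Sum>m\<in>Poly_Mapping.keys r. if m = m0 then Poly_Mapping.lookup r m0 * co m0 else 0) = Poly_Mapping.lookup r m0 * co m0"
    using m0(1) unfolding K_def by (simp add: sum.delta)
  ultimately have "P dvd Poly_Mapping.lookup (sym_chart r) (top m0) - Poly_Mapping.lookup r m0 * co m0" by (simp add: sum_subtractf)
  moreover have "P dvd Poly_Mapping.lookup (sym_chart r) (top m0)" using dvd unfolding of_int_dvd_poly_iff by blast
  ultimately have "P dvd Poly_Mapping.lookup r m0 * co m0" by (simp add: dvd_diff_right_iff)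
  then have "P dvd Poly_Mapping.lookup r m0" unfolding co_def by (rule dvd_two_power_cancel[OF P])
  then show False using m0(1) unfolding K_def by simp
qed

text \<open>Pseudo-division by \<open>sdet\<close> as a quadratic polynomial in x_12, whose leading
  coefficient is -x_00.\<close>

lemma sdet_division:
  assumes "x \<in> poly_carrier (sym_vars 3)"
  shows "\<exists>N r s w. r \<in> poly_carrier (sym_vars 3 - {(1, 2)}) \<and> s \<in> poly_carrier (sym_vars 3 - {(1, 2)}) \<and> w \<in> poly_carrier (sym_vars 3)
    \<and> Var (0, 0) ^ N * x = r + s * Var (1, 2) + sdet * w"
  using assms
proof (induction x rule: poly_carrier_induct)
  case (of_int c)
  show ?case by (rule exI[of _ 0], rule exI[of _ "of_int c"], rule exI[of _ 0], rule exI[of _ 0]) simp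
next
  case (add x y)
  let ?a = "Var (0, 0)" and ?D = "poly_carrier (sym_vars 3 - {(1, 2)})" and ?S = "poly_carrier (sym_vars 3)"
  have a: "?a \<in> ?D" "?a \<in> ?S" by (simp_all add: sym_vars_3)
  obtain N r s w where 1: "r \<in> ?D" "s \<in> ?D" "w \<in> ?S" "?a ^ N * x = r + s * Var (1, 2) + sdet * w" using add by blast
  obtain N' r' s' w' where 2: "r' \<in> ?D" "s' \<in> ?D" "w' \<in> ?S" "?a ^ N' * y = r' + s' * Var (1, 2) + sdet * w'" using add by blast
  have "?a ^ (N + N') * (x + y) = ?a ^ N' * (?a ^ N * x) + ?a ^ N * (?a ^ N' * y)" by (simp add: power_add algebra_simps)
  also have "\<dots> = (?a ^ N' * r + ?a ^ N * r') + (?a ^ N' * s + ?a ^ N * s') * Var (1, 2) + sdet * (?a ^ N' * w + ?a ^ N * w')"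
    unfolding 1 2 by (simp add: algebra_simps)
  finally show ?case using 1 2 a
    by (intro exI[of _ "N + N'"] exI[of _ "?a ^ N' * r + ?a ^ N * r'"] exI[of _ "?a ^ N' * s + ?a ^ N * s'"] exI[of _ "?a ^ N' * w + ?a ^ N * w'"]) simp
next
  case (Var v x)
  let ?a = "Var (0, 0)" and ?b = "Var (1, 1)" and ?c = "Var (2, 2)" and ?d = "Var (1, 2)" and ?e = "Var (0, 2)" and ?h = "Var (0, 1)"
  let ?D = "poly_carrier (sym_vars 3 - {(1, 2)})" and ?S = "poly_carrier (sym_vars 3)"
  have a: "?a \<in> ?D" "?b \<in> ?D" "?c \<in> ?D" "?e \<in> ?D" "?h \<in> ?D" "?a \<in> ?S" "?d \<in> ?S" by (simp_all add: sym_vars_3)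
  have DS: "?D \<subseteq> ?S" by (auto simp: poly_carrier_def)
  obtain N r s w where 1: "r \<in> ?D" "s \<in> ?D" "w \<in> ?S" "?a ^ N * x = r + s * ?d + sdet * w" using Var by blast
  show ?case
  proof (cases "v = (1, 2)")
    case True
    \<comment> \<open>Multiplying the remainder by \<open>?d\<close> creates
      \<open>s * ?d ^ 2\<close>. One more factor \<open>?a\<close> allows \<open>?a * ?d ^ 2\<close>
      to be rewritten by means of \<open>sdet\<close>.\<close>
    let ?r = "s * (?a * ?b * ?c - ?b * ?e ^ 2 - ?c * ?h ^ 2)" and ?s = "?a * r + 2 * ?e * ?h * s" and ?w = "?a * ?d * w - s"
    have "?a ^ Suc N * (Var v * x) = ?a * ?d * (?a ^ N * x)" using True by (simp add: ac_simps)
    also have "\<dots> = ?r + ?s * ?d + sdet * ?w" unfolding 1 sdet_Var by (simp add: algebra_simps power2_eq_square)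
    finally have eq: "?a ^ Suc N * (Var v * x) = ?r + ?s * ?d + sdet * ?w" .
    have "?r \<in> ?D" "?s \<in> ?D" "?w \<in> ?S"
      using 1 a subsetD[OF DS 1(2)] by (auto intro!: poly_carrier_add poly_carrier_mult poly_carrier_diff poly_carrier_power)
    with eq show ?thesis by blast
  next
    case False
    then have v: "Var v \<in> ?D" "Var v \<in> ?S" using Var by simp_all
    have "?a ^ N * (Var v * x) = Var v * (?a ^ N * x)" by (simp add: ac_simps)
    also have "\<dots> = (Var v * r) + (Var v * s) * ?d + sdet * (Var v * w)" unfolding 1 by (simp add: algebra_simps)
    finally have eq: "?a ^ N * (Var v * x) = (Var v * r) + (Var v * s) * ?d + sdet * (Var v * w)" .
    have "Var v * r \<in> ?D" "Var v * s \<in> ?D" "Var v * w \<in> ?S" using 1 v by simp_all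
    with eq show ?thesis by blast
  qed
qed

text \<open>x_00 is a nonzerodivisor modulo \<open>sdet\<close> and \<open>P\<close>, since
  \<open>sdet\<close> stays nonzero modulo \<open>P\<close> when x_00 is set to 0: the term
  \<open>- b * e ^ 2\<close> survives.\<close>

lemma hyper_ideal_colon:
  assumes P: "P = 0 \<or> prime P" and x: "x \<in> poly_carrier (sym_vars 3)"
    and ax: "Var (0, 0) * x \<in> hyper_ideal (sym_vars 3) sdet P"
  shows "x \<in> hyper_ideal (sym_vars 3) sdet P"
proof -
  let ?S = "poly_carrier (sym_vars 3)" and ?a = "(0, 0) :: nat \<times> nat"
  have aV: "?a \<in> sym_vars 3" by (simp add: sym_vars_3)
  obtain g k where gk: "g \<in> ?S" "k \<in> ?S" "Var ?a * x = sdet * g + of_int P * k" using ax by (rule hyper_idealE)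
  have "kill ?a (Var ?a * x) = kill ?a sdet * kill ?a g + of_int P * kill ?a k" unfolding gk by (simp add: kill_def ev_simps)
  then have "kill ?a sdet * kill ?a g = - (of_int P * kill ?a k)" by (simp add: kill_def ev_simps eq_neg_iff_add_eq_0)
  then have "of_int P dvd kill ?a sdet * kill ?a g" by simp
  moreover have "\<not> of_int P dvd kill ?a sdet"
  proof
    assume "of_int P dvd kill ?a sdet"
    moreover have "kill ?a sdet = sterm 2 0 0 0 1 1 1 + sterm (- 1) 0 1 0 0 2 0 + sterm (- 1) 0 0 1 0 0 2"
      unfolding sdet_Var sterm_eq kill_def by (simp add: ev_simps mult.assoc)
    ultimately have "P dvd Poly_Mapping.lookup ((sterm 2 0 0 0 1 1 1 + sterm (- 1) 0 1 0 0 2 0 + sterm (- 1) 0 0 1 0 0 2) * 1) (smon 0 1 0 0 2 0)"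
      unfolding of_int_dvd_poly_iff by simp
    moreover have "smon 0 0 0 0 0 0 = 0" by (simp add: smon_def)
    ultimately have "P dvd - 1" unfolding distrib_right lookup_add lookup_sterm_mult by simp
    then show False using P not_prime_unit by auto
  qed
  ultimately have "of_int P dvd kill ?a g" using of_int_dvd_multD[OF P] by blast
  then have "\<exists>g2. g2 \<in> ?S \<and> kill ?a g = of_int P * g2"
    using poly_carrier_dvd[of P "kill ?a g" "sym_vars 3"] kill_carrier[OF gk(1), of ?a] by (cases "P = 0") (auto intro: exI[of _ 0])
  then obtain g2 where g2: "g2 \<in> ?S" "kill ?a g = of_int P * g2" by blast
  obtain y where y: "y \<in> ?S" "g = kill ?a g + Var ?a * y" using kill_decomp[OF gk(1) aV] by blast
  have "Var ?a * (x - sdet * y) = Var ?a * x - sdet * (Var ?a * y)" by (simp add: algebra_simps)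
  also have "\<dots> = sdet * (g - Var ?a * y) + of_int P * k" unfolding gk by (simp add: algebra_simps)
  also have "g - Var ?a * y = of_int P * g2" using y(2) g2(2) by (metis add_diff_cancel_right')
  finally have "Var ?a * (x - sdet * y) = of_int P * (sdet * g2 + k)" by (simp add: algebra_simps)
  then have "of_int P dvd Var ?a * (x - sdet * y)" by simp
  then have "of_int P dvd x - sdet * y" using of_int_dvd_multD[OF P] not_dvd_Var[OF P] by blast
  then have "\<exists>z. z \<in> ?S \<and> x - sdet * y = of_int P * z"
    using poly_carrier_dvd[of P "x - sdet * y" "sym_vars 3"] x y(1) sdet_carrier by (cases "P = 0") (auto intro: exI[of _ 0])
  then obtain z where "z \<in> ?S" "x - sdet * y = of_int P * z" by blast
  then show ?thesis by (intro hyper_idealI[OF y(1)]) (auto simp: algebra_simps)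
qed

text \<open>Pseudo-division leaves a remainder linear in x_12, where the chart is injective modulo
  \<open>P\<close>; the power of x_00 is then removed by \<open>hyper_ideal_colon\<close>. The case
  \<open>P = 0\<close> compares operators on \<open>R\<close> itself, the prime case operators on
  \<open>R / p\<close>.\<close>

theorem sym_iota_kernel:
  assumes P: "P = 0 \<or> prime P \<and> P \<noteq> 2" and x: "x \<in> poly_carrier (sym_vars 3)" and dvd: "of_int P dvd sym_iota x"
  shows "x \<in> hyper_ideal (sym_vars 3) sdet P"
proof -
  let ?S = "poly_carrier (sym_vars 3)" and ?a = "Var (0, 0)" and ?D = "poly_carrier (sym_vars 3 - {(1, 2)})"
  have P': "P = 0 \<or> prime P" using P by blast
  obtain N r s w where 1: "r \<in> ?D" "s \<in> ?D" "w \<in> ?S" "?a ^ N * x = r + s * Var (1, 2) + sdet * w"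
    using sdet_division[OF x] by blast
  define y where "y = r + s * Var (1, 2)"
  have DS: "?D \<subseteq> ?S" by (auto simp: poly_carrier_def)
  have yS: "y \<in> ?S" unfolding y_def using subsetD[OF DS 1(1)] subsetD[OF DS 1(2)] by (simp add: sym_vars_3)
  have "sym_chart (?a ^ N * x) = sym_chart (y + sdet * w)" unfolding y_def by (simp only: 1(4))
  also have "\<dots> = sym_chart y" by (simp only: sym_chart_simps sym_chart_sdet mult_zero_left add_0_right)
  finally have "sym_chart (?a ^ N * x) = sym_chart y" .
  moreover have "of_int P dvd sym_chart x" unfolding sym_chart_def by (rule ev_dvd[OF dvd])
  ultimately have "of_int P dvd sym_chart y" unfolding sym_chart_simps(2) by (metis dvd_mult)
  moreover have "Poly_Mapping.lookup m (1, 2) \<le> 1" if m: "m \<in> Poly_Mapping.keys y" for m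
  proof -
    have free: "Poly_Mapping.lookup k (1, 2) = 0" if "z \<in> ?D" "k \<in> Poly_Mapping.keys z" for z k
    proof -
      have "(1, 2) \<notin> Poly_Mapping.keys k" using that unfolding poly_carrier_def by blast
      then show ?thesis by (simp add: in_keys_iff)
    qed
    have "m \<in> Poly_Mapping.keys r \<or> m \<in> Poly_Mapping.keys (s * Var (1, 2))"
      using subsetD[OF Poly_Mapping.keys_add m[unfolded y_def]] by (simp only: Un_iff)
    then show ?thesis
    proof
      assume "m \<in> Poly_Mapping.keys r" then show ?thesis using free[OF 1(1)] by simp
    next
      assume "m \<in> Poly_Mapping.keys (s * Var (1, 2))"
      then obtain k l where kl: "k \<in> Poly_Mapping.keys s" "l \<in> Poly_Mapping.keys (Var (1, 2))" "m = k + l"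
        using subsetD[OF Poly_Mapping.keys_mult] by blast
      then have "l = Poly_Mapping.single (1, 2) 1" by (simp add: Var_def)
      then show ?thesis using free[OF 1(2) kl(1)] kl(3) by (simp add: lookup_add)
    qed
  qed
  ultimately have "of_int P dvd y" using sym_chart_independent[OF P yS] by blast
  then have "\<exists>z. z \<in> ?S \<and> y = of_int P * z"
    using poly_carrier_dvd[of P y "sym_vars 3"] yS by (cases "P = 0") (auto intro: exI[of _ 0])
  then obtain z where z: "z \<in> ?S" "y = of_int P * z" by blast
  have "?a ^ N * x \<in> hyper_ideal (sym_vars 3) sdet P"
    by (rule hyper_idealI[OF 1(3) z(1)]) (simp only: 1(4) y_def[symmetric] z(2) add.commute)
  then show ?thesis
  proof (induction N)
    case (Suc N)
    have "?a ^ N * x \<in> ?S" using x by (simp add: sym_vars_3)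
    moreover have "?a * (?a ^ N * x) \<in> hyper_ideal (sym_vars 3) sdet P" using Suc.prems by (simp add: mult.assoc)
    ultimately have "?a ^ N * x \<in> hyper_ideal (sym_vars 3) sdet P" using hyper_ideal_colon[OF P'] by blast
    then show ?case by (rule Suc.IH)
  qed simp
qed

section \<open>Torus weights, the swap, and averaging\<close>

definition uv :: "(nat \<times> nat) set" where
  "uv = {(0, 0), (0, 1), (0, 2), (1, 0), (1, 1), (1, 2)}"

text \<open>The character of the torus of O_2, which scales u by t and v by 1/t.\<close>

definition uw :: "mon \<Rightarrow> int" where
  "uw m = (\<Sum>i<3. int (Poly_Mapping.lookup m (0, i)) - int (Poly_Mapping.lookup m (1, i)))"

definition adm :: "int \<Rightarrow> mon \<Rightarrow> bool" where
  "adm j m \<longleftrightarrow> Poly_Mapping.keys m \<subseteq> uv \<and> uw m = j"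

lemma uv_iff: "(i, j) \<in> uv \<longleftrightarrow> i < 2 \<and> j < 3"
proof -
  have "j < 3 \<longleftrightarrow> j = 0 \<or> j = 1 \<or> j = 2" "i < 2 \<longleftrightarrow> i = 0 \<or> i = 1" by presburger+
  then show ?thesis unfolding uv_def by auto
qed

lemma keys_mon_add: "Poly_Mapping.keys (m + n :: mon) = Poly_Mapping.keys m \<union> Poly_Mapping.keys n"
  by (auto simp: in_keys_iff lookup_add)

lemma uw_add: "uw (m + n) = uw m + uw n"
  unfolding uw_def sum.distrib[symmetric] by (rule sum.cong) (simp_all add: lookup_add)

lemma uw_zero [simp]: "uw 0 = 0" by (simp add: uw_def)

lemma adm_add: "Poly_Mapping.keys n \<subseteq> uv \<Longrightarrow> adm j (n + m) \<longleftrightarrow> adm (j - uw n) m"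
  unfolding adm_def keys_mon_add uw_add by auto

text \<open>The projection to one torus weight. It also discards monomials with variables outside
  \<open>uv\<close>, since \<open>adm\<close> includes the support condition.\<close>

definition wpart :: "int \<Rightarrow> ipoly \<Rightarrow> ipoly" where
  "wpart j = frag_extend (\<lambda>m. if adm j m then Poly_Mapping.single m 1 else 0)"

lemma wpart_add: "wpart j (x + y) = wpart j x + wpart j y"
  and wpart_diff: "wpart j (x - y) = wpart j x - wpart j y"
  and wpart_zero [simp]: "wpart j 0 = 0"
  unfolding wpart_def by (simp_all add: frag_extend_add frag_extend_diff)

lemma wpart_of_int_mult: "wpart j (of_int c * x) = of_int c * wpart j x"
  unfolding wpart_def by (simp add: frag_extend_cmul flip: frag_cmul_eq)

lemma wpart_sum: "wpart j (sum g I) = (\<Sum>i\<in>I. wpart j (g i))"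
  by (induction I rule: infinite_finite_induct) (auto simp: wpart_add)

lemma wpart_single: "wpart j (Poly_Mapping.single m c) = (if adm j m then Poly_Mapping.single m c else 0)"
  by (cases "c = 0") (simp_all add: wpart_def frag_extend_def frag_cmul_eq of_int_mult_single)

lemma wpart_single_mult:
  assumes "Poly_Mapping.keys n \<subseteq> uv"
  shows "wpart j (Poly_Mapping.single n c * x) = Poly_Mapping.single n c * wpart (j - uw n) x"
proof -
  have "wpart j (Poly_Mapping.single n c * Poly_Mapping.single m d) = Poly_Mapping.single n c * wpart (j - uw n) (Poly_Mapping.single m d)" for m d
    by (simp add: mult_single wpart_single adm_add[OF assms])
  then show ?thesis by (subst (1 2) poly_sum_monomials[of x]) (simp only: sum_distrib_left wpart_sum)
qed

lemma wpart_wpart: "wpart i (wpart j x) = (if i = j then wpart j x else 0)"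
proof -
  have "wpart i (wpart j (Poly_Mapping.single m c)) = (if i = j then wpart j (Poly_Mapping.single m c) else 0)" for m c
    by (auto simp: wpart_single adm_def)
  then show ?thesis by (subst (1 2) poly_sum_monomials[of x]) (simp add: wpart_sum)
qed

lemma pcong_wpart: "pcong p x y \<Longrightarrow> pcong p (wpart j x) (wpart j y)"
  unfolding pcong_def by (auto elim!: dvdE simp: wpart_diff[symmetric] wpart_of_int_mult)

definition W0 :: "ipoly \<Rightarrow> bool" where
  "W0 z \<longleftrightarrow> (\<forall>n\<in>Poly_Mapping.keys z. adm 0 n)"

lemma W0_add: "W0 x \<Longrightarrow> W0 y \<Longrightarrow> W0 (x + y)"
  unfolding W0_def using subsetD[OF Poly_Mapping.keys_add, of _ x y] by blast

lemma W0_uminus: "W0 x \<Longrightarrow> W0 (- x)" by (simp add: W0_def)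

lemma W0_diff: "W0 x \<Longrightarrow> W0 y \<Longrightarrow> W0 (x - y)" using W0_add[of x "- y"] W0_uminus by simp

lemma W0_mult:
  assumes "W0 x" "W0 y" shows "W0 (x * y)"
  unfolding W0_def
proof
  fix m assume "m \<in> Poly_Mapping.keys (x * y)"
  then obtain k l where kl: "k \<in> Poly_Mapping.keys x" "l \<in> Poly_Mapping.keys y" "m = k + l"
    using subsetD[OF Poly_Mapping.keys_mult] by blast
  then have "adm 0 k" "adm 0 l" using assms unfolding W0_def by blast+
  then show "adm 0 m" unfolding kl(3) adm_def keys_mon_add uw_add by simp
qed

lemma W0_of_int: "W0 (of_int c)"
proof -
  have "of_int c = Poly_Mapping.single (0::mon) c" using of_int_mult_single[of c 0 1] by (simp add: single_one)
  then show ?thesis by (simp add: W0_def adm_def)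
qed

lemma wpart_mult_W0:
  assumes "W0 z" shows "wpart 0 (z * x) = z * wpart 0 x"
proof -
  have "wpart 0 (Poly_Mapping.single n (Poly_Mapping.lookup z n) * x) = Poly_Mapping.single n (Poly_Mapping.lookup z n) * wpart 0 x"
    if "n \<in> Poly_Mapping.keys z" for n
    using assms that by (subst wpart_single_mult) (auto simp: W0_def adm_def)
  then show ?thesis
    by (subst (1 2) poly_sum_monomials[of z]) (simp add: sum_distrib_right wpart_sum)
qed

lemma wpart_W0: "W0 z \<Longrightarrow> wpart 0 z = z"
  using wpart_mult_W0[of z 1] wpart_single[of 0 0 1] by (simp add: adm_def single_one)

definition sw :: "nat \<times> nat \<Rightarrow> nat \<times> nat" where
  "sw v = (if fst v = 0 then (1, snd v) else if fst v = 1 then (0, snd v) else v)"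

text \<open>The exchange of u and v, which generates O_2 together with the torus.\<close>

definition sigma :: "ipoly \<Rightarrow> ipoly" where "sigma = ev (\<lambda>v. Var (sw v))"

definition swm :: "mon \<Rightarrow> mon" where
  "swm m = (\<Sum>v\<in>Poly_Mapping.keys m. Poly_Mapping.single (sw v) (Poly_Mapping.lookup m v))"

lemma sw_sw [simp]: "sw (sw v) = v" by (cases v) (auto simp: sw_def)

lemma sigma_simps:
  "sigma (x + y) = sigma x + sigma y" "sigma (x - y) = sigma x - sigma y" "sigma (x * y) = sigma x * sigma y"
  "sigma (x ^ n) = sigma x ^ n" "sigma (of_int c) = of_int c" "sigma (numeral k) = numeral k" "sigma 1 = 1" "sigma 0 = 0"
  "sigma (Var v) = Var (sw v)" "sigma (- x) = - sigma x"
  by (simp_all add: sigma_def ev_simps)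

lemma sigma_sigma [simp]: "sigma (sigma x) = x"
  by (simp add: sigma_def ev_comp)

lemma sigma_sym_iota: "sigma (sym_iota s) = sym_iota s"
  unfolding sigma_def sym_iota_def ev_comp
  by (rule ev_cong[of _ UNIV]) (auto simp: ev_simps sw_def mult.commute add.commute)

lemma pcong_sigma: "pcong p x y \<Longrightarrow> pcong p (sigma x) (sigma y)"
  unfolding sigma_def by (rule pcong_ev)

lemma sigma_single: "sigma (Poly_Mapping.single m c) = Poly_Mapping.single (swm m) c"
proof -
  have "finite A \<Longrightarrow> (\<Prod>v\<in>A. Var (sw v) ^ k v) = Poly_Mapping.single (\<Sum>v\<in>A. Poly_Mapping.single (sw v) (k v)) 1" for A k
    by (induction A rule: finite_induct) (auto simp: Var_power mult_single)
  then show ?thesis by (simp add: sigma_def ev_single mon_ev_def swm_def of_int_mult_single)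
qed

lemma lookup_swm: "Poly_Mapping.lookup (swm m) v = Poly_Mapping.lookup m (sw v)"
proof -
  have "sw w = v \<longleftrightarrow> w = sw v" for w by (metis sw_sw)
  then show ?thesis
    by (simp add: swm_def lookup_sum lookup_single when_def sum.delta in_keys_iff)
qed

lemma adm_swm: "adm j (swm m) \<longleftrightarrow> adm (- j) m"
proof -
  have "sw v \<in> uv \<longleftrightarrow> v \<in> uv" for v by (cases v) (auto simp: sw_def uv_iff)
  then have "Poly_Mapping.keys (swm m) \<subseteq> uv \<longleftrightarrow> Poly_Mapping.keys m \<subseteq> uv"
  proof -
    assume h: "\<And>v. sw v \<in> uv \<longleftrightarrow> v \<in> uv"
    have "(\<forall>v. Poly_Mapping.lookup m (sw v) \<noteq> 0 \<longrightarrow> v \<in> uv) \<longleftrightarrow> (\<forall>v. Poly_Mapping.lookup m v \<noteq> 0 \<longrightarrow> v \<in> uv)" (is "?L \<longleftrightarrow> ?R")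
    proof
      assume L: ?L
      show ?R using L[rule_format, of "sw v" for v] h by simp
    next
      assume R: ?R
      show ?L using R[rule_format, of "sw v" for v] h by simp
    qed
    then show ?thesis unfolding subset_iff in_keys_iff lookup_swm .
  qed
  moreover have "uw (swm m) = - uw m" unfolding uw_def lookup_swm sum_negf[symmetric] by (rule sum.cong) (simp_all add: sw_def)
  ultimately show ?thesis unfolding adm_def by auto
qed

lemma wpart_sigma: "wpart 0 (sigma x) = sigma (wpart 0 x)"
proof -
  have s: "sigma (sum g I) = (\<Sum>i\<in>I. sigma (g i))" for g and I :: "mon set" unfolding sigma_def by (rule ev_sum)
  have "wpart 0 (sigma (Poly_Mapping.single m c)) = sigma (wpart 0 (Poly_Mapping.single m c))" for m c
    by (simp add: sigma_single wpart_single adm_swm sigma_simps)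
  then show ?thesis by (subst (1 2) poly_sum_monomials[of x]) (simp only: wpart_sum s)
qed

text \<open>Twice the Reynolds operator of O_2: the factor keeps averaging inside integer
  polynomials.\<close>

definition rho2 :: "ipoly \<Rightarrow> ipoly" where "rho2 x = wpart 0 x + sigma (wpart 0 x)"

lemma rho2_add: "rho2 (x + y) = rho2 x + rho2 y" by (simp add: rho2_def wpart_add sigma_simps)

lemma rho2_diff: "rho2 (x - y) = rho2 x - rho2 y" by (simp add: rho2_def wpart_diff sigma_simps)

lemma rho2_zero [simp]: "rho2 0 = 0" by (simp add: rho2_def sigma_simps)

lemma rho2_of_int_mult: "rho2 (of_int c * x) = of_int c * rho2 x"
  by (simp add: rho2_def wpart_of_int_mult sigma_simps distrib_left)

lemma rho2_sigma: "rho2 (sigma x) = rho2 x" by (simp add: rho2_def wpart_sigma add.commute)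

lemma rho2_invariant_mult: "W0 z \<Longrightarrow> sigma z = z \<Longrightarrow> rho2 (z * x) = z * rho2 x"
  by (simp add: rho2_def wpart_mult_W0 sigma_simps distrib_left)

lemma rho2_invariant: "W0 z \<Longrightarrow> sigma z = z \<Longrightarrow> rho2 z = 2 * z"
  by (simp add: rho2_def wpart_W0)

lemma pcong_rho2: "pcong p x y \<Longrightarrow> pcong p (rho2 x) (rho2 y)"
  unfolding rho2_def by (intro pcong_add pcong_sigma pcong_wpart)

definition Mo :: "int \<Rightarrow> ipoly \<Rightarrow> bool" where
  "Mo j x \<longleftrightarrow> (\<exists>n. x = Poly_Mapping.single n 1 \<and> adm j n)"

lemma Mo_mult: "Mo j x \<Longrightarrow> Mo k y \<Longrightarrow> Mo (j + k) (x * y)"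
proof -
  assume "Mo j x" "Mo k y"
  then obtain m n where "x = Poly_Mapping.single m 1" "adm j m" "y = Poly_Mapping.single n 1" "adm k n" unfolding Mo_def by blast
  then show ?thesis unfolding Mo_def by (intro exI[of _ "m + n"]) (simp add: mult_single adm_def keys_mon_add uw_add)
qed

lemma Mo_one: "Mo 0 1"
  unfolding Mo_def by (rule exI[of _ 0]) (simp add: adm_def single_one)

lemma Mo_power: "Mo j x \<Longrightarrow> Mo (int k * j) (x ^ k)"
proof (induction k)
  case (Suc k)
  then show ?case using Mo_mult[of j x "int k * j" "x ^ k"] by (simp add: algebra_simps)
qed (simp add: Mo_one)

lemma adm_u: "i < 3 \<Longrightarrow> adm 1 (Poly_Mapping.single (0, i) 1)"
  by (simp add: adm_def uv_iff uw_def lookup_single when_def if_distrib[of int] sum.delta sum.delta' cong: if_cong)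

lemma adm_v: "i < 3 \<Longrightarrow> adm (- 1) (Poly_Mapping.single (1, i) 1)"
  by (simp add: adm_def uv_iff uw_def lookup_single when_def if_distrib[of int] sum.delta sum.delta' sum_negf cong: if_cong)

lemma Mo_u: "i < 3 \<Longrightarrow> Mo 1 (Var (0, i))"
  unfolding Mo_def Var_def using adm_u by blast

lemma Mo_sigma: "Mo j x \<Longrightarrow> Mo (- j) (sigma x)"
  unfolding Mo_def by (auto simp: sigma_single adm_swm)

lemma Mo_v: "i < 3 \<Longrightarrow> Mo (- 1) (Var (1, i))"
  using Mo_sigma[OF Mo_u[of i]] by (simp add: sigma_simps sw_def)

lemma Mo_W0: "Mo 0 x \<Longrightarrow> W0 x" unfolding Mo_def W0_def by auto

lemma W0_sym_entry: "i < 3 \<Longrightarrow> j < 3 \<Longrightarrow> W0 (Var (0, i) * Var (1, j) + Var (0, j) * Var (1, i))"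
  using Mo_mult[OF Mo_u[of i] Mo_v[of j]] Mo_mult[OF Mo_u[of j] Mo_v[of i]] by (intro W0_add Mo_W0) simp_all

lemma W0_sym_iota: "s \<in> poly_carrier (sym_vars 3) \<Longrightarrow> W0 (sym_iota s)"
proof (induction s rule: poly_carrier_induct)
  case (Var v x)
  obtain i j where "v = (i, j)" "i < 3" "j < 3" using Var(1) by (cases v) (auto simp: sym_vars_def)
  then show ?case using Var(3) W0_sym_entry by (simp add: sym_iota_simps W0_mult)
qed (simp_all add: sym_iota_simps W0_of_int W0_add)

section \<open>Invariants of O_2\<close>

text \<open>The 2 \<times> 2 minors of the matrix with columns u and v. They are torus invariant but
  change sign under \<open>sigma\<close>; products of two of them are again in the image of
  \<open>sym_iota\<close>.\<close>

definition yy :: "nat \<Rightarrow> nat \<Rightarrow> ipoly" where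
  "yy i j = Var (0, i) * Var (1, j) - Var (0, j) * Var (1, i)"

lemma W0_yy: "i < 3 \<Longrightarrow> j < 3 \<Longrightarrow> W0 (yy i j)"
  unfolding yy_def using Mo_mult[OF Mo_u[of i] Mo_v[of j]] Mo_mult[OF Mo_u[of j] Mo_v[of i]] by (intro W0_diff Mo_W0) simp_all

lemma sigma_yy: "sigma (yy i j) = - yy i j" by (simp add: yy_def sigma_simps sw_def)

text \<open>The invariants generated by the image of \<open>sym_iota\<close> after inverting 2.\<close>

definition Pp :: "ipoly \<Rightarrow> bool" where
  "Pp z \<longleftrightarrow> (\<exists>k. \<exists>s\<in>poly_carrier (sym_vars 3). 2 ^ k * z = sym_iota s)"

lemma Pp_iota: "s \<in> poly_carrier (sym_vars 3) \<Longrightarrow> Pp (sym_iota s)"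
  unfolding Pp_def by (rule exI[of _ 0]) auto

lemma Pp_mult: assumes "Pp x" "Pp y" shows "Pp (x * y)"
proof -
  obtain k s l t where 1: "s \<in> poly_carrier (sym_vars 3)" "2 ^ k * x = sym_iota s" "t \<in> poly_carrier (sym_vars 3)" "2 ^ l * y = sym_iota t"
    using assms unfolding Pp_def by blast
  have "2 ^ (k + l) * (x * y) = (2 ^ k * x) * (2 ^ l * y)" by (simp add: power_add ac_simps)
  also have "\<dots> = sym_iota (s * t)" unfolding 1 sym_iota_simps ..
  finally show ?thesis using 1 unfolding Pp_def by (intro exI[of _ "k + l"] bexI[of _ "s * t"]) auto
qed

lemma Pp_add: assumes "Pp x" "Pp y" shows "Pp (x + y)"
proof -
  obtain k s l t where 1: "s \<in> poly_carrier (sym_vars 3)" "2 ^ k * x = sym_iota s" "t \<in> poly_carrier (sym_vars 3)" "2 ^ l * y = sym_iota t"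
    using assms unfolding Pp_def by blast
  have "2 ^ (k + l) * (x + y) = 2 ^ l * (2 ^ k * x) + 2 ^ k * (2 ^ l * y)" by (simp add: power_add algebra_simps)
  also have "\<dots> = sym_iota (2 ^ l * s + 2 ^ k * t)" unfolding 1 sym_iota_simps ..
  finally show ?thesis using 1 unfolding Pp_def by (intro exI[of _ "k + l"] bexI[of _ "2 ^ l * s + 2 ^ k * t"]) auto
qed

lemma Pp_half: "Pp (2 * x) \<Longrightarrow> Pp x"
proof -
  assume "Pp (2 * x)"
  then obtain k s where s: "s \<in> poly_carrier (sym_vars 3)" "2 ^ k * (2 * x) = sym_iota s" unfolding Pp_def by blast
  have "2 ^ Suc k * x = 2 ^ k * (2 * x)" by simp
  then show ?thesis unfolding Pp_def using s by metis
qed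

lemma Pp_of_int: "Pp (of_int c)" using Pp_iota[of "of_int c"] by (simp add: sym_iota_simps)

text \<open>Up to sign, such a product is a 2 \<times> 2 minor of the symmetric matrix u v^T + v
  u^T.\<close>

lemma Pp_yy_yy:
  assumes "i < 3" "j < 3" "k < 3" "l < 3" shows "Pp (yy i j * yy k l)"
proof -
  have S: "sym_entry a b \<in> poly_carrier (sym_vars 3)" if "a < 3" "b < 3" for a b
    using that unfolding sym_entry_def by (intro poly_carrier_Var) (auto simp: sym_vars_def)
  have e: "sym_iota (sym_entry a b) = Var (0, a) * Var (1, b) + Var (0, b) * Var (1, a)" for a b
    by (simp add: sym_entry_def sym_iota_simps min_def max_def add.commute)
  have "yy i j * yy k l = sym_iota (sym_entry i l * sym_entry j k - sym_entry i k * sym_entry j l)"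
    unfolding sym_iota_simps e yy_def by (simp add: algebra_simps)
  then show ?thesis using S assms by (simp add: Pp_iota)
qed

lemma Pp_x: "i < 3 \<Longrightarrow> j < 3 \<Longrightarrow> Pp (Var (0, i) * Var (1, j) + Var (0, j) * Var (1, i))"
  using Pp_iota[of "Var (min i j, max i j)"] by (simp add: sym_vars_def sym_iota_simps min_def max_def add.commute split: if_splits)

text \<open>A strengthening that is stable under multiplication by \<open>u_k * v_l\<close>, which
  is half of x_kl plus the bracket \<open>yy k l\<close>: the symmetric part of the product involves
  the antisymmetric part of \<open>z\<close> multiplied by a bracket, and conversely.\<close>

definition good :: "ipoly \<Rightarrow> bool" where
  "good z \<longleftrightarrow> Pp (z + sigma z) \<and> (\<forall>i<3. \<forall>j<3. Pp (yy i j * (z - sigma z)))"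

lemma good_step:
  assumes g: "good z" and kl: "k < 3" "l < 3"
  shows "good (Var (0, k) * Var (1, l) * z)"
proof -
  let ?x = "Var (0, k) * Var (1, l) + Var (0, l) * Var (1, k)" and ?w = "Var (0, k) * Var (1, l) * z"
  have s: "sigma ?w = Var (1, k) * Var (0, l) * sigma z" by (simp add: sigma_simps sw_def)
  have "2 * (?w + sigma ?w) = ?x * (z + sigma z) + yy k l * (z - sigma z)"
    unfolding s yy_def by (simp add: algebra_simps)
  moreover have g1: "Pp (z + sigma z)" and g2: "i < 3 \<Longrightarrow> j < 3 \<Longrightarrow> Pp (yy i j * (z - sigma z))" for i j
    using g unfolding good_def by blast+
  moreover have "Pp (?x * (z + sigma z) + yy k l * (z - sigma z))"
    by (rule Pp_add[OF Pp_mult[OF Pp_x[OF kl] g1] g2[OF kl]])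
  ultimately have 1: "Pp (?w + sigma ?w)" by (metis Pp_half)
  have "Pp (yy i j * (?w - sigma ?w))" if ij: "i < 3" "j < 3" for i j
  proof -
    have "2 * (yy i j * (?w - sigma ?w)) = ?x * (yy i j * (z - sigma z)) + yy i j * yy k l * (z + sigma z)"
      unfolding s yy_def[of k l] by (simp add: algebra_simps)
    moreover have "Pp (?x * (yy i j * (z - sigma z)) + yy i j * yy k l * (z + sigma z))"
      by (rule Pp_add[OF Pp_mult[OF Pp_x[OF kl] g2[OF ij]] Pp_mult[OF Pp_yy_yy[OF ij kl] g1]])
    ultimately show ?thesis by (metis Pp_half)
  qed
  with 1 show ?thesis unfolding good_def by blast
qed

lemma good_add: "good x \<Longrightarrow> good y \<Longrightarrow> good (x + y)"
proof -
  assume g: "good x" "good y"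
  have "x + y + sigma (x + y) = (x + sigma x) + (y + sigma y)" by (simp add: sigma_simps)
  moreover have "yy i j * (x + y - sigma (x + y)) = yy i j * (x - sigma x) + yy i j * (y - sigma y)" for i j by (simp add: sigma_simps algebra_simps)
  moreover have gx: "Pp (x + sigma x)" "Pp (y + sigma y)" using g unfolding good_def by blast+
  moreover have "Pp ((x + sigma x) + (y + sigma y))" by (rule Pp_add[OF gx])
  moreover have "Pp (yy i j * (x - sigma x) + yy i j * (y - sigma y))" if "i < 3" "j < 3" for i j
  proof -
    have h: "Pp (yy i j * (x - sigma x))" "Pp (yy i j * (y - sigma y))" using g that unfolding good_def by blast+
    show ?thesis by (rule Pp_add[OF h])
  qed
  ultimately show ?thesis unfolding good_def by (simp only:) blast
qed

lemma good_of_int: "good (of_int c)"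
proof -
  have "of_int c + sigma (of_int c) = of_int (2 * c)" by (simp add: sigma_simps)
  then show ?thesis unfolding good_def using Pp_of_int[of "2 * c"] Pp_of_int[of 0] by (simp add: sigma_simps)
qed

text \<open>A monomial of weight 0 has as many factors u as factors v, so a pair
  \<open>u_k * v_l\<close> can be split off; the induction is on the degree in u.\<close>

lemma good_monomial:
  assumes "adm 0 m" shows "good (Poly_Mapping.single m c)"
  using assms
proof (induction "\<Sum>i<3. Poly_Mapping.lookup m (0, i)" arbitrary: m)
  case 0
  then have u: "Poly_Mapping.lookup m (0, i) = 0" if "i < 3" for i using that by simp
  then have "(\<Sum>i<3. int (Poly_Mapping.lookup m (1, i))) = 0" using 0(2) by (simp add: adm_def uw_def sum_negf)
  then have "Poly_Mapping.lookup m (1, i) = 0" if "i < 3" for i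
    using that by (subst (asm) sum_nonneg_eq_0_iff) auto
  then have z: "Poly_Mapping.lookup m v = 0" if "v \<in> uv" for v
    using that u by (cases v) (auto simp: uv_iff less_2_cases_iff)
  have "Poly_Mapping.keys m \<subseteq> uv" using 0(2) unfolding adm_def by blast
  then have "v \<notin> Poly_Mapping.keys m" for v using z by (metis in_keys_iff subsetD)
  then have "Poly_Mapping.keys m = {}" by blast
  then have "m = 0" by simp
  then have "Poly_Mapping.single m c = of_int c" using of_int_mult_single[of c 0 1] by (simp add: single_one)
  then show ?case using good_of_int by simp
next
  case (Suc N)
  have "\<exists>k<3. Poly_Mapping.lookup m (0, k) > 0"
  proof (rule ccontr)
    assume "\<not> ?thesis" then have "(\<Sum>i<3. Poly_Mapping.lookup m (0, i)) = 0" by simp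
    then show False using Suc(2) by simp
  qed
  then obtain k where k: "k < 3" "Poly_Mapping.lookup m (0, k) > 0" by blast
  have "(\<Sum>i<3. int (Poly_Mapping.lookup m (1, i))) = int (\<Sum>i<3. Poly_Mapping.lookup m (0, i))"
    using Suc(3) by (simp add: adm_def uw_def sum_subtractf)
  then have "(\<Sum>i<3. int (Poly_Mapping.lookup m (1, i))) > 0" using Suc(2) by (metis of_nat_0_less_iff zero_less_Suc)
  have "\<exists>l<3. Poly_Mapping.lookup m (1, l) > 0"
  proof (rule ccontr)
    assume "\<not> ?thesis" then have "(\<Sum>i<3. int (Poly_Mapping.lookup m (1, i))) = 0" by simp
    then show False using \<open>(\<Sum>i<3. int (Poly_Mapping.lookup m (1, i))) > 0\<close> by simp
  qed
  then obtain l where l: "l < 3" "Poly_Mapping.lookup m (1, l) > 0" by blast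
  let ?e = "Poly_Mapping.single (0, k) 1 + Poly_Mapping.single (1, l) (1::nat)"
  define n where "n = m - ?e"
  have m: "m = ?e + n" unfolding n_def
    by (rule mon_le_add) (use k l in \<open>auto simp: lookup_add lookup_single when_def\<close>)
  have e: "Poly_Mapping.keys ?e \<subseteq> uv" "uw ?e = 0"
    using adm_u[OF k(1)] adm_v[OF l(1)] unfolding adm_def keys_mon_add uw_add by simp_all
  have n: "adm 0 n" using Suc(3) unfolding m adm_add[OF e(1)] e(2) by simp
  have "(\<Sum>i<3. Poly_Mapping.lookup m (0, i)) = (\<Sum>i<3. (if i = k then 1 else 0) + Poly_Mapping.lookup n (0, i))"
    unfolding m by (rule sum.cong) (auto simp: lookup_add lookup_single when_def)
  also have "\<dots> = 1 + (\<Sum>i<3. Poly_Mapping.lookup n (0, i))" using k(1) by (simp add: sum.distrib sum.delta)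
  finally have "N = (\<Sum>i<3. Poly_Mapping.lookup n (0, i))" using Suc(2) by simp
  from Suc(1)[OF this n] have "good (Var (0, k) * Var (1, l) * Poly_Mapping.single n c)" using k l by (intro good_step)
  then show ?case unfolding m by (simp add: Var_def mult_single)
qed

text \<open>The first fundamental theorem for O_2, up to powers of 2.\<close>

lemma rho2_Pp: "Pp (rho2 x)"
proof -
  have g: "good (wpart 0 (Poly_Mapping.single m c))" for m c
    using good_monomial good_of_int[of 0] by (simp add: wpart_single)
  have "good (\<Sum>m\<in>A. wpart 0 (Poly_Mapping.single m (Poly_Mapping.lookup x m)))" if "finite A" for A
    using that by (induction A rule: finite_induct) (use good_of_int[of 0] g in \<open>auto intro: good_add\<close>)
  then have "good (\<Sum>m\<in>Poly_Mapping.keys x. wpart 0 (Poly_Mapping.single m (Poly_Mapping.lookup x m)))" by simp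
  then have "good (wpart 0 x)" unfolding wpart_sum[symmetric] poly_sum_monomials[symmetric] .
  then show ?thesis unfolding rho2_def good_def by blast
qed

text \<open>\<open>rho2\<close> doubles an invariant, and \<open>Pp\<close> is insensitive to a
  factor 2.\<close>

lemma invariant_Pp: "W0 z \<Longrightarrow> sigma z = z \<Longrightarrow> Pp z"
  by (rule Pp_half) (metis rho2_Pp rho2_invariant)

section \<open>Coprimality of brackets\<close>

lemma not_dvd_yy:
  assumes p: "p = 0 \<or> prime p" and ij: "i \<noteq> j" shows "\<not> of_int p dvd yy i j"
proof
  assume "of_int p dvd yy i j"
  then have "of_int p dvd kill (0, j) (yy i j)" unfolding kill_def by (rule ev_dvd)
  then have "of_int p dvd Var (0, i) * Var (1, j)" using ij by (simp add: kill_def yy_def ev_simps)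
  then show False using of_int_dvd_multD[OF p] not_dvd_Var[OF p] by blast
qed

text \<open>Modulo \<open>yy 0 1\<close> the product of u_1 and v_0 equals the product of u_0 and
  v_1, so multiplication by u_1 eliminates v_0.\<close>

lemma yy_division:
  "\<exists>N Q M0. M0 \<in> poly_carrier (UNIV - {(1, 0)}) \<and> Var (0, 1) ^ N * M = yy 0 1 * Q + M0"
proof -
  let ?u = "Var (0, 1)" and ?D = "poly_carrier (UNIV - {(1, 0)})"
  have u: "?u \<in> ?D" "Var (0, 0) \<in> ?D" "Var (1, 1) \<in> ?D" by simp_all
  have "M \<in> poly_carrier UNIV" by simp
  then show ?thesis
  proof (induction M rule: poly_carrier_induct)
    case (of_int c)
    show ?case by (rule exI[of _ 0], rule exI[of _ 0], rule exI[of _ "of_int c"]) simp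
  next
    case (add x y)
    then obtain N Q M0 N' Q' M0' where 1: "M0 \<in> ?D" "?u ^ N * x = yy 0 1 * Q + M0" "M0' \<in> ?D" "?u ^ N' * y = yy 0 1 * Q' + M0'" by blast
    have "?u ^ (N + N') * (x + y) = ?u ^ N' * (?u ^ N * x) + ?u ^ N * (?u ^ N' * y)" by (simp add: power_add algebra_simps)
    also have "\<dots> = yy 0 1 * (?u ^ N' * Q + ?u ^ N * Q') + (?u ^ N' * M0 + ?u ^ N * M0')" unfolding 1 by (simp add: algebra_simps)
    finally have "?u ^ (N + N') * (x + y) = yy 0 1 * (?u ^ N' * Q + ?u ^ N * Q') + (?u ^ N' * M0 + ?u ^ N * M0')" .
    moreover have "?u ^ N' * M0 + ?u ^ N * M0' \<in> ?D" using 1 u by (intro poly_carrier_add poly_carrier_mult poly_carrier_power)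
    ultimately show ?case by blast
  next
    case (Var v x)
    then obtain N Q M0 where 1: "M0 \<in> ?D" "?u ^ N * x = yy 0 1 * Q + M0" by blast
    show ?case
    proof (cases "v = (1, 0)")
      case True
      have "?u ^ Suc N * (Var v * x) = ?u * Var (1, 0) * (?u ^ N * x)" using True by (simp add: ac_simps)
      also have "\<dots> = yy 0 1 * (?u * Var (1, 0) * Q - M0) + Var (0, 0) * Var (1, 1) * M0" unfolding 1 by (simp add: yy_def algebra_simps)
      finally have "?u ^ Suc N * (Var v * x) = yy 0 1 * (?u * Var (1, 0) * Q - M0) + Var (0, 0) * Var (1, 1) * M0" .
      moreover have "Var (0, 0) * Var (1, 1) * M0 \<in> ?D" using 1 u by (intro poly_carrier_mult)
      ultimately show ?thesis by blast
    next
      case False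
      then have "Var v * M0 \<in> ?D" using 1 by simp
      moreover have "?u ^ N * (Var v * x) = Var v * (?u ^ N * x)" by (simp add: ac_simps)
      then have "?u ^ N * (Var v * x) = yy 0 1 * (Var v * Q) + Var v * M0" unfolding 1 by (simp add: algebra_simps)
      ultimately show ?thesis by blast
    qed
  qed
qed

text \<open>A multiple of \<open>yy 0 1\<close> that does not involve \<open>v\<^sub>0\<close> vanishes: look at the coefficient of its highest power of \<open>v\<^sub>0\<close>.\<close>

lemma yy_multiple_free:
  assumes F: "F \<in> poly_carrier (UNIV - {(1, 0)})" and c: "pcong p F (yy 0 1 * Z)"
  shows "of_int p dvd Z"
proof (rule ccontr)
  assume neg: "\<not> of_int p dvd Z"
  define K where "K = {m \<in> Poly_Mapping.keys Z. \<not> p dvd Poly_Mapping.lookup Z m}"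
  define g where "g m = Poly_Mapping.lookup m (1, 0)" for m :: mon
  obtain m where m: "\<not> p dvd Poly_Mapping.lookup Z m" using neg unfolding of_int_dvd_poly_iff by blast
  then have "Poly_Mapping.lookup Z m \<noteq> 0" by (metis dvd_0_right)
  then have "m \<in> K" using m unfolding K_def by (simp add: in_keys_iff)
  then have ne: "g ` K \<noteq> {}" by blast
  have fin: "finite (g ` K)" unfolding K_def by simp
  have "Max (g ` K) \<in> g ` K" by (rule Max_in[OF fin ne])
  then obtain n where n: "n \<in> K" "Max (g ` K) = g n" by (rule imageE)
  have le: "g m \<le> g n" if "m \<in> K" for m unfolding n(2)[symmetric] by (rule Max_ge[OF fin imageI[OF that]])
  let ?e = "Poly_Mapping.single (0, 1) 1 + Poly_Mapping.single (1, 0) (1::nat)"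
  let ?f = "Poly_Mapping.single (0, 0) 1 + Poly_Mapping.single (1, 1) (1::nat)"
  have "yy 0 1 * Z = Poly_Mapping.single ?f 1 * Z - Poly_Mapping.single ?e 1 * Z"
    unfolding yy_def Var_def mult_single by (simp add: left_diff_distrib)
  then have l: "Poly_Mapping.lookup (yy 0 1 * Z) (?e + n) = Poly_Mapping.lookup (Poly_Mapping.single ?f 1 * Z) (?e + n) - Poly_Mapping.lookup Z n"
    by (simp only: lookup_minus lookup_single_mult_add mult_1)
  have "p dvd Poly_Mapping.lookup (Poly_Mapping.single ?f 1 * Z) (?e + n)"
  proof (cases "\<exists>m'. ?e + n = ?f + m'")
    case True
    then obtain m' where m': "?e + n = ?f + m'" by blast
    have "Poly_Mapping.lookup (?e + n) (1, 0) = Poly_Mapping.lookup (?f + m') (1, 0)" unfolding m' ..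
    then have "g m' = g n + 1" unfolding g_def by (simp add: lookup_add lookup_single)
    then have "m' \<notin> K" using le by fastforce
    then have "p dvd Poly_Mapping.lookup Z m'" unfolding K_def by (auto simp: in_keys_iff)
    then show ?thesis unfolding m' by (simp only: lookup_single_mult_add mult_1)
  next
    case False
    then show ?thesis using lookup_single_mult_not[of "?e + n" ?f 1 Z] by simp
  qed
  moreover have "Poly_Mapping.lookup F (?e + n) = 0"
  proof (rule ccontr)
    assume "Poly_Mapping.lookup F (?e + n) \<noteq> 0"
    then have "Poly_Mapping.keys (?e + n) \<subseteq> UNIV - {(1, 0)}" using F unfolding poly_carrier_def by (simp add: in_keys_iff)
    then have "(1, 0) \<notin> Poly_Mapping.keys (?e + n)" by blast
    then show False by (simp add: in_keys_iff lookup_add)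
  qed
  moreover have "[Poly_Mapping.lookup F (?e + n) = Poly_Mapping.lookup (yy 0 1 * Z) (?e + n)] (mod p)" using c unfolding pcong_poly_iff by blast
  ultimately have "p dvd Poly_Mapping.lookup Z n" unfolding l
    by (simp add: cong_iff_dvd_diff dvd_diff_right_iff dvd_diff_left_iff)
  then show False using n(1) unfolding K_def by simp
qed

text \<open>After eliminating v_0 from \<open>M\<close>, the product \<open>M0 * yy 1 2\<close> is
  free of v_0 and congruent to a multiple of \<open>yy 0 1\<close>, hence 0 modulo \<open>p\<close>.
  The powers of u_1 introduced on the way are removed because u_1 is coprime to
  \<open>yy 0 1\<close>.\<close>

lemma cop_yy:
  assumes p: "p = 0 \<or> prime p" shows "cop p (yy 0 1) (yy 1 2)"
  unfolding cop_def
proof (intro allI impI)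
  fix M N' assume *: "pcong p (M * yy 1 2) (yy 0 1 * N')"
  let ?u = "Var (0, 1)"
  obtain N Q M0 where M0: "M0 \<in> poly_carrier (UNIV - {(1, 0)})" "?u ^ N * M = yy 0 1 * Q + M0" using yy_division by blast
  have "pcong p (?u ^ N * (M * yy 1 2)) (?u ^ N * (yy 0 1 * N'))" by (intro pcong_mult pcong_refl *)
  moreover have "?u ^ N * (M * yy 1 2) = yy 0 1 * (Q * yy 1 2) + M0 * yy 1 2"
    using arg_cong[OF M0(2), of "\<lambda>t. t * yy 1 2"] by (simp add: algebra_simps)
  ultimately have "pcong p (yy 0 1 * (Q * yy 1 2) + M0 * yy 1 2 - yy 0 1 * (Q * yy 1 2)) (?u ^ N * (yy 0 1 * N') - yy 0 1 * (Q * yy 1 2))"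
    by (intro pcong_diff pcong_refl) simp
  then have c: "pcong p (M0 * yy 1 2) (yy 0 1 * (?u ^ N * N' - Q * yy 1 2))" by (simp add: algebra_simps)
  have "M0 * yy 1 2 \<in> poly_carrier (UNIV - {(1, 0)})" using M0(1) unfolding yy_def by simp
  from yy_multiple_free[OF this c] have "of_int p dvd yy 0 1 * (?u ^ N * N' - Q * yy 1 2)" by simp
  then have "pcong p (M0 * yy 1 2) 0" by (intro pcong_trans[OF c]) (simp only: pcong_0_iff)
  then have "of_int p dvd M0 * yy 1 2" by (simp only: pcong_0_iff)
  then have "of_int p dvd M0" using of_int_dvd_multD[OF p] not_dvd_yy[OF p, of 1 2] by auto
  then have "pcong p (M * ?u ^ N) (yy 0 1 * Q)" unfolding pcong_def mult.commute[of M] M0(2) by simp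
  moreover have "cop p (yy 0 1) ?u"
  proof (rule cop_sym[OF p _ not_dvd_Var[OF p]], rule cop_kill[OF p])
    show "\<not> of_int p dvd kill (0, 1) (yy 0 1)"
      using of_int_dvd_multD[OF p] not_dvd_Var[OF p] by (auto simp: kill_def yy_def ev_simps)
  qed
  ultimately show "\<exists>Q. pcong p M (yy 0 1 * Q)" using cop_power_right unfolding cop_def by blast
qed

text \<open>The two polynomials are the determinants of the pairs chosen in
  \<open>extension_monomial\<close>: their monomial factors involve different variables and their
  brackets are \<open>yy 0 1\<close> and \<open>yy 1 2\<close>.\<close>

lemma cop_discriminants:
  assumes p: "p = 0 \<or> prime p"
  shows "cop p ((Var (0, 0) * Var (1, 0)) ^ k * yy 0 1) ((Var (0, 1) * Var (1, 1)) ^ k * yy 1 2)"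
proof -
  note V = not_dvd_Var[OF p]
  have VV: "\<not> of_int p dvd Var a * Var b" for a b using of_int_dvd_multD[OF p] V by blast
  have y: "\<not> of_int p dvd yy 0 1" "\<not> of_int p dvd yy 1 2" by (rule not_dvd_yy[OF p]; simp)+
  have 1: "cop p (Var a) (Var b)" if "a \<noteq> b" for a b by (rule cop_kill[OF p]) (use that V in \<open>simp add: kill_def\<close>)
  have 2: "cop p (Var (0, 0)) (yy 1 2)" "cop p (Var (1, 0)) (yy 1 2)"
    by (rule cop_kill[OF p], use y(2) in \<open>simp add: kill_def yy_def ev_simps\<close>)+
  have 3: "cop p (Var (0, 1)) (yy 0 1)" "cop p (Var (1, 1)) (yy 0 1)"
    by (rule cop_kill[OF p], use VV in \<open>simp add: kill_def yy_def ev_simps\<close>)+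
  have 4: "cop p (yy 0 1) (Var (0, 1))" "cop p (yy 0 1) (Var (1, 1))" using 3 cop_sym[OF p _ V] by blast+
  have a: "cop p (Var (0, 0) * Var (1, 0)) ((Var (0, 1) * Var (1, 1)) ^ k * yy 1 2)"
    by (intro cop_mult_left[OF p V] cop_mult_right cop_power_right 1 2) auto
  have b: "cop p (yy 0 1) ((Var (0, 1) * Var (1, 1)) ^ k * yy 1 2)"
    by (intro cop_mult_right cop_power_right 4 cop_yy[OF p])
  have n: "\<not> of_int p dvd (Var (0, 0) * Var (1, 0)) ^ k"
  proof (induction k)
    case 0
    have "\<not> of_int p dvd 1 * Var (0, 0)" using V by simp
    then show ?case using dvd_mult2[of "of_int p" 1 "Var (0, 0)"] by (simp only: power_0) blast
  next
    case (Suc k)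
    then show ?case unfolding power_Suc using of_int_dvd_multD[OF p] VV by blast
  qed
  show ?thesis by (rule cop_mult_left[OF p n cop_power_left[OF p VV a] b])
qed

section \<open>Divided power operators\<close>

abbreviation dop :: "nat \<Rightarrow> (ipoly \<Rightarrow> ipoly) \<Rightarrow> bool" where
  "dop \<equiv> diffop_mod UNIV {0}"

lemma dop_0_iff: "dop 0 T \<longleftrightarrow> (\<exists>r. \<forall>x. T x = r * x)" by simp

lemma dop_Suc_iff:
  "dop (Suc n) T \<longleftrightarrow> (\<forall>x y. T (x + y) = T x + T y) \<and> (\<forall>r. dop n (\<lambda>x. r * T x - T (r * x)))"
  by simp

lemma dop_additive: "dop n T \<Longrightarrow> T (x + y) = T x + T y"
  by (cases n) (auto simp: distrib_left)

lemma dop_zero: "dop n (\<lambda>x. 0)"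
  by (induction n) (auto intro: exI[of _ 0])

lemma dop_add: "dop n T \<Longrightarrow> dop n T' \<Longrightarrow> dop n (\<lambda>x. T x + T' x)"
proof (induction n arbitrary: T T')
  case 0
  then obtain r r' where "\<And>x. T x = r * x" "\<And>x. T' x = r' * x" unfolding dop_0_iff by blast
  then show ?case unfolding dop_0_iff by (intro exI[of _ "r + r'"]) (simp add: distrib_right)
next
  case (Suc n)
  have "dop n (\<lambda>x. (r * T x - T (r * x)) + (r * T' x - T' (r * x)))" for r
    using Suc.prems unfolding dop_Suc_iff by (intro Suc.IH) blast+
  moreover have "(\<lambda>x. (r * T x - T (r * x)) + (r * T' x - T' (r * x))) = (\<lambda>x. r * (T x + T' x) - (T (r * x) + T' (r * x)))" for r
    by (simp add: algebra_simps)
  ultimately show ?case using Suc.prems unfolding dop_Suc_iff by (simp add: algebra_simps)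
qed

lemma dop_lmult: "dop n T \<Longrightarrow> dop n (\<lambda>x. a * T x)"
proof (induction n arbitrary: T)
  case 0
  then obtain r where "\<And>x. T x = r * x" unfolding dop_0_iff by blast
  then show ?case unfolding dop_0_iff by (intro exI[of _ "a * r"]) (simp add: mult.assoc)
next
  case (Suc n)
  have "dop n (\<lambda>x. a * (r * T x - T (r * x)))" for r using Suc.prems unfolding dop_Suc_iff by (intro Suc.IH) blast
  moreover have "(\<lambda>x. a * (r * T x - T (r * x))) = (\<lambda>x. r * (a * T x) - a * T (r * x))" for r by (simp add: algebra_simps)
  ultimately show ?case using Suc.prems unfolding dop_Suc_iff by (simp add: distrib_left)
qed

lemma dop_rmult: "dop n T \<Longrightarrow> dop n (\<lambda>x. T (a * x))"
proof (induction n arbitrary: T)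
  case 0
  then obtain r where "\<And>x. T x = r * x" unfolding dop_0_iff by blast
  then show ?case unfolding dop_0_iff by (intro exI[of _ "r * a"]) (simp add: mult.assoc)
next
  case (Suc n)
  have "dop n (\<lambda>x. r * T (a * x) - T (r * (a * x)))" for r
    using Suc.IH[of "\<lambda>x. r * T x - T (r * x)"] Suc.prems unfolding dop_Suc_iff by blast
  moreover have "r * (a * x) = a * (r * x)" for r x :: ipoly by (simp add: ac_simps)
  ultimately show ?case using Suc.prems unfolding dop_Suc_iff by (simp add: distrib_left)
qed

lemma dop_sum: "finite I \<Longrightarrow> (\<And>i. i \<in> I \<Longrightarrow> dop n (T i)) \<Longrightarrow> dop n (\<lambda>x. \<Sum>i\<in>I. T i x)"
  by (induction I rule: finite_induct) (auto intro: dop_add dop_zero)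

text \<open>The commutator with a sum or product is built from the commutators with its parts, and
  integers commute with an additive map, so commutators with variables decide.\<close>

lemma dop_generators:
  assumes add: "\<And>x y. T (x + y) = T x + T y" and int: "\<And>c x. T (of_int c * x) = of_int c * T x"
    and V: "\<And>v. dop n (\<lambda>x. Var v * T x - T (Var v * x))"
  shows "dop (Suc n) T"
proof -
  have "dop n (\<lambda>x. r * T x - T (r * x))" for r
  proof -
    have "r \<in> poly_carrier UNIV" by simp
    then show ?thesis
    proof (induction r rule: poly_carrier_induct)
      case (of_int c)
      then show ?case using dop_zero by (simp add: int)
    next
      case (add r s)
      have "(\<lambda>x. (r + s) * T x - T ((r + s) * x)) = (\<lambda>x. (r * T x - T (r * x)) + (s * T x - T (s * x)))"
        by (simp add: distrib_right assms(1) algebra_simps)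
      then show ?case using dop_add[OF add(3,4)] by simp
    next
      case (Var v r)
      have "(\<lambda>x. (Var v * r) * T x - T ((Var v * r) * x)) = (\<lambda>x. Var v * (r * T x - T (r * x)) + (Var v * T (r * x) - T (Var v * (r * x))))"
        by (simp add: algebra_simps)
      then show ?case using dop_add[OF dop_lmult[OF Var(3), of "Var v"] dop_rmult[OF V[of v], of r]] by simp
    qed
  qed
  then show ?thesis unfolding dop_Suc_iff using add by blast
qed

text \<open>The divided power derivative of multi-index \<open>k\<close>, that is, the
  \<open>k\<close>-th partial derivative divided by the factorials of \<open>k\<close>, for
  variables in \<open>U\<close>.\<close>

definition hasse :: "(nat \<times> nat) set \<Rightarrow> mon \<Rightarrow> ipoly \<Rightarrow> ipoly" where
  "hasse U k = frag_extend (\<lambda>m. Poly_Mapping.single (m - k) (\<Prod>v\<in>U. int (Poly_Mapping.lookup m v choose Poly_Mapping.lookup k v)))"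

lemma hasse_add: "hasse U k (x + y) = hasse U k x + hasse U k y"
  unfolding hasse_def by (rule frag_extend_add)

lemma hasse_of_int_mult: "hasse U k (of_int c * x) = of_int c * hasse U k x"
  unfolding hasse_def by (simp add: frag_extend_cmul flip: frag_cmul_eq)

lemma hasse_single: "hasse U k (Poly_Mapping.single m c) = Poly_Mapping.single (m - k) (c * (\<Prod>v\<in>U. int (Poly_Mapping.lookup m v choose Poly_Mapping.lookup k v)))"
  by (cases "c = 0") (simp_all add: hasse_def frag_extend_def frag_cmul_eq of_int_mult_single)

lemma hasse_sum: "hasse U k (sum g I) = (\<Sum>i\<in>I. hasse U k (g i))"
  by (induction I rule: infinite_finite_induct) (auto simp: hasse_add, simp_all add: hasse_def)

text \<open>Pascal's rule in the variable \<open>v\<close>. The other exponents are unaffected, and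
  where subtraction of exponents truncates the binomial coefficient is 0.\<close>

lemma hasse_commutator:
  assumes U: "finite U" and k: "Poly_Mapping.keys k \<subseteq> U"
  shows "Var v * hasse U k x - hasse U k (Var v * x) = (if Poly_Mapping.lookup k v = 0 then 0 else - hasse U (k - Poly_Mapping.single v 1) x)"
proof -
  let ?e = "Poly_Mapping.single v (1::nat)"
  have mono: "Var v * hasse U k (Poly_Mapping.single m c) - hasse U k (Var v * Poly_Mapping.single m c)
     = (if Poly_Mapping.lookup k v = 0 then 0 else - hasse U (k - ?e) (Poly_Mapping.single m c))" for m c
  proof (cases "Poly_Mapping.lookup k v = 0")
    case True
    have "?e + (m - k) = (?e + m) - k"
      by (rule poly_mapping_eqI) (use True in \<open>auto simp: lookup_add lookup_minus lookup_single when_def\<close>)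
    moreover have "(\<Prod>w\<in>U. int (Poly_Mapping.lookup (?e + m) w choose Poly_Mapping.lookup k w)) = (\<Prod>w\<in>U. int (Poly_Mapping.lookup m w choose Poly_Mapping.lookup k w))"
      by (rule prod.cong) (use True in \<open>auto simp: lookup_add lookup_single when_def\<close>)
    ultimately show ?thesis using True by (simp add: Var_def mult_single hasse_single)
  next
    case False
    then have vU: "v \<in> U" using k by (auto simp: in_keys_iff)
    obtain j where j: "Poly_Mapping.lookup k v = Suc j" using False by (cases "Poly_Mapping.lookup k v") auto
    let ?R = "\<Prod>w\<in>U - {v}. int (Poly_Mapping.lookup m w choose Poly_Mapping.lookup k w)"
    have split: "(\<Prod>w\<in>U. F w) = F v * (\<Prod>w\<in>U - {v}. F w)" for F :: "nat \<times> nat \<Rightarrow> int" by (rule prod.remove[OF U vU])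
    have r1: "(\<Prod>w\<in>U - {v}. int (Poly_Mapping.lookup (?e + m) w choose Poly_Mapping.lookup k w)) = ?R"
      by (rule prod.cong) (auto simp: lookup_add lookup_single when_def)
    have r2: "(\<Prod>w\<in>U - {v}. int (Poly_Mapping.lookup m w choose Poly_Mapping.lookup (k - ?e) w)) = ?R"
      by (rule prod.cong) (auto simp: lookup_minus lookup_single when_def)
    have e1: "(?e + m) - k = m - (k - ?e)"
      by (rule poly_mapping_eqI) (use j in \<open>auto simp: lookup_add lookup_minus lookup_single when_def\<close>)
    let ?n = "Poly_Mapping.lookup m v"
    have 1: "hasse U k (Var v * Poly_Mapping.single m c) = Poly_Mapping.single (m - (k - ?e)) (c * (int (Suc ?n choose Suc j) * ?R))"
      unfolding Var_def mult_single hasse_single split r1 e1 by (simp add: lookup_add j)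
    have 2: "hasse U (k - ?e) (Poly_Mapping.single m c) = Poly_Mapping.single (m - (k - ?e)) (c * (int (?n choose j) * ?R))"
      unfolding hasse_single split r2 by (simp add: lookup_minus j)
    have 3: "Var v * hasse U k (Poly_Mapping.single m c) = Poly_Mapping.single (m - (k - ?e)) (c * (int (?n choose Suc j) * ?R))"
    proof (cases "Suc j \<le> ?n")
      case True
      have "?e + (m - k) = m - (k - ?e)"
        by (rule poly_mapping_eqI) (use True j in \<open>auto simp: lookup_add lookup_minus lookup_single when_def\<close>)
      then show ?thesis unfolding hasse_single split Var_def mult_single by (simp add: j)
    next
      case False
      then show ?thesis unfolding hasse_single split by (simp add: j binomial_eq_0)
    qed
    show ?thesis unfolding 1 2 3 using False by (simp add: single_diff[symmetric] single_uminus[symmetric] algebra_simps)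
  qed
  let ?t = "\<lambda>m. Poly_Mapping.single m (Poly_Mapping.lookup x m)"
  have x: "x = (\<Sum>m\<in>Poly_Mapping.keys x. ?t m)" by (rule poly_sum_monomials)
  have "Var v * hasse U k (sum ?t I) - hasse U k (Var v * sum ?t I)
    = (if Poly_Mapping.lookup k v = 0 then 0 else - hasse U (k - ?e) (sum ?t I))" for I
  proof -
    have "Var v * hasse U k (sum ?t I) - hasse U k (Var v * sum ?t I) = (\<Sum>m\<in>I. Var v * hasse U k (?t m) - hasse U k (Var v * ?t m))"
      by (simp only: hasse_sum sum_distrib_left sum_subtractf)
    also have "\<dots> = (\<Sum>m\<in>I. if Poly_Mapping.lookup k v = 0 then 0 else - hasse U (k - ?e) (?t m))" by (simp only: mono)
    also have "\<dots> = (if Poly_Mapping.lookup k v = 0 then 0 else - hasse U (k - ?e) (sum ?t I))" by (simp add: hasse_sum sum_negf)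
    finally show ?thesis .
  qed
  from this[of "Poly_Mapping.keys x"] show ?thesis unfolding x[symmetric] .
qed

lemma dop_hasse:
  assumes U: "finite U" and k: "Poly_Mapping.keys k \<subseteq> U" and n: "(\<Sum>v\<in>U. Poly_Mapping.lookup k v) = n"
  shows "dop n (hasse U k)"
  using k n
proof (induction n arbitrary: k)
  case 0
  then have z: "Poly_Mapping.lookup k v = 0" if "v \<in> U" for v using U that by simp
  have "v \<notin> Poly_Mapping.keys k" for v using 0(1) z by (metis in_keys_iff subsetD)
  then have "Poly_Mapping.keys k = {}" by blast
  then have k0: "k = 0" by simp
  have "hasse U k x = 1 * x" for x
    unfolding k0 by (subst (1 2) poly_sum_monomials[of x]) (simp add: hasse_sum hasse_single)
  then show ?case unfolding dop_0_iff by blast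
next
  case (Suc n)
  show ?case
  proof (rule dop_generators[OF hasse_add hasse_of_int_mult])
    fix v
    show "dop n (\<lambda>x. Var v * hasse U k x - hasse U k (Var v * x))"
    proof (cases "Poly_Mapping.lookup k v = 0")
      case True
      then show ?thesis unfolding hasse_commutator[OF U Suc.prems(1)] using dop_zero by simp
    next
      case False
      let ?k = "k - Poly_Mapping.single v 1"
      have vU: "v \<in> U" using False Suc.prems(1) by (auto simp: in_keys_iff)
      have "Poly_Mapping.keys ?k \<subseteq> U" using Suc.prems(1) by (auto simp: in_keys_iff lookup_minus)
      moreover have "(\<Sum>w\<in>U. Poly_Mapping.lookup ?k w) = n"
      proof -
        have "(\<Sum>w\<in>U. Poly_Mapping.lookup k w) = (\<Sum>w\<in>U. Poly_Mapping.lookup ?k w + (if w = v then 1 else 0))"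
          by (rule sum.cong) (use False in \<open>auto simp: lookup_minus lookup_single when_def\<close>)
        also have "\<dots> = (\<Sum>w\<in>U. Poly_Mapping.lookup ?k w) + 1" using U vU by (simp add: sum.distrib sum.delta)
        finally show ?thesis using Suc.prems(2) by simp
      qed
      ultimately have "dop n (\<lambda>x. (- 1) * hasse U ?k x)" by (intro dop_lmult Suc.IH)
      then show ?thesis unfolding hasse_commutator[OF U Suc.prems(1)] using False by simp
    qed
  qed
qed

text \<open>\<open>Phi_S\<close> is the divided power derivative with all indices
  \<open>q - 1\<close>, hence a differential operator over the integers and not only modulo
  \<open>p\<close>. This is what makes operators built from it liftable.\<close>

lemma dop_Phi_S:
  assumes "finite U" shows "\<exists>n. dop n (Phi_S U q)"
proof -
  let ?e = "\<Sum>v\<in>U. Poly_Mapping.single v (q - 1)"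
  have "Phi_S U q x = hasse U ?e x" for x
  proof -
    have "(\<Prod>v\<in>U. int (Poly_Mapping.lookup m v choose (q - 1))) = (\<Prod>v\<in>U. int (Poly_Mapping.lookup m v choose Poly_Mapping.lookup ?e v))" for m
      by (rule prod.cong) (simp_all add: lookup_sum_singles[OF assms])
    then show ?thesis unfolding Phi_S_eq hasse_def by simp
  qed
  then have "Phi_S U q = hasse U ?e" by blast
  moreover have "Poly_Mapping.keys ?e \<subseteq> U" by (auto simp: in_keys_iff lookup_sum_singles[OF assms] split: if_splits)
  ultimately show ?thesis using dop_hasse[OF assms] by auto
qed

lemma additive_of_int_mult:
  fixes T :: "ipoly \<Rightarrow> ipoly"
  assumes add: "\<And>x y. T (x + y) = T x + T y"
  shows "T (of_int c * x) = of_int c * T x"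
proof -
  have 0: "T 0 = 0" using add[of 0 0] by simp
  have m: "T (- x) = - T x" for x using add[of x "- x"] 0 by (simp add: eq_neg_iff_add_eq_0 add.commute)
  have n: "T (of_nat n * x) = of_nat n * T x" for n x by (induction n) (simp_all add: 0 distrib_right add)
  show ?thesis by (cases c rule: int_cases2) (simp_all add: n m)
qed

section \<open>From operators on the polynomial ring to operators on the hypersurface\<close>

lemma rho2_iota_mult: "s \<in> poly_carrier (sym_vars 3) \<Longrightarrow> rho2 (sym_iota s * x) = sym_iota s * rho2 x"
  by (rule rho2_invariant_mult[OF W0_sym_iota sigma_sym_iota])

lemma common_denominator:
  assumes "k \<le> K" "s \<in> poly_carrier (sym_vars 3)" "2 ^ k * z = sym_iota s"
  shows "\<exists>s'\<in>poly_carrier (sym_vars 3). 2 ^ K * z = sym_iota s'"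
proof -
  have "2 ^ K * z = 2 ^ (K - k) * (2 ^ k * z)" using assms(1) by (simp add: mult.assoc[symmetric] power_add[symmetric])
  also have "\<dots> = sym_iota (2 ^ (K - k) * s)" unfolding assms(3) sym_iota_simps ..
  finally show ?thesis using assms(2) by (intro bexI[of _ "2 ^ (K - k) * s"]) auto
qed

text \<open>\<open>rho2_Pp\<close> bounds the power of 2 for one element at a time, whereas an
  operator on the hypersurface needs one bound for all. Induction on the order provides it: passing
  from \<open>x\<close> to \<open>Var v * x\<close> introduces only a commutator of smaller
  order.\<close>

lemma uniform_denominator:
  assumes "dop n T"
  shows "\<exists>K. \<forall>s\<in>poly_carrier (sym_vars 3). \<exists>s'\<in>poly_carrier (sym_vars 3). 2 ^ K * rho2 (T (sym_iota s)) = sym_iota s'"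
  using assms
proof (induction n arbitrary: T)
  case 0
  let ?S = "poly_carrier (sym_vars 3)"
  obtain r where r: "\<And>x. T x = r * x" using 0 unfolding dop_0_iff by blast
  obtain k s0 where k: "s0 \<in> ?S" "2 ^ k * rho2 r = sym_iota s0" using rho2_Pp[of r] unfolding Pp_def by blast
  show ?case
  proof (intro exI[of _ k] ballI)
    fix s assume s: "s \<in> ?S"
    have "2 ^ k * rho2 (T (sym_iota s)) = sym_iota s * (2 ^ k * rho2 r)"
      unfolding r mult.commute[of r] rho2_iota_mult[OF s] by (simp add: ac_simps)
    also have "\<dots> = sym_iota (s * s0)" unfolding k sym_iota_simps ..
    finally show "\<exists>s'\<in>?S. 2 ^ k * rho2 (T (sym_iota s)) = sym_iota s'" using s k(1) by (intro bexI[of _ "s * s0"]) auto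
  qed
next
  case (Suc n)
  let ?S = "poly_carrier (sym_vars 3)"
  let ?C = "\<lambda>v x. sym_iota (Var v) * T x - T (sym_iota (Var v) * x)"
  have add: "T (x + y) = T x + T y" for x y using Suc.prems unfolding dop_Suc_iff by blast
  have "dop n (?C v)" for v using Suc.prems unfolding dop_Suc_iff by blast
  then have "\<forall>v. \<exists>K. \<forall>s\<in>?S. \<exists>s'\<in>?S. 2 ^ K * rho2 (?C v (sym_iota s)) = sym_iota s'" using Suc.IH by blast
  then obtain Kf where Kf: "\<And>v s. s \<in> ?S \<Longrightarrow> \<exists>s'\<in>?S. 2 ^ Kf v * rho2 (?C v (sym_iota s)) = sym_iota s'" by metis
  obtain k s0 where k: "s0 \<in> ?S" "2 ^ k * rho2 (T 1) = sym_iota s0" using rho2_Pp[of "T 1"] unfolding Pp_def by blast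
  \<comment> \<open>One exponent for the value at 1 and for the commutators with the six matrix
    entries.\<close>
  define K where "K = k + (\<Sum>v\<in>sym_vars 3. Kf v)"
  have KK: "Kf v \<le> K" if "v \<in> sym_vars 3" for v
  proof -
    have "Kf v \<le> (\<Sum>v\<in>sym_vars 3. Kf v)" by (rule member_le_sum[OF that]) (simp_all add: sym_vars_3)
    then show ?thesis unfolding K_def by simp
  qed
  show ?case
  proof (intro exI[of _ K] ballI)
    fix s assume "s \<in> ?S"
    then show "\<exists>s'\<in>?S. 2 ^ K * rho2 (T (sym_iota s)) = sym_iota s'"
    proof (induction s rule: poly_carrier_induct)
      case (of_int c)
      obtain s1 where s1: "s1 \<in> ?S" "2 ^ K * rho2 (T 1) = sym_iota s1" using common_denominator[OF _ k, of K] by (auto simp: K_def)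
      have "T (of_int c) = of_int c * T 1" using additive_of_int_mult[of T c 1, OF add] by simp
      then have "2 ^ K * rho2 (T (sym_iota (of_int c))) = of_int c * (2 ^ K * rho2 (T 1))" by (simp add: sym_iota_simps rho2_of_int_mult ac_simps)
      also have "\<dots> = sym_iota (of_int c * s1)" unfolding s1 sym_iota_simps ..
      finally show ?case using s1(1) by (intro bexI[of _ "of_int c * s1"]) auto
    next
      case (add x y)
      then obtain x' y' where "x' \<in> ?S" "y' \<in> ?S" "2 ^ K * rho2 (T (sym_iota x)) = sym_iota x'" "2 ^ K * rho2 (T (sym_iota y)) = sym_iota y'" by blast
      then show ?case by (intro bexI[of _ "x' + y'"]) (auto simp: sym_iota_simps assms Suc.prems \<open>\<And>x y. T (x + y) = T x + T y\<close> rho2_add distrib_left)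
    next
      case (Var v x)
      obtain x' where x': "x' \<in> ?S" "2 ^ K * rho2 (T (sym_iota x)) = sym_iota x'" using Var by blast
      obtain z0 where "z0 \<in> ?S" "2 ^ Kf v * rho2 (?C v (sym_iota x)) = sym_iota z0" using Kf Var(2) by blast
      then obtain z where z: "z \<in> ?S" "2 ^ K * rho2 (?C v (sym_iota x)) = sym_iota z" using common_denominator[OF KK[OF Var(1)]] by blast
      have vS: "Var v \<in> ?S" using Var(1) by simp
      have "T (sym_iota (Var v * x)) = sym_iota (Var v) * T (sym_iota x) - ?C v (sym_iota x)" by (simp add: sym_iota_simps(3))
      then have "2 ^ K * rho2 (T (sym_iota (Var v * x))) = sym_iota (Var v) * (2 ^ K * rho2 (T (sym_iota x))) - 2 ^ K * rho2 (?C v (sym_iota x))"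
        by (simp only: rho2_diff rho2_iota_mult[OF vS] right_diff_distrib ac_simps)
      also have "\<dots> = sym_iota (Var v * x' - z)" unfolding x' z sym_iota_simps(2,3) ..
      finally show ?case using vS x'(1) z(1) by (intro bexI[of _ "Var v * x' - z"]) auto
    qed
  qed
qed

text \<open>\<open>rho2\<close> is linear over the image of \<open>sym_iota\<close>, so commutators
  of \<open>D\<close> correspond to commutators of \<open>T\<close> under \<open>sym_iota\<close>.
  Its kernel over the integers is generated by \<open>sdet\<close>, which turns equalities of images
  into congruences.\<close>

lemma diffop_of_dop:
  assumes "dop n T" "\<And>s. s \<in> poly_carrier (sym_vars 3) \<Longrightarrow> D s \<in> poly_carrier (sym_vars 3)"
    "\<And>s. s \<in> poly_carrier (sym_vars 3) \<Longrightarrow> sym_iota (D s) = c * rho2 (T (sym_iota s))"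
  shows "diffop_mod (poly_carrier (sym_vars 3)) (hyper_ideal (sym_vars 3) sdet 0) n D"
proof -
  let ?S = "poly_carrier (sym_vars 3)" and ?J = "hyper_ideal (sym_vars 3) sdet 0"
  have ker: "x \<in> ?J" if "x \<in> ?S" "sym_iota x = 0" for x using sym_iota_kernel[of 0 x] that by simp
  show ?thesis using assms
  proof (induction n arbitrary: T D)
    case 0
    obtain r where r: "\<And>x. T x = r * x" using 0(1) unfolding dop_0_iff by blast
    have "D x - D 1 * x \<in> ?J" if x: "x \<in> ?S" for x
    proof (rule ker)
      have "sym_iota (D x) = c * (sym_iota x * rho2 r)"
        unfolding 0(3)[OF x] r mult.commute[of r] rho2_iota_mult[OF x] ..
      moreover have "sym_iota (D 1) = c * rho2 r" using 0(3)[of 1] by (simp add: r sym_iota_simps)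
      ultimately show "sym_iota (D x - D 1 * x) = 0" by (simp add: sym_iota_simps)
    qed (use x 0(2) in simp)
    then show ?case using 0(2)[of 1] by auto
  next
    case (Suc n)
    have add: "T (x + y) = T x + T y" for x y using Suc.prems(1) unfolding dop_Suc_iff by blast
    have 1: "D (x + y) - (D x + D y) \<in> ?J" if "x \<in> ?S" "y \<in> ?S" for x y
      by (rule ker) (use that Suc.prems in \<open>simp_all add: sym_iota_simps add rho2_add distrib_left\<close>)
    have 2: "diffop_mod ?S ?J n (\<lambda>x. r * D x - D (r * x))" if r: "r \<in> ?S" for r
    proof (rule Suc.IH)
      show "dop n (\<lambda>x. sym_iota r * T x - T (sym_iota r * x))" using Suc.prems(1) unfolding dop_Suc_iff by blast
      show "r * D x - D (r * x) \<in> ?S" if "x \<in> ?S" for x using that r Suc.prems(2) by simp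
      show "sym_iota (r * D x - D (r * x)) = c * rho2 (sym_iota r * T (sym_iota x) - T (sym_iota r * sym_iota x))" if x: "x \<in> ?S" for x
      proof -
        have "sym_iota (D (r * x)) = c * rho2 (T (sym_iota r * sym_iota x))" using Suc.prems(3)[of "r * x"] r x by (simp add: sym_iota_simps)
        then show ?thesis unfolding sym_iota_simps(2,3) rho2_diff rho2_iota_mult[OF r] Suc.prems(3)[OF x] by (simp add: algebra_simps)
      qed
    qed
    show ?case using 1 2 by simp
  qed
qed

section \<open>Extending Frobenius-linear operators from the invariants\<close>

text \<open>\<open>\<Gamma>\<close> abstracts the map that averages by \<open>rho2\<close> and then
  applies the given operator modulo \<open>p\<close>. It is linear over \<open>q\<close>-th powers
  of invariants only; the goal is to write it as \<open>rho2\<close> after an operator on the whole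
  polynomial ring.\<close>

locale frobenius_functional =
  fixes p e q :: nat and \<Gamma> :: "ipoly \<Rightarrow> ipoly"
  assumes p: "prime p" "p \<noteq> 2" and q: "q = p ^ e"
    and G_add: "pcong (int p) (\<Gamma> (x + y)) (\<Gamma> x + \<Gamma> y)"
    and G_cong: "pcong (int p) x y \<Longrightarrow> pcong (int p) (\<Gamma> x) (\<Gamma> y)"
    and G_mult: "Pp r \<Longrightarrow> pcong (int p) (\<Gamma> (r ^ q * x)) (r ^ q * \<Gamma> x)"
    and G_sigma: "sigma (\<Gamma> x) = \<Gamma> x" and G_rho: "rho2 (\<Gamma> x) = 2 * \<Gamma> x"
    and G_wpart: "wpart 0 x = 0 \<Longrightarrow> pcong (int p) (\<Gamma> x) 0"
begin

lemma not_dvd_power: "\<not> of_int (int p) dvd (x::ipoly) \<Longrightarrow> \<not> of_int (int p) dvd x ^ n"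
proof (induction n)
  case 0
  then show ?case using dvd_mult2[of "of_int (int p)" 1 x] by auto
next
  case (Suc n)
  have "int p = 0 \<or> prime (int p)" using p by simp
  then show ?case unfolding power_Suc using of_int_dvd_multD[of "int p" x "x ^ n"] Suc by blast
qed

lemma ip: "int p = 0 \<or> prime (int p)" using p by simp

lemma q_pos: "q > 0" using p q prime_gt_0_nat by simp

lemma q_odd: "odd q" using p q prime_odd_nat[of p] prime_ge_2_nat[of p] by simp

lemma frobenius3:
  assumes "x + y + z = (0::ipoly)" shows "pcong (int p) (x ^ q + y ^ q + z ^ q) 0"
proof -
  define g where "g i = (if i = 0 then x else if i = 1 then y else z)" for i :: nat
  have s: "(\<Sum>i<3. h (g i)) = h x + h y + h z" for h :: "ipoly \<Rightarrow> ipoly"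
    by (simp add: g_def numeral_3_eq_3 lessThan_Suc add.commute add.left_commute)
  have "pcong (int p) ((\<Sum>i<3. g i) ^ (p ^ e)) (\<Sum>i<3. g i ^ (p ^ e))" by (rule pcong_frobenius_sum_power[OF p(1)])
  then show ?thesis using s[of "\<lambda>x. x"] s[of "\<lambda>x. x ^ q"] assms q_pos unfolding q by (simp add: pcong_sym zero_power)
qed

lemma frobenius_diff: "pcong (int p) ((x - y) ^ q) (x ^ q - (y::ipoly) ^ q)"
proof -
  have m: "(- t) ^ q = - (t ^ q)" for t :: ipoly using q_odd by (rule power_minus_odd)
  have "pcong (int p) (x ^ q + (- y) ^ q + (- (x - y)) ^ q) 0" by (rule frobenius3) simp
  then have "pcong (int p) (x ^ q - y ^ q - (x - y) ^ q) 0" unfolding m by simp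
  then have "pcong (int p) (x ^ q - y ^ q) ((x - y) ^ q)" by (simp add: pcong_def)
  then show ?thesis by (rule pcong_sym)
qed

text \<open>The determinant of \<open>s\<close>, \<open>t\<close> and their images under
  \<open>sigma\<close>, which changes sign under \<open>sigma\<close>. For \<open>s\<close> and
  \<open>t\<close> of equal weight, its product with a bracket is an invariant.\<close>

definition delta :: "ipoly \<Rightarrow> ipoly \<Rightarrow> ipoly" where "delta s t = s * sigma t - t * sigma s"

lemma delta_power: "pcong (int p) (delta s t ^ q) (s ^ q * sigma t ^ q - t ^ q * sigma s ^ q)"
  unfolding delta_def power_mult_distrib[symmetric] by (rule frobenius_diff)

lemma Pp_yy_delta:
  assumes "Mo w s" "Mo w t" shows "Pp (yy 0 1 * delta s t)"
proof (rule invariant_Pp)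
  have h: "W0 (s * sigma t)" "W0 (t * sigma s)"
    using Mo_mult[OF assms(1) Mo_sigma[OF assms(2)]] Mo_mult[OF assms(2) Mo_sigma[OF assms(1)]] by (simp_all add: Mo_W0)
  show "W0 (yy 0 1 * delta s t)" unfolding delta_def by (rule W0_mult[OF W0_yy W0_diff[OF h]]) auto
  show "sigma (yy 0 1 * delta s t) = yy 0 1 * delta s t"
    unfolding delta_def by (simp add: sigma_simps sigma_yy algebra_simps)
qed

text \<open>The three-term relation of the determinants \<open>delta\<close>. The factor
  \<open>yy 0 1\<close> makes the coefficients invariant, so that \<open>q\<close>-linearity of
  \<open>\<Gamma>\<close> applies; it is cancelled afterwards.\<close>

lemma plucker:
  assumes s: "Mo w s1" "Mo w s2" "Mo w s3"
  shows "pcong (int p) (delta s1 s2 ^ q * \<Gamma> (s3 ^ q * a) + delta s2 s3 ^ q * \<Gamma> (s1 ^ q * a) + delta s3 s1 ^ q * \<Gamma> (s2 ^ q * a)) 0"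
proof -
  let ?y = "yy 0 1"
  let ?A = "?y * delta s1 s2 * s3" and ?B = "?y * delta s2 s3 * s1" and ?C = "?y * delta s3 s1 * s2"
  have step: "pcong (int p) (?y ^ q * (delta s t ^ q * \<Gamma> (r ^ q * a))) (\<Gamma> ((?y * delta s t * r) ^ q * a))"
    if "Mo w s" "Mo w t" for s t r
    using pcong_sym[OF G_mult[OF Pp_yy_delta[OF that], of "r ^ q * a"]] by (simp add: power_mult_distrib mult.assoc)
  have "?A + ?B + ?C = 0" unfolding delta_def by (simp add: algebra_simps)
  then have z: "pcong (int p) ((?A ^ q + ?B ^ q + ?C ^ q) * a) (0 * a)" by (intro pcong_mult pcong_refl frobenius3)
  have "pcong (int p) (?y ^ q * (delta s1 s2 ^ q * \<Gamma> (s3 ^ q * a)) + ?y ^ q * (delta s2 s3 ^ q * \<Gamma> (s1 ^ q * a)) + ?y ^ q * (delta s3 s1 ^ q * \<Gamma> (s2 ^ q * a)))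
     (\<Gamma> (?A ^ q * a) + \<Gamma> (?B ^ q * a) + \<Gamma> (?C ^ q * a))" by (intro pcong_add step s)
  also have "pcong (int p) (\<Gamma> (?A ^ q * a) + \<Gamma> (?B ^ q * a) + \<Gamma> (?C ^ q * a)) (\<Gamma> (?A ^ q * a + ?B ^ q * a + ?C ^ q * a))"
    by (rule pcong_sym[OF pcong_trans[OF G_add]]) (intro pcong_add G_add pcong_refl)
  also have "pcong (int p) (\<Gamma> (?A ^ q * a + ?B ^ q * a + ?C ^ q * a)) 0"
    using pcong_trans[OF G_cong[OF z] G_wpart] by (simp add: distrib_right)
  finally have "pcong (int p) (?y ^ q * (delta s1 s2 ^ q * \<Gamma> (s3 ^ q * a) + delta s2 s3 ^ q * \<Gamma> (s1 ^ q * a) + delta s3 s1 ^ q * \<Gamma> (s2 ^ q * a))) (?y ^ q * 0)"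
    by (simp add: distrib_left)
  then show ?thesis by (rule pcong_cancel[OF ip]) (use not_dvd_power not_dvd_yy[OF ip] in auto)
qed

end

lemma Mo_single: "Poly_Mapping.keys n \<subseteq> uv \<Longrightarrow> Mo (uw n) (Poly_Mapping.single n 1)"
  unfolding Mo_def adm_def by blast

lemma wpart_Mo_mult:
  assumes "Mo j x" shows "wpart k (x * y) = x * wpart (k - j) y"
proof -
  obtain n where n: "x = Poly_Mapping.single n 1" "adm j n" using assms unfolding Mo_def by blast
  then have "Poly_Mapping.keys n \<subseteq> uv" "uw n = j" unfolding adm_def by auto
  then show ?thesis using wpart_single_mult[of n k 1 y] n(1) by simp
qed

lemma wpart_Mo: "Mo j x \<Longrightarrow> wpart k x = (if k = j then x else 0)"
  unfolding Mo_def by (auto simp: wpart_single adm_def)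

context frobenius_functional
begin

lemma not_dvd_2: "\<not> of_int (int p) dvd (2::ipoly)"
proof
  assume "of_int (int p) dvd (2::ipoly)"
  then have "of_int (int p) dvd (of_int 2 * 1 :: ipoly)" by simp
  then have "int p dvd Poly_Mapping.lookup (of_int 2 * 1 :: ipoly) 0" unfolding of_int_dvd_poly_iff by blast
  then have "int p dvd 2" unfolding lookup_of_int_mult by simp
  then have "p dvd 2" by presburger
  then show False using p primes_dvd_imp_eq[of p 2] by auto
qed

lemma sigma_delta: "sigma (delta s t) = - delta s t"
  by (simp add: delta_def sigma_simps algebra_simps)

text \<open>Let \<open>w\<close> be the weight for which \<open>q * w + uw m = 0\<close>. On
  semi-invariants \<open>s\<close> of weight \<open>w\<close> the map \<open>L\<close> taking
  \<open>s\<close> to \<open>\<Gamma> (s ^ q * a)\<close> is determined by two values, with a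
  denominator \<open>D\<close>. A second pair has a coprime denominator, so the division by
  \<open>D\<close> is possible modulo \<open>p\<close>, and the quotient \<open>E0\<close>
  represents \<open>L\<close>.\<close>

lemma extension_monomial:
  assumes m: "Poly_Mapping.keys m \<subseteq> uv"
  shows "\<exists>E. \<forall>n. Poly_Mapping.keys n \<subseteq> uv \<longrightarrow>
    pcong (int p) (\<Gamma> (Poly_Mapping.single n 1 ^ q * Poly_Mapping.single m 1)) (rho2 (Poly_Mapping.single n 1 ^ q * E))"
proof -
  define a :: ipoly where "a = Poly_Mapping.single m 1"
  have a: "Mo (uw m) a" unfolding a_def by (rule Mo_single[OF m])
  have Mq: "Mo (int q * uw n) (Poly_Mapping.single n 1 ^ q)" if "Poly_Mapping.keys n \<subseteq> uv" for n by (rule Mo_power[OF Mo_single[OF that]])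
  have vanish: "pcong (int p) (\<Gamma> (Poly_Mapping.single n 1 ^ q * a)) 0" if n: "Poly_Mapping.keys n \<subseteq> uv" "int q * uw n + uw m \<noteq> 0" for n
    by (rule G_wpart) (use wpart_Mo[OF Mo_mult[OF Mq[OF n(1)] a], of 0] n(2) in simp)
  show ?thesis
  proof (cases "int q dvd uw m")
    case False
    have "int q * uw n + uw m \<noteq> 0" for n
    proof
      assume "int q * uw n + uw m = 0"
      then have "uw m = int q * (- uw n)" by simp
      then show False using False by simp
    qed
    then show ?thesis using vanish unfolding a_def by (intro exI[of _ 0]) simp
  next
    case True
    then obtain t where t: "uw m = int q * t" by blast
    define w where "w = - t"
    define k where "k = nat \<bar>w\<bar>"
    define mo where "mo i = (if w \<ge> 0 then Var (0, i) ^ k else Var (1, i) ^ k)" for i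
    have mo: "Mo w (mo i)" if "i < 3" for i
      using Mo_power[OF Mo_u[OF that], of k] Mo_power[OF Mo_v[OF that], of k] unfolding mo_def k_def by auto
    have mos: "mo i * sigma (mo i) = (Var (0, i) * Var (1, i)) ^ k" for i
      unfolding mo_def by (simp add: sigma_simps sw_def power_mult_distrib mult.commute)
    \<comment> \<open>The monomials \<open>mo i\<close> have weight \<open>w\<close> for either sign
      of \<open>w\<close>. Within each pair the entries differ by a monomial of weight 0, so the
      determinant is a monomial times a bracket, \<open>yy 0 1\<close> for the first pair and
      \<open>yy 1 2\<close> for the second.\<close>
    define s1 s2 t1 t2 where "s1 = mo 0 * (Var (0, 0) * Var (1, 1))" and "s2 = mo 0" and "t1 = mo 1 * (Var (0, 1) * Var (1, 2))" and "t2 = mo 1"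
    have Mst: "Mo w s1" "Mo w s2" "Mo w t1" "Mo w t2"
      using Mo_mult[OF mo[of 0] Mo_mult[OF Mo_u[of 0] Mo_v[of 1]]] Mo_mult[OF mo[of 1] Mo_mult[OF Mo_u[of 1] Mo_v[of 2]]] mo[of 0] mo[of 1]
      unfolding s1_def s2_def t1_def t2_def by simp_all
    have d1: "delta s1 s2 = (Var (0, 0) * Var (1, 0)) ^ k * yy 0 1"
      unfolding delta_def s1_def s2_def mos[of 0, symmetric] yy_def by (simp add: sigma_simps sw_def algebra_simps)
    have d2: "delta t1 t2 = (Var (0, 1) * Var (1, 1)) ^ k * yy 1 2"
      unfolding delta_def t1_def t2_def mos[of 1, symmetric] yy_def by (simp add: sigma_simps sw_def algebra_simps)
    have nd: "\<not> of_int (int p) dvd delta s1 s2"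
    proof
      assume "of_int (int p) dvd delta s1 s2"
      then have "of_int (int p) dvd (Var (0, 0) * Var (1, 0)) ^ k \<or> of_int (int p) dvd yy 0 1" unfolding d1 by (rule of_int_dvd_multD[OF ip])
      moreover have "\<not> of_int (int p) dvd Var (0, 0) * Var (1, 0)" using of_int_dvd_multD[OF ip] not_dvd_Var[OF ip] by blast
      ultimately show False using not_dvd_power not_dvd_yy[OF ip, of 0 1] by auto
    qed
    define D D' where "D = delta s1 s2 ^ q" and "D' = delta t1 t2 ^ q"
    have cop: "cop (int p) D D'" unfolding D_def D'_def
      by (rule cop_power_left[OF ip nd cop_power_right]) (unfold d1 d2, rule cop_discriminants[OF ip])
    have D0: "\<not> of_int (int p) dvd D" unfolding D_def by (rule not_dvd_power[OF nd])
    define L where "L s = \<Gamma> (s ^ q * a)" for s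
    define N where "N = sigma s2 ^ q * L s1 - sigma s1 ^ q * L s2"
    define N' where "N' = sigma t2 ^ q * L t1 - sigma t1 ^ q * L t2"
    have sN: "sigma N = s2 ^ q * L s1 - s1 ^ q * L s2" unfolding N_def L_def by (simp add: sigma_simps G_sigma)
    \<comment> \<open>Cramer's rule: \<open>plucker\<close> for \<open>s1\<close>, \<open>s2\<close>
      and \<open>s\<close>, with \<open>N\<close> collecting the two known values.\<close>
    have key: "pcong (int p) (D * L s) (s ^ q * N - sigma s ^ q * sigma N)" if s: "Mo w s" for s
    proof -
      let ?X = "s2 ^ q * sigma s ^ q - s ^ q * sigma s2 ^ q" and ?Y = "s ^ q * sigma s1 ^ q - s1 ^ q * sigma s ^ q"
      have "pcong (int p) (D * L s + ?X * L s1 + ?Y * L s2) (D * L s + delta s2 s ^ q * L s1 + delta s s1 ^ q * L s2)"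
        by (intro pcong_add pcong_mult pcong_refl pcong_sym[OF delta_power])
      also have "pcong (int p) (D * L s + delta s2 s ^ q * L s1 + delta s s1 ^ q * L s2) 0"
        unfolding D_def L_def by (rule plucker[OF Mst(1,2) s])
      finally have "pcong (int p) (D * L s + ?X * L s1 + ?Y * L s2) 0" .
      moreover have "D * L s + ?X * L s1 + ?Y * L s2 - 0 = D * L s - (s ^ q * N - sigma s ^ q * sigma N)"
        unfolding sN by (simp add: N_def algebra_simps)
      ultimately show ?thesis unfolding pcong_def by (simp only:)
    qed
    \<comment> \<open>Inserting \<open>t1\<close> and \<open>t2\<close> into \<open>key\<close>
      eliminates \<open>sigma N\<close>, so both pairs give the same quotient; since
      \<open>D\<close> and \<open>D'\<close> are coprime modulo \<open>p\<close>, \<open>D\<close>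
      divides \<open>N\<close>.\<close>
    have "pcong (int p) (D * N') (N * D')"
    proof -
      have "D * N' = sigma t2 ^ q * (D * L t1) - sigma t1 ^ q * (D * L t2)" unfolding N'_def by (simp add: algebra_simps)
      also have "pcong (int p) \<dots> (sigma t2 ^ q * (t1 ^ q * N - sigma t1 ^ q * sigma N) - sigma t1 ^ q * (t2 ^ q * N - sigma t2 ^ q * sigma N))"
        by (intro pcong_diff pcong_mult pcong_refl key Mst)
      also have "sigma t2 ^ q * (t1 ^ q * N - sigma t1 ^ q * sigma N) - sigma t1 ^ q * (t2 ^ q * N - sigma t2 ^ q * sigma N)
        = N * (t1 ^ q * sigma t2 ^ q - t2 ^ q * sigma t1 ^ q)" by (simp add: algebra_simps)
      also have "pcong (int p) \<dots> (N * D')" unfolding D'_def by (intro pcong_mult pcong_refl pcong_sym[OF delta_power])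
      finally show ?thesis .
    qed
    then have "pcong (int p) (N * D') (D * N')" by (rule pcong_sym)
    then obtain E0 where E0: "pcong (int p) N (D * E0)" using cop unfolding cop_def by blast
    \<comment> \<open>Uses that \<open>q\<close> is odd; this sign turns the difference in
      \<open>key\<close> into a sum symmetric under \<open>sigma\<close>.\<close>
    have "sigma D = - D" unfolding D_def using power_minus_odd[OF q_odd, of "delta s1 s2"] by (simp add: sigma_simps sigma_delta)
    then have sE0: "pcong (int p) (sigma N) (- D * sigma E0)" using pcong_sigma[OF E0] by (simp add: sigma_simps)
    have main: "pcong (int p) (L s) (rho2 (s ^ q * E0))" if s: "Mo w s" for s
    proof -
      have "pcong (int p) (D * L s) (s ^ q * (D * E0) - sigma s ^ q * (- D * sigma E0))"
        by (rule pcong_trans[OF key[OF s]]) (intro pcong_diff pcong_mult pcong_refl E0 sE0)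
      also have "s ^ q * (D * E0) - sigma s ^ q * (- D * sigma E0) = D * (s ^ q * E0 + sigma (s ^ q * E0))"
        by (simp add: sigma_simps algebra_simps)
      finally have "pcong (int p) (L s) (s ^ q * E0 + sigma (s ^ q * E0))" by (rule pcong_cancel[OF ip _ D0])
      \<comment> \<open>The values of \<open>\<Gamma>\<close> are invariant, so \<open>rho2\<close>
        doubles the left side; on the right the two summands are exchanged by \<open>sigma\<close>
        and have the same average.\<close>
      from pcong_rho2[OF this] have "pcong (int p) (2 * L s) (2 * rho2 (s ^ q * E0))"
        unfolding L_def G_rho rho2_add rho2_sigma by simp
      then show ?thesis by (rule pcong_cancel[OF ip _ not_dvd_2])
    qed
    \<comment> \<open>Projecting \<open>E0\<close> to weight \<open>uw m\<close> makes the average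
      of \<open>n ^ q * E\<close> vanish for every \<open>n\<close> of weight other than
      \<open>w\<close>, in agreement with \<open>\<Gamma>\<close>.\<close>
    show ?thesis
    proof (intro exI[of _ "wpart (uw m) E0"] allI impI)
      fix n :: mon assume n: "Poly_Mapping.keys n \<subseteq> uv"
      have wp: "wpart 0 (Poly_Mapping.single n 1 ^ q * y) = Poly_Mapping.single n 1 ^ q * wpart (0 - int q * uw n) y" for y
        by (rule wpart_Mo_mult[OF Mq[OF n]])
      show "pcong (int p) (\<Gamma> (Poly_Mapping.single n 1 ^ q * Poly_Mapping.single m 1)) (rho2 (Poly_Mapping.single n 1 ^ q * wpart (uw m) E0))"
      proof (cases "uw n = w")
        case True
        then have "uw m = 0 - int q * uw n" unfolding t w_def by simp
        then have "rho2 (Poly_Mapping.single n 1 ^ q * wpart (uw m) E0) = rho2 (Poly_Mapping.single n 1 ^ q * E0)"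
          unfolding rho2_def wp by (simp add: wpart_wpart)
        moreover have "Mo w (Poly_Mapping.single n 1)" using Mo_single[OF n] True by simp
        ultimately show ?thesis using main unfolding L_def a_def by simp
      next
        case False
        have "int q * (uw n - w) \<noteq> 0" using False q_pos by simp
        then have ne: "int q * uw n + uw m \<noteq> 0" unfolding t w_def by (simp add: algebra_simps)
        then have "rho2 (Poly_Mapping.single n 1 ^ q * wpart (uw m) E0) = 0"
          unfolding rho2_def wp wpart_wpart by (auto simp: sigma_simps)
        then show ?thesis using vanish[OF n ne] unfolding a_def by simp
      qed
    qed
  qed
qed

section \<open>Assembling the extension from divided power operators\<close>

lemma mod_shift_iff:
  fixes r m :: nat
  assumes "r < q" shows "(q - 1 - r + m) mod q = q - 1 \<longleftrightarrow> m mod q = r"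
proof -
  have t: "m mod q < q" using q_pos by simp
  have e: "(q - 1 - r + m) mod q = (q - 1 - r + m mod q) mod q" by (simp add: mod_add_right_eq)
  show ?thesis
  proof (cases "m mod q \<le> r")
    case True
    then have "q - 1 - r + m mod q < q" using assms by linarith
    then have "(q - 1 - r + m mod q) mod q = q - 1 - r + m mod q" by simp
    then show ?thesis unfolding e using True assms by linarith
  next
    case False
    then have "q - 1 - r + m mod q = q + (m mod q - r - 1)" "m mod q - r - 1 < q - 1" using assms t by linarith+
    then have "(q - 1 - r + m mod q) mod q = m mod q - r - 1" by simp
    then show ?thesis unfolding e using False \<open>m mod q - r - 1 < q - 1\<close> by linarith
  qed
qed

lemma finite_uv: "finite uv" by (simp add: uv_def)

text \<open>The monomials with exponents below \<open>q\<close>: every monomial in \<open>uv\<close>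
  is uniquely a \<open>q\<close>-th power times one of these, by division with remainder of its
  exponents.\<close>

definition residues_mon :: "mon set" where
  "residues_mon = {r. Poly_Mapping.keys r \<subseteq> uv \<and> (\<forall>v. Poly_Mapping.lookup r v < q)}"

definition mod_mon :: "mon \<Rightarrow> mon" where
  "mod_mon m = (\<Sum>v\<in>uv. Poly_Mapping.single v (Poly_Mapping.lookup m v mod q))"

definition div_mon :: "mon \<Rightarrow> mon" where
  "div_mon m = (\<Sum>v\<in>uv. Poly_Mapping.single v (Poly_Mapping.lookup m v div q))"

lemma finite_residues_mon: "finite residues_mon"
proof -
  have "residues_mon \<subseteq> (\<lambda>f. \<Sum>v\<in>uv. Poly_Mapping.single v (f v)) ` (uv \<rightarrow>\<^sub>E {..<q})"
  proof
    fix r assume r: "r \<in> residues_mon"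
    then have kr: "Poly_Mapping.keys r \<subseteq> uv" unfolding residues_mon_def by blast
    have "r = (\<Sum>v\<in>uv. Poly_Mapping.single v (restrict (Poly_Mapping.lookup r) uv v))"
    proof (rule poly_mapping_eqI)
      fix v show "Poly_Mapping.lookup r v = Poly_Mapping.lookup (\<Sum>v\<in>uv. Poly_Mapping.single v (restrict (Poly_Mapping.lookup r) uv v)) v"
        unfolding lookup_sum_singles[OF finite_uv] using subsetD[OF kr, of v] by (cases "v \<in> uv") (auto simp: in_keys_iff)
    qed
    moreover have "restrict (Poly_Mapping.lookup r) uv \<in> uv \<rightarrow>\<^sub>E {..<q}" using r unfolding residues_mon_def by auto
    ultimately show "r \<in> (\<lambda>f. \<Sum>v\<in>uv. Poly_Mapping.single v (f v)) ` (uv \<rightarrow>\<^sub>E {..<q})" by (rule image_eqI)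
  qed
  then show ?thesis by (rule finite_subset) (intro finite_imageI finite_PiE finite_uv finite_lessThan)
qed

text \<open>The coordinate function of the residue \<open>r\<close>: multiplication by the
  complement of \<open>r\<close> moves the remainder \<open>r\<close>, and no other, to
  \<open>q - 1\<close> in every exponent, which is what \<open>Phi_S\<close> selects modulo
  \<open>p\<close>.\<close>

lemma Phi_S_residue:
  assumes r: "r \<in> residues_mon" and m: "Poly_Mapping.keys m \<subseteq> uv"
  shows "pcong (int p) (Phi_S uv q (Poly_Mapping.single ((\<Sum>v\<in>uv. Poly_Mapping.single v (q - 1)) - r) 1 * Poly_Mapping.single m 1))
    (if r = mod_mon m then Poly_Mapping.single (div_mon m) 1 ^ q else 0)"
proof -
  let ?e = "\<Sum>v\<in>uv. Poly_Mapping.single v (q - 1)"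
  let ?P = "\<Prod>v\<in>uv. int (Poly_Mapping.lookup (?e - r + m) v choose (q - 1))"
  have rq: "Poly_Mapping.lookup r v < q" for v using r unfolding residues_mon_def by blast
  have kr: "Poly_Mapping.lookup r v = 0" "Poly_Mapping.lookup m v = 0" if "v \<notin> uv" for v
  proof -
    have "Poly_Mapping.keys r \<subseteq> uv" using r unfolding residues_mon_def by blast
    then have "v \<notin> Poly_Mapping.keys r" "v \<notin> Poly_Mapping.keys m" using m that by blast+
    then show "Poly_Mapping.lookup r v = 0" "Poly_Mapping.lookup m v = 0" by (simp_all add: in_keys_iff)
  qed
  have le: "Poly_Mapping.lookup (?e - r + m) v = q - 1 - Poly_Mapping.lookup r v + Poly_Mapping.lookup m v" if "v \<in> uv" for v
    using that by (simp add: lookup_add lookup_minus lookup_sum_singles[OF finite_uv])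
  have "[int (Poly_Mapping.lookup (?e - r + m) v choose (q - 1)) = (if Poly_Mapping.lookup m v mod q = Poly_Mapping.lookup r v then 1 else 0)] (mod int p)"
    if v: "v \<in> uv" for v
  proof -
    have "[Poly_Mapping.lookup (?e - r + m) v choose (q - 1) = (if Poly_Mapping.lookup m v mod q = Poly_Mapping.lookup r v then 1 else 0)] (mod p)"
      using choose_prime_power_cong[OF p(1), of "Poly_Mapping.lookup (?e - r + m) v" e] unfolding q[symmetric] le[OF v] mod_shift_iff[OF rq] .
    then have "[int (Poly_Mapping.lookup (?e - r + m) v choose (q - 1)) = int (if Poly_Mapping.lookup m v mod q = Poly_Mapping.lookup r v then 1 else 0)] (mod int p)"
      by (simp only: cong_int_iff)
    then show ?thesis by (simp only: if_distrib[of int] of_nat_1 of_nat_0)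
  qed
  then have P: "[?P = (\<Prod>v\<in>uv. if Poly_Mapping.lookup m v mod q = Poly_Mapping.lookup r v then 1 else 0)] (mod int p)"
    by (rule cong_prod)
  have lm: "Poly_Mapping.lookup (mod_mon m) v = (if v \<in> uv then Poly_Mapping.lookup m v mod q else 0)" for v
    unfolding mod_mon_def by (rule lookup_sum_singles[OF finite_uv])
  have eq: "Phi_S uv q (Poly_Mapping.single (?e - r) 1 * Poly_Mapping.single m 1) = Poly_Mapping.single (?e - r + m - ?e) ?P"
    unfolding mult_single Phi_S_single by simp
  show ?thesis
  proof (cases "r = mod_mon m")
    case True
    have "(\<Prod>v\<in>uv. if Poly_Mapping.lookup m v mod q = Poly_Mapping.lookup r v then 1 else 0) = (1::int)"
      by (rule prod.neutral) (simp add: True lm)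
    with P have P1: "[?P = 1] (mod int p)" by simp
    have "?e - r + m - ?e = ((+) (div_mon m) ^^ q) 0"
    proof (rule poly_mapping_eqI)
      fix v
      have ld: "Poly_Mapping.lookup (div_mon m) v = (if v \<in> uv then Poly_Mapping.lookup m v div q else 0)"
        unfolding div_mon_def by (rule lookup_sum_singles[OF finite_uv])
      have "q - 1 - Poly_Mapping.lookup m v mod q + Poly_Mapping.lookup m v - (q - 1) = q * (Poly_Mapping.lookup m v div q)"
      proof -
        have "Poly_Mapping.lookup m v mod q < q" using q_pos by simp
        moreover have "Poly_Mapping.lookup m v = q * (Poly_Mapping.lookup m v div q) + Poly_Mapping.lookup m v mod q" by simp
        ultimately show ?thesis by linarith
      qed
      then show "Poly_Mapping.lookup (?e - r + m - ?e) v = Poly_Mapping.lookup (((+) (div_mon m) ^^ q) 0) v"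
        unfolding lookup_funpow_add ld True using kr(2)[of v]
        by (cases "v \<in> uv") (simp_all add: lookup_add lookup_minus lookup_sum_singles[OF finite_uv] lm)
    qed
    moreover have "Poly_Mapping.single (div_mon m) (1::int) ^ q = Poly_Mapping.single (((+) (div_mon m) ^^ q) 0) 1" by (simp add: single_power)
    moreover have "pcong (int p) (Poly_Mapping.single x ?P) (Poly_Mapping.single x 1)" for x :: mon
      unfolding pcong_poly_iff using P1 by (auto simp: lookup_single when_def)
    ultimately show ?thesis unfolding eq using True by simp
  next
    case False
    have "\<exists>v\<in>uv. Poly_Mapping.lookup m v mod q \<noteq> Poly_Mapping.lookup r v"
    proof (rule ccontr)
      assume "\<not> ?thesis"
      then have "Poly_Mapping.lookup r v = Poly_Mapping.lookup (mod_mon m) v" for v using kr(1)[of v] lm[of v] by (cases "v \<in> uv") auto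
      then show False using False poly_mapping_eqI by blast
    qed
    then have "(\<Prod>v\<in>uv. if Poly_Mapping.lookup m v mod q = Poly_Mapping.lookup r v then 1 else 0) = (0::int)"
      using finite_uv by (intro prod_zero) auto
    with P have P0: "[?P = 0] (mod int p)" by simp
    have "pcong (int p) (Poly_Mapping.single x ?P) 0" for x :: mon
      unfolding pcong_poly_iff using P0 by (auto simp: lookup_single when_def)
    then show ?thesis unfolding eq using False by simp
  qed
qed

lemma extension_operator:
  "\<exists>T n. dop n T \<and> (\<forall>x\<in>poly_carrier uv. pcong (int p) (\<Gamma> x) (rho2 (T x)))"
proof -
  let ?e = "\<Sum>v\<in>uv. Poly_Mapping.single v (q - 1)"
  have "\<forall>m. \<exists>E. Poly_Mapping.keys m \<subseteq> uv \<longrightarrow> (\<forall>n. Poly_Mapping.keys n \<subseteq> uv \<longrightarrow>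
    pcong (int p) (\<Gamma> (Poly_Mapping.single n 1 ^ q * Poly_Mapping.single m 1)) (rho2 (Poly_Mapping.single n 1 ^ q * E)))"
    using extension_monomial by blast
  from choice[OF this] obtain Ef where Ef: "\<And>m n. Poly_Mapping.keys m \<subseteq> uv \<Longrightarrow> Poly_Mapping.keys n \<subseteq> uv \<Longrightarrow>
    pcong (int p) (\<Gamma> (Poly_Mapping.single n 1 ^ q * Poly_Mapping.single m 1)) (rho2 (Poly_Mapping.single n 1 ^ q * Ef m))" by blast
  \<comment> \<open>Coordinates with respect to the residues, recombined with the values
    \<open>Ef r\<close>. Modulo \<open>p\<close> this sends \<open>n ^ q * r\<close> to
    \<open>n ^ q * Ef r\<close>, but it is a differential operator over the integers.\<close>
  define T where "T x = (\<Sum>r\<in>residues_mon. Ef r * Phi_S uv q (Poly_Mapping.single (?e - r) 1 * x))" for x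
  obtain N where N: "dop N (Phi_S uv q)" using dop_Phi_S[OF finite_uv] by blast
  have dT: "dop N T" unfolding T_def[abs_def]
    by (rule dop_sum[OF finite_residues_mon]) (rule dop_lmult[OF dop_rmult[OF N]])
  have mono: "pcong (int p) (\<Gamma> (Poly_Mapping.single m 1)) (rho2 (T (Poly_Mapping.single m 1)))" if m: "Poly_Mapping.keys m \<subseteq> uv" for m
  proof -
    have sub: "Poly_Mapping.keys (mod_mon m) \<subseteq> uv" "Poly_Mapping.keys (div_mon m) \<subseteq> uv"
      by (auto simp: in_keys_iff mod_mon_def div_mon_def lookup_sum_singles[OF finite_uv] split: if_splits)
    have R: "mod_mon m \<in> residues_mon"
      using sub(1) q_pos unfolding residues_mon_def by (auto simp: mod_mon_def lookup_sum_singles[OF finite_uv])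
    have "pcong (int p) (T (Poly_Mapping.single m 1)) (\<Sum>r\<in>residues_mon. Ef r * (if r = mod_mon m then Poly_Mapping.single (div_mon m) 1 ^ q else 0))"
      unfolding T_def by (intro pcong_sum pcong_mult pcong_refl Phi_S_residue m)
    also have "(\<Sum>r\<in>residues_mon. Ef r * (if r = mod_mon m then Poly_Mapping.single (div_mon m) 1 ^ q else 0))
       = (\<Sum>r\<in>residues_mon. if r = mod_mon m then Poly_Mapping.single (div_mon m) 1 ^ q * Ef r else 0)"
      by (rule sum.cong) (simp_all add: mult.commute)
    also have "\<dots> = Poly_Mapping.single (div_mon m) 1 ^ q * Ef (mod_mon m)" using finite_residues_mon R by (simp add: sum.delta)
    finally have 1: "pcong (int p) (T (Poly_Mapping.single m 1)) (Poly_Mapping.single (div_mon m) 1 ^ q * Ef (mod_mon m))" .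
    have "m = ((+) (div_mon m) ^^ q) 0 + mod_mon m"
    proof (rule poly_mapping_eqI)
      fix v
      have "Poly_Mapping.lookup m v = 0" if "v \<notin> uv" using m that by (auto simp: in_keys_iff)
      then show "Poly_Mapping.lookup m v = Poly_Mapping.lookup (((+) (div_mon m) ^^ q) 0 + mod_mon m) v"
        unfolding lookup_add lookup_funpow_add mod_mon_def div_mon_def lookup_sum_singles[OF finite_uv] by (cases "v \<in> uv") simp_all
    qed
    then have "Poly_Mapping.single m (1::int) = Poly_Mapping.single (((+) (div_mon m) ^^ q) 0) 1 * Poly_Mapping.single (mod_mon m) 1"
      unfolding mult_single by simp
    then have "Poly_Mapping.single m (1::int) = Poly_Mapping.single (div_mon m) 1 ^ q * Poly_Mapping.single (mod_mon m) 1" by (simp add: single_power)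
    then have "pcong (int p) (\<Gamma> (Poly_Mapping.single m 1)) (rho2 (Poly_Mapping.single (div_mon m) 1 ^ q * Ef (mod_mon m)))" using Ef[OF sub] by simp
    then show ?thesis by (rule pcong_trans) (rule pcong_sym[OF pcong_rho2[OF 1]])
  qed
  define Q where "Q x \<longleftrightarrow> pcong (int p) (\<Gamma> x) (rho2 (T x))" for x
  have T_add: "T (x + y) = T x + T y" for x y by (rule dop_additive[OF dT])
  have Q_add: "Q (x + y)" if "Q x" "Q y" for x y
    using that unfolding Q_def T_add rho2_add by (intro pcong_trans[OF G_add] pcong_add)
  have T0: "T 0 = 0" using T_add[of 0 0] by simp
  have G0: "pcong (int p) (\<Gamma> 0) 0" by (rule G_wpart) simp
  have Q0: "Q 0" unfolding Q_def T0 using G0 by simp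
  have Q_minus: "Q (- x)" if "Q x" for x
  proof -
    have "T (- x) = - T x" using T_add[of x "- x"] T0 by (simp add: eq_neg_iff_add_eq_0 add.commute)
    then have Tm: "rho2 (T (- x)) = - rho2 (T x)" using rho2_diff[of 0 "T x"] by simp
    have "pcong (int p) (\<Gamma> x + \<Gamma> (- x)) 0" using pcong_trans[OF pcong_sym[OF G_add[of x "- x"]]] G0 by simp
    then have "pcong (int p) (\<Gamma> x + \<Gamma> (- x) - \<Gamma> x) (0 - rho2 (T x))" using that unfolding Q_def by (rule pcong_diff)
    then show ?thesis unfolding Q_def Tm by simp
  qed
  have Q_single: "Q (Poly_Mapping.single m c)" if m: "Poly_Mapping.keys m \<subseteq> uv" for m c
  proof -
    have n: "Q (Poly_Mapping.single m (int k))" for k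
    proof (induction k)
      case (Suc k)
      have "Q (Poly_Mapping.single m 1)" unfolding Q_def by (rule mono[OF m])
      then show ?case using Q_add[OF _ Suc, of "Poly_Mapping.single m 1"] by (simp add: single_add[symmetric])
    qed (simp add: Q0)
    then show ?thesis using Q_minus[OF n] by (cases c rule: int_cases2) (simp_all add: single_uminus)
  qed
  have "Q x" if x: "x \<in> poly_carrier uv" for x
  proof -
    have "Q (\<Sum>m\<in>A. Poly_Mapping.single m (Poly_Mapping.lookup x m))" if "finite A" "A \<subseteq> Poly_Mapping.keys x" for A
      using that
    proof (induction A rule: finite_induct)
      case (insert m A)
      then have "Poly_Mapping.keys m \<subseteq> uv" using x unfolding poly_carrier_def by blast
      then show ?case using insert by (simp add: Q_add Q_single)
    qed (simp add: Q0)
    from this[OF finite_keys order_refl] show ?thesis unfolding poly_sum_monomials[symmetric] .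
  qed
  then show ?thesis using dT unfolding Q_def by blast
qed

end

section \<open>Lifting for odd primes\<close>

lemma hyper_ideal_iota_dvd:
  assumes "x \<in> hyper_ideal (sym_vars 3) sdet k" shows "of_int k dvd sym_iota x"
proof -
  obtain a b where "x = sdet * a + of_int k * b" using assms by (rule hyper_idealE)
  then show ?thesis by (simp only: sym_iota_simps sym_iota_sdet mult_zero_left add_0_left dvd_triv_left)
qed

theorem symmetric_determinant_lifts:
  assumes p: "prime p" "2 < p"
    and \<delta>: "diffop (mod_int (hypersurface (sym_vars 3) sdet) p) \<delta>"
  shows "lifts_to_ring (hypersurface (sym_vars 3) sdet) p \<delta>"
proof -
  let ?V = "sym_vars 3" and ?S = "poly_carrier (sym_vars 3)" and ?H = "hypersurface (sym_vars 3) sdet"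
  let ?J = "hyper_ideal (sym_vars 3) sdet (int p)" and ?Z = "hyper_ideal (sym_vars 3) sdet 0" and ?i = sym_iota
  let ?eq = "pcong (int p)"
  interpret H: quotient_presentation ?H ?S ?Z "hproj ?V sdet"
    by (rule presentation_hypersurface[OF sdet_carrier])
  interpret Mp: quotient_presentation "mod_int ?H p" ?S ?J "mproj ?V sdet p"
    by (rule presentation_mod_int[OF sdet_carrier])
  obtain d n where d: "\<And>x. x \<in> ?S \<Longrightarrow> d x \<in> ?S" "\<And>x. x \<in> ?S \<Longrightarrow> mproj ?V sdet p (d x) = \<delta> (mproj ?V sdet p x)"
    "diffop_mod ?S ?J n d" "\<And>x y. x \<in> ?S \<Longrightarrow> y \<in> ?S \<Longrightarrow> x - y \<in> ?J \<Longrightarrow> d x - d y \<in> ?J"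
    using Mp.diffop_representative[OF \<delta>] by metis
  define q where "q = p ^ n"
  have ip: "int p = 0 \<or> prime (int p)" "int p = 0 \<or> prime (int p) \<and> int p \<noteq> 2" using p by auto
  have kerp: "x - y \<in> ?J" if "x \<in> ?S" "y \<in> ?S" "?eq (?i x) (?i y)" for x y
    using sym_iota_kernel[OF ip(2), of "x - y"] that by (simp add: pcong_def sym_iota_simps)
  have ker0: "x - y \<in> ?Z" if "x \<in> ?S" "y \<in> ?S" "?i x = ?i y" for x y
    using sym_iota_kernel[of 0 "x - y"] that by (simp add: sym_iota_simps)
  have Jeq: "?eq (?i x) (?i y)" if "x - y \<in> ?J" for x y
    using hyper_ideal_iota_dvd[OF that] by (simp add: pcong_def sym_iota_simps)
  have d_lin: "?eq (?i (d (a ^ q * x))) (?i a ^ q * ?i (d x))" if "a \<in> ?S" "x \<in> ?S" for a x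
  proof -
    have "of_nat p \<in> ?J" using hyper_ideal_int[of 1 ?V "int p" sdet] by simp
    then have "d (a ^ (p ^ n) * x) - a ^ (p ^ n) * d x \<in> ?J"
      using that d by (intro diffop_mod_power_linear[where S = ?S]) (auto intro: hyper_ideal_add hyper_ideal_mult)
    from Jeq[OF this] show ?thesis unfolding q_def by (simp add: sym_iota_simps)
  qed
  have d_add: "?eq (?i (d (x + y))) (?i (d x) + ?i (d y))" if "x \<in> ?S" "y \<in> ?S" for x y
    using Jeq[OF diffop_mod_additive[OF d(3) that]] by (simp add: sym_iota_simps)
  have d_two: "?eq (?i (d (2 ^ k * x))) (2 ^ k * ?i (d x))" if "x \<in> ?S" for x k
    using Jeq[OF additive_mod_of_nat[OF diffop_mod_additive[OF d(3)] that, of "2 ^ k"]] by (simp add: sym_iota_simps)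
  have d_cong: "?eq (?i (d x)) (?i (d y))" if "x \<in> ?S" "y \<in> ?S" "?eq (?i x) (?i y)" for x y
    by (rule Jeq[OF d(4)[OF that(1,2) kerp[OF that]]])
  \<comment> \<open>An inverse of 2 modulo \<open>p\<close>, as
    \<open>2 * c = p + 1\<close>.\<close>
  define c where "c = (int p + 1) div 2"
  have "odd p" using p prime_odd_nat by blast
  then have "odd (int p)" by simp
  then have c2: "2 * c = int p + 1" unfolding c_def by presburger
  have c_one: "?eq (of_int (c ^ k) * 2 ^ k) (1::ipoly)" for k
  proof -
    have "?eq (of_int (2 * c)) (of_int 1 :: ipoly)" by (rule pcong_of_int) (simp add: c2 cong_iff_dvd_diff)
    then have "?eq (of_int (2 * c) ^ k) ((of_int 1 :: ipoly) ^ k)" by (rule pcong_power)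
    then show ?thesis by (simp add: power_mult_distrib mult.commute)
  qed
  have nd: "\<not> of_int (int p) dvd (2 ^ k :: ipoly)" for k
  proof
    assume "of_int (int p) dvd (2 ^ k :: ipoly)"
    then have "of_int (int p) dvd of_int (c ^ k) * (2 ^ k :: ipoly)" by (rule dvd_mult)
    then have "?eq (of_int (c ^ k) * 2 ^ k) (0::ipoly)" by (simp only: pcong_0_iff)
    from pcong_trans[OF pcong_sym[OF this] c_one] have "?eq 0 (1::ipoly)" .
    then have "of_int (int p) dvd (1::ipoly)" using pcong_sym pcong_0_iff by blast
    then have "of_int (int p) dvd 1 * Var (0, 0)" by (rule dvd_mult2)
    then show False using not_dvd_Var[OF ip(1)] by simp
  qed
  have cancel: "?eq x y" if "?eq (2 ^ k * x) (2 ^ k * y)" for x y :: ipoly and k :: nat by (rule pcong_cancel[OF ip(1) that nd])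
  have r2: "rho2 (2 ^ k * x) = 2 ^ k * rho2 x" for k x using rho2_of_int_mult[of "2 ^ k" x] by simp
  have "\<forall>z. \<exists>ks. snd ks \<in> ?S \<and> 2 ^ fst ks * rho2 z = ?i (snd ks)"
  proof
    fix z
    obtain k s where "s \<in> ?S" "2 ^ k * rho2 z = ?i s" using rho2_Pp[of z] unfolding Pp_def by blast
    then show "\<exists>ks. snd ks \<in> ?S \<and> 2 ^ fst ks * rho2 z = ?i (snd ks)" by (intro exI[of _ "(k, s)"]) simp
  qed
  from choice[OF this] obtain F where F: "\<And>z. snd (F z) \<in> ?S" "\<And>z. 2 ^ fst (F z) * rho2 z = ?i (snd (F z))" by blast
  define kk ss where "kk z = fst (F z)" and "ss z = snd (F z)" for z
  have ss: "ss z \<in> ?S" "2 ^ kk z * rho2 z = ?i (ss z)" for z unfolding kk_def ss_def by (rule F)+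
  \<comment> \<open>Stands for \<open>d\<close> applied to \<open>rho2 z\<close>:
    \<open>2 ^ kk z\<close> clears the denominator of the average, and \<open>c ^ kk z\<close>
    divides by it again modulo \<open>p\<close>.\<close>
  define \<Gamma> where "\<Gamma> z = of_int (c ^ kk z) * ?i (d (ss z))" for z
  have G0: "?eq (2 ^ kk z * \<Gamma> z) (?i (d (ss z)))" for z
    using pcong_mult[OF c_one[of "kk z"] pcong_refl, of "?i (d (ss z))"] unfolding \<Gamma>_def by (simp add: ac_simps)
  \<comment> \<open>The value does not depend on the denominator and preimage chosen: any other
    choice agrees after multiplication by powers of 2, through which \<open>d\<close> passes modulo
    \<open>p\<close>.\<close>
  have G1: "?eq (2 ^ k * \<Gamma> z) (?i (d s))" if s: "s \<in> ?S" "?eq (2 ^ k * rho2 z) (?i s)" for z k s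
  proof (rule cancel[of "kk z"])
    have "?eq (2 ^ kk z * (2 ^ k * rho2 z)) (2 ^ kk z * ?i s)" by (intro pcong_mult pcong_refl s)
    moreover have "2 ^ kk z * (2 ^ k * rho2 z) = 2 ^ k * (2 ^ kk z * rho2 z)" by (simp add: ac_simps)
    ultimately have "?eq (?i (2 ^ k * ss z)) (?i (2 ^ kk z * s))" by (simp add: sym_iota_simps ss(2))
    then have 1: "?eq (?i (d (2 ^ k * ss z))) (?i (d (2 ^ kk z * s)))" using ss(1) s(1) by (intro d_cong) auto
    have "2 ^ kk z * (2 ^ k * \<Gamma> z) = 2 ^ k * (2 ^ kk z * \<Gamma> z)" by (simp add: ac_simps)
    also have "?eq \<dots> (2 ^ k * ?i (d (ss z)))" by (intro pcong_mult pcong_refl G0)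
    also have "?eq \<dots> (?i (d (2 ^ k * ss z)))" by (rule pcong_sym[OF d_two[OF ss(1)]])
    also note 1
    also have "?eq (?i (d (2 ^ kk z * s))) (2 ^ kk z * ?i (d s))" by (rule d_two[OF s(1)])
    finally show "?eq (2 ^ kk z * (2 ^ k * \<Gamma> z)) (2 ^ kk z * ?i (d s))" .
  qed
  interpret frobenius_functional p n q \<Gamma>
  proof
    show "prime p" "p \<noteq> 2" "q = p ^ n" using p q_def by auto
    show "?eq (\<Gamma> (x + y)) (\<Gamma> x + \<Gamma> y)" for x y
    proof (rule cancel[of "kk x + kk y"])
      let ?s = "2 ^ kk y * ss x" and ?t = "2 ^ kk x * ss y"
      have st: "?s \<in> ?S" "?t \<in> ?S" using ss(1) by auto
      have "2 ^ (kk x + kk y) * rho2 (x + y) = 2 ^ kk y * (2 ^ kk x * rho2 x) + 2 ^ kk x * (2 ^ kk y * rho2 y)"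
        by (simp add: rho2_add power_add algebra_simps)
      then have "?eq (2 ^ (kk x + kk y) * rho2 (x + y)) (?i (?s + ?t))" by (simp add: ss(2) sym_iota_simps)
      from G1[OF _ this] have "?eq (2 ^ (kk x + kk y) * \<Gamma> (x + y)) (?i (d (?s + ?t)))" using st by simp
      also have "?eq \<dots> (?i (d ?s) + ?i (d ?t))" by (rule d_add[OF st])
      also have "?eq \<dots> (2 ^ kk y * ?i (d (ss x)) + 2 ^ kk x * ?i (d (ss y)))" by (intro pcong_add d_two ss)
      also have "?eq \<dots> (2 ^ kk y * (2 ^ kk x * \<Gamma> x) + 2 ^ kk x * (2 ^ kk y * \<Gamma> y))"
        by (intro pcong_add pcong_mult pcong_refl pcong_sym[OF G0])
      also have "2 ^ kk y * (2 ^ kk x * \<Gamma> x) + 2 ^ kk x * (2 ^ kk y * \<Gamma> y) = 2 ^ (kk x + kk y) * (\<Gamma> x + \<Gamma> y)"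
        by (simp add: power_add algebra_simps)
      finally show "?eq (2 ^ (kk x + kk y) * \<Gamma> (x + y)) (2 ^ (kk x + kk y) * (\<Gamma> x + \<Gamma> y))" .
    qed
    show "?eq (\<Gamma> x) (\<Gamma> y)" if "?eq x y" for x y
    proof (rule cancel[of "kk y"])
      have "?eq (2 ^ kk y * rho2 x) (2 ^ kk y * rho2 y)" by (intro pcong_mult pcong_refl pcong_rho2 that)
      then have "?eq (2 ^ kk y * \<Gamma> x) (?i (d (ss y)))" unfolding ss(2) by (rule G1[OF ss(1)])
      then show "?eq (2 ^ kk y * \<Gamma> x) (2 ^ kk y * \<Gamma> y)" by (rule pcong_trans) (rule pcong_sym[OF G0])
    qed
    show "?eq (\<Gamma> (r ^ q * x)) (r ^ q * \<Gamma> x)" if r: "Pp r" for r x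
    proof -
      obtain l \<rho> where l: "\<rho> \<in> ?S" "2 ^ l * r = ?i \<rho>" using r unfolding Pp_def by blast
      have pq: "2 ^ (l * q) * r ^ q = ?i \<rho> ^ q" unfolding l(2)[symmetric] by (simp add: power_mult_distrib power_mult)
      have "2 ^ (l * q) * rho2 (r ^ q * x) = rho2 (2 ^ (l * q) * (r ^ q * x))" by (rule r2[symmetric])
      also have "2 ^ (l * q) * (r ^ q * x) = ?i (\<rho> ^ q) * x" using pq by (simp add: mult.assoc[symmetric] sym_iota_simps)
      also have "rho2 \<dots> = ?i (\<rho> ^ q) * rho2 x" using l(1) by (intro rho2_iota_mult) simp
      finally have e: "2 ^ (l * q) * rho2 (r ^ q * x) = ?i (\<rho> ^ q) * rho2 x" .
      have "2 ^ (l * q + kk x) * rho2 (r ^ q * x) = 2 ^ kk x * (2 ^ (l * q) * rho2 (r ^ q * x))" by (simp add: power_add ac_simps)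
      also have "\<dots> = ?i (\<rho> ^ q) * (2 ^ kk x * rho2 x)" unfolding e by (simp add: ac_simps)
      finally have "?eq (2 ^ (l * q + kk x) * rho2 (r ^ q * x)) (?i (\<rho> ^ q * ss x))" by (simp add: ss(2) sym_iota_simps)
      from G1[OF _ this] have "?eq (2 ^ (l * q + kk x) * \<Gamma> (r ^ q * x)) (?i (d (\<rho> ^ q * ss x)))" using l(1) ss(1) by simp
      also have "?eq \<dots> (?i \<rho> ^ q * ?i (d (ss x)))" by (rule d_lin[OF l(1) ss(1)])
      also have "?eq \<dots> (?i \<rho> ^ q * (2 ^ kk x * \<Gamma> x))" by (intro pcong_mult pcong_refl pcong_sym[OF G0])
      also have "?i \<rho> ^ q * (2 ^ kk x * \<Gamma> x) = 2 ^ (l * q + kk x) * (r ^ q * \<Gamma> x)"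
        unfolding pq[symmetric] by (simp add: power_add ac_simps)
      finally show ?thesis by (rule cancel)
    qed
    show "sigma (\<Gamma> x) = \<Gamma> x" for x unfolding \<Gamma>_def by (simp only: sigma_simps sigma_sym_iota)
    show "rho2 (\<Gamma> x) = 2 * \<Gamma> x" for x
      unfolding \<Gamma>_def rho2_of_int_mult using rho2_invariant[OF W0_sym_iota[OF d(1)[OF ss(1)]] sigma_sym_iota]
      by (simp add: ac_simps)
    show "?eq (\<Gamma> x) 0" if "wpart 0 x = 0" for x
    proof -
      have "rho2 x = 0" using that by (simp add: rho2_def sigma_simps)
      then have "?eq (2 ^ 0 * rho2 x) (?i 0)" by (simp add: sym_iota_simps)
      from G1[OF _ this] have "?eq (\<Gamma> x) (?i (d 0))" by simp
      moreover have "?eq (?i (d (0 + 0)) - ?i (d 0)) (?i (d 0) + ?i (d 0) - ?i (d 0))"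
        by (intro pcong_diff pcong_refl d_add) auto
      then have "?eq (?i (d 0)) 0" using pcong_sym by simp
      ultimately show ?thesis by (rule pcong_trans)
    qed
  qed
  obtain T N where T: "dop N T" "\<And>x. x \<in> poly_carrier uv \<Longrightarrow> ?eq (\<Gamma> x) (rho2 (T x))" using extension_operator by blast
  obtain K where K: "\<forall>s\<in>?S. \<exists>s'\<in>?S. 2 ^ K * rho2 (T (?i s)) = ?i s'" using uniform_denominator[OF T(1)] by blast
  then have "\<forall>s. \<exists>s'. s \<in> ?S \<longrightarrow> s' \<in> ?S \<and> 2 ^ K * rho2 (T (?i s)) = ?i s'" by blast
  from choice[OF this] obtain D0 where D0: "\<And>s. s \<in> ?S \<Longrightarrow> D0 s \<in> ?S" "\<And>s. s \<in> ?S \<Longrightarrow> 2 ^ K * rho2 (T (?i s)) = ?i (D0 s)" by blast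
  \<comment> \<open>\<open>K\<close> factors \<open>c\<close> compensate the uniform denominator,
    and one more compensates the factor 2 by which \<open>rho2\<close> exceeds averaging. So
    \<open>D\<close> is integral and agrees with \<open>d\<close> modulo \<open>p\<close>.\<close>
  define D where "D s = of_int (c ^ Suc K) * D0 s" for s
  have DS: "D s \<in> ?S" if "s \<in> ?S" for s unfolding D_def using D0(1)[OF that] by simp
  have iD: "?i (D s) = (of_int (c ^ Suc K) * 2 ^ K) * rho2 (T (?i s))" if "s \<in> ?S" for s
    unfolding D_def sym_iota_simps D0(2)[OF that, symmetric] by (simp add: mult.assoc)
  have ND: "diffop_mod ?S ?Z N D" by (rule diffop_of_dop[OF T(1) DS iD])
  have compat: "D x - D y \<in> ?Z" if "x \<in> ?S" "y \<in> ?S" "x - y \<in> ?Z" for x y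
  proof (rule ker0)
    have "?i (x - y) = 0" using hyper_ideal_iota_dvd[OF that(3)] by simp
    then have "?i x = ?i y" by (simp add: sym_iota_simps)
    then show "?i (D x) = ?i (D y)" using iD that by simp
  qed (use DS that in auto)
  have Dd: "D s - d s \<in> ?J" if s: "s \<in> ?S" for s
  proof (rule kerp[OF DS[OF s] d(1)[OF s]])
    have iS: "?i s \<in> poly_carrier uv" using W0_sym_iota[OF s] unfolding W0_def adm_def poly_carrier_def by blast
    have "?eq (2 ^ 0 * rho2 (?i s)) (?i (2 ^ 1 * s))" using rho2_invariant[OF W0_sym_iota[OF s] sigma_sym_iota] by (simp add: sym_iota_simps)
    from G1[OF _ this] have "?eq (\<Gamma> (?i s)) (?i (d (2 ^ 1 * s)))" using s by simp
    also have "?eq \<dots> (2 ^ 1 * ?i (d s))" by (rule d_two[OF s])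
    finally have g: "?eq (\<Gamma> (?i s)) (2 ^ 1 * ?i (d s))" .
    have "?eq (?i (D s)) ((of_int (c ^ Suc K) * 2 ^ K) * (2 ^ 1 * ?i (d s)))"
      unfolding iD[OF s] by (intro pcong_mult pcong_refl pcong_trans[OF pcong_sym[OF T(2)[OF iS]] g])
    also have "(of_int (c ^ Suc K) * 2 ^ K) * (2 ^ 1 * ?i (d s)) = (of_int (c ^ Suc K) * 2 ^ Suc K) * ?i (d s)" by (simp add: ac_simps)
    also have "?eq \<dots> (1 * ?i (d s))" by (intro pcong_mult pcong_refl c_one)
    finally show "?eq (?i (D s)) (?i (d s))" by simp
  qed
  obtain \<delta>' where \<delta>': "diffop ?H \<delta>'" "\<And>x. x \<in> ?S \<Longrightarrow> \<delta>' (hproj ?V sdet x) = hproj ?V sdet (D x)"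
    using H.diffop_of_representative[of D N] DS ND compat by metis
  have "int_ideal ?H p +>\<^bsub>?H\<^esub> \<delta>' r = \<delta> (int_ideal ?H p +>\<^bsub>?H\<^esub> r)" if r: "r \<in> carrier ?H" for r
  proof -
    obtain x where x: "x \<in> ?S" "hproj ?V sdet x = r" using H.proj_surj[OF r] by blast
    have "mproj ?V sdet p (D x) = mproj ?V sdet p (d x)" using Mp.proj_eq_iff[OF DS[OF x(1)] d(1)[OF x(1)]] Dd[OF x(1)] by blast
    then have "mproj ?V sdet p (D x) = \<delta> (mproj ?V sdet p x)" using d(2)[OF x(1)] by simp
    then show ?thesis using \<delta>'(2)[OF x(1)] unfolding mproj_def x(2) by simp
  qed
  then show ?thesis unfolding lifts_to_ring_def using \<delta>'(1) by blast
qed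

theorem theorem1p2:
  shows
  "(\<forall>n p. 3 \<le> n \<and> prime p \<longrightarrow>
      (let V = gen_vars n; f = det_poly n gen_entry; R = hypersurface V f in
        \<not> lifts_to_mod_sq R p (frob_trace V f p) \<and> \<not> lifts_to_ring R p (frob_trace V f p)))
 \<and> (\<forall>n p. 4 \<le> n \<and> even n \<and> prime p \<longrightarrow>
      (let V = alt_vars n; f = pf_poly n alt_entry; R = hypersurface V f in
        \<not> lifts_to_mod_sq R p (frob_trace V f p) \<and> \<not> lifts_to_ring R p (frob_trace V f p)))
 \<and> (\<forall>p. prime p \<and> 2 < p \<longrightarrow>
      (let V = sym_vars 3; f = det_poly 3 sym_entry; R = hypersurface V f in
        \<forall>\<delta>. diffop (mod_int R p) \<delta> \<longrightarrow> lifts_to_ring R p \<delta>))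
 \<and> (let V = sym_vars 3; f = det_poly 3 sym_entry; R = hypersurface V f in
        \<not> lifts_to_mod_sq R 2 (frob_trace V f 2) \<and> \<not> lifts_to_ring R 2 (frob_trace V f 2))"
proof (intro conjI allI impI)
  fix n p :: nat assume "3 \<le> n \<and> prime p"
  then show "let V = gen_vars n; f = det_poly n gen_entry; R = hypersurface V f in
        \<not> lifts_to_mod_sq R p (frob_trace V f p) \<and> \<not> lifts_to_ring R p (frob_trace V f p)"
    using generic_determinant_no_lift[of n p] by (simp add: Let_def)
next
  fix n p :: nat assume n: "4 \<le> n \<and> even n \<and> prime p"
  then obtain k where "n = 2 * k" by blast
  moreover have "4 \<le> n" using n by blast
  ultimately have "n = 2 * (k - 2) + 4" by linarith
  then show "let V = alt_vars n; f = pf_poly n alt_entry; R = hypersurface V f in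
        \<not> lifts_to_mod_sq R p (frob_trace V f p) \<and> \<not> lifts_to_ring R p (frob_trace V f p)"
    using pfaffian_no_lift[of p n "k - 2"] n unfolding Let_def by blast
next
  fix p :: nat assume "prime p \<and> 2 < p"
  then show "let V = sym_vars 3; f = sdet; R = hypersurface V f in
        \<forall>\<delta>. diffop (mod_int R p) \<delta> \<longrightarrow> lifts_to_ring R p \<delta>"
    unfolding Let_def using symmetric_determinant_lifts by blast
next
  show "let V = sym_vars 3; f = sdet; R = hypersurface V f in
        \<not> lifts_to_mod_sq R 2 (frob_trace V f 2) \<and> \<not> lifts_to_ring R 2 (frob_trace V f 2)"
    unfolding Let_def by (rule symmetric_determinant_no_lift)
qed

end
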